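(* Let $f$ be a nonzero modular form of weight $r>0$ for a finite index subgroup $\Gamma$ of $\mathrm{SL}_2(\mathbb Z)$ (setting as in the context), let $\alpha>\alpha_0$, let $x_0\in\mathbb Q$ and let $\sigma=\sigma_{x_0}$ be any scaling matrix for the cusp $x_0$. Then there exist nonzero constants $A,B$ with $B>0$ such that for all real $x\ne x_0$ $$f_\alpha(x)=A\,i^{-\alpha}f(x_0)\,\psi(x-x_0)+B|x-x_0|^{2\alpha}(x-x_0)^{-r}f^\sigma_\alpha(\sigma^{-1}x)+E(x),$$ where $\psi(t)=t^{\alpha-r}$ if $\alpha-r\notin\mathbb Z$ and $\psi(t)=t^{\alpha-r}\log t$ if $\alpha-r\in\mathbb Z$, and the error term $E$ belongs to $\mathcal C^{1,0}(\mathbb R\setminus\{x_0\})$ and to $\mathcal C^{2\alpha-r+1}(x_0)$.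
   Context: Let $\Gamma$ be a subgroup of finite index of $\mathrm{SL}_2(\mathbb Z)$, $r>0$ real, and $\{\mu_\gamma\}$ a multiplier system of unimodular complex numbers. $f$ is a nonzero modular form of weight $r$: holomorphic on $\mathbb H$, $f(\gamma z)=\mu_\gamma(cz+d)^rf(z)$ for all $\gamma=\begin{pmatrix}a&b\\c&d\end{pmatrix}\in\Gamma$ ($\gamma z=(az+b)/(cz+d)$), at most polynomial growth as $\Im z\to0^+$. All powers and logarithms use the branch $-\pi<\arg z\le\pi$. For $\gamma\in\mathrm{GL}_2^+(\mathbb R)$, $f^\gamma(z)=(\det\gamma)^{r/2}f(\gamma z)/(cz+d)^r$. Cusps: $\mathbb Q\cup\{\infty\}$; width $m_{\mathfrak a}$ = order of the stabilizer of $\mathfrak a$ in $\mathrm{SL}_2(\mathbb Z)$ modulo $\Gamma$. A scaling matrix for $\mathfrak a$ is $\sigma_{\mathfrak a}=\gamma\eta$ with $\gamma\in\mathrm{SL}_2(\mathbb Z)$, $\gamma(\infty)=\mathfrak a$, bottom row $(c,d)$ of $\gamma$ satisfying $c<0$ or ($c=0$, $d=1$), $\eta=\mathrm{diag}(\sqrt{m_{\mathfrak a}},1/\sqrt{m_{\mathfrak a}})$. Then $f^{\sigma_{\mathfrak a}}(z)=\sum_{n\ge0}a_n^{\mathfrak a}e^{2\pi i(n+\kappa_{\mathfrak a})z}$ with $0\le\kappa_{\mathfrak a}<1$, assumed rational. $f$ is cuspidal at $\mathfrak a$ if $\kappa_{\mathfrak a}>0$ or $a_0^{\mathfrak a}=0$,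 and then $f(\mathfrak a):=0$; otherwise $f(\mathfrak a):=a_0^{\mathfrak a}$ (depending on the chosen scaling matrix). $f$ is a cusp form if cuspidal at every cusp; $\alpha_0=r/2$ if $f$ is a cusp form and $\alpha_0=r$ otherwise. With $m=m_\infty,\kappa=\kappa_\infty$ and $f(mz)=\sum a_ne^{2\pi i(n+\kappa)z}$, $f_\alpha(mx)=\sum_{n+\kappa>0}a_n(n+\kappa)^{-\alpha}e^{2\pi i(n+\kappa)x}$. For the scaling matrix $\sigma=\sigma_{\mathfrak a}$, $f^\sigma_\alpha(x)=\sum_{n+\kappa_{\mathfrak a}>0}a^{\mathfrak a}_n(n+\kappa_{\mathfrak a})^{-\alpha}e^{2\pi i(n+\kappa_{\mathfrak a})x}$. Spaces: $g\in\mathcal C^s(x_0)$ if $g$ is continuous and some polynomial $P$ of degree $<s$ has $|g(x)-P(x-x_0)|\le C|x-x_0|^s$ as $x\to x_0$; $g\in\mathcal C^{1,0}(\Omega)$ for open $\Omega$ if $g'$ exists and is continuous on $\Omega$. *)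

theory Defs
  imports "HOL-Analysis.Analysis" "HOL-Computational_Algebra.Polynomial"
begin

datatype imat = IM int int int int   (* IM a b c d  =  [[a,b],[c,d]] *)
datatype rmat = RM real real real real

fun imult :: "imat \<Rightarrow> imat \<Rightarrow> imat" where
  "imult (IM a b c d) (IM a' b' c' d') =
     IM (a*a' + b*c') (a*b' + b*d') (c*a' + d*c') (c*b' + d*d')"

fun idet :: "imat \<Rightarrow> int" where
  "idet (IM a b c d) = a*d - b*c"

fun iinv :: "imat \<Rightarrow> imat" where
  "iinv (IM a b c d) = IM d (-b) (-c) a"

definition iid :: imat where "iid = IM 1 0 0 1"

definition SL2Z :: "imat set" where
  "SL2Z = {g. idet g = 1}"

fun rmult :: "rmat \<Rightarrow> rmat \<Rightarrow> rmat" where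
  "rmult (RM a b c d) (RM a' b' c' d') =
     RM (a*a' + b*c') (a*b' + b*d') (c*a' + d*c') (c*b' + d*d')"

fun of_imat :: "imat \<Rightarrow> rmat" where
  "of_imat (IM a b c d) = RM (of_int a) (of_int b) (of_int c) (of_int d)"

definition eta :: "nat \<Rightarrow> rmat" where
  "eta m = RM (sqrt (real m)) 0 0 (1 / sqrt (real m))"

fun rdet :: "rmat \<Rightarrow> real" where
  "rdet (RM a b c d) = a*d - b*c"

fun moeb :: "rmat \<Rightarrow> complex \<Rightarrow> complex" where
  "moeb (RM a b c d) z = (of_real a * z + of_real b) / (of_real c * z + of_real d)"

fun rinv_act :: "rmat \<Rightarrow> real \<Rightarrow> real" where
  "rinv_act (RM a b c d) x = (d * x - b) / (- c * x + a)"

text \<open>automorphy factor (c z + d)^r, principal branch (complex powr uses Ln,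
  whose argument lies in (-pi, pi])\<close>
fun jfac :: "rmat \<Rightarrow> real \<Rightarrow> complex \<Rightarrow> complex" where
  "jfac (RM a b c d) r z = (of_real c * z + of_real d) powr (of_real r)"

definition rcoset_i :: "imat set \<Rightarrow> imat \<Rightarrow> imat set" where
  "rcoset_i \<Gamma> g = {imult h g | h. h \<in> \<Gamma>}"

definition finite_index_subgroup :: "imat set \<Rightarrow> bool" where
  "finite_index_subgroup \<Gamma> \<longleftrightarrow>
     \<Gamma> \<subseteq> SL2Z \<and> iid \<in> \<Gamma> \<and>
     (\<forall>g\<in>\<Gamma>. \<forall>h\<in>\<Gamma>. imult g h \<in> \<Gamma>) \<and> (\<forall>g\<in>\<Gamma>. iinv g \<in> \<Gamma>) \<and>
     finite (rcoset_i \<Gamma> ` SL2Z)"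

datatype cusp = CInf | CQ rat

fun cusp_act :: "imat \<Rightarrow> cusp \<Rightarrow> cusp" where
  "cusp_act (IM a b c d) CInf = (if c = 0 then CInf else CQ (of_int a / of_int c))"
| "cusp_act (IM a b c d) (CQ q) =
     (if of_int c * q + of_int d = 0 then CInf
      else CQ ((of_int a * q + of_int b) / (of_int c * q + of_int d)))"

definition stab :: "cusp \<Rightarrow> imat set" where
  "stab \<a> = {g \<in> SL2Z. cusp_act g \<a> = \<a>}"

text \<open>width: order of the stabilizer of the cusp in SL2(Z) modulo Gamma, i.e. the
  number of (right) Gamma-cosets met by the stabilizer = [Stab : Stab \<inter> Gamma]\<close>
definition width :: "imat set \<Rightarrow> cusp \<Rightarrow> nat" where
  "width \<Gamma> \<a> = card (rcoset_i \<Gamma> ` stab \<a>)"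

fun bottom_ok :: "imat \<Rightarrow> bool" where
  "bottom_ok (IM a b c d) \<longleftrightarrow> c < 0 \<or> (c = 0 \<and> d = 1)"

definition scaling_matrix :: "imat set \<Rightarrow> cusp \<Rightarrow> rmat \<Rightarrow> bool" where
  "scaling_matrix \<Gamma> \<a> \<sigma> \<longleftrightarrow>
     (\<exists>\<gamma>\<in>SL2Z. cusp_act \<gamma> CInf = \<a> \<and> bottom_ok \<gamma> \<and>
        \<sigma> = rmult (of_imat \<gamma>) (eta (width \<Gamma> \<a>)))"

definition upper_half :: "complex set" where
  "upper_half = {z. Im z > 0}"

definition modular_form ::
  "imat set \<Rightarrow> real \<Rightarrow> (imat \<Rightarrow> complex) \<Rightarrow> (complex \<Rightarrow> complex) \<Rightarrow> bool" where
  "modular_form \<Gamma> r \<mu> f \<longleftrightarrow>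
     f holomorphic_on upper_half \<and>
     (\<forall>\<gamma>\<in>\<Gamma>. norm (\<mu> \<gamma>) = 1) \<and>
     (\<forall>\<gamma>\<in>\<Gamma>. \<forall>z\<in>upper_half.
        f (moeb (of_imat \<gamma>) z) = \<mu> \<gamma> * jfac (of_imat \<gamma>) r z * f z) \<and>
     (\<exists>C k. \<forall>z. 0 < Im z \<and> Im z < 1 \<longrightarrow> norm (f z) \<le> C * Im z powr (- k))"

definition slash :: "real \<Rightarrow> (complex \<Rightarrow> complex) \<Rightarrow> rmat \<Rightarrow> complex \<Rightarrow> complex" where
  "slash r f \<gamma> z = of_real (rdet \<gamma> powr (r / 2)) * f (moeb \<gamma> z) / jfac \<gamma> r z"

definition has_fexp :: "(complex \<Rightarrow> complex) \<Rightarrow> real \<Rightarrow> (nat \<Rightarrow> complex) \<Rightarrow> bool" where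
  "has_fexp g \<kappa> a \<longleftrightarrow> 0 \<le> \<kappa> \<and> \<kappa> < 1 \<and>
     (\<forall>z\<in>upper_half. (\<lambda>n. a n * exp (2 * of_real pi * \<i> * of_real (real n + \<kappa>) * z)) sums g z)"

definition fkappa :: "(complex \<Rightarrow> complex) \<Rightarrow> real" where
  "fkappa g = (SOME \<kappa>. \<exists>a. has_fexp g \<kappa> a)"

definition fcoeff :: "(complex \<Rightarrow> complex) \<Rightarrow> nat \<Rightarrow> complex" where
  "fcoeff g = (SOME a. has_fexp g (fkappa g) a)"

definition cuspidal_at :: "real \<Rightarrow> (complex \<Rightarrow> complex) \<Rightarrow> rmat \<Rightarrow> bool" where
  "cuspidal_at r f \<sigma> \<longleftrightarrow> fkappa (slash r f \<sigma>) > 0 \<or> fcoeff (slash r f \<sigma>) 0 = 0"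

definition cusp_value :: "real \<Rightarrow> (complex \<Rightarrow> complex) \<Rightarrow> rmat \<Rightarrow> complex" where
  "cusp_value r f \<sigma> = (if cuspidal_at r f \<sigma> then 0 else fcoeff (slash r f \<sigma>) 0)"

definition cusp_form :: "imat set \<Rightarrow> real \<Rightarrow> (complex \<Rightarrow> complex) \<Rightarrow> bool" where
  "cusp_form \<Gamma> r f \<longleftrightarrow> (\<forall>\<a> \<sigma>. scaling_matrix \<Gamma> \<a> \<sigma> \<longrightarrow> cuspidal_at r f \<sigma>)"

definition alpha0 :: "imat set \<Rightarrow> real \<Rightarrow> (complex \<Rightarrow> complex) \<Rightarrow> real" where
  "alpha0 \<Gamma> r f = (if cusp_form \<Gamma> r f then r / 2 else r)"

definition frac_sigma :: "real \<Rightarrow> (complex \<Rightarrow> complex) \<Rightarrow> rmat \<Rightarrow> real \<Rightarrow> real \<Rightarrow> complex" where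
  "frac_sigma r f \<sigma> \<alpha> x =
     (let g = slash r f \<sigma>; \<kappa> = fkappa g; a = fcoeff g in
      (\<Sum>n. if real n + \<kappa> > 0 then
              a n * of_real ((real n + \<kappa>) powr (- \<alpha>)) *
              exp (2 * of_real pi * \<i> * of_real ((real n + \<kappa>) * x))
            else 0))"

text \<open>f_alpha(m x) = f^{sigma_infty}_alpha(x), since f(m z) = f^{eta_m}(z)\<close>
definition frac_int :: "imat set \<Rightarrow> real \<Rightarrow> (complex \<Rightarrow> complex) \<Rightarrow> real \<Rightarrow> real \<Rightarrow> complex" where
  "frac_int \<Gamma> r f \<alpha> x =
     (let m = width \<Gamma> CInf in frac_sigma r f (eta m) \<alpha> (x / real m))"

definition psi :: "real \<Rightarrow> real \<Rightarrow> real \<Rightarrow> complex" where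
  "psi \<alpha> r t = (if \<alpha> - r \<in> \<int>
      then of_real t powr of_real (\<alpha> - r) * Ln (of_real t)
      else of_real t powr of_real (\<alpha> - r))"

definition C10 :: "real set \<Rightarrow> (real \<Rightarrow> complex) \<Rightarrow> bool" where
  "C10 \<Omega> g \<longleftrightarrow> (\<exists>g'. (\<forall>x\<in>\<Omega>. (g has_vector_derivative g' x) (at x)) \<and> continuous_on \<Omega> g')"

definition Cs_at :: "real \<Rightarrow> real \<Rightarrow> (real \<Rightarrow> complex) \<Rightarrow> bool" where
  "Cs_at s x0 g \<longleftrightarrow> continuous_on UNIV g \<and>
     (\<exists>P :: complex poly. \<exists>C. real (degree P) < s \<and>
        (\<forall>\<^sub>F x in at x0. norm (g x - poly P (of_real (x - x0))) \<le> C * \<bar>x - x0\<bar> powr s))"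

end

theory Submission
  imports Defs "HOL-Complex_Analysis.Complex_Analysis" "HOL-Algebra.Coset" "HOL-Algebra.FiniteProduct"
begin

text \<open>
  For \<open>\<alpha> > \<alpha>\<^sub>0\<close> the fractional integral is, up to a constant, the Mellin transform
  \<open>\<integral>\<^sub>0\<^sup>\<infinity> t\<^bsup>\<alpha>-1\<^esup> (f(x + it) - a\<^sub>0) dt\<close>, because \<open>|f|\<close> grows at most like \<open>y\<^bsup>-\<alpha>\<^sub>0\<^esup>\<close>.
  With \<open>h = x - x\<^sub>0\<close>, the part \<open>t \<ge> 1\<close> is smooth in \<open>h\<close>. For \<open>t < 1\<close> write \<open>u = h + it\<close>; modularity turns
  \<open>f(x\<^sub>0 + u)\<close> into \<open>c\<^bsup>-r\<^esup> u\<^bsup>-r\<^esup> f\<^sup>\<sigma>(e - 1/(c\<^sup>2u))\<close>. The constant term of \<open>f\<^sup>\<sigma>\<close> contributes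
  \<open>\<integral>\<^sub>0\<^sup>1 t\<^bsup>\<alpha>-1\<^esup> (h + it)\<^bsup>-r\<^esup> dt\<close>, which is a multiple of \<open>\<psi>(h)\<close> plus a smooth function. In the
  contribution of the exponentially decaying rest, the segment from \<open>h\<close> to \<open>h + i\<close> is deformed to the semicircle from
  \<open>h\<close> to \<open>0\<close> followed by the segments from \<open>0\<close> to \<open>i\<close> and from \<open>i\<close> to \<open>h + i\<close>. The segments give smooth functions of
  \<open>h\<close>, since the integrand vanishes to infinite order at the cusp. The inversion maps the semicircle to the vertical
  half-line above \<open>\<sigma>\<^sup>-\<^sup>1x\<close>, which gives \<open>f\<^sup>\<sigma>\<^sub>\<alpha>(\<sigma>\<^sup>-\<^sup>1x)\<close> with the weight \<open>(1 - ic\<^sup>2h\<tau>)\<^bsup>r-\<alpha>-1\<^esup>\<close>; replacing the weight by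
  \<open>1\<close> costs a remainder of size \<open>O(|h|)\<close>.
\<close>

subsection \<open>Integrals depending on a parameter\<close>

text \<open>Three obstacles shape the argument. For \<alpha> only slightly above \<alpha>0 no
  absolute convergence of the series is available, so the passage to the Mellin integral rests on a
  uniform bound for partial sums. All powers are principal and h takes both signs, so the phase of
  h^(-r) has to come out of the contour correctly; the parametrisation u = h / (1 - i q h \<tau>) of
  the semicircle keeps every argument in range. Finally the remainder must be continuously
  differentiable away from the cusp although differentiating the form costs a power of the height:
  the factor weight minus 1 vanishes to first order in the height and pays for it. The exponent
  \<alpha>0 combines r/2 from the invariant |f| y^(r/2) with another r/2 when some cusp has a
  nonzero constant term. The logarithm in \<psi> is a resonance: for integral \<alpha> - r the
  singular power collides with the smooth powers. With m the width at infinity and -c the lower left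
  entry of \<sigma>, the constant \<open>B\<close> is m^(r/2 - \<alpha>) c^(2\<alpha> - r), while q
  = c^2. The constant terms at infinity and at the cusp are removed separately; only the latter
  meets a singular power.\<close>

text \<open>In this form differentiation under an integral becomes continuity at a single point of
  the integrated difference quotient.\<close>

lemma has_vector_derivative_iff_quotient:
  fixes f :: "real \<Rightarrow> 'a::real_normed_vector"
  shows "(f has_vector_derivative d) (at x) \<longleftrightarrow> ((\<lambda>y. (f y - f x) /\<^sub>R (y - x)) \<longlongrightarrow> d) (at x)"
proof -
  have "(f has_vector_derivative d) (at x) \<longleftrightarrow>
      ((\<lambda>y. norm (f y - f x - (y - x) *\<^sub>R d) / norm (y - x)) \<longlongrightarrow> 0) (at x)"
    by (simp add: has_vector_derivative_def has_derivative_iff_norm bounded_linear_scaleR_left)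
  also have "\<dots> \<longleftrightarrow> ((\<lambda>y. norm ((f y - f x) /\<^sub>R (y - x) - d)) \<longlongrightarrow> 0) (at x)"
  proof (rule filterlim_cong[OF refl refl])
    show "\<forall>\<^sub>F y in at x. norm (f y - f x - (y - x) *\<^sub>R d) / norm (y - x) = norm ((f y - f x) /\<^sub>R (y - x) - d)"
      using eventually_neq_at_within[of x x UNIV]
    proof eventually_elim
      case (elim y)
      have "(f y - f x) /\<^sub>R (y - x) - d = (f y - f x - (y - x) *\<^sub>R d) /\<^sub>R (y - x)"
        using elim by (simp add: scaleR_right_diff_distrib)
      then show ?case by (simp only: norm_scaleR norm_inverse divide_inverse_commute real_norm_def abs_inverse)
    qed
  qed
  also have "\<dots> \<longleftrightarrow> ((\<lambda>y. (f y - f x) /\<^sub>R (y - x)) \<longlongrightarrow> d) (at x)"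
    unfolding tendsto_norm_zero_iff LIM_zero_iff ..
  finally show ?thesis .
qed

lemma vector_derivative_bound:
  fixes f :: "real \<Rightarrow> 'a::real_normed_vector"
  assumes "convex S" "\<And>x. x \<in> S \<Longrightarrow> (f has_vector_derivative f' x) (at x within S)"
    "\<And>x. x \<in> S \<Longrightarrow> norm (f' x) \<le> B" "x \<in> S" "y \<in> S"
  shows "norm (f x - f y) \<le> B * norm (x - y)"
proof (rule differentiable_bound[OF assms(1) _ _ assms(4,5)])
  show "(f has_derivative (\<lambda>h. h *\<^sub>R f' x)) (at x within S)" if "x \<in> S" for x
    using assms(2)[OF that] by (simp add: has_vector_derivative_def)
  show "onorm (\<lambda>h. h *\<^sub>R f' x) \<le> B" if "x \<in> S" for x
    using assms(3)[OF that] by (intro onorm_le) (simp add: mult.commute[of B] mult_left_mono)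
qed

lemma isCont_integral_dominated:
  fixes \<phi> :: "real \<Rightarrow> real \<Rightarrow> complex"
  assumes "e > 0"
    and meas: "\<And>h. \<bar>h - h0\<bar> < e \<Longrightarrow> set_borel_measurable lborel A (\<phi> h)"
    and bound: "\<And>h t. \<bar>h - h0\<bar> < e \<Longrightarrow> t \<in> A \<Longrightarrow> norm (\<phi> h t) \<le> w t"
    and w: "set_integrable lborel A w"
    and cont: "\<And>t. t \<in> A \<Longrightarrow> isCont (\<lambda>h. \<phi> h t) h0"
  shows "isCont (\<lambda>h. LINT t:A|lborel. \<phi> h t) h0"
  unfolding continuous_at_sequentially comp_def
proof safe
  fix X :: "nat \<Rightarrow> real" assume X: "X \<longlonglongrightarrow> h0"
  have "\<forall>\<^sub>F n in sequentially. \<bar>X n - h0\<bar> < e"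
    using X \<open>e > 0\<close> unfolding tendsto_iff dist_real_def by auto
  then obtain N where N: "\<And>n. n \<ge> N \<Longrightarrow> \<bar>X n - h0\<bar> < e"
    unfolding eventually_sequentially by blast
  \<comment> \<open>The majorant is valid only for parameters within e of h0, and dominated
    convergence asks for it at every index; hence the sequence is shifted by
    \<open>N\<close>.\<close>
  have "(\<lambda>n. LINT t:A|lborel. \<phi> (X (n + N)) t) \<longlonglongrightarrow> (LINT t:A|lborel. \<phi> h0 t)"
    unfolding set_lebesgue_integral_def
  proof (rule integral_dominated_convergence[where w="\<lambda>t. indicator A t *\<^sub>R w t"])
    show "(\<lambda>x. indicat_real A x *\<^sub>R \<phi> h0 x) \<in> borel_measurable lborel"
      using meas[of h0] \<open>e > 0\<close> by (simp add: set_borel_measurable_def)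
    show "(\<lambda>x. indicat_real A x *\<^sub>R \<phi> (X (n + N)) x) \<in> borel_measurable lborel" for n
      using meas[of "X (n + N)"] N[of "n + N"] by (simp add: set_borel_measurable_def)
    show "integrable lborel (\<lambda>t. indicat_real A t *\<^sub>R w t)"
      using w by (simp add: set_integrable_def)
    show "AE x in lborel. (\<lambda>i. indicat_real A x *\<^sub>R \<phi> (X (i + N)) x) \<longlonglongrightarrow> indicat_real A x *\<^sub>R \<phi> h0 x"
    proof (rule AE_I2)
      fix t
      show "(\<lambda>i. indicat_real A t *\<^sub>R \<phi> (X (i + N)) t) \<longlonglongrightarrow> indicat_real A t *\<^sub>R \<phi> h0 t"
      proof (cases "t \<in> A")
        case True
        have "(\<lambda>i. X (i + N)) \<longlonglongrightarrow> h0" using X by (rule LIMSEQ_ignore_initial_segment)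
        then have "(\<lambda>i. \<phi> (X (i + N)) t) \<longlonglongrightarrow> \<phi> h0 t"
          by (rule isCont_tendsto_compose[OF cont[OF True]])
        then show ?thesis using True by simp
      qed auto
    qed
    show "AE x in lborel. norm (indicat_real A x *\<^sub>R \<phi> (X (n + N)) x) \<le> indicat_real A x *\<^sub>R w x" for n
      using bound[of "X (n + N)"] N[of "n + N"] by (auto simp: indicator_def)
  qed
  then show "(\<lambda>n. LINT t:A|lborel. \<phi> (X n) t) \<longlonglongrightarrow> (LINT t:A|lborel. \<phi> h0 t)"
    by (rule LIMSEQ_offset)
qed

lemma has_vector_derivative_integral_dominated:
  fixes \<phi> \<phi>' :: "real \<Rightarrow> real \<Rightarrow> complex"
  assumes "e > 0"
    and int: "\<And>h. \<bar>h - h0\<bar> < e \<Longrightarrow> set_integrable lborel A (\<phi> h)"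
    and meas: "set_borel_measurable lborel A (\<phi>' h0)"
    and bound: "\<And>h t. \<bar>h - h0\<bar> < e \<Longrightarrow> t \<in> A \<Longrightarrow> norm (\<phi>' h t) \<le> w t"
    and w: "set_integrable lborel A w"
    and deriv: "\<And>h t. \<bar>h - h0\<bar> < e \<Longrightarrow> t \<in> A \<Longrightarrow> ((\<lambda>h. \<phi> h t) has_vector_derivative \<phi>' h t) (at h)"
  shows "((\<lambda>h. LINT t:A|lborel. \<phi> h t) has_vector_derivative (LINT t:A|lborel. \<phi>' h0 t)) (at h0)"
  unfolding has_vector_derivative_iff_quotient
proof -
  \<comment> \<open>The difference quotient, completed at h0 by the derivative. It is dominated by
    the same \<open>w\<close> through the mean value inequality, so continuity of its integral at h0
    is the claim.\<close>
  define Q where "Q h t = (if h = h0 then \<phi>' h0 t else (\<phi> h t - \<phi> h0 t) /\<^sub>R (h - h0))" for h t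
  have mphi: "set_borel_measurable lborel A (\<phi> h)" if "\<bar>h - h0\<bar> < e" for h
    using int[OF that] by (simp add: set_integrable_def set_borel_measurable_def)
  have "isCont (\<lambda>h. LINT t:A|lborel. Q h t) h0"
  proof (rule isCont_integral_dominated[OF \<open>e > 0\<close> _ _ w])
    fix h assume h: "\<bar>h - h0\<bar> < e"
    show "set_borel_measurable lborel A (Q h)"
    proof (cases "h = h0")
      case False
      have "(\<lambda>t. (indicator A t *\<^sub>R \<phi> h t - indicator A t *\<^sub>R \<phi> h0 t) /\<^sub>R (h - h0)) \<in> borel_measurable lborel"
        using mphi[OF h] mphi[of h0] \<open>e > 0\<close> unfolding set_borel_measurable_def by auto
      moreover have "(indicator A t *\<^sub>R \<phi> h t - indicator A t *\<^sub>R \<phi> h0 t) /\<^sub>R (h - h0) = indicator A t *\<^sub>R Q h t" for t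
        using False by (simp add: Q_def indicator_def)
      ultimately show ?thesis unfolding set_borel_measurable_def by simp
    qed (use meas in \<open>simp add: Q_def set_borel_measurable_def\<close>)
    fix t assume t: "t \<in> A"
    show "norm (Q h t) \<le> w t"
    proof (cases "h = h0")
      case False
      have "norm (\<phi> h t - \<phi> h0 t) \<le> w t * norm (h - h0)"
      proof (rule vector_derivative_bound[of "{h0-e<..<h0+e}" "\<lambda>h. \<phi> h t" "\<lambda>h. \<phi>' h t"])
        fix x assume "x \<in> {h0-e<..<h0+e}"
        then have x: "\<bar>x - h0\<bar> < e" by auto
        show "((\<lambda>h. \<phi> h t) has_vector_derivative \<phi>' x t) (at x within {h0-e<..<h0+e})"
          using deriv[OF x t] by (rule has_vector_derivative_at_within)
        show "norm (\<phi>' x t) \<le> w t" by (rule bound[OF x t])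
      qed (use h \<open>e > 0\<close> in auto)
      then show ?thesis using False by (simp add: Q_def divide_simps mult.commute)
    qed (use bound[of h0 t] t \<open>e > 0\<close> in \<open>simp add: Q_def\<close>)
  next
    fix t assume t: "t \<in> A"
    have "((\<lambda>y. (\<phi> y t - \<phi> h0 t) /\<^sub>R (y - h0)) \<longlongrightarrow> \<phi>' h0 t) (at h0)"
      using deriv[of h0 t] t \<open>e > 0\<close> unfolding has_vector_derivative_iff_quotient by simp
    then have "((\<lambda>y. Q y t) \<longlongrightarrow> \<phi>' h0 t) (at h0)"
      by (rule Lim_transform_eventually) (auto simp: Q_def eventually_at_filter)
    then show "isCont (\<lambda>h. Q h t) h0"
      unfolding isCont_def by (simp add: Q_def)
  qed
  then have lim: "((\<lambda>h. LINT t:A|lborel. Q h t) \<longlongrightarrow> (LINT t:A|lborel. \<phi>' h0 t)) (at h0)"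
    unfolding isCont_def Q_def[of h0] by simp
  show "((\<lambda>y. ((LINT t:A|lborel. \<phi> y t) - (LINT t:A|lborel. \<phi> h0 t)) /\<^sub>R (y - h0)) \<longlongrightarrow> (LINT t:A|lborel. \<phi>' h0 t)) (at h0)"
  proof (rule Lim_transform_eventually[OF lim])
    have "\<forall>\<^sub>F y in at h0. \<bar>y - h0\<bar> < e \<and> y \<noteq> h0"
      using \<open>e > 0\<close> by (auto simp: eventually_at dist_real_def)
    then show "\<forall>\<^sub>F y in at h0. (LINT t:A|lborel. Q y t) = ((LINT t:A|lborel. \<phi> y t) - (LINT t:A|lborel. \<phi> h0 t)) /\<^sub>R (y - h0)"
    proof eventually_elim
      case (elim y)
      then show ?case using int[of y] int[of h0] \<open>e > 0\<close> by (simp add: Q_def)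
    qed
  qed
qed

section \<open>Gamma integrals and majorants of the form power times exponential\<close>

lemma set_integrable_powr_exp:
  fixes p d :: real
  assumes "p > 0" "d > 0"
  shows "set_integrable lborel {0<..} (\<lambda>t. t powr (p - 1) * exp (- d * t))"
proof -
  have "(\<lambda>t. complex_of_real t powr (of_real p - 1) / of_real (exp (d * t))) absolutely_integrable_on {0<..}"
    using assms by (intro absolutely_integrable_Gamma_integral) auto
  \<comment> \<open>The norm of the complex Gamma integrand is the real integrand wanted; Borel
    measurability then carries integrability from \<open>lebesgue\<close> to
    \<open>lborel\<close>.\<close>
  then have "integrable lebesgue (\<lambda>t. norm (indicat_real {0<..} t *\<^sub>R (complex_of_real t powr (of_real p - 1) / of_real (exp (d * t)))))"
    unfolding set_integrable_def by (rule Bochner_Integration.integrable_norm)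
  also have "(\<lambda>t. norm (indicat_real {0<..} t *\<^sub>R (complex_of_real t powr (of_real p - 1) / of_real (exp (d * t))))) =
      (\<lambda>t. indicat_real {0<..} t *\<^sub>R (t powr (p - 1) * exp (- d * t)))"
  proof
    fix t :: real
    show "norm (indicat_real {0<..} t *\<^sub>R (complex_of_real t powr (of_real p - 1) / of_real (exp (d * t)))) =
      indicat_real {0<..} t *\<^sub>R (t powr (p - 1) * exp (- d * t))"
    proof (cases "t > 0")
      case True
      then have "norm (complex_of_real t powr (of_real p - 1)) = t powr (p - 1)"
        by (subst norm_powr_real_powr) auto
      then show ?thesis using True by (simp add: norm_divide exp_minus divide_inverse norm_inverse norm_mult)
    qed simp
  qed
  finally show ?thesis
    unfolding set_integrable_def by (rule iffD1[OF integrable_completion, rotated]) measurable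
qed

lemma LINT_powr_exp:
  fixes p d :: real
  assumes "p > 0" "d > 0"
  shows "(LINT t:{0<..}|lborel. t powr (p - 1) * exp (- d * t)) = Gamma p * d powr (- p)"
proof -
  have g: "((\<lambda>t. t powr (p - 1) / exp t) has_integral Gamma p) {0..}"
    by (rule Gamma_integral_real[OF \<open>p > 0\<close>])
  have 1: "(LINT t:{0<..}|lborel. t powr (p - 1) * exp (- 1 * t)) = Gamma p"
  proof -
    have "((\<lambda>t. t powr (p - 1) * exp (- 1 * t)) has_integral (LINT t:{0<..}|lborel. t powr (p - 1) * exp (- 1 * t))) {0<..}"
      using set_borel_integral_eq_integral[OF set_integrable_powr_exp[of p 1]] assms
      by (simp add: integrable_integral)
    moreover have "((\<lambda>t. t powr (p - 1) * exp (- 1 * t)) has_integral Gamma p) {0<..}"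
    proof -
      have "((\<lambda>t. if t \<in> {0<..} then t powr (p - 1) * exp (- 1 * t) else 0) has_integral Gamma p) {0..}"
        by (rule has_integral_spike[OF _ _ g, of "{0}"]) (auto simp: exp_minus field_simps)
      then show ?thesis by (subst (asm) has_integral_restrict) auto
    qed
    ultimately show ?thesis by (rule has_integral_unique)
  qed
  have "(LINT t:{0<..}|lborel. t powr (p - 1) * exp (- 1 * t)) =
      \<bar>d\<bar> *\<^sub>R (\<integral>t. indicator {0<..} (0 + d * t) *\<^sub>R ((0 + d * t) powr (p - 1) * exp (- 1 * (0 + d * t))) \<partial>lborel)"
    unfolding set_lebesgue_integral_def using assms by (intro lborel_integral_real_affine) auto
  also have "\<dots> = d * (\<integral>t. d powr (p - 1) * (indicator {0<..} t *\<^sub>R (t powr (p - 1) * exp (- d * t))) \<partial>lborel)"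
  proof -
    have "indicator {0<..} (0 + d * t) *\<^sub>R ((0 + d * t) powr (p - 1) * exp (- 1 * (0 + d * t))) =
        d powr (p - 1) * (indicator {0<..} t *\<^sub>R (t powr (p - 1) * exp (- d * t)))" for t
      using assms by (auto simp: indicator_def zero_less_mult_iff powr_mult)
    note eq = this
    show ?thesis unfolding eq using assms by simp
  qed
  also have "\<dots> = d * d powr (p - 1) * (LINT t:{0<..}|lborel. t powr (p - 1) * exp (- d * t))"
    by (simp add: set_lebesgue_integral_def)
  also have "d * d powr (p - 1) = d powr p" using assms by (simp add: powr_diff)
  finally show ?thesis using 1 assms by (simp add: powr_minus field_simps)
qed

lemma set_borel_measurable_continuous_on_interval:
  fixes f :: "real \<Rightarrow> complex"
  assumes "continuous_on A f" "A \<in> sets borel"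
  shows "set_borel_measurable lborel A f"
  using borel_measurable_continuous_on_indicator[OF assms(2,1)] by (simp add: set_borel_measurable_def)

lemma set_integrable_dominated:
  fixes f :: "real \<Rightarrow> complex"
  assumes "continuous_on A f" "A \<in> sets borel" "set_integrable lborel A w"
    "\<And>t. t \<in> A \<Longrightarrow> norm (f t) \<le> w t"
  shows "set_integrable lborel A f"
  using assms(3) unfolding set_integrable_def
proof (rule Bochner_Integration.integrable_bound)
  show "(\<lambda>x. indicat_real A x *\<^sub>R f x) \<in> borel_measurable lborel"
    using set_borel_measurable_continuous_on_interval[OF assms(1,2)] by (simp add: set_borel_measurable_def)
  show "AE x in lborel. norm (indicat_real A x *\<^sub>R f x) \<le> norm (indicat_real A x *\<^sub>R w x)"
    using assms(4) by (intro AE_I2) (force simp: indicator_def)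
qed

lemma set_integrable_powr_exp_bound:
  fixes f :: "real \<Rightarrow> complex"
  assumes "continuous_on A f" "A \<in> sets borel" "A \<subseteq> {0<..}" "p > 0" "d > 0"
    "\<And>t. t \<in> A \<Longrightarrow> norm (f t) \<le> C * t powr (p - 1) * exp (- d * t)"
  shows "set_integrable lborel A f"
proof (rule set_integrable_dominated[OF assms(1,2)])
  show "set_integrable lborel A (\<lambda>t. C * (t powr (p - 1) * exp (- d * t)))"
    using set_integrable_subset[OF set_integrable_powr_exp[OF assms(4,5)], of A] assms(2,3) by simp
  show "norm (f t) \<le> C * (t powr (p - 1) * exp (- d * t))" if "t \<in> A" for t
    using assms(6)[OF that] by (simp add: mult.assoc)
qed

text \<open>A single term of the exponential series dominates the power, with n the rounded up
  exponent. An arbitrarily small rate d suffices, so later estimates spend only part of an available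
  decay on polynomial factors.\<close>

lemma bounded_powr_exp:
  fixes a d :: real
  assumes "a \<ge> 0" "d > 0"
  shows "\<exists>C>0. \<forall>t\<ge>0. (1 + t) powr a \<le> C * exp (d * t)"
proof (intro exI conjI allI impI)
  define n where "n = nat \<lceil>a\<rceil>"
  define e where "e = min d 1"
  have e: "0 < e" "e \<le> d" "e \<le> 1" using assms by (auto simp: e_def)
  have an: "a \<le> real n" using assms by (simp add: n_def of_nat_ceiling)
  show "fact n * exp e / e ^ n > 0" using e by simp
  fix t :: real assume t: "t \<ge> 0"
  have "(1 + t) powr a \<le> (1 + t) powr real n" using t an by (intro powr_mono) auto
  also have "\<dots> = (1 + t) ^ n" using t by (simp add: powr_realpow)
  also have "\<dots> = (e * (1 + t)) ^ n / fact n * (fact n / e ^ n)" using e by (simp add: power_mult_distrib)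
  also have "\<dots> \<le> exp (e * (1 + t)) * (fact n / e ^ n)"
  proof (rule mult_right_mono)
    have s: "(\<lambda>k. (e * (1 + t)) ^ k /\<^sub>R fact k) sums exp (e * (1 + t))" by (rule exp_converges)
    have "(\<Sum>k\<in>{n}. (e * (1 + t)) ^ k /\<^sub>R fact k) \<le> exp (e * (1 + t))"
      unfolding sums_unique[OF s] using e t by (intro sum_le_suminf sums_summable[OF s]) auto
    then show "(e * (1 + t)) ^ n / fact n \<le> exp (e * (1 + t))" by (simp add: field_simps)
  qed (use e in auto)
  also have "\<dots> \<le> (exp e * exp (d * t)) * (fact n / e ^ n)"
    using e t by (intro mult_right_mono) (auto simp: distrib_left exp_add mult_right_mono)
  finally show "(1 + t) powr a \<le> fact n * exp e / e ^ n * exp (d * t)" by (simp add: field_simps)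
qed

text \<open>The whole family of derivatives is the witness: \<open>D k\<close> is the k-th
  derivative. Closure properties then amount to combining families, and shifting the index shows
  that the derivative is smooth again.\<close>

definition smooth :: "(real \<Rightarrow> complex) \<Rightarrow> bool" where
  "smooth S \<longleftrightarrow> (\<exists>D. D 0 = S \<and> (\<forall>k x. (D k has_vector_derivative D (Suc k) x) (at x)))"

lemma smooth_const: "smooth (\<lambda>x. c)"
  unfolding smooth_def by (rule exI[of _ "\<lambda>k x. if k = 0 then c else 0"]) auto

lemma smooth_add: "smooth S \<Longrightarrow> smooth T \<Longrightarrow> smooth (\<lambda>x. S x + T x)"
  unfolding smooth_def
proof (elim exE conjE)
  fix D E assume "D 0 = S" "E 0 = T" "\<forall>k x. (D k has_vector_derivative D (Suc k) x) (at x)"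
    "\<forall>k x. (E k has_vector_derivative E (Suc k) x) (at x)"
  then show "\<exists>D. D 0 = (\<lambda>x. S x + T x) \<and> (\<forall>k x. (D k has_vector_derivative D (Suc k) x) (at x))"
    by (intro exI[of _ "\<lambda>k x. D k x + E k x"]) (auto intro!: has_vector_derivative_add)
qed

lemma smooth_cmult: "smooth S \<Longrightarrow> smooth (\<lambda>x. c * S x)"
  unfolding smooth_def
proof (elim exE conjE)
  fix D assume "D 0 = S" "\<forall>k x. (D k has_vector_derivative D (Suc k) x) (at x)"
  then show "\<exists>D. D 0 = (\<lambda>x. c * S x) \<and> (\<forall>k x. (D k has_vector_derivative D (Suc k) x) (at x))"
    by (intro exI[of _ "\<lambda>k x. c * D k x"]) (auto intro!: has_vector_derivative_mult_right)
qed

lemma smooth_holomorphic: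
  assumes "open U" "F holomorphic_on U" "\<And>x. complex_of_real x \<in> U"
  shows "smooth (\<lambda>x. F (of_real x))"
  unfolding smooth_def
proof (intro exI[of _ "\<lambda>k x. (deriv ^^ k) F (of_real x)"] conjI allI)
  fix k x
  have "(deriv ^^ k) F holomorphic_on U" by (rule holomorphic_higher_deriv[OF assms(2,1)])
  then have "((deriv ^^ k) F has_field_derivative (deriv ^^ Suc k) F (of_real x)) (at (of_real x))"
    using assms(1,3) by (simp add: holomorphic_derivI)
  then show "((\<lambda>x. (deriv ^^ k) F (complex_of_real x)) has_vector_derivative (deriv ^^ Suc k) F (complex_of_real x)) (at x)"
    by (rule has_vector_derivative_real_field)
qed auto

lemma smooth_C1:
  assumes "smooth S"
  obtains S' where "\<And>x. (S has_vector_derivative S' x) (at x)" "continuous_on UNIV S'"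
proof -
  obtain D where D: "D 0 = S" "\<And>k x. (D k has_vector_derivative D (Suc k) x) (at x)"
    using assms by (auto simp: smooth_def)
  show ?thesis
  proof
    show "(S has_vector_derivative D 1 x) (at x)" for x using D(1) D(2)[of 0 x] by simp
    show "continuous_on UNIV (D 1)"
      using D(2)[of 1] by (meson continuous_at_imp_continuous_on has_vector_derivative_continuous)
  qed
qed

text \<open>Induction through the derivative: a polynomial approximating the derivative is
  integrated, and the mean value inequality on the interval from -|x| to |x| gains one power of
  |x|.\<close>

lemma smooth_taylor:
  assumes "smooth S"
  shows "\<exists>P C. degree P < Suc n \<and> C \<ge> 0 \<and>
    (\<forall>x. \<bar>x\<bar> \<le> 1 \<longrightarrow> norm (S x - poly P (complex_of_real x)) \<le> C * \<bar>x\<bar> ^ Suc n)"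
  using assms
proof (induction n arbitrary: S)
  case 0
  obtain S' where S': "\<And>x. (S has_vector_derivative S' x) (at x)" "continuous_on UNIV S'"
    using smooth_C1[OF 0] by blast
  have "compact (S' ` {-1..1})"
    using S'(2) by (intro compact_continuous_image) (auto intro: continuous_on_subset)
  then obtain C where C: "\<And>x. x \<in> {-1..1} \<Longrightarrow> norm (S' x) \<le> C"
    by (metis compact_imp_bounded bounded_iff imageI)
  have "C \<ge> 0" using C[of 0] by (auto intro: order_trans[OF norm_ge_zero])
  have "norm (S x - S 0) \<le> C * norm (x - 0)" if "\<bar>x\<bar> \<le> 1" for x
    by (rule vector_derivative_bound[of "{-1..1}" _ S'])
      (use that C S' in \<open>auto intro: has_vector_derivative_at_within\<close>)
  with \<open>C \<ge> 0\<close> show ?case by (intro exI[of _ "[:S 0:]"] exI[of _ C]) auto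
next
  case (Suc n)
  then obtain D where D: "D 0 = S" "\<And>k x. (D k has_vector_derivative D (Suc k) x) (at x)"
    by (auto simp: smooth_def)
  have "smooth (D 1)" unfolding smooth_def using D(2) by (intro exI[of _ "\<lambda>k. D (Suc k)"]) auto
  from Suc.IH[OF this] obtain P C where P: "degree P < Suc n" "C \<ge> 0"
    "\<And>x. \<bar>x\<bar> \<le> 1 \<Longrightarrow> norm (D 1 x - poly P (complex_of_real x)) \<le> C * \<bar>x\<bar> ^ Suc n" by blast
  \<comment> \<open>The primitive of \<open>P\<close> that agrees with \<open>S\<close> at
    0.\<close>
  define Q where "Q = [:S 0:] + (\<Sum>i\<le>n. monom (coeff P i / of_nat (Suc i)) (Suc i))"
  have Q: "poly Q z = S 0 + (\<Sum>i\<le>n. coeff P i / of_nat (Suc i) * z ^ Suc i)" for z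
    by (simp add: Q_def poly_sum poly_monom)
  have cQ: "coeff Q (Suc k) = (if k \<le> n then coeff P k / of_nat (Suc k) else 0)" for k
    unfolding Q_def by (simp add: coeff_sum coeff_monom)
  have "pderiv Q = P"
    using P(1) by (intro poly_eqI) (auto simp: coeff_pderiv cQ coeff_eq_0 simp del: of_nat_Suc)
  then have dQ: "(poly Q has_field_derivative poly P z) (at z)" for z
    using poly_DERIV[of Q z] by simp
  have "coeff Q i = 0" if "i > Suc n" for i
    using that cQ[of "i - 1"] by (cases i) auto
  then have "degree Q \<le> Suc n" by (intro degree_le) blast
  then have degQ: "degree Q < Suc (Suc n)" by simp
  have bound: "norm (S x - poly Q (of_real x)) \<le> C * \<bar>x\<bar> ^ Suc (Suc n)" if x: "\<bar>x\<bar> \<le> 1" for x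
  proof -
    have "norm ((S x - poly Q (of_real x)) - (S 0 - poly Q (of_real 0))) \<le> (C * \<bar>x\<bar> ^ Suc n) * norm (x - 0)"
    proof (rule vector_derivative_bound[where f = "\<lambda>x. S x - poly Q (of_real x)" and S = "{-\<bar>x\<bar>..\<bar>x\<bar>}"
          and f' = "\<lambda>x. D 1 x - poly P (of_real x)" and B = "C * \<bar>x\<bar> ^ Suc n" and x = x and y = 0])
      fix y assume y: "y \<in> {-\<bar>x\<bar>..\<bar>x\<bar>}"
      have "((\<lambda>x. poly Q (of_real x)) has_vector_derivative poly P (of_real y)) (at y)"
        by (rule has_vector_derivative_real_field[OF dQ])
      moreover have "(S has_vector_derivative D 1 y) (at y)" using D(1) D(2)[of 0 y] by simp
      ultimately show "((\<lambda>x. S x - poly Q (of_real x)) has_vector_derivative D 1 y - poly P (of_real y)) (at y within {-\<bar>x\<bar>..\<bar>x\<bar>})"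
        by (intro has_vector_derivative_at_within[OF has_vector_derivative_diff])
      have "norm (D 1 y - poly P (of_real y)) \<le> C * \<bar>y\<bar> ^ Suc n" using y x by (intro P(3)) auto
      also have "\<dots> \<le> C * \<bar>x\<bar> ^ Suc n" using y P(2) by (intro mult_left_mono power_mono) auto
      finally show "norm (D 1 y - poly P (of_real y)) \<le> C * \<bar>x\<bar> ^ Suc n" .
    qed auto
    moreover have "S 0 - poly Q (of_real 0) = 0" by (simp add: Q)
    ultimately show ?thesis by (simp add: mult_ac)
  qed
  show ?case using degQ P(2) bound by blast
qed

subsection \<open>Fourier expansions and fractional integrals\<close>

definition qchar :: "real \<Rightarrow> complex \<Rightarrow> complex" where
  "qchar \<nu> z = exp (2 * of_real pi * \<i> * of_real \<nu> * z)"

lemma norm_qchar: "norm (qchar \<nu> z) = exp (- (2 * pi * \<nu> * Im z))"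
  by (simp add: qchar_def norm_exp_eq_Re mult.assoc)

lemma qchar_add: "qchar \<nu> (z + w) = qchar \<nu> z * qchar \<nu> w"
  by (simp add: qchar_def algebra_simps exp_add)

lemma qchar_add_left: "qchar (\<mu> + \<nu>) z = qchar \<mu> z * qchar \<nu> z"
  by (simp add: qchar_def algebra_simps exp_add)

lemma qchar_of_nat: "qchar (real n) z = qchar 1 z ^ n"
  by (simp add: qchar_def flip: exp_of_nat_mult) (simp add: mult_ac)

lemma qchar_0 [simp]: "qchar 0 z = 1"
  by (simp add: qchar_def)

lemma continuous_on_qchar [continuous_intros]:
  "continuous_on A f \<Longrightarrow> continuous_on A (\<lambda>x. qchar \<nu> (f x))"
  unfolding qchar_def by (intro continuous_intros)

text \<open>Strict positivity of \<kappa> says that no constant term is present. When the exponents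
  are integers, the constant term is split off and the series is re-indexed to start at exponent
  1.\<close>

definition fourier_exp :: "real \<Rightarrow> (nat \<Rightarrow> complex) \<Rightarrow> (complex \<Rightarrow> complex) \<Rightarrow> bool" where
  "fourier_exp \<kappa> b G \<longleftrightarrow> \<kappa> > 0 \<and> (\<forall>z\<in>upper_half. (\<lambda>n. b n * qchar (real n + \<kappa>) z) sums G z)"

text \<open>Exactly what a Mellin integral along vertical lines needs: order s at the real axis,
  exponential decay towards i times infinity, and constants independent of the real part.\<close>

definition decays :: "real \<Rightarrow> (complex \<Rightarrow> complex) \<Rightarrow> bool" where
  "decays s G \<longleftrightarrow> G holomorphic_on upper_half \<and>
     (\<exists>C d. C > 0 \<and> d > 0 \<and> (\<forall>z\<in>upper_half. norm (G z) \<le> C * Im z powr (- s) * exp (- d * Im z)))"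

text \<open>Convergence at height y/2 bounds the terms there; the remaining half of the height
  contributes a geometric factor.\<close>

lemma summable_coeff_of_sums:
  assumes "\<And>z. z \<in> upper_half \<Longrightarrow> (\<lambda>n. b n * qchar (real n + \<kappa>) z) sums G z" and "y > 0"
  shows "summable (\<lambda>n. norm (b n) * exp (- (2 * pi * (real n + \<kappa>) * y)))"
proof -
  have "(\<lambda>n. b n * qchar (real n + \<kappa>) (\<i> * of_real (y/2))) sums G (\<i> * of_real (y/2))"
    using assms(1)[of "\<i> * of_real (y/2)"] assms(2) by (auto simp: upper_half_def)
  then have "Bseq (\<lambda>n. b n * qchar (real n + \<kappa>) (\<i> * of_real (y/2)))"
    using summable_LIMSEQ_zero sums_summable convergent_def convergent_imp_Bseq by blast
  then obtain M where M0: "\<And>n. norm (b n * qchar (real n + \<kappa>) (\<i> * of_real (y/2))) \<le> M"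
    unfolding Bseq_def by blast
  then have M: "norm (b n) * exp (- (2 * pi * (real n + \<kappa>) * (y/2))) \<le> M" for n
    using M0[of n] unfolding norm_mult norm_qchar by simp
  have "summable (\<lambda>n. M * exp (- (pi * \<kappa> * y)) * exp (- (pi * y)) ^ n)"
    using assms(2) by (intro summable_mult summable_geometric) auto
  then show ?thesis
  proof (rule summable_comparison_test'[where N=0])
    fix n :: nat
    have "norm (b n) * exp (- (2 * pi * (real n + \<kappa>) * y)) =
        (norm (b n) * exp (- (2 * pi * (real n + \<kappa>) * (y/2)))) * exp (- (pi * (real n + \<kappa>) * y))"
      by (simp add: mult.assoc flip: exp_add)
    also have "\<dots> \<le> M * exp (- (pi * (real n + \<kappa>) * y))"
      using M[of n] by (intro mult_right_mono) auto
    also have "\<dots> = M * exp (- (pi * \<kappa> * y)) * exp (- (pi * y)) ^ n"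
      by (simp add: mult.assoc flip: exp_of_nat_mult exp_add) (simp add: algebra_simps)
    finally show "norm (norm (b n) * exp (- (2 * pi * (real n + \<kappa>) * y))) \<le> M * exp (- (pi * \<kappa> * y)) * exp (- (pi * y)) ^ n"
      by simp
  qed
qed

text \<open>For Im z at least 1 one has 2(n+\<kappa>) Im z >= (n+\<kappa>) + \<kappa> Im z, so the
  exponential factor comes out of a series that converges at height 1/2.\<close>

lemma fourier_exp_decay:
  assumes "fourier_exp \<kappa> b G"
  shows "\<exists>C. \<forall>z. Im z \<ge> 1 \<longrightarrow> norm (G z) \<le> C * exp (- (pi * \<kappa> * Im z))"
proof -
  have \<kappa>: "\<kappa> > 0" and sums: "\<And>z. z \<in> upper_half \<Longrightarrow> (\<lambda>n. b n * qchar (real n + \<kappa>) z) sums G z"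
    using assms by (auto simp: fourier_exp_def)
  have sm: "summable (\<lambda>n. norm (b n) * exp (- (2 * pi * (real n + \<kappa>) * (1/2))))"
    by (rule summable_coeff_of_sums[OF sums]) auto
  have "norm (G z) \<le> (\<Sum>n. norm (b n) * exp (- (2 * pi * (real n + \<kappa>) * (1/2)))) * exp (- (pi * \<kappa> * Im z))"
    if z: "Im z \<ge> 1" for z
  proof -
    have le: "norm (b n * qchar (real n + \<kappa>) z) \<le>
        norm (b n) * exp (- (2 * pi * (real n + \<kappa>) * (1/2))) * exp (- (pi * \<kappa> * Im z))" for n
    proof -
      have "real n * 1 \<le> real n * Im z" "\<kappa> * 1 \<le> \<kappa> * Im z" "0 \<le> real n * Im z"
        using z \<kappa> mult_left_mono[of 1 "Im z" "real n"] mult_left_mono[of 1 "Im z" \<kappa>] by auto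
      then have "0 \<le> pi * (2 * (real n + \<kappa>) * Im z - ((real n + \<kappa>) + \<kappa> * Im z))"
        by (intro mult_nonneg_nonneg) (auto simp: algebra_simps)
      then have "exp (- (2 * pi * (real n + \<kappa>) * Im z)) \<le> exp (- (2 * pi * (real n + \<kappa>) * (1/2)) + - (pi * \<kappa> * Im z))"
        by (simp add: algebra_simps)
      then show ?thesis by (simp add: norm_mult norm_qchar mult.assoc mult_left_mono flip: exp_add)
    qed
    have "G z = (\<Sum>n. b n * qchar (real n + \<kappa>) z)"
      using sums[of z] z by (auto simp: upper_half_def sums_iff)
    also have "norm \<dots> \<le> (\<Sum>n. norm (b n) * exp (- (2 * pi * (real n + \<kappa>) * (1/2))) * exp (- (pi * \<kappa> * Im z)))"
      by (intro norm_suminf_le le summable_mult2 sm)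
    also have "\<dots> = (\<Sum>n. norm (b n) * exp (- (2 * pi * (real n + \<kappa>) * (1/2)))) * exp (- (pi * \<kappa> * Im z))"
      by (rule suminf_mult2[OF sm, symmetric])
    finally show ?thesis .
  qed
  then show ?thesis by blast
qed

lemma decaysI:
  assumes "fourier_exp \<kappa> b G" "G holomorphic_on upper_half" "s \<ge> 0"
    and bound: "\<And>z. 0 < Im z \<Longrightarrow> Im z < 1 \<Longrightarrow> norm (G z) \<le> C * Im z powr (- s)"
  shows "decays s G"
proof -
  have \<kappa>: "\<kappa> > 0" using assms(1) by (simp add: fourier_exp_def)
  obtain C1 where C1: "\<And>z. Im z \<ge> 1 \<Longrightarrow> norm (G z) \<le> C1 * exp (- (pi * \<kappa> * Im z))"
    using fourier_exp_decay[OF assms(1)] by blast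
  \<comment> \<open>Half of the decay rate: the other half absorbs the power Im z^s for large Im
    z.\<close>
  define d where "d = pi * \<kappa> / 2"
  have d: "d > 0" using \<kappa> by (simp add: d_def)
  obtain C2 where C2: "C2 > 0" "\<And>t. t \<ge> 0 \<Longrightarrow> (1 + t) powr s \<le> C2 * exp (d * t)"
    using bounded_powr_exp[OF \<open>s \<ge> 0\<close> d] by blast
  define K where "K = \<bar>C1\<bar> * C2 + \<bar>C\<bar> * exp d + 1"
  have "norm (G z) \<le> K * Im z powr (- s) * exp (- d * Im z)" if z: "z \<in> upper_half" for z
  proof (cases "Im z < 1")
    case True
    have y: "Im z > 0" using z by (simp add: upper_half_def)
    have "d * Im z \<le> d" using True y d by (simp add: mult_left_le)
    have "norm (G z) \<le> \<bar>C\<bar> * Im z powr (- s)"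
      using bound[OF y True] mult_right_mono[OF abs_ge_self, of "Im z powr (- s)" C] by simp
    also have "\<dots> \<le> \<bar>C\<bar> * Im z powr (- s) * (exp d * exp (- d * Im z))"
    proof -
      have "1 \<le> exp d * exp (- d * Im z)" using \<open>d * Im z \<le> d\<close> by (simp flip: exp_add)
      from mult_left_mono[OF this, of "\<bar>C\<bar> * Im z powr (- s)"] show ?thesis by simp
    qed
    also have "\<dots> = (\<bar>C\<bar> * exp d) * (Im z powr (- s) * exp (- d * Im z))" by simp
    also have "\<dots> \<le> K * (Im z powr (- s) * exp (- d * Im z))"
      using C2 by (intro mult_right_mono) (auto simp: K_def)
    finally show ?thesis by simp
  next
    case False
    then have y: "Im z \<ge> 1" by simp
    have "Im z powr s \<le> (1 + Im z) powr s" using y assms(3) by (intro powr_mono2) auto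
    also have "\<dots> \<le> C2 * exp (d * Im z)" using C2(2) y by auto
    finally have 1: "1 \<le> C2 * exp (d * Im z) * Im z powr (- s)"
      using y by (simp add: powr_minus field_simps)
    have "norm (G z) \<le> \<bar>C1\<bar> * exp (- (2 * d * Im z))"
      using order_trans[OF C1[OF y] mult_right_mono[OF abs_ge_self]] by (simp add: d_def)
    also have "\<dots> \<le> \<bar>C1\<bar> * exp (- (2 * d * Im z)) * (C2 * exp (d * Im z) * Im z powr (- s))"
      using mult_left_mono[OF 1, of "\<bar>C1\<bar> * exp (- (2 * d * Im z))"] by simp
    also have "\<dots> = (\<bar>C1\<bar> * C2) * (Im z powr (- s) * (exp (- (2 * d * Im z)) * exp (d * Im z)))" by simp
    also have "exp (- (2 * d * Im z)) * exp (d * Im z) = exp (- d * Im z)" by (simp flip: exp_add)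
    also have "(\<bar>C1\<bar> * C2) * (Im z powr (- s) * exp (- d * Im z)) \<le> K * (Im z powr (- s) * exp (- d * Im z))"
      using C2 by (intro mult_right_mono) (auto simp: K_def)
    finally show ?thesis by simp
  qed
  moreover have "K > 0" unfolding K_def using C2 by (intro add_nonneg_pos add_nonneg_nonneg mult_nonneg_nonneg) auto
  ultimately show ?thesis unfolding decays_def using assms(2) d by blast
qed

lemma set_integrable_complex_of_real:
  "set_integrable M A f \<Longrightarrow> set_integrable M A (\<lambda>t. complex_of_real (f t))"
  unfolding set_integrable_def by (drule integrable_of_real[where 'a = complex]) (simp add: scaleR_conv_of_real)

text \<open>Cauchy's inequality on the disc of radius Im z / 2 costs one power of Im z and half of
  the exponential rate.\<close>

lemma decays_deriv:
  assumes "decays s G" "s \<ge> 0"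
  shows "decays (s + 1) (deriv G)"
proof -
  obtain C d where C: "C > 0" "d > 0" and hol: "G holomorphic_on upper_half"
    and b: "\<And>z. z \<in> upper_half \<Longrightarrow> norm (G z) \<le> C * Im z powr (- s) * exp (- d * Im z)"
    using assms by (auto simp: decays_def)
  have op: "open upper_half" unfolding upper_half_def by (rule open_halfspace_Im_gt)
  have "norm (deriv G z) \<le> (2 * C * 2 powr s) * Im z powr (- (s + 1)) * exp (- (d/2) * Im z)"
    if z: "z \<in> upper_half" for z
  proof -
    define y where "y = Im z"
    have y: "y > 0" using z by (simp add: y_def upper_half_def)
    have Im: "Im w \<ge> y/2" if "w \<in> cball z (y/2)" for w
      using that abs_Im_le_cmod[of "z - w"] by (auto simp: dist_norm y_def)
    have sub: "cball z (y/2) \<subseteq> upper_half" using Im y by (force simp: upper_half_def)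
    have "norm ((deriv ^^ 1) G z) \<le> fact 1 * (C * (y/2) powr (- s) * exp (- d * (y/2))) / (y/2) ^ 1"
    proof (rule Cauchy_inequality)
      show "G holomorphic_on ball z (y/2)" using hol sub ball_subset_cball by (blast intro: holomorphic_on_subset)
      show "continuous_on (cball z (y/2)) G" using hol sub by (blast intro: holomorphic_on_imp_continuous_on holomorphic_on_subset)
      show "0 < y/2" using y by simp
      fix w assume w: "norm (z - w) = y/2"
      then have wi: "w \<in> cball z (y/2)" by (simp add: dist_norm)
      have "norm (G w) \<le> C * Im w powr (- s) * exp (- d * Im w)" using b sub wi by blast
      also have "\<dots> \<le> C * (y/2) powr (- s) * exp (- d * (y/2))"
        using Im[OF wi] y C assms(2) by (intro mult_mono mult_left_mono powr_mono2') auto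
      finally show "norm (G w) \<le> C * (y/2) powr (- s) * exp (- d * (y/2))" .
    qed
    also have "\<dots> = (2 * C * 2 powr s) * y powr (- (s + 1)) * exp (- (d/2) * y)"
    proof -
      have "y powr (- (s + 1)) = y powr (- s) / y" using y powr_diff[of y "- s" 1] by simp
      moreover have "(y/2) powr (- s) = 2 powr s * y powr (- s)" using y by (simp add: powr_divide powr_minus field_simps)
      ultimately show ?thesis using y by (simp add: field_simps)
    qed
    finally show ?thesis by (simp add: y_def)
  qed
  then show ?thesis
    unfolding decays_def using C holomorphic_deriv[OF hol op]
    by (intro conjI exI[of _ "2 * C * 2 powr s"] exI[of _ "d/2"]) auto
qed

lemma decays_integrable:
  assumes "decays s G" "s < \<alpha>"
  shows "set_integrable lborel {0<..} (\<lambda>t. of_real (t powr (\<alpha> - 1)) * G (Complex x t))"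
proof -
  obtain C d where C: "C > 0" "d > 0" and hol: "G holomorphic_on upper_half"
    and b: "\<And>z. z \<in> upper_half \<Longrightarrow> norm (G z) \<le> C * Im z powr (- s) * exp (- d * Im z)"
    using assms by (auto simp: decays_def)
  show ?thesis
  proof (rule set_integrable_powr_exp_bound[where p = "\<alpha> - s" and C = C and d = d])
    have "continuous_on {0<..} (\<lambda>t. G (Complex x t))"
      by (rule continuous_on_compose2[OF holomorphic_on_imp_continuous_on[OF hol]])
        (auto simp: upper_half_def Complex_eq intro!: continuous_intros)
    then show "continuous_on {0<..} (\<lambda>t. of_real (t powr (\<alpha> - 1)) * G (Complex x t))"
      by (intro continuous_intros) auto
    fix t :: real assume t: "t \<in> {0<..}"
    have "norm (G (Complex x t)) \<le> C * t powr (- s) * exp (- d * t)"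
      using b[of "Complex x t"] t by (simp add: upper_half_def)
    then have "t powr (\<alpha> - 1) * norm (G (Complex x t)) \<le> t powr (\<alpha> - 1) * (C * t powr (- s) * exp (- d * t))"
      by (rule mult_left_mono) auto
    also have "\<dots> = C * (t powr (\<alpha> - 1) * t powr (- s)) * exp (- d * t)" by simp
    also have "t powr (\<alpha> - 1) * t powr (- s) = t powr (\<alpha> - s - 1)" using t by (simp add: algebra_simps flip: powr_add)
    finally show "norm (of_real (t powr (\<alpha> - 1)) * G (Complex x t)) \<le> C * t powr (\<alpha> - s - 1) * exp (- d * t)"
      by (simp add: norm_mult)
  qed (use assms C in auto)
qed

section \<open>The Dirichlet kernel and bounds for partial Fourier sums\<close>

lemma sin_ge_half:
  assumes "0 \<le> x" "x \<le> pi / 2"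
  shows "x / 2 \<le> sin x"
proof (cases "x \<le> pi / 3")
  case True
  have "(\<lambda>x. sin x - x / 2) 0 \<le> (\<lambda>x. sin x - x / 2) x"
  proof (rule DERIV_nonneg_imp_nondecreasing[OF assms(1)])
    fix t assume t: "0 \<le> t" "t \<le> x"
    have "cos (pi / 3) \<le> cos t" using t True by (intro cos_monotone_0_pi_le) auto
    then show "\<exists>y. ((\<lambda>x. sin x - x / 2) has_real_derivative y) (at t) \<and> 0 \<le> y"
      by (intro exI[of _ "cos t - 1/2"] conjI derivative_eq_intros) (auto simp: cos_60)
  qed
  then show ?thesis by simp
next
  case False
  \<comment> \<open>Beyond pi/3 the crude value 17/20 already exceeds pi/4, the largest value of x/2
    on the interval.\<close>
  have "sin (pi / 3) \<le> sin x" using False assms by (intro sin_monotone_2pi_le) auto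
  moreover have "sin (pi / 3) \<ge> 17/20"
    unfolding sin_60 using real_le_rsqrt[of "17/10" 3] by (simp add: power2_eq_square)
  moreover have "pi \<le> 3.2" using pi_approx by simp
  ultimately show ?thesis using assms by simp
qed

lemma one_minus_qchar_ge:
  assumes "\<bar>\<theta>\<bar> \<le> 1/2"
  shows "norm (1 - qchar 1 (of_real \<theta>)) \<ge> \<bar>\<theta>\<bar>"
proof -
  have "norm (qchar 1 (of_real \<theta>) - 1) = norm (exp (\<i> * of_real (2 * pi * \<theta>)) - 1)"
    by (simp add: qchar_def mult_ac)
  also have "\<dots> = 2 * \<bar>sin (pi * \<theta>)\<bar>" using dist_exp_i_1[of "2 * pi * \<theta>"] by simp
  also have "\<bar>sin (pi * \<theta>)\<bar> = sin (pi * \<bar>\<theta>\<bar>)"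
  proof -
    have "sin (pi * \<bar>\<theta>\<bar>) \<ge> 0" using assms by (intro sin_ge_zero) (auto simp: mult_left_le)
    then show ?thesis by (cases "\<theta> \<ge> 0") auto
  qed
  finally have "norm (qchar 1 (of_real \<theta>) - 1) = 2 * sin (pi * \<bar>\<theta>\<bar>)" .
  moreover have "pi * \<bar>\<theta>\<bar> / 2 \<le> sin (pi * \<bar>\<theta>\<bar>)" using assms by (intro sin_ge_half) auto
  moreover have "1 * \<bar>\<theta>\<bar> \<le> pi * \<bar>\<theta>\<bar>" using pi_gt3 by (intro mult_right_mono) auto
  ultimately show ?thesis by (simp add: norm_minus_commute)
qed

text \<open>Along a horizontal segment the series converges uniformly, so it may be integrated
  termwise. The shift \<kappa> cancels in the differences of exponents, which are integers;
  orthogonality over one period leaves the n-th term.\<close>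

lemma fourier_coeff_integral:
  assumes "\<And>z. z \<in> upper_half \<Longrightarrow> (\<lambda>n. b n * qchar (real n + \<kappa>) z) sums G z" "z \<in> upper_half"
  shows "((\<lambda>\<theta>. G (z + of_real \<theta>) * qchar (- (real n + \<kappa>)) (of_real \<theta>)) has_integral
      b n * qchar (real n + \<kappa>) z) {-1/2..1/2}"
proof -
  define \<nu> where "\<nu> k = real k + \<kappa>" for k
  define f where "f k \<theta> = b k * qchar (\<nu> k) z * qchar (\<nu> k - \<nu> n) (of_real \<theta>)" for k \<theta>
  have y: "Im z > 0" using assms(2) by (simp add: upper_half_def)
  have "(\<lambda>k. f k \<theta>) sums (G (z + of_real \<theta>) * qchar (- \<nu> n) (of_real \<theta>))" for \<theta>
  proof -
    have "(\<lambda>k. b k * qchar (\<nu> k) (z + of_real \<theta>) * qchar (- \<nu> n) (of_real \<theta>)) sums (G (z + of_real \<theta>) * qchar (- \<nu> n) (of_real \<theta>))"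
      unfolding \<nu>_def using y by (intro sums_mult2 assms(1)) (auto simp: upper_half_def)
    moreover have "b k * qchar (\<nu> k) (z + of_real \<theta>) * qchar (- \<nu> n) (of_real \<theta>) = f k \<theta>" for k
      using qchar_add_left[of "\<nu> k" "- \<nu> n" "of_real \<theta>"] by (simp add: f_def qchar_add)
    ultimately show ?thesis by simp
  qed
  then have Gs: "(\<Sum>k. f k \<theta>) = G (z + of_real \<theta>) * qchar (- \<nu> n) (of_real \<theta>)" for \<theta>
    by (simp add: sums_iff)
  have ul: "uniform_limit {-1/2..1/2} (\<lambda>N \<theta>. \<Sum>k<N. f k \<theta>) (\<lambda>\<theta>. \<Sum>k. f k \<theta>) sequentially"
  proof (rule Weierstrass_m_test)
    show "norm (f k \<theta>) \<le> norm (b k) * exp (- (2 * pi * (real k + \<kappa>) * Im z))" for k \<theta>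
      by (simp add: f_def norm_mult norm_qchar \<nu>_def)
    show "summable (\<lambda>k. norm (b k) * exp (- (2 * pi * (real k + \<kappa>) * Im z)))"
      by (rule summable_coeff_of_sums[OF assms(1) y])
  qed
  have fint: "(f k has_integral (if k = n then b n * qchar (\<nu> n) z else 0)) {-1/2..1/2}" for k
  proof (cases "k = n")
    case True
    have "((\<lambda>\<theta>::real. b n * qchar (\<nu> n) z) has_integral (1/2 - (-1/2)) *\<^sub>R (b n * qchar (\<nu> n) z)) {-1/2..1/2}"
      using has_integral_const_real[of "b n * qchar (\<nu> n) z" "-1/2" "1/2"] by simp
    then show ?thesis using True by (simp add: f_def[abs_def])
  next
    case False
    define m where "m = \<nu> k - \<nu> n"
    have m: "m \<noteq> 0" "m = of_int (int k - int n)" using False by (auto simp: m_def \<nu>_def)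
    have "((\<lambda>\<theta>. qchar m (of_real \<theta>)) has_integral
        (qchar m (of_real (1/2)) / (2 * of_real pi * \<i> * of_real m) - qchar m (of_real (-1/2)) / (2 * of_real pi * \<i> * of_real m))) {-1/2..1/2}"
    proof (rule fundamental_theorem_of_calculus)
      fix \<theta> :: real
      have "((\<lambda>w. qchar m w / (2 * of_real pi * \<i> * of_real m)) has_field_derivative qchar m (of_real \<theta>)) (at (of_real \<theta>))"
        unfolding qchar_def using m(1) by (auto intro!: derivative_eq_intros)
      from has_vector_derivative_real_field[OF this]
      show "((\<lambda>\<theta>. qchar m (of_real \<theta>) / (2 * of_real pi * \<i> * of_real m)) has_vector_derivative qchar m (of_real \<theta>)) (at \<theta> within {-1/2..1/2})"
        by (rule has_vector_derivative_at_within)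
    qed auto
    moreover have "qchar m (of_real (1/2)) = qchar m (of_real (-1/2))"
    proof -
      have "qchar m (of_real (-1/2) + 1) = qchar m (of_real (-1/2)) * qchar m 1" by (rule qchar_add)
      moreover have "qchar m 1 = 1"
        unfolding qchar_def m(2) using exp_integer_2pi[of "of_int (int k - int n)"] by (simp add: mult_ac)
      ultimately show ?thesis by (simp add: field_simps)
    qed
    ultimately have "((\<lambda>\<theta>. qchar m (of_real \<theta>)) has_integral 0) {-1/2..1/2}" by simp
    from has_integral_mult_right[OF this, of "b k * qchar (\<nu> k) z"]
    show ?thesis using False by (simp add: f_def[abs_def] m_def)
  qed
  have sumint: "((\<lambda>\<theta>. \<Sum>k<N. f k \<theta>) has_integral (\<Sum>k<N. if k = n then b n * qchar (\<nu> n) z else 0)) {-1/2..1/2}" for N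
    by (intro has_integral_sum fint) auto
  obtain I J where I: "\<And>N. ((\<lambda>\<theta>. \<Sum>k<N. f k \<theta>) has_integral I N) {-1/2..1/2}"
    and J: "((\<lambda>\<theta>. \<Sum>k. f k \<theta>) has_integral J) {-1/2..1/2}" "I \<longlonglongrightarrow> J"
  proof (rule uniform_limit_integral[OF ul])
    have "continuous_on {-1/2..1/2} (f k)" for k unfolding f_def by (intro continuous_intros)
    then show "continuous_on {-1/2..1/2} (\<lambda>\<theta>. \<Sum>k<N. f k \<theta>)" for N by (intro continuous_intros)
  qed auto
  have "I N = b n * qchar (\<nu> n) z" if "N > n" for N
    using has_integral_unique[OF I sumint, of N] that by (simp add: sum.delta)
  then have "\<forall>\<^sub>F N in sequentially. b n * qchar (\<nu> n) z = I N"
    by (intro eventually_mono[OF eventually_gt_at_top[of n]]) simp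
  then have "I \<longlonglongrightarrow> b n * qchar (\<nu> n) z" by (rule Lim_transform_eventually[OF tendsto_const])
  then have "J = b n * qchar (\<nu> n) z" using J(2) LIMSEQ_unique by blast
  then show ?thesis using J(1) unfolding Gs by (simp add: \<nu>_def)
qed

text \<open>Here q is the ratio of the geometric sum in the Dirichlet kernel at height y/2. The
  first bound is radial, from |q| = exp(-pi y); the second is angular, since moving q radially to
  the unit circle costs at most |1 - q|.\<close>

lemma one_minus_qchar_lower:
  fixes \<theta> y :: real
  assumes "\<bar>\<theta>\<bar> \<le> 1/2" "y > 0"
  defines "q \<equiv> qchar 1 (\<i> * of_real (y/2) - of_real \<theta>)"
  shows "norm (1 - q) \<ge> y / (1 + y)" "norm (1 - q) \<ge> \<bar>\<theta>\<bar> / 2" "norm q \<le> 1"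
proof -
  define \<rho> where "\<rho> = exp (- (pi * y))"
  define q0 where "q0 = qchar 1 (of_real (-\<theta>))"
  have nq: "norm q = \<rho>" unfolding q_def norm_qchar \<rho>_def by simp
  have q: "q = of_real \<rho> * q0"
  proof -
    have "q = qchar 1 (\<i> * of_real (y/2)) * q0" unfolding q_def q0_def by (simp flip: qchar_add)
    also have "qchar 1 (\<i> * of_real (y/2)) = exp (of_real (- (pi * y)))"
      unfolding qchar_def by (rule arg_cong[where f = exp]) (simp add: algebra_simps)
    finally show ?thesis unfolding \<rho>_def exp_of_real .
  qed
  have nq0: "norm q0 = 1" by (simp add: q0_def norm_qchar)
  have "1 + y \<le> exp y" by (rule exp_ge_add_one_self)
  moreover have "y * 1 \<le> y * pi" using assms(2) pi_gt3 by (intro mult_left_mono) auto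
  then have "exp y \<le> exp (pi * y)" by (simp add: mult.commute)
  ultimately have "1 + y \<le> exp (pi * y)" by linarith
  then have "\<rho> \<le> 1 / (1 + y)" unfolding \<rho>_def exp_minus using assms(2) by (simp add: field_simps)
  then have r: "1 - \<rho> \<ge> y / (1 + y)" using assms(2) by (simp add: field_simps)
  have \<rho>1: "\<rho> \<le> 1" using assms(2) by (simp add: \<rho>_def)
  have n1: "1 - \<rho> \<le> norm (1 - q)" using norm_triangle_ineq2[of 1 q] nq by simp
  show "norm (1 - q) \<ge> y / (1 + y)" using r n1 by linarith
  have "q - q0 = of_real (\<rho> - 1) * q0" by (simp add: q algebra_simps)
  then have "norm (q - q0) = \<bar>\<rho> - 1\<bar>" by (simp only: norm_mult nq0 norm_of_real mult_1_right)
  then have "norm (q - q0) \<le> norm (1 - q)" using n1 \<rho>1 by simp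
  moreover have "norm (1 - q0) \<le> norm (1 - q) + norm (q - q0)"
    using norm_triangle_ineq[of "1 - q" "q - q0"] by simp
  moreover have "norm (1 - q0) \<ge> \<bar>\<theta>\<bar>"
    using one_minus_qchar_ge[of "-\<theta>"] assms(1) by (simp add: q0_def)
  ultimately show "norm (1 - q) \<ge> \<bar>\<theta>\<bar> / 2" by linarith
  show "norm q \<le> 1" using nq \<rho>1 by simp
qed

text \<open>The exponent loses an arbitrarily small \<open>\<epsilon>\<close>, which absorbs the logarithm coming from the
  $L^1$-norm of the Dirichlet kernel.\<close>

lemma partial_sum_bound:
  assumes sums: "\<And>z. z \<in> upper_half \<Longrightarrow> (\<lambda>n. b n * qchar (real n + \<kappa>) z) sums G z"
    and "\<kappa> \<ge> 0" "decays s G" "s \<ge> 0" "0 < \<epsilon>" "\<epsilon> < 1"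
  shows "\<exists>C d. d > 0 \<and> (\<forall>N. \<forall>z\<in>upper_half.
    norm (\<Sum>n<N. b n * qchar (real n + \<kappa>) z) \<le> C * Im z powr (- (s + \<epsilon>)) * exp (- d * Im z))"
proof -
  obtain C d where C: "C > 0" "d > 0" and hol: "G holomorphic_on upper_half"
    and bG: "\<And>z. z \<in> upper_half \<Longrightarrow> norm (G z) \<le> C * Im z powr (- s) * exp (- d * Im z)"
    using assms(3) by (auto simp: decays_def)
  obtain C2 where C2: "C2 > 0" "\<And>t. t \<ge> 0 \<Longrightarrow> (1 + t) powr \<epsilon> \<le> C2 * exp (d/4 * t)"
    using bounded_powr_exp[of \<epsilon> "d/4"] assms(5) C by auto
  \<comment> \<open>An integrable majorant of the kernel; the exponent -1 itself would diverge, and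
    this is where \<epsilon> > 0 enters.\<close>
  define g where "g \<theta> = \<bar>\<theta>\<bar> powr (\<epsilon> - 1)" for \<theta> :: real
  have "(\<lambda>x. x powr (\<epsilon> - 1)) integrable_on {0..1/2}"
    using assms(5) by (intro integrable_on_powr_from_0) auto
  then have g1: "g integrable_on {0..1/2}"
    by (rule integrable_eq) (auto simp: g_def)
  have "(\<lambda>x. g (- x)) integrable_on {-(1/2)..-0}"
    using g1 unfolding Henstock_Kurzweil_Integration.integrable_reflect_real .
  then have g2: "g integrable_on {-1/2..0}" by (simp add: g_def[abs_def])
  have gint: "g integrable_on {-1/2..1/2}"
    by (rule Henstock_Kurzweil_Integration.integrable_combine[OF _ _ g2 g1]) auto
  define I where "I = integral {-1/2..1/2} g"
  have I0: "I \<ge> 0" unfolding I_def by (rule integral_nonneg[OF gint]) (simp add: g_def)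
  define K where "K = C * 2 powr s * (2 * C2 * 2 powr (1 - \<epsilon>)) * I"
  have "norm (\<Sum>n<N. b n * qchar (real n + \<kappa>) z) \<le> K * Im z powr (- (s + \<epsilon>)) * exp (- (d/4) * Im z)"
    if z: "z \<in> upper_half" for N z
  proof -
    define \<nu> where "\<nu> k = real k + \<kappa>" for k
    define y where "y = Im z"
    \<comment> \<open>The height of z is shared: half goes to the point where G is evaluated, half
      to the kernel, whose geometric ratio is thereby strictly inside the unit disc.\<close>
    define w where "w = z - \<i> * of_real (y/2)"
    have y: "y > 0" using z by (simp add: y_def upper_half_def)
    have w: "w \<in> upper_half" "Im w = y/2" using y by (auto simp: w_def upper_half_def y_def)
    define D where "D \<theta> = (\<Sum>n<N. qchar (\<nu> n) (\<i> * of_real (y/2) - of_real \<theta>))" for \<theta>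
    have "((\<lambda>\<theta>. \<Sum>n<N. (G (w + of_real \<theta>) * qchar (- \<nu> n) (of_real \<theta>)) * qchar (\<nu> n) (\<i> * of_real (y/2))) has_integral
        (\<Sum>n<N. (b n * qchar (\<nu> n) w) * qchar (\<nu> n) (\<i> * of_real (y/2)))) {-1/2..1/2}"
      using fourier_coeff_integral[OF sums w(1)] unfolding \<nu>_def
      by (intro has_integral_sum has_integral_mult_left) auto
    moreover have "qchar (- \<nu> n) (of_real \<theta>) * qchar (\<nu> n) (\<i> * of_real (y/2)) = qchar (\<nu> n) (\<i> * of_real (y/2) - of_real \<theta>)" for n and \<theta> :: real
      unfolding qchar_def exp_add[symmetric] by (simp add: algebra_simps)
    moreover have "qchar (\<nu> n) w * qchar (\<nu> n) (\<i> * of_real (y/2)) = qchar (\<nu> n) z" for n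
      by (simp add: w_def flip: qchar_add)
    ultimately have hi: "((\<lambda>\<theta>. G (w + of_real \<theta>) * D \<theta>) has_integral (\<Sum>n<N. b n * qchar (\<nu> n) z)) {-1/2..1/2}"
      by (simp add: D_def sum_distrib_left mult.assoc)
    \<comment> \<open>The integrand is changed at one point because \<open>g 0\<close> is 0 by the
      convention for \<open>powr\<close>, which would spoil the pointwise majorant.\<close>
    have hi': "((\<lambda>\<theta>. if \<theta> = 0 then 0 else G (w + of_real \<theta>) * D \<theta>) has_integral (\<Sum>n<N. b n * qchar (\<nu> n) z)) {-1/2..1/2}"
      by (rule has_integral_spike[OF _ _ hi, of "{0}"]) auto
    define A where "A = C * (y/2) powr (- s) * exp (- d * (y/2)) * (2 * ((1 + y) / y) powr \<epsilon> * 2 powr (1 - \<epsilon>))"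
    have Db: "norm (D \<theta>) \<le> 2 * ((1 + y) / y) powr \<epsilon> * 2 powr (1 - \<epsilon>) * g \<theta>"
      if \<theta>: "\<bar>\<theta>\<bar> \<le> 1/2" "\<theta> \<noteq> 0" for \<theta>
    proof -
      define u where "u = \<i> * of_real (y/2) - complex_of_real \<theta>"
      define q where "q = qchar 1 u"
      note q = one_minus_qchar_lower[OF \<theta>(1) y, folded u_def, folded q_def]
      have q1: "norm (1 - q) > 0" using \<theta>(2) by (intro less_le_trans[OF _ q(2)]) simp
      then have "q \<noteq> 1" by auto
      have "D \<theta> = (\<Sum>n<N. qchar \<kappa> u * q ^ n)"
        unfolding D_def u_def[symmetric] \<nu>_def q_def qchar_add_left qchar_of_nat by (simp add: mult.commute)
      also have "\<dots> = qchar \<kappa> u * ((1 - q ^ N) / (1 - q))"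
        using \<open>q \<noteq> 1\<close> sum_gp_strict[of q N] by (simp flip: sum_distrib_left)
      finally have "norm (D \<theta>) = norm (qchar \<kappa> u) * norm (1 - q ^ N) / norm (1 - q)"
        by (simp add: norm_mult norm_divide)
      also have "\<dots> \<le> 1 * 2 / norm (1 - q)"
      proof (intro divide_right_mono mult_mono)
        show "norm (qchar \<kappa> u) \<le> 1" using y assms(2) by (simp add: norm_qchar u_def)
        have "norm (1 - q ^ N) \<le> norm (1::complex) + norm (q ^ N)" by (rule norm_triangle_ineq4)
        also have "norm (q ^ N) \<le> 1" using q(3) by (simp add: norm_power power_le_one)
        finally show "norm (1 - q ^ N) \<le> 2" by simp
      qed auto
      \<comment> \<open>Interpolation: the radial bound is used with exponent \<epsilon> and the
        angular bound with exponent 1 - \<epsilon>.\<close>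
      also have "\<dots> = 2 * ((1 / norm (1 - q)) powr \<epsilon> * (1 / norm (1 - q)) powr (1 - \<epsilon>))"
        using q1 by (simp flip: powr_add)
      also have "\<dots> \<le> 2 * (((1 + y) / y) powr \<epsilon> * (2 / \<bar>\<theta>\<bar>) powr (1 - \<epsilon>))"
      proof (intro mult_left_mono mult_mono powr_mono2)
        show "1 / norm (1 - q) \<le> (1 + y) / y" using q(1) q1 y by (simp add: field_simps)
        show "1 / norm (1 - q) \<le> 2 / \<bar>\<theta>\<bar>" using q(2) q1 \<theta>(2) by (simp add: field_simps)
      qed (use assms(5,6) in auto)
      also have "(2 / \<bar>\<theta>\<bar>) powr (1 - \<epsilon>) = 2 powr (1 - \<epsilon>) * g \<theta>"
        unfolding g_def using powr_minus[of "\<bar>\<theta>\<bar>" "1 - \<epsilon>"] by (simp add: powr_mult inverse_powr divide_inverse)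
      finally show ?thesis by (simp add: mult.assoc)
    qed
    have Gb: "norm (G (w + of_real \<theta>)) \<le> C * (y/2) powr (- s) * exp (- d * (y/2))" for \<theta>
      using bG[of "w + of_real \<theta>"] w by (simp add: upper_half_def)
    have A: "norm (if \<theta> = 0 then 0 else G (w + of_real \<theta>) * D \<theta>) \<le> A * g \<theta>" if \<theta>: "\<theta> \<in> {-1/2..1/2}" for \<theta>
    proof (cases "\<theta> = 0")
      case False
      have "\<bar>\<theta>\<bar> \<le> 1/2" using \<theta> by auto
      then have "norm (G (w + of_real \<theta>) * D \<theta>) \<le> (C * (y/2) powr (- s) * exp (- d * (y/2))) * (2 * ((1 + y) / y) powr \<epsilon> * 2 powr (1 - \<epsilon>) * g \<theta>)"
        unfolding norm_mult using Gb Db False C by (intro mult_mono) auto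
      then show ?thesis using False by (simp add: A_def mult.assoc)
    qed (simp add: g_def)
    have "norm (\<Sum>n<N. b n * qchar (\<nu> n) z) \<le> integral {-1/2..1/2} (\<lambda>\<theta>. A * g \<theta>)"
      unfolding integral_unique[OF hi', symmetric]
      by (rule integral_norm_bound_integral[OF has_integral_integrable[OF hi'] integrable_on_cmult_left[OF gint, of A, unfolded of_real_eq_id id_apply] A])
    also have "\<dots> = A * I" by (simp add: I_def)
    also have "\<dots> \<le> K * y powr (- (s + \<epsilon>)) * exp (- (d/4) * y)"
    proof -
      have "((1 + y) / y) powr \<epsilon> = (1 + y) powr \<epsilon> * y powr (- \<epsilon>)"
        using y by (simp add: powr_mult inverse_powr powr_minus divide_inverse)
      also have "\<dots> \<le> (C2 * exp (d/4 * y)) * y powr (- \<epsilon>)"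
        using C2(2)[of y] y by (intro mult_right_mono) auto
      finally have 1: "((1 + y) / y) powr \<epsilon> \<le> (C2 * exp (d/4 * y)) * y powr (- \<epsilon>)" .
      have 2: "(y/2) powr (- s) = 2 powr s * y powr (- s)" using y by (simp add: powr_divide powr_minus field_simps)
      have "A * I \<le> C * (y/2) powr (- s) * exp (- d * (y/2)) * (2 * ((C2 * exp (d/4 * y)) * y powr (- \<epsilon>)) * 2 powr (1 - \<epsilon>)) * I"
        unfolding A_def using C I0 1 by (intro mult_right_mono mult_left_mono) auto
      also have "\<dots> = K * (y powr (- s) * y powr (- \<epsilon>)) * (exp (- d * (y/2)) * exp (d/4 * y))"
        unfolding 2 K_def by (simp add: mult_ac)
      also have "y powr (- s) * y powr (- \<epsilon>) = y powr (- (s + \<epsilon>))" using y by (simp flip: powr_add)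
      also have "exp (- d * (y/2)) * exp (d/4 * y) = exp (- (d/4) * y)"
        by (simp flip: exp_add)
      finally show ?thesis .
    qed
    finally show ?thesis unfolding \<nu>_def y_def .
  qed
  then show ?thesis using C(2) by (intro exI[of _ K] exI[of _ "d/4"]) auto
qed

text \<open>Each term is a Gamma integral, so the partial sums are Mellin integrals of partial sums
  of G. The uniform bound of \<open>partial_sum_bound\<close> allows dominated convergence; absolute
  convergence of the series is never asserted.\<close>

lemma fractional_series_sums:
  assumes "fourier_exp \<kappa> b G" "decays s G" "s \<ge> 0" "s < \<alpha>"
  shows "(\<lambda>n. b n * of_real ((real n + \<kappa>) powr (- \<alpha>)) * qchar (real n + \<kappa>) (of_real x)) sums
    (of_real ((2 * pi) powr \<alpha> / Gamma \<alpha>) * (LINT t:{0<..}|lborel. of_real (t powr (\<alpha> - 1)) * G (Complex x t)))"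
proof -
  have \<kappa>: "\<kappa> > 0" and sums: "\<And>z. z \<in> upper_half \<Longrightarrow> (\<lambda>n. b n * qchar (real n + \<kappa>) z) sums G z"
    using assms(1) by (auto simp: fourier_exp_def)
  have \<alpha>: "\<alpha> > 0" using assms by simp
  \<comment> \<open>At most half of the gap between s and \<alpha> is given away, so that the
    majorant stays integrable at 0.\<close>
  define \<epsilon> where "\<epsilon> = min (1/2) ((\<alpha> - s) / 2)"
  have \<epsilon>: "0 < \<epsilon>" "\<epsilon> < 1" "s + \<epsilon> < \<alpha>" using assms(4) by (auto simp: \<epsilon>_def min_def field_simps)
  obtain C d where d: "d > 0" and b: "\<And>N z. z \<in> upper_half \<Longrightarrow>
     norm (\<Sum>n<N. b n * qchar (real n + \<kappa>) z) \<le> C * Im z powr (- (s + \<epsilon>)) * exp (- d * Im z)"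
    using partial_sum_bound[OF sums less_imp_le[OF \<kappa>] assms(2,3) \<epsilon>(1,2)] by blast
  define \<phi> where "\<phi> N t = of_real (t powr (\<alpha> - 1)) * (\<Sum>n<N. b n * qchar (real n + \<kappa>) (Complex x t))" for N t
  have cont: "continuous_on {0<..} (\<phi> N)" for N
    unfolding \<phi>_def Complex_eq by (intro continuous_intros) auto
  have \<phi>b: "norm (\<phi> N t) \<le> C * (t powr (\<alpha> - s - \<epsilon> - 1) * exp (- d * t))" if t: "t > 0" for N t
  proof -
    have "norm (\<phi> N t) \<le> t powr (\<alpha> - 1) * (C * t powr (- (s + \<epsilon>)) * exp (- d * t))"
      unfolding \<phi>_def norm_mult using b[of "Complex x t" N] t by (simp add: upper_half_def mult_left_mono)
    also have "\<dots> = C * ((t powr (\<alpha> - 1) * t powr (- (s + \<epsilon>))) * exp (- d * t))" by (simp only: mult_ac)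
    also have "t powr (\<alpha> - 1) * t powr (- (s + \<epsilon>)) = t powr (\<alpha> - s - \<epsilon> - 1)"
      using t by (simp add: algebra_simps flip: powr_add)
    finally show ?thesis .
  qed
  have wint: "set_integrable lborel {0<..} (\<lambda>t. C * (t powr (\<alpha> - s - \<epsilon> - 1) * exp (- d * t)))"
    using set_integrable_powr_exp[of "\<alpha> - s - \<epsilon>" d] \<epsilon>(3) d by simp
  have lim: "(\<lambda>N. LINT t:{0<..}|lborel. \<phi> N t) \<longlonglongrightarrow> (LINT t:{0<..}|lborel. of_real (t powr (\<alpha> - 1)) * G (Complex x t))"
    unfolding set_lebesgue_integral_def
  proof (rule integral_dominated_convergence[where w = "\<lambda>t. indicator {0<..} t *\<^sub>R (C * (t powr (\<alpha> - s - \<epsilon> - 1) * exp (- d * t)))"])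
    show "(\<lambda>t. indicat_real {0<..} t *\<^sub>R (of_real (t powr (\<alpha> - 1)) * G (Complex x t))) \<in> borel_measurable lborel"
      using decays_integrable[OF assms(2,4), of x] by (simp add: set_integrable_def)
    show "(\<lambda>t. indicat_real {0<..} t *\<^sub>R \<phi> N t) \<in> borel_measurable lborel" for N
      using set_borel_measurable_continuous_on_interval[OF cont] by (simp add: set_borel_measurable_def)
    show "integrable lborel (\<lambda>t. indicat_real {0<..} t *\<^sub>R (C * (t powr (\<alpha> - s - \<epsilon> - 1) * exp (- d * t))))"
      using wint unfolding set_integrable_def .
    show "AE t in lborel. (\<lambda>N. indicat_real {0<..} t *\<^sub>R \<phi> N t) \<longlonglongrightarrow> indicat_real {0<..} t *\<^sub>R (of_real (t powr (\<alpha> - 1)) * G (Complex x t))"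
    proof (rule AE_I2)
      fix t :: real
      show "(\<lambda>N. indicat_real {0<..} t *\<^sub>R \<phi> N t) \<longlonglongrightarrow> indicat_real {0<..} t *\<^sub>R (of_real (t powr (\<alpha> - 1)) * G (Complex x t))"
      proof (cases "t > 0")
        case True
        then have "(\<lambda>N. \<Sum>n<N. b n * qchar (real n + \<kappa>) (Complex x t)) \<longlonglongrightarrow> G (Complex x t)"
          using sums[of "Complex x t"] by (simp add: upper_half_def sums_def)
        then show ?thesis using True unfolding \<phi>_def by (auto intro!: tendsto_intros)
      qed auto
    qed
    show "AE t in lborel. norm (indicat_real {0<..} t *\<^sub>R \<phi> N t) \<le> indicat_real {0<..} t *\<^sub>R (C * (t powr (\<alpha> - s - \<epsilon> - 1) * exp (- d * t)))" for N
      using \<phi>b by (intro AE_I2) (auto simp: indicator_def)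
  qed
  have int1: "(LINT t:{0<..}|lborel. complex_of_real (t powr (\<alpha> - 1)) * qchar \<nu> (Complex x t)) =
      qchar \<nu> (of_real x) * of_real (Gamma \<alpha> * (2 * pi * \<nu>) powr (- \<alpha>))"
    and int2: "set_integrable lborel {0<..} (\<lambda>t. complex_of_real (t powr (\<alpha> - 1)) * qchar \<nu> (Complex x t))"
    if \<nu>: "\<nu> > 0" for \<nu>
  proof -
    have eq: "complex_of_real (t powr (\<alpha> - 1)) * qchar \<nu> (Complex x t) =
        qchar \<nu> (of_real x) * of_real (t powr (\<alpha> - 1) * exp (- (2 * pi * \<nu>) * t))" for t
    proof -
      have "qchar \<nu> (Complex x t) = qchar \<nu> (of_real x) * qchar \<nu> (\<i> * of_real t)"
        by (simp add: Complex_eq qchar_add)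
      also have "qchar \<nu> (\<i> * of_real t) = exp (of_real (- (2 * pi * \<nu>) * t))"
        unfolding qchar_def by (rule arg_cong[where f = exp]) (simp add: algebra_simps)
      finally show ?thesis unfolding exp_of_real by simp
    qed
    have i: "set_integrable lborel {0<..} (\<lambda>t. complex_of_real (t powr (\<alpha> - 1) * exp (- (2 * pi * \<nu>) * t)))"
      using \<nu> \<alpha> set_integrable_powr_exp[of \<alpha> "2 * pi * \<nu>"]
      by (intro set_integrable_complex_of_real) (auto simp: mult_pos_pos)
    show "set_integrable lborel {0<..} (\<lambda>t. complex_of_real (t powr (\<alpha> - 1)) * qchar \<nu> (Complex x t))"
      unfolding eq using i by simp
    have "(LINT t:{0<..}|lborel. complex_of_real (t powr (\<alpha> - 1) * exp (- (2 * pi * \<nu>) * t))) = of_real (Gamma \<alpha> * (2 * pi * \<nu>) powr (- \<alpha>))"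
      unfolding set_integral_complex_of_real using \<nu> \<alpha> LINT_powr_exp[of \<alpha> "2 * pi * \<nu>"] by simp
    then show "(LINT t:{0<..}|lborel. complex_of_real (t powr (\<alpha> - 1)) * qchar \<nu> (Complex x t)) =
      qchar \<nu> (of_real x) * of_real (Gamma \<alpha> * (2 * pi * \<nu>) powr (- \<alpha>))"
      unfolding eq by simp
  qed
  define c where "c = (2 * pi) powr \<alpha> / Gamma \<alpha>"
  have "of_real c * (LINT t:{0<..}|lborel. \<phi> N t) = (\<Sum>n<N. b n * of_real ((real n + \<kappa>) powr (- \<alpha>)) * qchar (real n + \<kappa>) (of_real x))" for N
  proof -
    have "(LINT t:{0<..}|lborel. \<phi> N t) = (LINT t:{0<..}|lborel. (\<Sum>n<N. b n * (of_real (t powr (\<alpha> - 1)) * qchar (real n + \<kappa>) (Complex x t))))"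
      unfolding \<phi>_def by (simp add: sum_distrib_left mult_ac)
    also have "\<dots> = (\<Sum>n<N. (LINT t:{0<..}|lborel. b n * (of_real (t powr (\<alpha> - 1)) * qchar (real n + \<kappa>) (Complex x t))))"
      unfolding set_lebesgue_integral_def scaleR_sum_right
    proof (rule Bochner_Integration.integral_sum)
      fix n
      have "set_integrable lborel {0<..} (\<lambda>t. b n * (of_real (t powr (\<alpha> - 1)) * qchar (real n + \<kappa>) (Complex x t)))"
        using \<kappa> int2[of "real n + \<kappa>"] by simp
      then show "integrable lborel (\<lambda>t. indicat_real {0<..} t *\<^sub>R (b n * (of_real (t powr (\<alpha> - 1)) * qchar (real n + \<kappa>) (Complex x t))))"
        unfolding set_integrable_def .
    qed
    also have "\<dots> = (\<Sum>n<N. b n * (qchar (real n + \<kappa>) (of_real x) * of_real (Gamma \<alpha> * (2 * pi * (real n + \<kappa>)) powr (- \<alpha>))))"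
      using \<kappa> by (intro sum.cong refl) (simp add: int1)
    also have "of_real c * \<dots> = (\<Sum>n<N. b n * of_real ((real n + \<kappa>) powr (- \<alpha>)) * qchar (real n + \<kappa>) (of_real x))"
      unfolding sum_distrib_left
    proof (intro sum.cong refl)
      fix n
      have "c * (Gamma \<alpha> * (2 * pi * (real n + \<kappa>)) powr (- \<alpha>)) = (real n + \<kappa>) powr (- \<alpha>)"
      proof -
        have "(2 * pi * (real n + \<kappa>)) powr (- \<alpha>) = (2 * pi) powr (- \<alpha>) * (real n + \<kappa>) powr (- \<alpha>)"
          using \<kappa> by (intro powr_mult)
        moreover have "(2 * pi) powr \<alpha> * (2 * pi) powr (- \<alpha>) = 1" by (simp flip: powr_add)
        moreover have "Gamma \<alpha> \<noteq> 0" using Gamma_real_pos[OF \<alpha>] by simp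
        ultimately show ?thesis by (simp add: c_def)
      qed
      then have "complex_of_real c * of_real (Gamma \<alpha> * (2 * pi * (real n + \<kappa>)) powr (- \<alpha>)) = of_real ((real n + \<kappa>) powr (- \<alpha>))"
        by (simp flip: of_real_mult)
      then show "of_real c * (b n * (qchar (real n + \<kappa>) (of_real x) * of_real (Gamma \<alpha> * (2 * pi * (real n + \<kappa>)) powr (- \<alpha>)))) =
          b n * of_real ((real n + \<kappa>) powr (- \<alpha>)) * qchar (real n + \<kappa>) (of_real x)"
        by (simp add: mult_ac)
    qed
    finally show ?thesis .
  qed
  then have "(\<lambda>N. \<Sum>n<N. b n * of_real ((real n + \<kappa>) powr (- \<alpha>)) * qchar (real n + \<kappa>) (of_real x)) \<longlonglongrightarrow>
      of_real c * (LINT t:{0<..}|lborel. of_real (t powr (\<alpha> - 1)) * G (Complex x t))"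
    using tendsto_mult_left[OF lim, of "of_real c"] by simp
  then show ?thesis unfolding sums_def c_def .
qed

subsection \<open>The incomplete beta integral and its logarithmic case\<close>

text \<open>The function \<open>psi\<close> for complex arguments, with \<beta> in the role of
  \<alpha> - r. The integral is expanded along the imaginary axis and only afterwards rotated to
  real arguments.\<close>

definition chi :: "real \<Rightarrow> complex \<Rightarrow> complex" where
  "chi \<beta> y = (if \<beta> \<in> \<int> then y powr of_real \<beta> * Ln y else y powr of_real \<beta>)"

text \<open>The condition Re y > -1 keeps 1 + t y off the cut for t in [0,1]; removing the cut makes
  powers of y and of t + y holomorphic. All points -i h with real h nonzero lie in this set.\<close>

definition slit :: "complex set" where
  "slit = {y. Re y > -1} - \<real>\<^sub>\<le>\<^sub>0"

lemma open_right: "open {y. Re y > -1}"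
  by (rule open_halfspace_Re_gt)

lemma open_slit: "open slit"
  unfolding slit_def by (intro open_Diff open_right closed_nonpos_Reals_complex)

lemma connected_slit: "connected slit"
proof (rule starlike_imp_connected)
  have "(1 - u) *\<^sub>R 1 + u *\<^sub>R y \<in> slit" if y: "y \<in> slit" and u: "0 \<le> u" "u \<le> 1" for y u
  proof -
    have 1: "Re y > -1" "Re y > 0 \<or> Im y \<noteq> 0" using y by (auto simp: slit_def complex_nonpos_Reals_iff)
    have 2: "(1 - u) + u * Re y > -1"
    proof -
      have "u * Re y \<ge> u * (-1)" using 1 u by (intro mult_left_mono) auto
      moreover have "u * Re y > u * (-1)" if "u \<noteq> 0" using 1 u that by (intro mult_strict_left_mono) auto
      ultimately show ?thesis using u by (cases "u = 0") auto
    qed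
    have 3: "(1 - u) + u * Re y > 0 \<or> u * Im y \<noteq> 0"
    proof (cases "Im y = 0")
      case True
      then have "Re y > 0" using 1 by simp
      then have "u * Re y \<ge> 0" "u > 0 \<Longrightarrow> u * Re y > 0" using u by auto
      then show ?thesis using u by (cases "u = 0") auto
    next
      case False
      then show ?thesis using u by (cases "u = 0") auto
    qed
    show ?thesis using 2 3 by (auto simp: slit_def complex_nonpos_Reals_iff)
  qed
  then have "closed_segment 1 y \<subseteq> slit" if "y \<in> slit" for y
    using that unfolding closed_segment_def by blast
  then show "starlike slit"
    unfolding starlike_def by (intro bexI[of _ 1] ballI) (auto simp: slit_def complex_nonpos_Reals_iff)
qed

lemma continuous_on_powr_slit:
  fixes f :: "'a::topological_space \<Rightarrow> complex"
  assumes "continuous_on A f" "\<And>x. x \<in> A \<Longrightarrow> f x \<notin> \<real>\<^sub>\<le>\<^sub>0"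
  shows "continuous_on A (\<lambda>x. f x powr c)"
  using assms(2) by (intro continuous_on_powr_complex assms(1) continuous_on_const)
    (force simp: complex_nonpos_Reals_iff)+

text \<open>One Leibniz rule serves both families below: the integrand is a power of a function
  linear in y, with coefficients s^(1/a), 1 in one case and 1, s^(1/p) in the other.\<close>

lemma integral_linear_powr:
  fixes u v :: "real \<Rightarrow> real" and y0 :: complex
  assumes uv: "continuous_on {0..1} u" "continuous_on {0..1} v"
    and U: "open U" "y0 \<in> U"
    and E: "\<And>y s. y \<in> U \<Longrightarrow> s \<in> {0..1} \<Longrightarrow> of_real (u s) + of_real (v s) * y \<notin> \<real>\<^sub>\<le>\<^sub>0"
  shows "((\<lambda>y. integral {0..1} (\<lambda>s. (of_real (u s) + of_real (v s) * y) powr (- of_real r))) has_field_derivative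
      integral {0..1} (\<lambda>s. - of_real r * of_real (v s) * (of_real (u s) + of_real (v s) * y0) powr (- of_real r - 1))) (at y0)"
    and "(\<lambda>s. (of_real (u s) + of_real (v s) * y0) powr c) integrable_on {0..1}"
proof -
  obtain e where e: "e > 0" "ball y0 e \<subseteq> U" using U openE by blast
  define f where "f y s = (of_real (u s) + of_real (v s) * y) powr (- of_real r)" for y :: complex and s
  define fy where "fy y s = - of_real r * of_real (v s) * (of_real (u s) + of_real (v s) * y) powr (- of_real r - 1)" for y :: complex and s
  have cu: "continuous_on (ball y0 e \<times> {0..1}) (\<lambda>x. complex_of_real (u (snd x)))"
    and cv: "continuous_on (ball y0 e \<times> {0..1}) (\<lambda>x. complex_of_real (v (snd x)))"
    by (intro continuous_on_of_real continuous_on_compose2[OF uv(1)] continuous_on_compose2[OF uv(2)] continuous_intros; auto)+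
  have cE: "continuous_on (ball y0 e \<times> {0..1}) (\<lambda>x. (complex_of_real (u (snd x)) + of_real (v (snd x)) * fst x) powr c)" for c
    using e E by (intro continuous_on_powr_slit continuous_intros cu cv) auto
  have sec: "continuous_on {0..1} (\<lambda>s. (complex_of_real (u s) + of_real (v s) * y) powr c)" if "y \<in> ball y0 e" for y c
    using e E that by (intro continuous_on_powr_slit continuous_intros uv) auto
  have "((\<lambda>y. integral (cbox 0 1) (f y)) has_field_derivative integral (cbox 0 1) (fy y0)) (at y0 within ball y0 e)"
  proof (rule leibniz_rule_field_derivative)
    show "((\<lambda>y. f y s) has_field_derivative fy y s) (at y within ball y0 e)" if "y \<in> ball y0 e" "s \<in> cbox 0 1" for y s
    proof -
      have "of_real (u s) + of_real (v s) * y \<notin> \<real>\<^sub>\<le>\<^sub>0" using that e E by auto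
      then have "((\<lambda>y. f y s) has_field_derivative fy y s) (at y)"
        unfolding f_def fy_def by (auto intro!: derivative_eq_intros)
      then show ?thesis by (rule has_field_derivative_at_within)
    qed
    show "f y integrable_on cbox 0 1" if "y \<in> ball y0 e" for y
      using sec[OF that] unfolding f_def cbox_interval by (rule integrable_continuous_interval)
    show "continuous_on (ball y0 e \<times> cbox 0 1) (\<lambda>(y, s). fy y s)"
      unfolding fy_def cbox_interval case_prod_beta by (intro continuous_intros cE cv)
  qed (use e in auto)
  then show "((\<lambda>y. integral {0..1} (\<lambda>s. (of_real (u s) + of_real (v s) * y) powr (- of_real r))) has_field_derivative
      integral {0..1} (\<lambda>s. - of_real r * of_real (v s) * (of_real (u s) + of_real (v s) * y0) powr (- of_real r - 1))) (at y0)"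
    using e at_within_open[of y0 "ball y0 e"] by (simp add: f_def[abs_def] fy_def[abs_def])
  show "(\<lambda>s. (of_real (u s) + of_real (v s) * y0) powr c) integrable_on {0..1}"
    using sec e by (intro integrable_continuous_interval) auto
qed

text \<open>After the substitution \<open>s = t\<^sup>a\<close> the integral of \<open>t\<^bsup>a-1\<^esup> (t + y)\<^bsup>-r\<^esup>\<close> over \<open>[0,1]\<close> is \<open>Jint a r y / a\<close>, and the
  integrand is continuous.\<close>

definition Jint :: "real \<Rightarrow> real \<Rightarrow> complex \<Rightarrow> complex" where
  "Jint a r y = integral {0..1} (\<lambda>s. (of_real (s powr (1/a)) + of_real 1 * y) powr (- of_real r))"

text \<open>The Gauss function 2F1(r, p; p+1; -y), equal to p times the integral of t^(p-1) (1 + t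
  y)^(-r) over [0,1]. For p = r - a the inversion of t turns it into the integral of t^(a-1) (t +
  y)^(-r) over t > 1, up to a factor. It is holomorphic across y = 0.\<close>

definition Sint :: "real \<Rightarrow> real \<Rightarrow> complex \<Rightarrow> complex" where
  "Sint p r y = integral {0..1} (\<lambda>s. (of_real 1 + of_real (s powr (1/p)) * y) powr (- of_real r))"

lemma continuous_on_root_powr: "a > 0 \<Longrightarrow> continuous_on {0..1} (\<lambda>s::real. s powr (1/a))"
  by (rule continuous_on_powr') (auto intro!: continuous_intros)

lemma Jint_domain:
  fixes y :: complex
  assumes "y \<notin> \<real>\<^sub>\<le>\<^sub>0" "s \<in> {0..1}"
  shows "of_real (s powr k) + of_real 1 * y \<notin> \<real>\<^sub>\<le>\<^sub>0"
proof
  assume "of_real (s powr k) + of_real 1 * y \<in> \<real>\<^sub>\<le>\<^sub>0"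
  then have "s powr k + Re y \<le> 0" "Im y = 0" by (auto simp: complex_nonpos_Reals_iff)
  moreover from this have "Re y \<le> 0" using powr_ge_zero[of s k] by linarith
  ultimately show False using assms(1) by (simp add: complex_nonpos_Reals_iff)
qed

lemma Sint_domain:
  assumes "Re y > -1" "s \<in> {0..1}" "k > 0"
  shows "of_real 1 + of_real (s powr k) * y \<notin> \<real>\<^sub>\<le>\<^sub>0"
proof -
  define t where "t = s powr k"
  have t: "0 \<le> t" "t \<le> 1" using assms by (auto simp: t_def powr_le1)
  have "1 + t * Re y > 0"
  proof (cases "t = 0")
    case False
    then have "t * Re y > t * (-1)" using t assms(1) by (intro mult_strict_left_mono) auto
    then show ?thesis using t by simp
  qed simp
  then show ?thesis unfolding complex_nonpos_Reals_iff by (simp add: t_def)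
qed

lemma Jint_has_deriv:
  assumes "a > 0" "y \<notin> \<real>\<^sub>\<le>\<^sub>0"
  shows "(Jint a r has_field_derivative - of_real r * Jint a (r + 1) y) (at y)"
proof -
  have *: "- complex_of_real r - 1 = - of_real (r + 1)" by simp
  have "(Jint a r has_field_derivative integral {0..1} (\<lambda>s. - of_real r * of_real 1 * (of_real (s powr (1/a)) + of_real 1 * y) powr (- of_real r - 1))) (at y)"
    unfolding Jint_def[abs_def]
    by (rule integral_linear_powr(1)[where U = "- \<real>\<^sub>\<le>\<^sub>0"])
      (use assms in \<open>auto simp: open_Compl closed_nonpos_Reals_complex continuous_on_root_powr dest: Jint_domain[simplified]\<close>)
  then show ?thesis unfolding * by (simp add: Jint_def)
qed

lemma Jint_integrable:
  fixes y :: complex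
  assumes "a > 0" "y \<notin> \<real>\<^sub>\<le>\<^sub>0"
  shows "(\<lambda>s. (of_real (s powr (1/a)) + of_real 1 * y) powr c) integrable_on {0..1}"
  by (rule integral_linear_powr(2)[where U = "- \<real>\<^sub>\<le>\<^sub>0"])
    (use assms in \<open>auto simp: open_Compl closed_nonpos_Reals_complex continuous_on_root_powr dest: Jint_domain[simplified]\<close>)

lemma Sint_has_deriv:
  assumes "p > 0" "Re y > -1"
  shows "(Sint p r has_field_derivative integral {0..1} (\<lambda>s. - of_real r * of_real (s powr (1/p)) *
      (of_real 1 + of_real (s powr (1/p)) * y) powr (- of_real r - 1))) (at y)"
  unfolding Sint_def[abs_def]
  by (rule integral_linear_powr(1)[where U = "{y. Re y > -1}"])
    (use assms in \<open>auto simp: open_right continuous_on_root_powr dest: Sint_domain[where k = "1/p", simplified]\<close>)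

text \<open>Integration of the derivative of s E(s)^(-r), where s^(1/a) is rewritten as E(s) - y.
  For a different from r it raises r by one; for a = r the first term drops out and the derivative
  of \<open>Jint a a\<close> becomes explicit.\<close>

lemma Jint_recursion:
  assumes "a > 0" "y \<notin> \<real>\<^sub>\<le>\<^sub>0"
  shows "(1 + y) powr (- of_real r) = of_real (1 - r / a) * Jint a r y + of_real (r / a) * y * Jint a (r + 1) y"
proof -
  define E where "E s = of_real (s powr (1/a)) + of_real 1 * y" for s :: real
  have dom: "E s \<notin> \<real>\<^sub>\<le>\<^sub>0" if "s \<in> {0..1}" for s
    unfolding E_def by (rule Jint_domain[OF assms(2) that])
  have cE: "continuous_on {0..1} E"
    unfolding E_def[abs_def] by (intro continuous_intros continuous_on_root_powr assms)
  have *: "- complex_of_real r - 1 = - of_real (r + 1)" by simp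
  have i1: "((\<lambda>s. of_real (1 - r / a) * E s powr (- of_real r) + of_real (r / a) * y * E s powr (- of_real r - 1)) has_integral
      (of_real 1 * E 1 powr (- of_real r) - of_real 0 * E 0 powr (- of_real r))) {0..1}"
  proof (rule fundamental_theorem_of_calculus_interior)
    show "continuous_on {0..1} (\<lambda>s. complex_of_real s * E s powr (- of_real r))"
      using dom by (intro continuous_on_powr_slit continuous_intros cE) auto
    fix s :: real assume s: "s \<in> {0<..<1}"
    have dE: "(E has_vector_derivative of_real (1/a * s powr (1/a - 1))) (at s)"
    proof -
      have "((\<lambda>s. s powr (1/a)) has_real_derivative 1/a * s powr (1/a - 1)) (at s)"
        using s by (auto intro!: derivative_eq_intros)
      then have "((\<lambda>s. complex_of_real (s powr (1/a))) has_vector_derivative of_real (1/a * s powr (1/a - 1))) (at s)"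
        by (rule has_vector_derivative_of_real)
      from has_vector_derivative_add[OF this has_vector_derivative_const[of y]]
      show ?thesis unfolding E_def[abs_def] by simp
    qed
    have "((\<lambda>z. z powr (- of_real r)) has_field_derivative - of_real r * E s powr (- of_real r - 1)) (at (E s))"
      using dom[of s] s by (intro has_field_derivative_powr) auto
    from field_vector_diff_chain_at[OF dE this]
    have "((\<lambda>s. E s powr (- of_real r)) has_vector_derivative of_real (1/a * s powr (1/a - 1)) * (- of_real r * E s powr (- of_real r - 1))) (at s)"
      unfolding comp_def .
    then have D: "((\<lambda>s. complex_of_real s * E s powr (- of_real r)) has_vector_derivative
       of_real s * (of_real (1/a * s powr (1/a - 1)) * (- of_real r * E s powr (- of_real r - 1))) + of_real 1 * E s powr (- of_real r)) (at s)"
      by (intro has_vector_derivative_mult has_vector_derivative_of_real) (auto intro!: derivative_eq_intros)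
    have "of_real s * (of_real (1/a * s powr (1/a - 1)) * (- of_real r * E s powr (- of_real r - 1))) =
        - of_real (r / a) * (of_real (s * s powr (1/a - 1)) * E s powr (- of_real r - 1))"
      using assms by (simp add: field_simps)
    also have "s * s powr (1/a - 1) = s powr (1/a)" using s by (simp add: powr_diff)
    also have "of_real (s powr (1/a)) = E s - y" by (simp add: E_def)
    also have "(E s - y) * E s powr (- of_real r - 1) = E s powr (- of_real r) - y * E s powr (- of_real r - 1)"
    proof -
      have nz: "E s \<noteq> 0" using dom[of s] s by auto
      then have "E s powr (- of_real r - 1) = E s powr (- of_real r) / E s" by (simp add: powr_diff)
      then show ?thesis using nz by (simp add: field_simps)
    qed
    finally show "((\<lambda>s. complex_of_real s * E s powr (- of_real r)) has_vector_derivative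
       of_real (1 - r / a) * E s powr (- of_real r) + of_real (r / a) * y * E s powr (- of_real r - 1)) (at s)"
      using D by (simp add: algebra_simps)
  qed auto
  have i2: "((\<lambda>s. of_real (1 - r / a) * E s powr (- of_real r) + of_real (r / a) * y * E s powr (- of_real r - 1)) has_integral
      (of_real (1 - r / a) * Jint a r y + of_real (r / a) * y * Jint a (r + 1) y)) {0..1}"
    unfolding Jint_def *[symmetric] E_def
    by (intro has_integral_add has_integral_mult_right integrable_integral Jint_integrable assms)
  from has_integral_unique[OF i1 i2] show ?thesis by (simp add: E_def)
qed

text \<open>The same boundary term s E(s)^(-r) as for \<open>Jint_recursion\<close>, now read as a
  first order differential equation in y.\<close>

lemma Sint_ode:
  assumes "p > 0" "Re y > -1"
  shows "(1 + y) powr (- of_real r) = Sint p r y + of_real (1 / p) * y * deriv (Sint p r) y"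
proof -
  define E where "E s = of_real 1 + of_real (s powr (1/p)) * y" for s :: real
  have dom: "E s \<notin> \<real>\<^sub>\<le>\<^sub>0" if "s \<in> {0..1}" for s
    unfolding E_def using assms that by (intro Sint_domain) auto
  have ck: "continuous_on {0..1} (\<lambda>s::real. s powr (1/p))" by (rule continuous_on_root_powr[OF assms(1)])
  have cE: "continuous_on {0..1} E"
    unfolding E_def[abs_def] by (intro continuous_intros ck)
  define g where "g s = - of_real r * of_real (s powr (1/p)) * E s powr (- of_real r - 1)" for s
  have i1: "((\<lambda>s. E s powr (- of_real r) + of_real (1 / p) * y * g s) has_integral
      (of_real 1 * E 1 powr (- of_real r) - of_real 0 * E 0 powr (- of_real r))) {0..1}"
  proof (rule fundamental_theorem_of_calculus_interior)
    show "continuous_on {0..1} (\<lambda>s. complex_of_real s * E s powr (- of_real r))"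
      using dom by (intro continuous_on_powr_slit continuous_intros cE) auto
    fix s :: real assume s: "s \<in> {0<..<1}"
    have dE: "(E has_vector_derivative of_real (1/p * s powr (1/p - 1)) * y) (at s)"
    proof -
      have "((\<lambda>s. s powr (1/p)) has_real_derivative 1/p * s powr (1/p - 1)) (at s)"
        using s by (auto intro!: derivative_eq_intros)
      then have "((\<lambda>s. complex_of_real (s powr (1/p))) has_vector_derivative of_real (1/p * s powr (1/p - 1))) (at s)"
        by (rule has_vector_derivative_of_real)
      from has_vector_derivative_add[OF has_vector_derivative_const[of 1] has_vector_derivative_mult_left[OF this, of y]]
      show ?thesis unfolding E_def[abs_def] by simp
    qed
    have "((\<lambda>z. z powr (- of_real r)) has_field_derivative - of_real r * E s powr (- of_real r - 1)) (at (E s))"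
      using dom[of s] s by (intro has_field_derivative_powr) auto
    from field_vector_diff_chain_at[OF dE this]
    have "((\<lambda>s. E s powr (- of_real r)) has_vector_derivative of_real (1/p * s powr (1/p - 1)) * y * (- of_real r * E s powr (- of_real r - 1))) (at s)"
      unfolding comp_def .
    then have D: "((\<lambda>s. complex_of_real s * E s powr (- of_real r)) has_vector_derivative
       of_real s * (of_real (1/p * s powr (1/p - 1)) * y * (- of_real r * E s powr (- of_real r - 1))) + of_real 1 * E s powr (- of_real r)) (at s)"
      by (intro has_vector_derivative_mult has_vector_derivative_of_real) (auto intro!: derivative_eq_intros)
    have "of_real s * (of_real (1/p * s powr (1/p - 1)) * y * (- of_real r * E s powr (- of_real r - 1))) =
        of_real (1 / p) * y * (- of_real r * of_real (s * s powr (1/p - 1)) * E s powr (- of_real r - 1))"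
      using assms by (simp add: field_simps)
    also have "s * s powr (1/p - 1) = s powr (1/p)" using s by (simp add: powr_diff)
    also have "of_real (1 / p) * y * (- of_real r * of_real (s powr (1/p)) * E s powr (- of_real r - 1)) = of_real (1 / p) * y * g s"
      by (simp add: g_def)
    finally show "((\<lambda>s. complex_of_real s * E s powr (- of_real r)) has_vector_derivative
       E s powr (- of_real r) + of_real (1 / p) * y * g s) (at s)"
      using D by (simp add: add.commute)
  qed auto
  have i2: "((\<lambda>s. E s powr (- of_real r) + of_real (1 / p) * y * g s) has_integral
      (Sint p r y + of_real (1 / p) * y * integral {0..1} g)) {0..1}"
    unfolding Sint_def E_def[symmetric]
  proof (intro has_integral_add has_integral_mult_right integrable_integral integrable_continuous_interval)
    show "continuous_on {0..1} (\<lambda>s. E s powr (- of_real r))" using dom by (intro continuous_on_powr_slit continuous_intros cE) auto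
    show "continuous_on {0..1} g" unfolding g_def[abs_def] using dom by (intro continuous_on_powr_slit continuous_intros cE ck) auto
  qed
  have "deriv (Sint p r) y = integral {0..1} g"
    using DERIV_imp_deriv[OF Sint_has_deriv[OF assms, of r]] by (simp add: g_def[abs_def] E_def)
  with has_integral_unique[OF i1 i2] show ?thesis by (simp add: E_def)
qed

lemma Sint_holomorphic:
  assumes "p > 0"
  shows "Sint p r holomorphic_on {y. Re y > -1}"
  unfolding holomorphic_on_open[OF open_right]
proof
  fix y assume "y \<in> {y. Re y > -1}"
  then show "\<exists>f'. (Sint p r has_field_derivative f') (at y)" using Sint_has_deriv[OF assms, of y r] by blast
qed

text \<open>Since a < r, the integral of t^(a-1) (t + y)^(-r) converges over the whole half-line and
  is homogeneous of degree a - r in y. Its part over t > 1 is the \<open>Sint\<close> term, so the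
  part over [0,1] is a pure power plus a holomorphic function.\<close>

lemma Jint_expansion_neg:
  assumes "0 < a" "a < r"
  shows "\<exists>A\<noteq>0. \<forall>y\<in>slit. Jint a r y = A * y powr of_real (a - r) + (- of_real (a / (r - a)) * Sint (r - a) r y)"
proof -
  define p where "p = r - a"
  have p: "p > 0" using assms by (simp add: p_def)
  \<comment> \<open>This is a times the integral over the whole half-line; homogeneity is proved by
    showing that y^p W has derivative zero.\<close>
  define W where "W y = Jint a r y + of_real (a / p) * Sint p r y" for y
  have dW: "((\<lambda>y. y powr of_real p * W y) has_field_derivative 0) (at y)" if y: "y \<in> slit" for y
  proof -
    have y': "y \<notin> \<real>\<^sub>\<le>\<^sub>0" "Re y > -1" "y \<noteq> 0" using y by (auto simp: slit_def)
    define j where "j = - of_real r * Jint a (r + 1) y"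
    define d where "d = deriv (Sint p r) y"
    have dS: "(Sint p r has_field_derivative d) (at y)"
      unfolding d_def by (rule holomorphic_derivI[OF Sint_holomorphic[OF p] open_right]) (use y' in auto)
    have dJ: "(Jint a r has_field_derivative j) (at y)"
      unfolding j_def by (rule Jint_has_deriv[OF assms(1) y'(1)])
    have D: "((\<lambda>y. y powr of_real p * W y) has_field_derivative
       y powr of_real p * (j + of_real (a / p) * d) + of_real p * y powr (of_real p - 1) * W y) (at y)"
      using DERIV_mult[OF has_field_derivative_powr[OF y'(1), of "of_real p"] DERIV_add[OF dJ DERIV_cmult[OF dS, of "of_real (a / p)"]]]
      unfolding W_def by (simp add: algebra_simps)
    have e1: "(1 + y) powr (- of_real r) = of_real (1 - r / a) * Jint a r y - of_real (1 / a) * y * j"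
      using Jint_recursion[OF assms(1) y'(1), of r] by (simp add: j_def)
    have e2: "(1 + y) powr (- of_real r) = Sint p r y + of_real (1 / p) * y * d"
      unfolding d_def by (rule Sint_ode[OF p y'(2)])
    have "of_real p * W y + y * (j + of_real (a / p) * d) =
        of_real a * ((Sint p r y + of_real (1 / p) * y * d) - (of_real (1 - r / a) * Jint a r y - of_real (1 / a) * y * j))"
    proof -
      have ra: "of_real (1 - r / a) = - complex_of_real p / of_real a" using assms by (simp add: p_def field_simps)
      show ?thesis unfolding W_def ra using assms p by (simp add: field_simps)
    qed
    also have "\<dots> = 0" using e1 e2 by simp
    finally have "of_real p * W y + y * (j + of_real (a / p) * d) = 0" .
    moreover have "y powr of_real p * (j + of_real (a / p) * d) + of_real p * y powr (of_real p - 1) * W y =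
        y powr (of_real p - 1) * (of_real p * W y + y * (j + of_real (a / p) * d))"
      using y'(3) by (simp add: powr_diff field_simps)
    ultimately show ?thesis using D by simp
  qed
  have "\<exists>c. \<forall>y\<in>slit. y powr of_real p * W y = c"
  proof -
    have "continuous_on slit (\<lambda>y. y powr of_real p * W y)"
      by (intro continuous_at_imp_continuous_on ballI DERIV_isCont[OF dW])
    then obtain c where "\<And>y. y \<in> slit \<Longrightarrow> y powr of_real p * W y = c"
      using DERIV_zero_connected_constant[OF connected_slit open_slit finite.emptyI] dW by auto
    then show ?thesis by blast
  qed
  then obtain B where B: "\<And>y. y \<in> slit \<Longrightarrow> y powr of_real p * W y = B" by blast
  have one: "1 \<in> slit" by (auto simp: slit_def complex_nonpos_Reals_iff)
  \<comment> \<open>The constant does not vanish because both integrals have positive integrands at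
    y = 1.\<close>
  have pos: "Re (integral {0..1} g) > 0" if "continuous_on {0..1} g" "\<And>s. s \<in> {0..1} \<Longrightarrow> Re (g s) > 0" for g :: "real \<Rightarrow> complex"
  proof -
    have i: "g integrable_on {0..1}" by (rule integrable_continuous_interval[OF that(1)])
    have "Re (integral {0..1} g) = integral {0..1} (\<lambda>s. Re (g s))"
      using integral_linear[OF i bounded_linear_Re] by (simp add: comp_def)
    moreover have "integral {0..1} (\<lambda>s. Re (g s)) > integral {0..1} (\<lambda>s::real. 0::real)"
      by (rule integral_less_real) (use that in \<open>auto intro!: continuous_intros\<close>)
    ultimately show ?thesis by simp
  qed
  have powrpos: "Re ((of_real x) powr (- of_real r)) > 0" if "x > 0" for x :: real
    using that powr_of_real[of x "-r"] by simp
  have "Re (Jint a r 1) > 0" unfolding Jint_def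
  proof (rule pos)
    show "continuous_on {0..1} (\<lambda>s. (complex_of_real (s powr (1/a)) + of_real 1 * 1) powr (- of_real r))"
      using Jint_domain[of 1] by (intro continuous_on_powr_slit continuous_intros continuous_on_root_powr assms) auto
    show "Re ((complex_of_real (s powr (1/a)) + of_real 1 * 1) powr (- of_real r)) > 0" for s
      using powrpos[of "s powr (1/a) + 1"] by (simp add: add_nonneg_pos)
  qed
  moreover have "Re (Sint p r 1) > 0" unfolding Sint_def
  proof (rule pos)
    show "continuous_on {0..1} (\<lambda>s. (of_real 1 + complex_of_real (s powr (1/p)) * 1) powr (- of_real r))"
      using Sint_domain[of 1 _ "1/p"] p by (intro continuous_on_powr_slit continuous_intros continuous_on_root_powr) auto
    show "Re ((of_real 1 + complex_of_real (s powr (1/p)) * 1) powr (- of_real r)) > 0" for s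
      using powrpos[of "1 + s powr (1/p)"] by (simp add: add_pos_nonneg)
  qed
  ultimately have "Re (W 1) > 0" unfolding W_def using assms p by (simp add: add_pos_pos)
  then have "B \<noteq> 0" using B[OF one] by auto
  moreover have "Jint a r y = B * y powr of_real (a - r) + (- of_real (a / (r - a)) * Sint (r - a) r y)" if "y \<in> slit" for y
  proof -
    have "y \<noteq> 0" using that by (auto simp: slit_def)
    then have "W y = B * y powr (- of_real p)"
      using B[OF that] by (simp add: powr_minus field_simps)
    then show ?thesis by (simp add: W_def p_def algebra_simps)
  qed
  ultimately show ?thesis by blast
qed

text \<open>In the resonant case the derivative of \<open>Jint a a\<close> is -a (1+y)^(-a) / y. Its
  simple pole at 0 has residue -a and integrates to the logarithm; what remains is holomorphic on a
  convex set and has a primitive.\<close>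

lemma Jint_expansion_zero:
  assumes "0 < a"
  shows "\<exists>A S. A \<noteq> 0 \<and> S holomorphic_on {y. Re y > -1} \<and> (\<forall>y\<in>slit. Jint a a y = A * Ln y + S y)"
proof -
  define f where "f y = - of_real a * (1 + y) powr (- of_real a)" for y :: complex
  \<comment> \<open>The derivative with its pole at 0 subtracted, continued across the removable
    singularity.\<close>
  define h where "h y = (if y = 0 then deriv f 0 else (f y - f 0) / (y - 0))" for y
  have fh: "f holomorphic_on {y. Re y > -1}"
    unfolding f_def[abs_def] by (intro holomorphic_intros) (auto simp: complex_nonpos_Reals_iff)
  have "h holomorphic_on {y. Re y > -1}"
    unfolding h_def[abs_def] by (rule pole_lemma[OF fh]) (simp add: interior_open[OF open_right])
  then obtain S where S: "\<And>y. Re y > -1 \<Longrightarrow> (S has_field_derivative h y) (at y)"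
    using holomorphic_convex_primitive'[OF convex_halfspace_Re_gt open_right, of h] at_within_open[OF _ open_right] by fastforce
  have "((\<lambda>y. Jint a a y + of_real a * Ln y - S y) has_field_derivative 0) (at y)" if y: "y \<in> slit" for y
  proof -
    have y': "y \<notin> \<real>\<^sub>\<le>\<^sub>0" "Re y > -1" "y \<noteq> 0" using y by (auto simp: slit_def)
    have "((\<lambda>y. Jint a a y + of_real a * Ln y - S y) has_field_derivative
        (- of_real a * Jint a (a + 1) y + of_real a * inverse y - h y)) (at y)"
      by (rule DERIV_diff[OF DERIV_add[OF Jint_has_deriv[OF assms y'(1)] DERIV_cmult[OF has_field_derivative_Ln[OF y'(1)]]] S[OF y'(2)]])
    moreover have "- of_real a * Jint a (a + 1) y + of_real a * inverse y - h y = 0"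
    proof -
      have "(1 + y) powr (- of_real a) = y * Jint a (a + 1) y"
        using Jint_recursion[OF assms y'(1), of a] assms by simp
      then show ?thesis using y'(3) by (simp add: h_def f_def field_simps)
    qed
    ultimately show ?thesis by simp
  qed
  note dW = this
  have "continuous_on slit (\<lambda>y. Jint a a y + of_real a * Ln y - S y)"
    by (intro continuous_at_imp_continuous_on ballI DERIV_isCont[OF dW])
  then obtain c where c: "\<And>y. y \<in> slit \<Longrightarrow> Jint a a y + of_real a * Ln y - S y = c"
    using DERIV_zero_connected_constant[OF connected_slit open_slit finite.emptyI] dW by auto
  have "(\<lambda>y. S y + c) holomorphic_on {y. Re y > -1}"
  proof -
    have "S holomorphic_on {y. Re y > -1}" using S by (auto simp: holomorphic_on_open[OF open_right])
    then show ?thesis by (intro holomorphic_intros)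
  qed
  moreover have "Jint a a y = - of_real a * Ln y + (S y + c)" if "y \<in> slit" for y
    using c[OF that] by (simp add: algebra_simps)
  ultimately show ?thesis using assms by (intro exI[of _ "- of_real a"] exI[of _ "\<lambda>y. S y + c"]) auto
qed

text \<open>The recursion lowers a - r by one until it lies in (-1,0], where it is either zero or
  not an integer. Going back multiplies by y, which turns \<open>chi\<close> for one exponent into
  \<open>chi\<close> for the next and keeps the logarithm.\<close>

lemma Jint_expansion:
  assumes "0 < a" "0 < r" "a - r > -1"
  shows "\<exists>A S. A \<noteq> 0 \<and> S holomorphic_on {y. Re y > -1} \<and> (\<forall>y\<in>slit. Jint a r y = A * chi (a - r) y + S y)"
proof -
  obtain n :: nat where "a - r \<le> real n" using real_arch_simple by blast
  then show ?thesis using assms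
  proof (induction n arbitrary: r)
    case 0
    show ?case
    proof (cases "a = r")
      case True
      have "chi (a - r) y = Ln y" if "y \<in> slit" for y using True that by (auto simp: chi_def slit_def)
      then show ?thesis using Jint_expansion_zero[OF \<open>0 < a\<close>] True by simp
    next
      case False
      then have ar: "a < r" using 0 by simp
      have "a - r \<notin> \<int>"
      proof
        assume "a - r \<in> \<int>"
        then obtain k :: int where "a - r = of_int k" by (auto elim: Ints_cases)
        then have "k > -1" "k \<le> 0" using 0 by linarith+
        then show False using \<open>a - r = of_int k\<close> False by simp
      qed
      then have chi: "chi (a - r) y = y powr of_real (a - r)" for y by (simp add: chi_def)
      have "(\<lambda>y. - of_real (a / (r - a)) * Sint (r - a) r y) holomorphic_on {y. Re y > -1}"
        using ar by (intro holomorphic_intros Sint_holomorphic) auto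
      then show ?thesis using Jint_expansion_neg[OF \<open>0 < a\<close> ar] unfolding chi by blast
    qed
  next
    case (Suc n)
    show ?case
    proof (cases "a - r \<le> real n")
      case True
      then show ?thesis using Suc by blast
    next
      case False
      then have pos: "a - r > 0" by (meson le_less_trans not_le of_nat_0_le_iff)
      obtain A S where A: "A \<noteq> 0" and S: "S holomorphic_on {y. Re y > -1}"
        and J: "\<And>y. y \<in> slit \<Longrightarrow> Jint a (r + 1) y = A * chi (a - (r + 1)) y + S y"
        using Suc.IH[of "r + 1"] Suc.prems pos by auto
      define A' where "A' = - of_real (r / (a - r)) * A"
      define S' where "S' y = of_real (a / (a - r)) * (1 + y) powr (- of_real r) - of_real (r / (a - r)) * y * S y" for y
      have "A' \<noteq> 0" using A Suc.prems pos by (simp add: A'_def)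
      moreover have "S' holomorphic_on {y. Re y > -1}"
        unfolding S'_def by (intro holomorphic_intros S) (auto simp: complex_nonpos_Reals_iff)
      moreover have "Jint a r y = A' * chi (a - r) y + S' y" if y: "y \<in> slit" for y
      proof -
        have y': "y \<notin> \<real>\<^sub>\<le>\<^sub>0" "y \<noteq> 0" using y by (auto simp: slit_def)
        have int: "a - (r + 1) \<in> \<int> \<longleftrightarrow> a - r \<in> \<int>"
          by (metis Ints_1 Ints_add Ints_diff add_diff_cancel_right' diff_add_cancel diff_diff_eq)
        have "y * y powr of_real (a - (r + 1)) = y powr of_real (a - r)"
          using y'(2) powr_add[of y 1 "of_real (a - (r + 1))"] by simp
        then have ychi: "y * chi (a - (r + 1)) y = chi (a - r) y"
          unfolding chi_def int by (simp flip: mult.assoc)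
        have "(1 + y) powr (- of_real r) = of_real (1 - r / a) * Jint a r y + of_real (r / a) * y * (A * chi (a - (r + 1)) y + S y)"
          using Jint_recursion[OF Suc.prems(2) y'(1), of r] J[OF y] by simp
        also have "\<dots> = of_real (1 - r / a) * Jint a r y + of_real (r / a) * (A * chi (a - r) y + y * S y)"
          unfolding ychi[symmetric] by (simp add: algebra_simps)
        finally have e: "(1 + y) powr (- of_real r) = of_real (1 - r / a) * Jint a r y + of_real (r / a) * (A * chi (a - r) y + y * S y)" .
        have "of_real (1 - r / a) = complex_of_real ((a - r) / a)" using Suc.prems by (simp add: field_simps)
        then have "of_real (a / (a - r)) * (1 + y) powr (- of_real r) = Jint a r y + of_real (r / (a - r)) * (A * chi (a - r) y + y * S y)"
          unfolding e using Suc.prems pos by (simp add: field_simps del: of_real_diff)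
        then show ?thesis unfolding A'_def S'_def by (simp add: algebra_simps)
      qed
      ultimately show ?thesis by blast
    qed
  qed
qed

subsection \<open>Contour integrals in the upper half-plane\<close>

lemma open_upper_half: "open upper_half"
  unfolding upper_half_def by (rule open_halfspace_Im_gt)

lemma convex_upper_half: "convex upper_half"
  unfolding upper_half_def by (rule convex_halfspace_Im_gt)

lemma LINT_FTC_unit:
  fixes F f :: "real \<Rightarrow> complex"
  assumes "\<And>t. t \<in> {0<..<1} \<Longrightarrow> (F has_vector_derivative f t) (at t)"
    "continuous_on {0<..<1} f" "set_integrable lborel {0<..<1} f"
    "(F \<longlongrightarrow> A) (at_right 0)" "(F \<longlongrightarrow> B) (at_left 1)"
  shows "(LINT t:{0<..<1}|lborel. f t) = B - A"
proof -
  have "(LBINT t=ereal 0..ereal 1. f t) = B - A"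
  proof (rule interval_integral_FTC_integrable)
    show "isCont f x" if "ereal 0 < ereal x" "ereal x < ereal 1" for x
      using that continuous_on_eq_continuous_at[of "{0<..<1}" f] assms(2) by auto
  qed (use assms in \<open>auto simp: ereal_tendsto_simps\<close>)
  then show ?thesis by (simp add: interval_lebesgue_integral_def)
qed

lemma LINT_FTC_infinite:
  fixes F f :: "real \<Rightarrow> complex"
  assumes "\<And>t. t > 0 \<Longrightarrow> (F has_vector_derivative f t) (at t)"
    "continuous_on {0<..} f" "set_integrable lborel {0<..} f"
    "(F \<longlongrightarrow> A) (at_right 0)" "(F \<longlongrightarrow> B) at_top"
  shows "(LINT t:{0<..}|lborel. f t) = B - A"
proof -
  have "(LBINT t=ereal 0..\<infinity>. f t) = B - A"
  proof (rule interval_integral_FTC_integrable)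
    show "isCont f x" if "ereal 0 < ereal x" "ereal x < \<infinity>" for x
      using that continuous_on_eq_continuous_at[of "{0<..}" f] assms(2) by auto
  qed (use assms in \<open>auto simp: ereal_tendsto_simps\<close>)
  then show ?thesis by (simp add: interval_lebesgue_integral_def)
qed

text \<open>The contour has corners at real points, where \<open>kern h\<close> is singular; a primitive still has a limit there along
  every path that stays in a cone.\<close>

lemma cone_limit:
  fixes P k :: "complex \<Rightarrow> complex" and p \<delta> \<rho> \<epsilon> C :: real
  assumes P: "\<And>u. Im u > 0 \<Longrightarrow> (P has_field_derivative k u) (at u)"
    and \<delta>: "0 < \<delta>" "\<delta> \<le> 1" and "\<rho> > 0" "\<epsilon> > 0"
    and bound: "\<And>u. Im u > 0 \<Longrightarrow> Im u \<ge> \<delta> * norm (u - of_real p) \<Longrightarrow> norm (u - of_real p) \<le> \<rho> \<Longrightarrow>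
        norm (k u) \<le> C * norm (u - of_real p) powr (\<epsilon> - 1)"
  obtains L where "\<And>F (g :: real \<Rightarrow> complex). (g \<longlongrightarrow> of_real p) F \<Longrightarrow>
      (\<forall>\<^sub>F t in F. Im (g t) > 0 \<and> Im (g t) \<ge> \<delta> * norm (g t - of_real p)) \<Longrightarrow> ((\<lambda>t. P (g t)) \<longlongrightarrow> L) F"
proof -
  \<comment> \<open>The limit is first found along the vertical ray above p and then carried to
    every approach inside the cone.\<close>
  define v where "v t = of_real p + \<i> * of_real t" for t :: real
  define \<phi> where "\<phi> t = P (v t)" for t
  have C0: "C \<ge> 0"
  proof -
    have "norm (k (v \<rho>)) \<le> C * \<rho> powr (\<epsilon> - 1)"
      using bound[of "v \<rho>"] \<delta> \<open>\<rho> > 0\<close> by (simp add: v_def norm_mult mult_left_le_one_le)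
    then have "0 \<le> C * \<rho> powr (\<epsilon> - 1)" using norm_ge_zero order_trans by blast
    then show ?thesis using \<open>\<rho> > 0\<close> by (simp add: zero_le_mult_iff)
  qed
  have vert: "norm (\<phi> t - \<phi> s) \<le> C / \<epsilon> * (t powr \<epsilon> - s powr \<epsilon>)" if st: "0 < s" "s \<le> t" "t \<le> \<rho>" for s t
  proof -
    have 1: "((\<lambda>x. \<i> * k (v x)) has_integral (\<phi> t - \<phi> s)) {s..t}"
    proof (rule fundamental_theorem_of_calculus)
      fix x assume x: "x \<in> {s..t}"
      have dv: "(v has_vector_derivative \<i>) (at x)" unfolding v_def by (auto intro!: derivative_eq_intros)
      have "(P has_field_derivative k (v x)) (at (v x))" using x st by (intro P) (simp add: v_def)
      from field_vector_diff_chain_at[OF dv this]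
      have "(\<phi> has_vector_derivative \<i> * k (v x)) (at x)" unfolding \<phi>_def[abs_def] comp_def .
      then show "(\<phi> has_vector_derivative \<i> * k (v x)) (at x within {s..t})"
        by (rule has_vector_derivative_at_within)
    qed (use st in auto)
    have 2: "((\<lambda>x. C * x powr (\<epsilon> - 1)) has_integral (C / \<epsilon> * t powr \<epsilon> - C / \<epsilon> * s powr \<epsilon>)) {s..t}"
    proof (rule fundamental_theorem_of_calculus)
      fix x assume x: "x \<in> {s..t}"
      have "((\<lambda>x. C / \<epsilon> * x powr \<epsilon>) has_real_derivative C * x powr (\<epsilon> - 1)) (at x)"
        using x st \<open>\<epsilon> > 0\<close> by (auto intro!: derivative_eq_intros)
      then have "((\<lambda>x. C / \<epsilon> * x powr \<epsilon>) has_vector_derivative C * x powr (\<epsilon> - 1)) (at x)"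
        by (simp add: has_real_derivative_iff_has_vector_derivative)
      then show "((\<lambda>x. C / \<epsilon> * x powr \<epsilon>) has_vector_derivative C * x powr (\<epsilon> - 1)) (at x within {s..t})"
        by (rule has_vector_derivative_at_within)
    qed (use st in auto)
    have "norm (integral {s..t} (\<lambda>x. \<i> * k (v x))) \<le> integral {s..t} (\<lambda>x. C * x powr (\<epsilon> - 1))"
    proof (rule integral_norm_bound_integral[OF has_integral_integrable[OF 1] has_integral_integrable[OF 2]])
      fix x assume "x \<in> {s..t}"
      then have "x > 0" "x \<le> \<rho>" using st by auto
      then show "norm (\<i> * k (v x)) \<le> C * x powr (\<epsilon> - 1)"
        using bound[of "v x"] \<delta> by (simp add: v_def norm_mult mult_left_le_one_le)
    qed
    then show ?thesis unfolding integral_unique[OF 1] integral_unique[OF 2] by (simp add: algebra_simps)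
  qed
  define t where "t n = \<rho> / real (Suc n)" for n
  have t: "0 < t n" "t n \<le> \<rho>" for n using \<open>\<rho> > 0\<close> by (auto simp: t_def field_simps)
  have "t \<longlonglongrightarrow> 0" unfolding t_def by (rule lim_const_over_n[THEN LIMSEQ_Suc])
  have tpow: "(\<lambda>n. t n powr \<epsilon>) \<longlonglongrightarrow> 0"
    by (rule tendsto_zero_powrI[OF \<open>t \<longlonglongrightarrow> 0\<close> tendsto_const _ \<open>\<epsilon> > 0\<close>]) (use t in \<open>auto intro: always_eventually less_imp_le\<close>)
  have tdec: "t n \<le> t m" if "m \<le> n" for m n
    unfolding t_def using that \<open>\<rho> > 0\<close> by (intro divide_left_mono) auto
  have "Cauchy (\<lambda>n. \<phi> (t n))"
  proof (rule CauchyI)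
    fix e :: real assume "e > 0"
    have "(\<lambda>n. C / \<epsilon> * t n powr \<epsilon>) \<longlonglongrightarrow> C / \<epsilon> * 0" by (intro tendsto_intros tpow)
    then have "\<forall>\<^sub>F n in sequentially. C / \<epsilon> * t n powr \<epsilon> < e" using \<open>e > 0\<close> by (auto dest!: order_tendstoD(2))
    then obtain N where N: "C / \<epsilon> * t N powr \<epsilon> < e" by (auto simp: eventually_sequentially)
    have *: "norm (\<phi> (t m) - \<phi> (t n)) < e" if mn: "N \<le> m" "m \<le> n" for m n
    proof -
      have "norm (\<phi> (t m) - \<phi> (t n)) \<le> C / \<epsilon> * (t m powr \<epsilon> - t n powr \<epsilon>)"
        by (rule vert[OF t(1) tdec[OF mn(2)] t(2)])
      also have "\<dots> \<le> C / \<epsilon> * t N powr \<epsilon>"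
      proof (rule mult_left_mono)
        have "t m powr \<epsilon> \<le> t N powr \<epsilon>" using tdec[OF mn(1)] t[of m] \<open>\<epsilon> > 0\<close> by (intro powr_mono2) (auto intro: less_imp_le)
        then show "t m powr \<epsilon> - t n powr \<epsilon> \<le> t N powr \<epsilon>" using powr_ge_zero[of "t n" \<epsilon>] by linarith
      qed (use C0 \<open>\<epsilon> > 0\<close> in auto)
      finally show ?thesis using N by linarith
    qed
    have "norm (\<phi> (t m) - \<phi> (t n)) < e" if "N \<le> m" "N \<le> n" for m n
      using *[of m n] *[of n m] that by (cases "m \<le> n") (auto simp: norm_minus_commute)
    then show "\<exists>M. \<forall>m\<ge>M. \<forall>n\<ge>M. norm (\<phi> (t m) - \<phi> (t n)) < e" by blast
  qed
  then obtain L where L: "(\<lambda>n. \<phi> (t n)) \<longlonglongrightarrow> L" using Cauchy_convergent convergent_def by blast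
  have lim_vert: "norm (\<phi> x - L) \<le> C / \<epsilon> * x powr \<epsilon>" if x: "0 < x" "x \<le> \<rho>" for x
  proof (rule tendsto_upperbound)
    show "(\<lambda>n. norm (\<phi> x - \<phi> (t n))) \<longlonglongrightarrow> norm (\<phi> x - L)" by (intro tendsto_intros L)
    have "\<forall>\<^sub>F n in sequentially. t n < x" using \<open>t \<longlonglongrightarrow> 0\<close> x by (auto dest!: order_tendstoD(2))
    then show "\<forall>\<^sub>F n in sequentially. norm (\<phi> x - \<phi> (t n)) \<le> C / \<epsilon> * x powr \<epsilon>"
    proof eventually_elim
      case (elim n)
      have "norm (\<phi> x - \<phi> (t n)) \<le> C / \<epsilon> * (x powr \<epsilon> - t n powr \<epsilon>)"
        using vert[of "t n" x] t elim x by auto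
      also have "\<dots> \<le> C / \<epsilon> * x powr \<epsilon>" using C0 \<open>\<epsilon> > 0\<close> by (intro mult_left_mono) auto
      finally show ?case .
    qed
  qed auto
  \<comment> \<open>Points of the set \<open>T\<close> below have distance between \<delta> R and R
    from p; this constant compares the powers of these distances for either sign of \<epsilon> -
    1.\<close>
  define M where "M = 1 + \<delta> powr (\<epsilon> - 1)"
  have M: "M \<ge> 0" by (simp add: M_def)
  \<comment> \<open>The point u is joined to the point at the same distance R vertically above p,
    inside a convex piece of the disc that stays at height at least \<delta> R.\<close>
  have horiz: "norm (P u - L) \<le> (2 * C * M + C / \<epsilon>) * norm (u - of_real p) powr \<epsilon>"
    if u: "Im u > 0" "Im u \<ge> \<delta> * norm (u - of_real p)" "norm (u - of_real p) \<le> \<rho>" for u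
  proof -
    define R where "R = norm (u - of_real p)"
    have R: "R > 0" "R \<le> \<rho>" using u by (auto simp: R_def)
    define T where "T = {z. Im z \<ge> \<delta> * R} \<inter> cball (of_real p) R"
    have T: "norm (z - of_real p) \<le> R" "Im z \<ge> \<delta> * R" "Im z > 0" "norm (z - of_real p) \<ge> \<delta> * R" if "z \<in> T" for z
    proof -
      show 1: "norm (z - of_real p) \<le> R" "Im z \<ge> \<delta> * R" using that by (auto simp: T_def dist_norm norm_minus_commute)
      then show "Im z > 0" using \<delta> R mult_pos_pos[of \<delta> R] by linarith
      show "norm (z - of_real p) \<ge> \<delta> * R" using 1 abs_Im_le_cmod[of "z - of_real p"] by simp
    qed
    have "norm (P u - P (v R)) \<le> (C * (M * R powr (\<epsilon> - 1))) * norm (u - v R)"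
    proof (rule field_differentiable_bound[of T P k])
      show "convex T" unfolding T_def by (intro convex_Int convex_halfspace_Im_ge convex_cball)
      show "(P has_field_derivative k z) (at z within T)" if "z \<in> T" for z
        by (rule has_field_derivative_at_within[OF P[OF T(3)[OF that]]])
      show "norm (k z) \<le> C * (M * R powr (\<epsilon> - 1))" if z: "z \<in> T" for z
      proof -
        have "\<delta> * norm (z - of_real p) \<le> \<delta> * R" using T(1)[OF z] \<delta> by (intro mult_left_mono) auto
        then have "norm (k z) \<le> C * norm (z - of_real p) powr (\<epsilon> - 1)"
          using T[OF z] R by (intro bound) linarith+
        also have "norm (z - of_real p) powr (\<epsilon> - 1) \<le> M * R powr (\<epsilon> - 1)"
        proof (cases "\<epsilon> \<ge> 1")
          case True
          then have "norm (z - of_real p) powr (\<epsilon> - 1) \<le> 1 * R powr (\<epsilon> - 1)" using T[OF z] by (simp add: powr_mono2)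
          also have "\<dots> \<le> M * R powr (\<epsilon> - 1)" unfolding M_def by (intro mult_right_mono) auto
          finally show ?thesis .
        next
          case False
          then have "norm (z - of_real p) powr (\<epsilon> - 1) \<le> (\<delta> * R) powr (\<epsilon> - 1)"
            using T[OF z] R \<delta> by (intro powr_mono2') auto
          also have "\<dots> = \<delta> powr (\<epsilon> - 1) * R powr (\<epsilon> - 1)" by (rule powr_mult)
          also have "\<dots> \<le> M * R powr (\<epsilon> - 1)" unfolding M_def by (intro mult_right_mono) auto
          finally show ?thesis .
        qed
        finally show ?thesis using C0 by (simp add: mult_left_mono)
      qed
      show "u \<in> T" using u by (auto simp: T_def R_def dist_norm norm_minus_commute)
      show "v R \<in> T" using R \<delta> by (auto simp: T_def v_def dist_norm norm_mult mult_left_le_one_le)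
    qed
    also have "\<dots> \<le> (C * (M * R powr (\<epsilon> - 1))) * (2 * R)"
    proof (rule mult_left_mono)
      have "norm (u - v R) \<le> norm (u - of_real p) + norm (\<i> * of_real R)"
        unfolding v_def using norm_triangle_ineq4[of "u - of_real p" "\<i> * of_real R"] by (simp add: algebra_simps)
      then show "norm (u - v R) \<le> 2 * R" using R by (simp add: norm_mult R_def)
    qed (use C0 M in auto)
    also have "\<dots> = 2 * C * M * (R powr (\<epsilon> - 1) * R)" by (simp add: mult_ac)
    also have "R powr (\<epsilon> - 1) * R = R powr \<epsilon>" using R by (simp add: powr_diff)
    finally have "norm (P u - \<phi> R) \<le> 2 * C * M * R powr \<epsilon>" by (simp add: \<phi>_def)
    moreover have "norm (\<phi> R - L) \<le> C / \<epsilon> * R powr \<epsilon>" by (rule lim_vert[OF R])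
    moreover have "norm (P u - L) \<le> norm (P u - \<phi> R) + norm (\<phi> R - L)"
      using norm_triangle_ineq[of "P u - \<phi> R" "\<phi> R - L"] by simp
    ultimately show ?thesis by (simp add: R_def algebra_simps)
  qed
  show ?thesis
  proof
    fix F and g :: "real \<Rightarrow> complex"
    assume g: "(g \<longlongrightarrow> of_real p) F" and ev: "\<forall>\<^sub>F t in F. Im (g t) > 0 \<and> Im (g t) \<ge> \<delta> * norm (g t - of_real p)"
    have n0: "((\<lambda>t. norm (g t - of_real p)) \<longlongrightarrow> 0) F"
      using tendsto_norm[OF tendsto_diff[OF g tendsto_const[of "of_real p"]]] by simp
    have "((\<lambda>t. norm (g t - of_real p) powr \<epsilon>) \<longlongrightarrow> 0) F"
      by (rule tendsto_zero_powrI[OF n0 tendsto_const _ \<open>\<epsilon> > 0\<close>]) (auto intro: always_eventually)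
    then have z: "((\<lambda>t. (2 * C * M + C / \<epsilon>) * norm (g t - of_real p) powr \<epsilon>) \<longlongrightarrow> 0) F"
      by (rule tendsto_mult_right_zero)
    have "\<forall>\<^sub>F t in F. norm (g t - of_real p) < \<rho>" using order_tendstoD(2)[OF n0 \<open>\<rho> > 0\<close>] .
    with ev have "\<forall>\<^sub>F t in F. norm (P (g t) - L) \<le> (2 * C * M + C / \<epsilon>) * norm (g t - of_real p) powr \<epsilon>"
      by eventually_elim (intro horiz; simp)
    then have "((\<lambda>t. P (g t) - L) \<longlongrightarrow> 0) F" by (rule Lim_null_comparison[OF _ z])
    then show "((\<lambda>t. P (g t)) \<longlongrightarrow> L) F" by (simp add: LIM_zero_iff)
  qed
qed

lemma powr_divide_right_half:
  fixes w z a :: complex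
  assumes "w \<noteq> 0" "Re z > 0" "- pi < Im (Ln w) - Im (Ln z)" "Im (Ln w) - Im (Ln z) \<le> pi"
  shows "(w / z) powr a = w powr a * z powr (- a)"
proof -
  have z: "z \<noteq> 0" "z \<notin> \<real>\<^sub>\<le>\<^sub>0" using assms(2) by (auto simp: complex_nonpos_Reals_iff)
  have "Ln (w * inverse z) = Ln w + Ln (inverse z)"
    using assms z Ln_inverse[OF z(2)] by (intro Ln_times_simple) auto
  then have "Ln (w / z) = Ln w - Ln z" using Ln_inverse[OF z(2)] by (simp add: divide_inverse)
  then show ?thesis using assms(1) z by (simp add: powr_def right_diff_distrib flip: exp_add)
qed

text \<open>For positive h the argument of h is 0 and that of z is below pi/2 in modulus. For
  negative h the argument of h is pi, but then z lies in the upper half-plane, so the difference of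
  arguments still is at most pi. The point minus h equals q h^2 \<tau> times i / z, whose power
  splits as well.\<close>

lemma semicircle_powr:
  fixes q h \<tau> a :: real
  assumes "q > 0" "h \<noteq> 0" "\<tau> > 0"
  defines "z \<equiv> 1 - \<i> * of_real (q * h * \<tau>)"
  shows "(of_real h / z) powr of_real a = of_real h powr of_real a * z powr (- of_real a)"
    and "(of_real h / z - of_real h) powr of_real a =
      of_real ((q * h\<^sup>2 * \<tau>) powr a) * \<i> powr of_real a * z powr (- of_real a)"
    and "Im (of_real h / z) > 0"
proof -
  have Re: "Re z > 0" by (simp add: z_def)
  have z0: "z \<noteq> 0" using Re by auto
  have argz: "\<bar>Im (Ln z)\<bar> < pi / 2" using Re_Ln_pos_lt[OF z0] Re by simp
  show "(of_real h / z) powr of_real a = of_real h powr of_real a * z powr (- of_real a)"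
  proof (cases "h > 0")
    case True
    have "Im (Ln (complex_of_real h)) = 0" using True by (subst Im_Ln_eq_0) auto
    then show ?thesis using argz Re assms(2) by (intro powr_divide_right_half) auto
  next
    case False
    then have h: "h < 0" using assms(2) by simp
    have "Im (Ln (complex_of_real h)) = pi" using h by (subst Im_Ln_eq_pi) auto
    moreover have "Im z > 0" using assms(1,3) h by (simp add: z_def mult_pos_neg mult_neg_pos)
    then have "Im (Ln z) > 0" using Im_Ln_pos_lt[OF z0] by simp
    ultimately show ?thesis using argz Re assms(2) by (intro powr_divide_right_half) auto
  qed
  have eq: "of_real h / z - of_real h = of_real (q * h\<^sup>2 * \<tau>) * (\<i> / z)"
  proof -
    have "of_real h / z - of_real h = of_real h * (1 - z) / z" using z0 by (simp add: field_simps)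
    also have "1 - z = \<i> * of_real (q * h * \<tau>)" by (simp add: z_def)
    finally show ?thesis by (simp add: power2_eq_square mult_ac)
  qed
  have "(of_real (q * h\<^sup>2 * \<tau>) * (\<i> / z)) powr of_real a = of_real (q * h\<^sup>2 * \<tau>) powr of_real a * (\<i> / z) powr of_real a"
    using assms by (intro powr_times_real_left) auto
  also have "(\<i> / z) powr of_real a = \<i> powr of_real a * z powr (- of_real a)"
    using argz Re by (intro powr_divide_right_half) auto
  also have "complex_of_real (q * h\<^sup>2 * \<tau>) powr of_real a = of_real ((q * h\<^sup>2 * \<tau>) powr a)"
    using assms by (intro powr_of_real) auto
  finally show "(of_real h / z - of_real h) powr of_real a =
      of_real ((q * h\<^sup>2 * \<tau>) powr a) * \<i> powr of_real a * z powr (- of_real a)"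
    unfolding eq by (simp add: mult.assoc)
  have "h * (q * h * \<tau>) = q * h\<^sup>2 * \<tau>" by (simp add: power2_eq_square)
  also have "\<dots> > 0" using assms by simp
  finally have "h * (q * h * \<tau>) > 0" .
  moreover have "Im (of_real h / z) = h * (q * h * \<tau>) / ((Re z)\<^sup>2 + (Im z)\<^sup>2)"
    by (simp add: Im_divide z_def)
  moreover have "(Re z)\<^sup>2 + (Im z)\<^sup>2 > 0" using Re by (simp add: add_pos_nonneg)
  ultimately show "Im (of_real h / z) > 0" by simp
qed

section \<open>The local model at a cusp and its contour identity\<close>

locale inversion =
  fixes q e r s \<alpha> :: real and G :: "complex \<Rightarrow> complex"
  assumes q: "q > 0" and r: "r > 0" and s: "s \<ge> 0" and s_less: "s < \<alpha>" and G: "decays s G"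
begin

text \<open>The inverse scaling matrix in the coordinate u = z - x0, with q the square of its lower
  left entry.\<close>

definition winv :: "complex \<Rightarrow> complex" where
  "winv u = of_real e - 1 / (of_real q * u)"

text \<open>Up to a positive factor this is f(x0 + u) after removal of the multiple of u^(-r) that
  comes from the constant term at the cusp.\<close>

definition K :: "complex \<Rightarrow> complex" where
  "K u = u powr (- of_real r) * G (winv u)"

definition kern :: "real \<Rightarrow> complex \<Rightarrow> complex" where
  "kern h u = (u - of_real h) powr of_real (\<alpha> - 1) * K u"

lemma Im_winv: "Im (winv u) = Im u / (q * (norm u)\<^sup>2)"
proof -
  have "winv u = of_real e - of_real (1 / q) * inverse u" by (simp add: winv_def divide_inverse)
  then have "Im (winv u) = - (1 / q) * Im (inverse u)" by simp
  also have "Im (inverse u) = - Im u / (norm u)\<^sup>2" by (simp add: cmod_power2)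
  finally show ?thesis by simp
qed

lemma winv_upper: "Im u > 0 \<Longrightarrow> winv u \<in> upper_half"
  using q by (auto simp: upper_half_def Im_winv intro!: divide_pos_pos mult_pos_pos)

lemma upper_not_nonpos: "Im u > 0 \<Longrightarrow> u \<notin> \<real>\<^sub>\<le>\<^sub>0"
  by (auto simp: complex_nonpos_Reals_iff)

lemma K_holomorphic: "K holomorphic_on upper_half"
proof -
  have "(G \<circ> winv) holomorphic_on upper_half"
  proof (rule holomorphic_on_compose_gen)
    show "winv holomorphic_on upper_half"
      unfolding winv_def[abs_def] using q by (intro holomorphic_intros) (auto simp: upper_half_def)
    show "G holomorphic_on upper_half" using G by (simp add: decays_def)
    show "winv ` upper_half \<subseteq> upper_half" using winv_upper by (auto simp: upper_half_def)
  qed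
  then show ?thesis
    unfolding K_def[abs_def] comp_def
    by (intro holomorphic_intros) (auto simp: upper_half_def upper_not_nonpos)
qed

lemma kern_holomorphic: "kern h holomorphic_on upper_half"
  unfolding kern_def[abs_def]
  by (intro holomorphic_intros K_holomorphic) (auto simp: upper_half_def upper_not_nonpos)

lemma K_bound:
  obtains C d where "C > 0" "d > 0" "\<And>u. Im u > 0 \<Longrightarrow>
    norm (K u) \<le> C * norm u powr (- r) * (Im (winv u) powr (- s) * exp (- d * Im (winv u)))"
proof -
  obtain C d where C: "C > 0" "d > 0"
    and b: "\<And>z. z \<in> upper_half \<Longrightarrow> norm (G z) \<le> C * Im z powr (- s) * exp (- d * Im z)"
    using G by (auto simp: decays_def)
  have "norm (K u) \<le> C * norm u powr (- r) * (Im (winv u) powr (- s) * exp (- d * Im (winv u)))" if u: "Im u > 0" for u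
  proof -
    have "norm (K u) = norm u powr (- r) * norm (G (winv u))"
      by (simp add: K_def norm_mult norm_powr_real_powr')
    also have "\<dots> \<le> norm u powr (- r) * (C * Im (winv u) powr (- s) * exp (- d * Im (winv u)))"
      by (intro mult_left_mono b winv_upper u) auto
    finally show ?thesis by (simp add: mult_ac)
  qed
  with C show ?thesis using that by blast
qed

text \<open>Inside the cone, Im (winv u) is at least 1 / (2 q |u|), and the exponential decay of G
  in this quantity beats every power of |u|.\<close>

lemma K_cone_small:
  assumes "\<rho> > 0" "M \<ge> 0"
  obtains C where "C \<ge> 0" "\<And>u. Im u > 0 \<Longrightarrow> Im u \<ge> 1/2 * norm u \<Longrightarrow> norm u \<le> \<rho> \<Longrightarrow> norm (K u) \<le> C * norm u powr M"
proof -
  obtain C d where C: "C > 0" "d > 0" and b: "\<And>u. Im u > 0 \<Longrightarrow>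
    norm (K u) \<le> C * norm u powr (- r) * (Im (winv u) powr (- s) * exp (- d * Im (winv u)))"
    using K_bound by blast
  \<comment> \<open>A lower bound for Im (winv u) valid on the whole truncated cone; it disposes of
    the decreasing factor with exponent -s.\<close>
  define x0 where "x0 = 1 / (2 * q * \<rho>)"
  have x0: "x0 > 0" using q assms by (simp add: x0_def)
  obtain C2 where C2: "C2 > 0" "\<And>t. t \<ge> 0 \<Longrightarrow> (1 + t) powr (r + M) \<le> C2 * exp (d * t)"
    using bounded_powr_exp[of "r + M" d] assms r C by auto
  define B where "B = C * x0 powr (- s) * C2 * (2 * q) powr (r + M)"
  have "norm (K u) \<le> B * norm u powr M" if u: "Im u > 0" "Im u \<ge> 1/2 * norm u" "norm u \<le> \<rho>" for u
  proof -
    have n: "norm u > 0" using u by auto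
    define x where "x = 1 / (2 * q * norm u)"
    have x: "x > 0" using n q by (simp add: x_def)
    have xx0: "x \<ge> x0" unfolding x_def x0_def using u n q assms(1) by (intro divide_left_mono mult_left_mono) auto
    have wx: "Im (winv u) \<ge> x"
    proof -
      have "x = (1/2 * norm u) / (q * (norm u)\<^sup>2)" using n q by (simp add: x_def power2_eq_square)
      also have "\<dots> \<le> Im u / (q * (norm u)\<^sup>2)" using u q by (intro divide_right_mono) auto
      finally show ?thesis by (simp add: Im_winv)
    qed
    have "norm (K u) \<le> C * norm u powr (- r) * (Im (winv u) powr (- s) * exp (- d * Im (winv u)))" by (rule b[OF u(1)])
    also have "\<dots> \<le> C * norm u powr (- r) * (x0 powr (- s) * exp (- d * x))"
      using wx x xx0 x0 C s by (intro mult_left_mono mult_mono powr_mono2') auto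
    also have "\<dots> \<le> C * norm u powr (- r) * (x0 powr (- s) * (C2 / x powr (r + M)))"
    proof -
      have "x powr (r + M) \<le> (1 + x) powr (r + M)" using x r assms by (intro powr_mono2) auto
      also have "\<dots> \<le> C2 * exp (d * x)" using C2(2) x by auto
      finally have "exp (- d * x) \<le> C2 / x powr (r + M)" using x by (simp add: exp_minus field_simps)
      then show ?thesis using C by (intro mult_left_mono) auto
    qed
    also have "1 / x powr (r + M) = (2 * q) powr (r + M) * norm u powr (r + M)"
      using n q by (simp add: x_def powr_divide powr_mult)
    then have "C * norm u powr (- r) * (x0 powr (- s) * (C2 / x powr (r + M))) =
        B * (norm u powr (- r) * norm u powr (r + M))" by (simp add: B_def divide_inverse mult_ac)
    also have "norm u powr (- r) * norm u powr (r + M) = norm u powr M" using n by (simp flip: powr_add)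
    finally show ?thesis .
  qed
  moreover have "B \<ge> 0" using C C2 by (simp add: B_def)
  ultimately show ?thesis using that by blast
qed

text \<open>Near h the height of winv u is comparable to |u - h| in the cone, so G costs |u -
  h|^(-s). The resulting exponent \<alpha> - s - 1 is integrable because s < \<alpha>.\<close>

lemma kern_near_h:
  assumes "h \<noteq> 0"
  obtains C where "\<And>u. Im u > 0 \<Longrightarrow> Im u \<ge> 1/2 * norm (u - of_real h) \<Longrightarrow> norm (u - of_real h) \<le> \<bar>h\<bar> / 2 \<Longrightarrow>
    norm (kern h u) \<le> C * norm (u - of_real h) powr ((\<alpha> - s) - 1)"
proof -
  obtain C d where C: "C > 0" "d > 0" and b: "\<And>u. Im u > 0 \<Longrightarrow>
    norm (K u) \<le> C * norm u powr (- r) * (Im (winv u) powr (- s) * exp (- d * Im (winv u)))"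
    using K_bound by blast
  define m where "m = 1/2 / (q * (3 * \<bar>h\<bar> / 2)\<^sup>2)"
  have m: "m > 0" using q assms by (simp add: m_def)
  have "norm (kern h u) \<le> (C * (\<bar>h\<bar> / 2) powr (- r) * m powr (- s)) * norm (u - of_real h) powr ((\<alpha> - s) - 1)"
    if u: "Im u > 0" "Im u \<ge> 1/2 * norm (u - of_real h)" "norm (u - of_real h) \<le> \<bar>h\<bar> / 2" for u
  proof -
    define R where "R = norm (u - of_real h)"
    have R: "R > 0" using u by (auto simp: R_def)
    have n1: "\<bar>h\<bar> / 2 \<le> norm u" using norm_triangle_ineq2[of "of_real h" "of_real h - u"] u(3) by (simp add: norm_minus_commute)
    have n2: "norm u \<le> 3 * \<bar>h\<bar> / 2" using norm_triangle_ineq[of "of_real h" "u - of_real h"] u(3) by simp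
    have n0: "norm u > 0" using assms by (intro less_le_trans[OF _ n1]) simp
    have wm: "Im (winv u) \<ge> m * R"
    proof -
      have "m * R = (1/2 * R) / (q * (3 * \<bar>h\<bar> / 2)\<^sup>2)" by (simp add: m_def)
      also have "\<dots> \<le> Im u / (q * (norm u)\<^sup>2)"
        using u q n0 n2 R assms by (intro frac_le mult_left_mono power_mono) (auto simp: R_def)
      finally show ?thesis by (simp add: Im_winv)
    qed
    have "norm (K u) \<le> C * norm u powr (- r) * (Im (winv u) powr (- s) * exp (- d * Im (winv u)))" by (rule b[OF u(1)])
    also have "\<dots> \<le> C * (\<bar>h\<bar> / 2) powr (- r) * ((m * R) powr (- s) * 1)"
    proof (intro mult_mono mult_left_mono powr_mono2')
      show "exp (- d * Im (winv u)) \<le> 1" using C wm order_trans[OF less_imp_le[OF mult_pos_pos[OF m R]] wm] by simp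
    qed (use C r s n1 wm m R assms in auto)
    also have "(m * R) powr (- s) = m powr (- s) * R powr (- s)" by (rule powr_mult)
    finally have Kb: "norm (K u) \<le> C * (\<bar>h\<bar> / 2) powr (- r) * (m powr (- s) * R powr (- s))" by simp
    have "norm (kern h u) = R powr (\<alpha> - 1) * norm (K u)"
      by (simp add: kern_def norm_mult R_def norm_powr_real_powr')
    also have "\<dots> \<le> R powr (\<alpha> - 1) * (C * (\<bar>h\<bar> / 2) powr (- r) * (m powr (- s) * R powr (- s)))"
      by (intro mult_left_mono Kb) auto
    also have "\<dots> = (C * (\<bar>h\<bar> / 2) powr (- r) * m powr (- s)) * (R powr (\<alpha> - 1) * R powr (- s))" by (simp add: mult_ac)
    also have "R powr (\<alpha> - 1) * R powr (- s) = R powr ((\<alpha> - s) - 1)" using R by (simp add: algebra_simps flip: powr_add)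
    finally show ?thesis by (simp add: R_def)
  qed
  then show ?thesis using that by blast
qed

text \<open>The kernel is merely bounded here; the exponent \<open>1 - 1\<close> is written so as to
  match \<open>cone_limit\<close> with \<epsilon> = 1.\<close>

lemma kern_near_0:
  assumes "h \<noteq> 0"
  obtains C where "\<And>u. Im u > 0 \<Longrightarrow> Im u \<ge> 1/2 * norm (u - of_real 0) \<Longrightarrow> norm (u - of_real 0) \<le> \<bar>h\<bar> / 2 \<Longrightarrow>
    norm (kern h u) \<le> C * norm (u - of_real 0) powr (1 - 1)"
proof -
  obtain C where C: "C \<ge> 0" "\<And>u. Im u > 0 \<Longrightarrow> Im u \<ge> 1/2 * norm u \<Longrightarrow> norm u \<le> \<bar>h\<bar> / 2 \<Longrightarrow> norm (K u) \<le> C * norm u powr 0"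
    using K_cone_small[of "\<bar>h\<bar> / 2" 0] assms by auto
  have "norm (kern h u) \<le> (((\<bar>h\<bar> / 2) powr (\<alpha> - 1) + (3 * \<bar>h\<bar> / 2) powr (\<alpha> - 1)) * C) * norm (u - of_real 0) powr (1 - 1)"
    if u: "Im u > 0" "Im u \<ge> 1/2 * norm u" "norm u \<le> \<bar>h\<bar> / 2" for u
  proof -
    define R where "R = norm (u - of_real h)"
    have n1: "\<bar>h\<bar> / 2 \<le> R" using norm_triangle_ineq2[of "of_real h" u] u(3) by (simp add: R_def norm_minus_commute)
    have n2: "R \<le> 3 * \<bar>h\<bar> / 2" using norm_triangle_ineq4[of u "of_real h"] u(3) by (simp add: R_def)
    have "norm u > 0" using u by auto
    have "R powr (\<alpha> - 1) \<le> (\<bar>h\<bar> / 2) powr (\<alpha> - 1) + (3 * \<bar>h\<bar> / 2) powr (\<alpha> - 1)"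
    proof (cases "\<alpha> \<ge> 1")
      case True
      then have "R powr (\<alpha> - 1) \<le> (3 * \<bar>h\<bar> / 2) powr (\<alpha> - 1)" using n1 n2 by (intro powr_mono2) auto
      then show ?thesis by (simp add: add_increasing)
    next
      case False
      then have "R powr (\<alpha> - 1) \<le> (\<bar>h\<bar> / 2) powr (\<alpha> - 1)" using n1 n2 assms by (intro powr_mono2') auto
      then show ?thesis by (simp add: add_increasing2)
    qed
    moreover have "norm (kern h u) = R powr (\<alpha> - 1) * norm (K u)"
      by (simp add: kern_def norm_mult R_def norm_powr_real_powr')
    moreover have "norm (K u) \<le> C" using C(2)[OF u] \<open>norm u > 0\<close> by simp
    ultimately show ?thesis using C(1) \<open>norm u > 0\<close> by (simp add: mult_mono)
  qed
  then show ?thesis using that by auto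
qed

lemma vertical_integrable:
  assumes "h \<noteq> 0"
  shows "set_integrable lborel {0<..<1} (\<lambda>t. \<i> * kern h (of_real h + \<i> * of_real t))"
proof -
  obtain C d where C: "C > 0" "d > 0" and b: "\<And>u. Im u > 0 \<Longrightarrow>
    norm (K u) \<le> C * norm u powr (- r) * (Im (winv u) powr (- s) * exp (- d * Im (winv u)))"
    using K_bound by blast
  define m where "m = 1 / (q * (\<bar>h\<bar> + 1)\<^sup>2)"
  have m: "m > 0" using q by (simp add: m_def add_nonneg_pos)
  show ?thesis
  \<comment> \<open>No exponential decay is available on the unit interval; the factor e * exp(-t),
    at least 1 there, supplies the shape that the majorant requires.\<close>
  proof (rule set_integrable_powr_exp_bound[where p = "\<alpha> - s" and d = 1 and C = "C * \<bar>h\<bar> powr (- r) * m powr (- s) * exp 1"])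
    show "continuous_on {0<..<1} (\<lambda>t. \<i> * kern h (of_real h + \<i> * of_real t))"
      by (intro continuous_intros continuous_on_compose2[OF holomorphic_on_imp_continuous_on[OF kern_holomorphic]])
        (auto simp: upper_half_def)
    fix t :: real assume t: "t \<in> {0<..<1}"
    define u where "u = of_real h + \<i> * of_real t"
    have u: "Im u > 0" "norm u > 0" using t by (auto simp: u_def complex_eq_iff)
    have n1: "\<bar>h\<bar> \<le> norm u" using abs_Re_le_cmod[of u] by (simp add: u_def)
    have n2: "norm u \<le> \<bar>h\<bar> + 1" using norm_triangle_ineq[of "of_real h" "\<i> * of_real t"] t by (simp add: u_def norm_mult)
    have wm: "Im (winv u) \<ge> m * t"
    proof -
      have "m * t = t / (q * (\<bar>h\<bar> + 1)\<^sup>2)" by (simp add: m_def)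
      also have "\<dots> \<le> t / (q * (norm u)\<^sup>2)"
        using u q n2 t by (intro divide_left_mono mult_left_mono power_mono mult_pos_pos) auto
      finally show ?thesis by (simp add: Im_winv u_def)
    qed
    have mt: "m * t > 0" using m t by simp
    have "norm (K u) \<le> C * norm u powr (- r) * (Im (winv u) powr (- s) * exp (- d * Im (winv u)))" by (rule b[OF u(1)])
    also have "\<dots> \<le> C * \<bar>h\<bar> powr (- r) * ((m * t) powr (- s) * 1)"
    proof (intro mult_mono mult_left_mono powr_mono2')
      show "exp (- d * Im (winv u)) \<le> 1" using C order_trans[OF less_imp_le[OF mt] wm] by simp
    qed (use C r s n1 wm mt assms in auto)
    also have "(m * t) powr (- s) = m powr (- s) * t powr (- s)" by (rule powr_mult)
    finally have Kb: "norm (K u) \<le> C * \<bar>h\<bar> powr (- r) * (m powr (- s) * t powr (- s))" by simp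
    have "norm (\<i> * kern h u) = t powr (\<alpha> - 1) * norm (K u)"
      using t by (simp add: kern_def norm_mult norm_powr_real_powr' u_def)
    also have "\<dots> \<le> t powr (\<alpha> - 1) * (C * \<bar>h\<bar> powr (- r) * (m powr (- s) * t powr (- s)))"
      by (intro mult_left_mono Kb) auto
    also have "\<dots> = (C * \<bar>h\<bar> powr (- r) * m powr (- s)) * (t powr (\<alpha> - 1) * t powr (- s)) * 1" by (simp add: mult_ac)
    also have "t powr (\<alpha> - 1) * t powr (- s) = t powr (\<alpha> - s - 1)" using t by (simp add: algebra_simps flip: powr_add)
    also have "(C * \<bar>h\<bar> powr (- r) * m powr (- s)) * t powr (\<alpha> - s - 1) * 1 \<le>
        (C * \<bar>h\<bar> powr (- r) * m powr (- s)) * t powr (\<alpha> - s - 1) * (exp 1 * exp (- 1 * t))"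
      using t C by (intro mult_left_mono) (auto simp flip: exp_add)
    finally show "norm (\<i> * kern h (of_real h + \<i> * of_real t)) \<le> C * \<bar>h\<bar> powr (- r) * m powr (- s) * exp 1 * t powr (\<alpha> - s - 1) * exp (- 1 * t)"
      by (simp add: u_def mult_ac)
  qed (use s_less in auto)
qed

text \<open>\<open>Vert (\<alpha> - 1)\<close>, \<open>Horiz\<close> and \<open>Semi\<close> are the integrals of \<open>kern h\<close> over the segment from \<open>0\<close> to \<open>i\<close>, over the segment
  from \<open>i\<close> to \<open>h + i\<close> and, after the substitution \<open>winv\<close>, over the semicircle from \<open>h\<close> to \<open>0\<close>.\<close>

definition Vert :: "real \<Rightarrow> real \<Rightarrow> complex" where
  "Vert \<gamma> h = (LINT t:{0<..<1}|lborel. (\<i> * of_real t - of_real h) powr of_real \<gamma> * K (\<i> * of_real t))"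

text \<open>For negative \<gamma> the first factor is singular at h = t = 0, but |it - h| >= t and K
  vanishes on the imaginary axis to any order, here |\<gamma>|. The bound is uniform in h near h0,
  including h0 = 0.\<close>

lemma Vert_kernel_bound:
  "\<exists>B. \<forall>h t. \<bar>h - h0\<bar> < 1 \<longrightarrow> t \<in> {0<..<1} \<longrightarrow> norm ((\<i> * of_real t - of_real h) powr of_real \<gamma> * K (\<i> * of_real t)) \<le> B"
proof -
  define M where "M = \<bar>\<gamma>\<bar>"
  define R where "R = \<bar>h0\<bar> + 2"
  obtain C where C: "C \<ge> 0" "\<And>u. Im u > 0 \<Longrightarrow> Im u \<ge> 1/2 * norm u \<Longrightarrow> norm u \<le> 1 \<Longrightarrow> norm (K u) \<le> C * norm u powr M"
    using K_cone_small[of 1 M] by (auto simp: M_def)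
  have "norm ((\<i> * of_real t - of_real h) powr of_real \<gamma> * K (\<i> * of_real t)) \<le> C * (R powr M + 1)"
    if h: "\<bar>h - h0\<bar> < 1" and t: "t \<in> {0<..<1}" for h t
  proof -
    define n where "n = norm (\<i> * of_real t - complex_of_real h)"
    have n1: "t \<le> n" using abs_Im_le_cmod[of "\<i> * of_real t - complex_of_real h"] by (simp add: n_def)
    have n2: "n \<le> R"
    proof -
      have "n \<le> t + \<bar>h\<bar>" using norm_triangle_ineq4[of "\<i> * of_real t" "of_real h"] t by (simp add: n_def norm_mult)
      then show ?thesis using h t unfolding R_def by auto
    qed
    have Kb: "norm (K (\<i> * of_real t)) \<le> C * t powr M" using C(2)[of "\<i> * of_real t"] t by (simp add: norm_mult)
    have "n powr \<gamma> * t powr M \<le> R powr M + 1"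
    proof (cases "\<gamma> \<ge> 0")
      case True
      have "n powr \<gamma> * t powr M \<le> R powr M * 1"
        using True n1 n2 t by (intro mult_mono) (auto simp: M_def powr_mono2 powr_le1)
      then show ?thesis by simp
    next
      case False
      have "n powr \<gamma> * t powr M \<le> t powr \<gamma> * t powr M"
        using False n1 t by (intro mult_right_mono powr_mono2') auto
      also have "\<dots> = 1" using t False by (simp add: M_def flip: powr_add)
      finally show ?thesis by (simp add: add_increasing)
    qed
    moreover have "norm ((\<i> * of_real t - of_real h) powr of_real \<gamma> * K (\<i> * of_real t)) = n powr \<gamma> * norm (K (\<i> * of_real t))"
      by (simp add: norm_mult n_def norm_powr_real_powr')
    moreover have "n powr \<gamma> * norm (K (\<i> * of_real t)) \<le> n powr \<gamma> * (C * t powr M)"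
      by (intro mult_left_mono Kb) auto
    ultimately show ?thesis using mult_left_mono[of "n powr \<gamma> * t powr M" "R powr M + 1" C] C(1) by (simp add: mult_ac)
  qed
  then show ?thesis by blast
qed

lemma Vert_kernel_continuous:
  "continuous_on {0<..<1} (\<lambda>t. (\<i> * of_real t - of_real h) powr of_real \<gamma> * K (\<i> * of_real t))"
  by (intro continuous_intros continuous_on_powr_slit continuous_on_compose2[OF holomorphic_on_imp_continuous_on[OF K_holomorphic]])
    (auto simp: upper_half_def complex_nonpos_Reals_iff)

lemma Vert_integrable:
  "set_integrable lborel {0<..<1} (\<lambda>t. (\<i> * of_real t - of_real h) powr of_real \<gamma> * K (\<i> * of_real t))"
proof -
  obtain B where B: "\<And>t. t \<in> {0<..<1} \<Longrightarrow> norm ((\<i> * of_real t - of_real h) powr of_real \<gamma> * K (\<i> * of_real t)) \<le> B"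
    using Vert_kernel_bound[of h \<gamma>] by force
  show ?thesis
    by (rule set_integrable_dominated[OF Vert_kernel_continuous _ _ B]) (auto simp: set_integrable_def)
qed

lemma Vert_deriv: "(Vert \<gamma> has_vector_derivative - of_real \<gamma> * Vert (\<gamma> - 1) h0) (at h0)"
proof -
  obtain B where B: "\<And>h t. \<bar>h - h0\<bar> < 1 \<Longrightarrow> t \<in> {0<..<1} \<Longrightarrow>
      norm ((\<i> * of_real t - of_real h) powr of_real (\<gamma> - 1) * K (\<i> * of_real t)) \<le> B"
    using Vert_kernel_bound[of h0 "\<gamma> - 1"] by blast
  have "((\<lambda>h. LINT t:{0<..<1}|lborel. (\<i> * of_real t - of_real h) powr of_real \<gamma> * K (\<i> * of_real t)) has_vector_derivative
      (LINT t:{0<..<1}|lborel. - of_real \<gamma> * ((\<i> * of_real t - of_real h0) powr of_real (\<gamma> - 1) * K (\<i> * of_real t)))) (at h0)"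
  proof (rule has_vector_derivative_integral_dominated[where e = 1 and w = "\<lambda>t. \<bar>\<gamma>\<bar> * B"])
    show "set_borel_measurable lborel {0<..<1} (\<lambda>t. - of_real \<gamma> * ((\<i> * of_real t - of_real h0) powr of_real (\<gamma> - 1) * K (\<i> * of_real t)))"
      by (intro set_borel_measurable_continuous_on_interval continuous_on_mult continuous_on_const Vert_kernel_continuous) auto
    show "set_integrable lborel {0<..<1} (\<lambda>t::real. \<bar>\<gamma>\<bar> * B)"
      by (auto simp: set_integrable_def intro!: integrable_real_indicator)
    fix h t :: real assume h: "\<bar>h - h0\<bar> < 1" and t: "t \<in> {0<..<1}"
    show "norm (- of_real \<gamma> * ((\<i> * of_real t - of_real h) powr of_real (\<gamma> - 1) * K (\<i> * of_real t))) \<le> \<bar>\<gamma>\<bar> * B"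
      using mult_left_mono[OF B[OF h t], of "\<bar>\<gamma>\<bar>"] by (simp add: norm_mult)
    have "((\<lambda>w. (\<i> * of_real t - w) powr of_real \<gamma>) has_field_derivative
        of_real \<gamma> * (\<i> * of_real t - of_real h) powr (of_real \<gamma> - 1) * (0 - 1)) (at (of_real h))"
      by (rule DERIV_chain2[OF has_field_derivative_powr]) (use t in \<open>auto intro!: derivative_eq_intros simp: complex_nonpos_Reals_iff\<close>)
    from has_vector_derivative_mult_left[OF has_vector_derivative_real_field[OF this], of "K (\<i> * of_real t)"]
    show "((\<lambda>h. (\<i> * of_real t - of_real h) powr of_real \<gamma> * K (\<i> * of_real t)) has_vector_derivative
        - of_real \<gamma> * ((\<i> * of_real t - of_real h) powr of_real (\<gamma> - 1) * K (\<i> * of_real t))) (at h)"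
      by (simp add: mult_ac)
  qed (use Vert_integrable in auto)
  then show ?thesis unfolding Vert_def[abs_def] set_integral_mult_right .
qed

text \<open>Each derivative lowers the exponent by one, which is why the exponent is a parameter of
  \<open>Vert\<close>; the product collects the factors produced.\<close>

lemma smooth_Vert: "smooth (Vert \<gamma>)"
  unfolding smooth_def
proof (intro exI[of _ "\<lambda>k x. (\<Prod>j<k. - of_real (\<gamma> - real j)) * Vert (\<gamma> - real k) x"] conjI allI)
  fix k and x :: real
  have "\<gamma> - real (Suc k) = \<gamma> - real k - 1" by simp
  note eq = this
  show "((\<lambda>x. (\<Prod>j<k. - of_real (\<gamma> - real j)) * Vert (\<gamma> - real k) x) has_vector_derivative
      (\<Prod>j<Suc k. - of_real (\<gamma> - real j)) * Vert (\<gamma> - real (Suc k)) x) (at x)"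
    using has_vector_derivative_mult_right[OF Vert_deriv[of "\<gamma> - real k" x], of "\<Prod>j<k. - of_real (\<gamma> - real j)"]
    unfolding eq by (simp add: mult_ac)
qed auto

definition Horiz :: "complex \<Rightarrow> complex" where
  "Horiz h = integral {0..1} (\<lambda>\<sigma>. h * ((\<i> + of_real (\<sigma> - 1) * h) powr of_real (\<alpha> - 1) * K (\<i> + of_real \<sigma> * h)))"

text \<open>Letting h be complex reduces smoothness to holomorphy. In the strip |Im h| < 1/2 both i
  + (\<sigma> - 1) h and i + \<sigma> h remain in the upper half-plane for \<sigma> in
  [0,1].\<close>

lemma Horiz_holomorphic: "Horiz holomorphic_on {h. \<bar>Im h\<bar> < 1/2}"
proof -
  define U where "U = {h. \<bar>Im h\<bar> < 1/2}"
  define a where "a h \<sigma> = \<i> + of_real (\<sigma> - 1) * h" for h :: complex and \<sigma> :: real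
  define b where "b h \<sigma> = \<i> + of_real \<sigma> * h" for h :: complex and \<sigma> :: real
  have ImU: "Im (a h \<sigma>) > 0" "Im (b h \<sigma>) > 0" if "h \<in> U" "\<sigma> \<in> {0..1}" for h \<sigma>
  proof -
    have "\<bar>(\<sigma> - 1) * Im h\<bar> \<le> 1 * \<bar>Im h\<bar>" "\<bar>\<sigma> * Im h\<bar> \<le> 1 * \<bar>Im h\<bar>"
      using that unfolding abs_mult by (intro mult_right_mono; auto)+
    then show "Im (a h \<sigma>) > 0" "Im (b h \<sigma>) > 0" using that by (auto simp: a_def b_def U_def)
  qed
  define f where "f h \<sigma> = h * (a h \<sigma> powr of_real (\<alpha> - 1) * K (b h \<sigma>))" for h \<sigma>
  define f' where "f' h \<sigma> = h * (a h \<sigma> powr of_real (\<alpha> - 1) * (deriv K (b h \<sigma>) * of_real \<sigma>)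
      + (of_real (\<alpha> - 1) * a h \<sigma> powr (of_real (\<alpha> - 1) - 1) * of_real (\<sigma> - 1)) * K (b h \<sigma>))
      + 1 * (a h \<sigma> powr of_real (\<alpha> - 1) * K (b h \<sigma>))" for h \<sigma>
  have K': "deriv K holomorphic_on upper_half" by (rule holomorphic_deriv[OF K_holomorphic open_upper_half])
  have d: "((\<lambda>h. f h \<sigma>) has_field_derivative f' h \<sigma>) (at h)" if hs: "h \<in> U" "\<sigma> \<in> {0..1}" for h \<sigma>
  proof -
    have "((\<lambda>h. a h \<sigma>) has_field_derivative of_real (\<sigma> - 1)) (at h)"
      unfolding a_def by (auto intro!: derivative_eq_intros)
    then have 1: "((\<lambda>h. a h \<sigma> powr of_real (\<alpha> - 1)) has_field_derivative
        of_real (\<alpha> - 1) * a h \<sigma> powr (of_real (\<alpha> - 1) - 1) * of_real (\<sigma> - 1)) (at h)"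
      by (intro DERIV_chain2[OF has_field_derivative_powr] upper_not_nonpos ImU hs)
    have "((\<lambda>h. b h \<sigma>) has_field_derivative of_real \<sigma>) (at h)"
      unfolding b_def by (auto intro!: derivative_eq_intros)
    moreover have "(K has_field_derivative deriv K (b h \<sigma>)) (at (b h \<sigma>))"
      by (rule holomorphic_derivI[OF K_holomorphic open_upper_half]) (use ImU hs in \<open>auto simp: upper_half_def\<close>)
    ultimately have 2: "((\<lambda>h. K (b h \<sigma>)) has_field_derivative deriv K (b h \<sigma>) * of_real \<sigma>) (at h)"
      by (intro DERIV_chain2)
    show ?thesis
      using DERIV_mult[OF DERIV_ident DERIV_mult[OF 1 2]] unfolding f_def f'_def by (simp add: algebra_simps)
  qed
  have "(\<lambda>h. integral (cbox 0 1) (f h)) holomorphic_on U"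
  proof (rule leibniz_rule_holomorphic)
    show "((\<lambda>h. f h \<sigma>) has_field_derivative f' h \<sigma>) (at h within U)" if "h \<in> U" "\<sigma> \<in> cbox 0 1" for h \<sigma>
      using d[of h \<sigma>] that by (simp add: has_field_derivative_at_within)
    show "f h integrable_on cbox 0 1" if h: "h \<in> U" for h
    proof -
      have "continuous_on {0..1} (f h)"
        unfolding f_def
        by (intro continuous_intros continuous_on_powr_slit continuous_on_compose2[OF holomorphic_on_imp_continuous_on[OF K_holomorphic]])
          (use ImU[OF h] in \<open>auto simp: a_def b_def upper_half_def upper_not_nonpos intro!: continuous_intros\<close>)
      then show ?thesis unfolding cbox_interval by (rule integrable_continuous_interval)
    qed
    have ca: "continuous_on (U \<times> {0..1}) (\<lambda>x. a (fst x) (snd x))" and cb: "continuous_on (U \<times> {0..1}) (\<lambda>x. b (fst x) (snd x))"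
      unfolding a_def b_def by (intro continuous_intros)+
    have cp: "continuous_on (U \<times> {0..1}) (\<lambda>x. a (fst x) (snd x) powr c)" for c
      by (intro continuous_on_powr_slit ca) (use ImU in \<open>auto simp: upper_not_nonpos\<close>)
    have c1: "continuous_on (U \<times> {0..1}) (\<lambda>x. fst x)"
      and c2: "continuous_on (U \<times> {0..1}) (\<lambda>x. complex_of_real (snd x))"
      and c3: "continuous_on (U \<times> {0..1}) (\<lambda>x. complex_of_real (snd x - 1))"
      by (intro continuous_intros)+
    have cK: "continuous_on (U \<times> {0..1}) (\<lambda>x. K (b (fst x) (snd x)))"
      by (rule continuous_on_compose2[OF holomorphic_on_imp_continuous_on[OF K_holomorphic] cb]) (use ImU in \<open>auto simp: upper_half_def\<close>)
    have cK': "continuous_on (U \<times> {0..1}) (\<lambda>x. deriv K (b (fst x) (snd x)))"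
      by (rule continuous_on_compose2[OF holomorphic_on_imp_continuous_on[OF K'] cb]) (use ImU in \<open>auto simp: upper_half_def\<close>)
    show "continuous_on (U \<times> cbox 0 1) (\<lambda>(h, \<sigma>). f' h \<sigma>)"
      unfolding f'_def cbox_interval case_prod_beta
      by (intro continuous_on_add continuous_on_mult cp cK cK' continuous_on_const c1 c2 c3)
    have "U = {h. Im h < 1/2} \<inter> {h. Im h > -1/2}" by (auto simp: U_def)
    then show "convex U" by (simp only: convex_Int convex_halfspace_Im_lt convex_halfspace_Im_gt)
  qed
  then show ?thesis unfolding U_def f_def[abs_def] a_def b_def Horiz_def[abs_def] by simp
qed

lemma smooth_Horiz: "smooth (\<lambda>h. Horiz (of_real h))"
proof (rule smooth_holomorphic[OF _ Horiz_holomorphic])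
  have "{h. \<bar>Im h\<bar> < 1/2} = {h. Im h < 1/2} \<inter> {h. Im h > -1/2}" by auto
  then show "open {h. \<bar>Im h\<bar> < 1/2}" by (simp only: open_Int open_halfspace_Im_lt open_halfspace_Im_gt)
qed auto

text \<open>For h nonzero, h / \<open>zfac h \<tau>\<close> is the point of the semicircle that
  \<open>winv\<close> sends to e - 1/(q h) + i \<tau>.\<close>

definition zfac :: "real \<Rightarrow> real \<Rightarrow> complex" where
  "zfac h \<tau> = 1 - \<i> * of_real (q * h * \<tau>)"

definition Semi :: "real \<Rightarrow> complex" where
  "Semi h = (LINT \<tau>:{0<..}|lborel. of_real (\<tau> powr (\<alpha> - 1)) * zfac h \<tau> powr of_real (r - \<alpha> - 1) * G (Complex (e - 1 / (q * h)) \<tau>))"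

lemma Re_zfac [simp]: "Re (zfac h \<tau>) = 1"
  by (simp add: zfac_def)

lemma zfac_nonpos: "zfac h \<tau> \<notin> \<real>\<^sub>\<le>\<^sub>0"
  by (simp add: complex_nonpos_Reals_iff)

lemma norm_zfac: "1 \<le> norm (zfac h \<tau>)" "\<tau> \<ge> 0 \<Longrightarrow> norm (zfac h \<tau>) \<le> 1 + q * \<bar>h\<bar> * \<tau>"
proof -
  show "1 \<le> norm (zfac h \<tau>)" using abs_Re_le_cmod[of "zfac h \<tau>"] by simp
  show "norm (zfac h \<tau>) \<le> 1 + q * \<bar>h\<bar> * \<tau>" if "\<tau> \<ge> 0"
    using norm_triangle_ineq4[of 1 "\<i> * of_real (q * h * \<tau>)"] q that by (simp add: zfac_def norm_mult abs_mult)
qed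

text \<open>Since |zfac| is at least 1, passing to the absolute value of the exponent treats both
  signs at once.\<close>

lemma norm_zfac_powr:
  assumes "\<tau> \<ge> 0" "\<bar>h\<bar> \<le> H"
  shows "norm (zfac h \<tau> powr of_real \<gamma>) \<le> ((1 + q * H) * (1 + \<tau>)) powr \<bar>\<gamma>\<bar>"
proof -
  have H: "H \<ge> 0" using assms(2) by simp
  have "norm (zfac h \<tau>) \<le> 1 + q * H * \<tau>"
    using norm_zfac(2)[OF assms(1), of h] mult_right_mono[OF mult_left_mono[OF assms(2) less_imp_le[OF q]] assms(1)] by linarith
  also have "\<dots> \<le> (1 + q * H) * (1 + \<tau>)" using q H assms(1) by (simp add: algebra_simps)
  finally have n: "norm (zfac h \<tau>) \<le> (1 + q * H) * (1 + \<tau>)" .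
  have "norm (zfac h \<tau> powr of_real \<gamma>) = norm (zfac h \<tau>) powr \<gamma>" by (simp add: norm_powr_real_powr')
  also have "\<dots> \<le> norm (zfac h \<tau>) powr \<bar>\<gamma>\<bar>" using norm_zfac(1) by (intro powr_mono) auto
  also have "\<dots> \<le> ((1 + q * H) * (1 + \<tau>)) powr \<bar>\<gamma>\<bar>" by (rule powr_mono2[OF _ _ n]) simp_all
  finally show ?thesis .
qed

lemma G_line_continuous:
  assumes "g holomorphic_on upper_half"
  shows "continuous_on {0<..} (\<lambda>\<tau>. g (Complex x \<tau>))"
  by (rule continuous_on_compose2[OF holomorphic_on_imp_continuous_on[OF assms]])
    (auto simp: upper_half_def Complex_eq intro!: continuous_intros)

lemma zfac_continuous: "continuous_on A (\<lambda>\<tau>. zfac h \<tau> powr c)"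
  by (intro continuous_on_powr_slit zfac_nonpos) (auto simp: zfac_def intro!: continuous_intros)

lemma Semi_integrable:
  "set_integrable lborel {0<..} (\<lambda>\<tau>. of_real (\<tau> powr (\<alpha> - 1)) * zfac h \<tau> powr of_real \<gamma> * G (Complex x \<tau>))"
proof -
  obtain C d where C: "C > 0" "d > 0" and hol: "G holomorphic_on upper_half"
    and b: "\<And>z. z \<in> upper_half \<Longrightarrow> norm (G z) \<le> C * Im z powr (- s) * exp (- d * Im z)"
    using G by (auto simp: decays_def)
  obtain C2 where C2: "C2 > 0" "\<And>t. t \<ge> 0 \<Longrightarrow> (1 + t) powr \<bar>\<gamma>\<bar> \<le> C2 * exp (d/2 * t)"
    using bounded_powr_exp[of "\<bar>\<gamma>\<bar>" "d/2"] C by auto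
  define B where "B = (1 + q * \<bar>h\<bar>) powr \<bar>\<gamma>\<bar> * C2 * C"
  show ?thesis
  proof (rule set_integrable_powr_exp_bound[where p = "\<alpha> - s" and d = "d/2" and C = B])
    show "continuous_on {0<..} (\<lambda>\<tau>. of_real (\<tau> powr (\<alpha> - 1)) * zfac h \<tau> powr of_real \<gamma> * G (Complex x \<tau>))"
      by (intro continuous_intros zfac_continuous G_line_continuous hol) auto
    fix t :: real assume t: "t \<in> {0<..}"
    have "norm (zfac h t powr of_real \<gamma>) \<le> (1 + q * \<bar>h\<bar>) powr \<bar>\<gamma>\<bar> * (1 + t) powr \<bar>\<gamma>\<bar>"
      using norm_zfac_powr[of t h "\<bar>h\<bar>" \<gamma>] t by (simp add: powr_mult)
    also have "\<dots> \<le> (1 + q * \<bar>h\<bar>) powr \<bar>\<gamma>\<bar> * (C2 * exp (d/2 * t))" using C2(2)[of t] t by (intro mult_left_mono) auto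
    finally have z: "norm (zfac h t powr of_real \<gamma>) \<le> (1 + q * \<bar>h\<bar>) powr \<bar>\<gamma>\<bar> * (C2 * exp (d/2 * t))" .
    have g: "norm (G (Complex x t)) \<le> C * t powr (- s) * exp (- d * t)" using b[of "Complex x t"] t by (simp add: upper_half_def)
    have "norm (of_real (t powr (\<alpha> - 1)) * zfac h t powr of_real \<gamma> * G (Complex x t)) \<le>
        t powr (\<alpha> - 1) * ((1 + q * \<bar>h\<bar>) powr \<bar>\<gamma>\<bar> * (C2 * exp (d/2 * t))) * (C * t powr (- s) * exp (- d * t))"
      unfolding norm_mult using z g C2(1) by (intro mult_mono) auto
    also have "\<dots> = B * (t powr (\<alpha> - 1) * t powr (- s)) * (exp (d/2 * t) * exp (- d * t))" by (simp add: B_def mult_ac)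
    also have "t powr (\<alpha> - 1) * t powr (- s) = t powr (\<alpha> - s - 1)" using t by (simp add: algebra_simps flip: powr_add)
    also have "exp (d/2 * t) * exp (- d * t) = exp (- (d/2) * t)" by (simp flip: exp_add)
    finally show "norm (of_real (t powr (\<alpha> - 1)) * zfac h t powr of_real \<gamma> * G (Complex x t)) \<le> B * t powr (\<alpha> - s - 1) * exp (- (d/2) * t)" .
  qed (use s_less C in auto)
qed

lemma contour_identity:
  assumes h: "h \<noteq> 0"
  shows "\<i> powr of_real \<alpha> * (LINT t:{0<..<1}|lborel. of_real (t powr (\<alpha> - 1)) * K (Complex h t)) =
    of_real (q powr \<alpha> * \<bar>h\<bar> powr (2 * \<alpha>)) * of_real h powr (- of_real r) * \<i> powr of_real \<alpha> * Semi h
    + \<i> * Vert (\<alpha> - 1) h + Horiz (of_real h)"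
proof -
  obtain P where P: "\<And>u. Im u > 0 \<Longrightarrow> (P has_field_derivative kern h u) (at u)"
    using holomorphic_convex_primitive'[OF convex_upper_half open_upper_half kern_holomorphic[of h]]
      at_within_open[OF _ open_upper_half] by (auto simp: upper_half_def)
  have Pc: "isCont P u" if "Im u > 0" for u using P[OF that] by (rule DERIV_isCont)
  obtain Ch where Ch: "\<And>u. Im u > 0 \<Longrightarrow> Im u \<ge> 1/2 * norm (u - of_real h) \<Longrightarrow> norm (u - of_real h) \<le> \<bar>h\<bar> / 2 \<Longrightarrow>
    norm (kern h u) \<le> Ch * norm (u - of_real h) powr ((\<alpha> - s) - 1)" using kern_near_h[OF h] by blast
  obtain Lh where Lh: "\<And>F (g :: real \<Rightarrow> complex). (g \<longlongrightarrow> of_real h) F \<Longrightarrow>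
      (\<forall>\<^sub>F t in F. Im (g t) > 0 \<and> Im (g t) \<ge> 1/2 * norm (g t - of_real h)) \<Longrightarrow> ((\<lambda>t. P (g t)) \<longlongrightarrow> Lh) F"
    using cone_limit[where k = "kern h" and P = P and p = h and \<delta> = "1/2" and \<rho> = "\<bar>h\<bar> / 2" and \<epsilon> = "\<alpha> - s" and C = Ch] P Ch h s_less by auto
  obtain C0 where C0: "\<And>u. Im u > 0 \<Longrightarrow> Im u \<ge> 1/2 * norm (u - of_real 0) \<Longrightarrow> norm (u - of_real 0) \<le> \<bar>h\<bar> / 2 \<Longrightarrow>
    norm (kern h u) \<le> C0 * norm (u - of_real 0) powr (1 - 1)" using kern_near_0[OF h] by blast
  obtain L0 where L0: "\<And>F (g :: real \<Rightarrow> complex). (g \<longlongrightarrow> of_real 0) F \<Longrightarrow>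
      (\<forall>\<^sub>F t in F. Im (g t) > 0 \<and> Im (g t) \<ge> 1/2 * norm (g t - of_real 0)) \<Longrightarrow> ((\<lambda>t. P (g t)) \<longlongrightarrow> L0) F"
    using cone_limit[where k = "kern h" and P = P and p = 0 and \<delta> = "1/2" and \<rho> = "\<bar>h\<bar> / 2" and \<epsilon> = 1 and C = C0] P C0 h by auto

  have V: "(LINT t:{0<..<1}|lborel. \<i> * kern h (of_real h + \<i> * of_real t)) = P (of_real h + \<i>) - Lh"
  proof (rule LINT_FTC_unit)
    fix t :: real assume t: "t \<in> {0<..<1}"
    have "((\<lambda>t. of_real h + \<i> * of_real t) has_vector_derivative \<i>) (at t)" by (auto intro!: derivative_eq_intros)
    from field_vector_diff_chain_at[OF this P] t
    show "((\<lambda>t. P (of_real h + \<i> * of_real t)) has_vector_derivative \<i> * kern h (of_real h + \<i> * of_real t)) (at t)"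
      by (simp add: comp_def)
  next
    show "continuous_on {0<..<1} (\<lambda>t. \<i> * kern h (of_real h + \<i> * of_real t))"
      by (intro continuous_intros continuous_on_compose2[OF holomorphic_on_imp_continuous_on[OF kern_holomorphic]])
        (auto simp: upper_half_def)
    show "set_integrable lborel {0<..<1} (\<lambda>t. \<i> * kern h (of_real h + \<i> * of_real t))" by (rule vertical_integrable[OF h])
    have "((\<lambda>t. of_real h + \<i> * of_real t) \<longlongrightarrow> of_real h + \<i> * of_real 0) (at_right 0)" by (intro tendsto_intros)
    then show "((\<lambda>t. P (of_real h + \<i> * of_real t)) \<longlongrightarrow> Lh) (at_right 0)"
      by (intro Lh) (auto simp: norm_mult eventually_at_filter)
    have "((\<lambda>t. of_real h + \<i> * of_real t) \<longlongrightarrow> of_real h + \<i> * of_real 1) (at_left 1)" by (intro tendsto_intros)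
    then show "((\<lambda>t. P (of_real h + \<i> * of_real t)) \<longlongrightarrow> P (of_real h + \<i>)) (at_left 1)"
      by (intro isCont_tendsto_compose[OF Pc]) auto
  qed

  have V0: "(LINT t:{0<..<1}|lborel. \<i> * ((\<i> * of_real t - of_real h) powr of_real (\<alpha> - 1) * K (\<i> * of_real t))) = P \<i> - L0"
  proof (rule LINT_FTC_unit)
    fix t :: real assume t: "t \<in> {0<..<1}"
    have "((\<lambda>t. \<i> * of_real t) has_vector_derivative \<i>) (at t)" by (auto intro!: derivative_eq_intros)
    from field_vector_diff_chain_at[OF this P] t
    show "((\<lambda>t. P (\<i> * of_real t)) has_vector_derivative \<i> * ((\<i> * of_real t - of_real h) powr of_real (\<alpha> - 1) * K (\<i> * of_real t))) (at t)"
      by (simp add: comp_def kern_def)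
  next
    show "continuous_on {0<..<1} (\<lambda>t. \<i> * ((\<i> * of_real t - of_real h) powr of_real (\<alpha> - 1) * K (\<i> * of_real t)))"
      by (intro continuous_on_mult continuous_on_const Vert_kernel_continuous)
    show "set_integrable lborel {0<..<1} (\<lambda>t. \<i> * ((\<i> * of_real t - of_real h) powr of_real (\<alpha> - 1) * K (\<i> * of_real t)))"
      by (intro set_integrable_mult_right Vert_integrable)
    have "((\<lambda>t. \<i> * of_real t) \<longlongrightarrow> \<i> * of_real 0) (at_right 0)" by (intro tendsto_intros)
    then show "((\<lambda>t. P (\<i> * of_real t)) \<longlongrightarrow> L0) (at_right 0)"
      by (intro L0) (auto simp: norm_mult eventually_at_filter)
    have "((\<lambda>t. \<i> * of_real t) \<longlongrightarrow> \<i> * of_real 1) (at_left 1)" by (intro tendsto_intros)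
    then show "((\<lambda>t. P (\<i> * of_real t)) \<longlongrightarrow> P \<i>) (at_left 1)"
      by (intro isCont_tendsto_compose[OF Pc]) auto
  qed

  have H: "Horiz (of_real h) = P (of_real h + \<i>) - P \<i>"
  proof -
    have i1: "((\<lambda>\<sigma>. of_real h * kern h (\<i> + of_real \<sigma> * of_real h)) has_integral
        P (\<i> + of_real 1 * of_real h) - P (\<i> + of_real 0 * of_real h)) {0..1}"
    proof (rule fundamental_theorem_of_calculus)
      fix \<sigma> :: real assume "\<sigma> \<in> {0..1}"
      have "((\<lambda>\<sigma>. \<i> + of_real \<sigma> * complex_of_real h) has_vector_derivative of_real h) (at \<sigma>)" by (auto intro!: derivative_eq_intros)
      from field_vector_diff_chain_at[OF this P]
      have "((\<lambda>\<sigma>. P (\<i> + of_real \<sigma> * of_real h)) has_vector_derivative of_real h * kern h (\<i> + of_real \<sigma> * of_real h)) (at \<sigma>)"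
        by (simp add: comp_def)
      then show "((\<lambda>\<sigma>. P (\<i> + of_real \<sigma> * of_real h)) has_vector_derivative of_real h * kern h (\<i> + of_real \<sigma> * of_real h)) (at \<sigma> within {0..1})"
        by (rule has_vector_derivative_at_within)
    qed auto
    have eq: "of_real h * kern h (\<i> + of_real \<sigma> * of_real h) =
        of_real h * ((\<i> + of_real (\<sigma> - 1) * of_real h) powr of_real (\<alpha> - 1) * K (\<i> + of_real \<sigma> * of_real h))" for \<sigma>
      by (simp add: kern_def algebra_simps)
    show ?thesis unfolding Horiz_def eq[symmetric] integral_unique[OF i1] by (simp add: add.commute)
  qed

  \<comment> \<open>Collected along u = h / z: (u - h)^(\<alpha>-1) gives (q h^2
    \<tau>)^(\<alpha>-1) i^(\<alpha>-1) z^(1-\<alpha>), u^(-r) gives h^(-r) z^r, and du gives i q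
    h^2 z^(-2) d\<tau>.\<close>
  define c where "c = of_real (q powr \<alpha> * \<bar>h\<bar> powr (2 * \<alpha>)) * of_real h powr (- of_real r) * \<i> powr of_real \<alpha>"
  define g where "g \<tau> = of_real h / zfac h \<tau>" for \<tau>
  have S: "(LINT \<tau>:{0<..}|lborel. c * (of_real (\<tau> powr (\<alpha> - 1)) * zfac h \<tau> powr of_real (r - \<alpha> - 1) * G (Complex (e - 1 / (q * h)) \<tau>))) = L0 - Lh"
  proof (rule LINT_FTC_infinite)
    fix \<tau> :: real assume \<tau>: "\<tau> > 0"
    define z where "z = zfac h \<tau>"
    have z0: "z \<noteq> 0" using zfac_nonpos[of h \<tau>] by (auto simp: z_def)
    note sc = semicircle_powr[OF q h \<tau>, folded zfac_def, folded z_def]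
    have dz: "(zfac h has_vector_derivative (- \<i> * of_real (q * h))) (at \<tau>)"
      unfolding zfac_def[abs_def] by (auto intro!: derivative_eq_intros)
    have "((\<lambda>z. of_real h / z) has_field_derivative - of_real h / z\<^sup>2) (at (zfac h \<tau>))"
      using z0 unfolding z_def[symmetric] by (auto intro!: derivative_eq_intros simp: power2_eq_square)
    from field_vector_diff_chain_at[OF dz this] have dg: "(g has_vector_derivative (- \<i> * of_real (q * h)) * (- of_real h / z\<^sup>2)) (at \<tau>)"
      unfolding g_def[abs_def] comp_def .
    have "(P has_field_derivative kern h (g \<tau>)) (at (g \<tau>))"
      by (rule P) (use sc(3) in \<open>simp add: g_def z_def\<close>)
    from field_vector_diff_chain_at[OF dg this] have D: "((\<lambda>\<tau>. P (g \<tau>)) has_vector_derivative (- \<i> * of_real (q * h)) * (- of_real h / z\<^sup>2) * kern h (g \<tau>)) (at \<tau>)"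
      unfolding comp_def .
    have w: "winv (g \<tau>) = Complex (e - 1 / (q * h)) \<tau>"
      using z0 h q by (simp add: winv_def g_def zfac_def Complex_eq field_simps)
    have "kern h (g \<tau>) = (of_real ((q * h\<^sup>2 * \<tau>) powr (\<alpha> - 1)) * \<i> powr of_real (\<alpha> - 1) * z powr (- of_real (\<alpha> - 1))) *
        ((of_real h powr (- of_real r) * z powr of_real r) * G (Complex (e - 1 / (q * h)) \<tau>))"
      using sc(1)[of "-r"] sc(2)[of "\<alpha> - 1"] unfolding kern_def K_def w by (simp add: g_def z_def)
    then have "(- \<i> * of_real (q * h)) * (- of_real h / z\<^sup>2) * kern h (g \<tau>) =
        (\<i> * \<i> powr of_real (\<alpha> - 1)) * of_real (q * h\<^sup>2 * (q * h\<^sup>2 * \<tau>) powr (\<alpha> - 1)) * of_real h powr (- of_real r) *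
        (z powr (- of_real (\<alpha> - 1)) * z powr of_real r * inverse (z\<^sup>2)) * G (Complex (e - 1 / (q * h)) \<tau>)"
      by (simp add: divide_inverse power2_eq_square mult_ac)
    also have "\<i> * \<i> powr of_real (\<alpha> - 1) = \<i> powr of_real \<alpha>" by (simp add: powr_diff)
    also have "q * h\<^sup>2 * (q * h\<^sup>2 * \<tau>) powr (\<alpha> - 1) = q powr \<alpha> * \<bar>h\<bar> powr (2 * \<alpha>) * \<tau> powr (\<alpha> - 1)"
    proof -
      have "(q * h\<^sup>2 * \<tau>) powr (\<alpha> - 1) = q powr (\<alpha> - 1) * (h\<^sup>2) powr (\<alpha> - 1) * \<tau> powr (\<alpha> - 1)" by (simp add: powr_mult)
      then have "q * h\<^sup>2 * (q * h\<^sup>2 * \<tau>) powr (\<alpha> - 1) = (q * q powr (\<alpha> - 1)) * (h\<^sup>2 * (h\<^sup>2) powr (\<alpha> - 1)) * \<tau> powr (\<alpha> - 1)"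
        by (simp only: mult_ac)
      also have "q * q powr (\<alpha> - 1) = q powr \<alpha>" using q by (simp add: powr_diff)
      also have "h\<^sup>2 * (h\<^sup>2) powr (\<alpha> - 1) = (h\<^sup>2) powr (1 + (\<alpha> - 1))" by (rule powr_mult_base) simp
      also have "(h\<^sup>2) powr (1 + (\<alpha> - 1)) = \<bar>h\<bar> powr (2 * \<alpha>)"
      proof -
        have "\<bar>h\<bar> powr 2 = h\<^sup>2" using h by simp
        then have "(h\<^sup>2) powr (1 + (\<alpha> - 1)) = (\<bar>h\<bar> powr 2) powr \<alpha>" by simp
        then show ?thesis unfolding powr_powr .
      qed
      finally show ?thesis .
    qed
    also have "z powr (- of_real (\<alpha> - 1)) * z powr of_real r * inverse (z\<^sup>2) = z powr of_real (r - \<alpha> - 1)"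
    proof -
      have "inverse (z\<^sup>2) = z powr (-2)" using z0 by (simp add: powr_minus powr_numeral)
      moreover have "- of_real (\<alpha> - 1) + of_real r + (-2) = complex_of_real (r - \<alpha> - 1)" by simp
      ultimately show ?thesis using z0 by (metis powr_add)
    qed
    finally show "((\<lambda>\<tau>. P (g \<tau>)) has_vector_derivative
        c * (of_real (\<tau> powr (\<alpha> - 1)) * zfac h \<tau> powr of_real (r - \<alpha> - 1) * G (Complex (e - 1 / (q * h)) \<tau>))) (at \<tau>)"
      using D by (simp add: c_def z_def mult_ac)
  next
    have hol: "G holomorphic_on upper_half" using G by (simp add: decays_def)
    show "continuous_on {0<..} (\<lambda>\<tau>. c * (of_real (\<tau> powr (\<alpha> - 1)) * zfac h \<tau> powr of_real (r - \<alpha> - 1) * G (Complex (e - 1 / (q * h)) \<tau>)))"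
      by (intro continuous_intros zfac_continuous G_line_continuous hol) auto
    show "set_integrable lborel {0<..} (\<lambda>\<tau>. c * (of_real (\<tau> powr (\<alpha> - 1)) * zfac h \<tau> powr of_real (r - \<alpha> - 1) * G (Complex (e - 1 / (q * h)) \<tau>)))"
      by (intro set_integrable_mult_right Semi_integrable)
    have z0: "zfac h \<tau> \<noteq> 0" for \<tau> using zfac_nonpos[of h \<tau>] by auto
    have Img: "Im (g \<tau>) > 0" if "\<tau> > 0" for \<tau>
      using semicircle_powr(3)[OF q h that] by (simp add: g_def zfac_def)
    have diff: "g \<tau> - of_real h = of_real (q * h * \<tau>) * \<i> * g \<tau>" for \<tau>
      using z0[of \<tau>] by (simp add: g_def zfac_def field_simps)
    have normg: "norm (g \<tau>) = \<bar>h\<bar> / norm (zfac h \<tau>)" for \<tau> by (simp add: g_def norm_divide)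
    have Img_eq: "Im (g \<tau>) = q * h\<^sup>2 * \<tau> / (norm (zfac h \<tau>))\<^sup>2" for \<tau>
      unfolding g_def Im_divide cmod_power2 by (simp add: zfac_def power2_eq_square)
    show "((\<lambda>\<tau>. P (g \<tau>)) \<longlongrightarrow> Lh) (at_right 0)"
    proof (rule Lh)
      have "((\<lambda>\<tau>. of_real h / zfac h \<tau>) \<longlongrightarrow> of_real h / zfac h 0) (at_right 0)"
        unfolding zfac_def by (intro tendsto_intros) auto
      then show "(g \<longlongrightarrow> of_real h) (at_right 0)" by (simp add: g_def[abs_def] zfac_def)
      \<comment> \<open>With n = |zfac|, the height of the point is q h^2 \<tau> / n^2 and its
        distance from h is q h^2 \<tau> / n; the cone condition with slope 1/2 is n <= 2.\<close>
      have "((\<lambda>\<tau>. norm (zfac h \<tau>)) \<longlongrightarrow> norm (zfac h 0)) (at_right 0)"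
        unfolding zfac_def by (intro tendsto_intros)
      then have "\<forall>\<^sub>F \<tau> in at_right 0. norm (zfac h \<tau>) < 2"
        by (rule order_tendstoD) (simp add: zfac_def)
      moreover have "\<forall>\<^sub>F \<tau> in at_right (0::real). \<tau> > 0" by (simp add: eventually_at_filter)
      ultimately show "\<forall>\<^sub>F \<tau> in at_right 0. Im (g \<tau>) > 0 \<and> Im (g \<tau>) \<ge> 1/2 * norm (g \<tau> - of_real h)"
      proof eventually_elim
        case (elim \<tau>)
        define n where "n = norm (zfac h \<tau>)"
        have n: "1 \<le> n" "n < 2" using norm_zfac(1) elim by (auto simp: n_def)
        have "norm (g \<tau> - of_real h) = q * \<bar>h\<bar> * \<tau> * (\<bar>h\<bar> / n)"
          unfolding diff norm_mult normg norm_of_real using q elim by (simp add: n_def abs_mult)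
        then have "1/2 * norm (g \<tau> - of_real h) = (q * h\<^sup>2 * \<tau>) * (1 / (2 * n))" by (simp add: power2_eq_square)
        also have "\<dots> \<le> (q * h\<^sup>2 * \<tau>) * (1 / n\<^sup>2)"
        proof (rule mult_left_mono)
          show "1 / (2 * n) \<le> 1 / n\<^sup>2" using n by (simp add: power2_eq_square field_simps)
          show "0 \<le> q * h\<^sup>2 * \<tau>" using q elim by simp
        qed
        finally show ?case using Img[of \<tau>] elim unfolding Img_eq by (simp add: n_def)
      qed
    qed
    show "((\<lambda>\<tau>. P (g \<tau>)) \<longlongrightarrow> L0) at_top"
    proof (rule L0)
      have ge: "norm (zfac h \<tau>) \<ge> q * \<bar>h\<bar> * \<tau>" for \<tau>
      proof -
        have "q * \<bar>h\<bar> * \<tau> \<le> q * \<bar>h\<bar> * \<bar>\<tau>\<bar>" using q by (intro mult_left_mono) auto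
        also have "\<dots> = \<bar>Im (zfac h \<tau>)\<bar>" using q by (simp add: zfac_def abs_mult)
        finally show ?thesis using abs_Im_le_cmod[of "zfac h \<tau>"] by linarith
      qed
      \<comment> \<open>From this height on, n <= 1 + q |h| \<tau> <= 2 q |h| \<tau>, which is the
        cone condition at 0.\<close>
      have ev1: "\<forall>\<^sub>F \<tau> in at_top. \<tau> \<ge> 1 / (q * \<bar>h\<bar>)" by (rule eventually_ge_at_top)
      have ev2: "\<forall>\<^sub>F \<tau> in at_top. \<tau> > (0::real)" by (rule eventually_gt_at_top)
      have "((\<lambda>\<tau>. (1/q) * (1/\<tau>)) \<longlongrightarrow> (1/q) * 0) at_top"
        by (intro tendsto_intros tendsto_divide_0[OF tendsto_const] filterlim_at_top_imp_at_infinity filterlim_ident)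
      then have lim0: "((\<lambda>\<tau>. (1/q) * (1/\<tau>)) \<longlongrightarrow> 0) at_top" by simp
      have "\<forall>\<^sub>F \<tau> in at_top. norm (g \<tau>) \<le> (1/q) * (1/\<tau>)"
        using ev2
      proof eventually_elim
        case (elim \<tau>)
        have "norm (g \<tau>) \<le> \<bar>h\<bar> / (q * \<bar>h\<bar> * \<tau>)"
          unfolding normg using ge[of \<tau>] q h elim norm_zfac(1)[of h \<tau>] by (intro divide_left_mono mult_pos_pos) auto
        then show ?case using h by simp
      qed
      then have "(g \<longlongrightarrow> 0) at_top" by (rule Lim_null_comparison[OF _ lim0])
      then show "(g \<longlongrightarrow> of_real 0) at_top" by simp
      show "\<forall>\<^sub>F \<tau> in at_top. Im (g \<tau>) > 0 \<and> Im (g \<tau>) \<ge> 1/2 * norm (g \<tau> - of_real 0)"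
        using ev1 ev2
      proof eventually_elim
        case (elim \<tau>)
        define n where "n = norm (zfac h \<tau>)"
        have n: "1 \<le> n" using norm_zfac(1) by (auto simp: n_def)
        have x: "q * \<bar>h\<bar> * \<tau> \<ge> 1" using elim q h by (simp add: field_simps)
        have "n \<le> 1 + q * \<bar>h\<bar> * \<tau>" using norm_zfac(2)[of \<tau> h] elim by (simp add: n_def)
        then have "n \<le> 2 * (q * \<bar>h\<bar> * \<tau>)" using x by linarith
        then have "\<bar>h\<bar> / (2 * n\<^sup>2) * n \<le> \<bar>h\<bar> / (2 * n\<^sup>2) * (2 * (q * \<bar>h\<bar> * \<tau>))" by (intro mult_left_mono) auto
        moreover have "\<bar>h\<bar> / (2 * n\<^sup>2) * n = 1/2 * (\<bar>h\<bar> / n)" using n by (simp add: power2_eq_square)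
        moreover have "\<bar>h\<bar> / (2 * n\<^sup>2) * (2 * (q * \<bar>h\<bar> * \<tau>)) = (q * \<bar>h\<bar> * \<tau>) * \<bar>h\<bar> / n / n" by (simp add: power2_eq_square)
        ultimately have "1/2 * (\<bar>h\<bar> / n) \<le> (q * \<bar>h\<bar> * \<tau>) * \<bar>h\<bar> / n / n" by simp
        also have "\<dots> = q * h\<^sup>2 * \<tau> / n\<^sup>2" by (simp add: power2_eq_square)
        finally show ?case using Img[of \<tau>] elim normg[of \<tau>] unfolding Img_eq by (simp add: n_def)
      qed
    qed
  qed

  have "\<i> powr of_real \<alpha> * (LINT t:{0<..<1}|lborel. of_real (t powr (\<alpha> - 1)) * K (Complex h t)) =
      (LINT t:{0<..<1}|lborel. \<i> powr of_real \<alpha> * (of_real (t powr (\<alpha> - 1)) * K (Complex h t)))" by simp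
  also have "\<dots> = (LINT t:{0<..<1}|lborel. \<i> * kern h (of_real h + \<i> * of_real t))"
  proof (rule set_lebesgue_integral_cong)
    show "\<forall>t. t \<in> {0<..<1} \<longrightarrow> \<i> powr of_real \<alpha> * (of_real (t powr (\<alpha> - 1)) * K (Complex h t)) = \<i> * kern h (of_real h + \<i> * of_real t)"
    proof (intro allI impI)
      fix t :: real assume t: "t \<in> {0<..<1}"
      have "(of_real t * \<i>) powr of_real (\<alpha> - 1) = of_real t powr of_real (\<alpha> - 1) * \<i> powr of_real (\<alpha> - 1)"
        using t by (intro powr_times_real_left) auto
      also have "complex_of_real t powr of_real (\<alpha> - 1) = of_real (t powr (\<alpha> - 1))"
        using t by (intro powr_of_real) auto
      finally have "(\<i> * of_real t) powr of_real (\<alpha> - 1) = of_real (t powr (\<alpha> - 1)) * \<i> powr of_real (\<alpha> - 1)" by (simp add: mult.commute)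
      moreover have "\<i> * \<i> powr of_real (\<alpha> - 1) = \<i> powr of_real \<alpha>" by (simp add: powr_diff)
      moreover have "Complex h t = of_real h + \<i> * of_real t" by (simp add: Complex_eq)
      ultimately show "\<i> powr of_real \<alpha> * (of_real (t powr (\<alpha> - 1)) * K (Complex h t)) = \<i> * kern h (of_real h + \<i> * of_real t)"
        unfolding kern_def by (simp add: mult_ac)
    qed
  qed auto
  \<comment> \<open>The path from h to h + i is traversed as semicircle from h to 0, vertical
    segment to i, horizontal segment to h + i; the values of the primitive telescope.\<close>
  also have "\<dots> = (L0 - Lh) + (P \<i> - L0) + (P (of_real h + \<i>) - P \<i>)" unfolding V by simp
  also have "L0 - Lh = c * Semi h" unfolding S[symmetric] Semi_def by simp
  also have "P \<i> - L0 = \<i> * Vert (\<alpha> - 1) h" unfolding V0[symmetric] Vert_def by simp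
  also have "P (of_real h + \<i>) - P \<i> = Horiz (of_real h)" by (simp add: H)
  finally show ?thesis by (simp add: c_def)
qed

end

subsection \<open>Regularity of the remainder\<close>

lemma decays_poly_bound:
  assumes "decays s g" "N \<ge> 0"
  obtains C d where "C > 0" "d > 0"
    "\<And>x t. t > 0 \<Longrightarrow> (1 + t) powr N * norm (g (Complex x t)) \<le> C * t powr (- s) * exp (- d * t)"
proof -
  obtain C d where C: "C > 0" "d > 0" and b: "\<And>z. z \<in> upper_half \<Longrightarrow> norm (g z) \<le> C * Im z powr (- s) * exp (- d * Im z)"
    using assms(1) by (auto simp: decays_def)
  obtain C2 where C2: "C2 > 0" "\<And>t. t \<ge> 0 \<Longrightarrow> (1 + t) powr N \<le> C2 * exp (d/2 * t)"
    using bounded_powr_exp[of N "d/2"] assms(2) C by auto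
  have "(1 + t) powr N * norm (g (Complex x t)) \<le> (C2 * C) * t powr (- s) * exp (- (d/2) * t)" if t: "t > 0" for x t
  proof -
    have "(1 + t) powr N * norm (g (Complex x t)) \<le> (C2 * exp (d/2 * t)) * (C * t powr (- s) * exp (- d * t))"
      using C2 b[of "Complex x t"] t by (intro mult_mono) (auto simp: upper_half_def)
    also have "\<dots> = (C2 * C) * t powr (- s) * (exp (d/2 * t) * exp (- d * t))" by (simp only: mult_ac)
    also have "exp (d/2 * t) * exp (- d * t) = exp (- (d/2) * t)" by (simp flip: exp_add)
    finally show ?thesis .
  qed
  then show ?thesis using that[of "C2 * C" "d/2"] C C2 by auto
qed

context inversion
begin

definition \<beta> :: real where "\<beta> = r - \<alpha> - 1"

definition base :: "real \<Rightarrow> real" where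
  "base h = e - 1 / (q * h)"

text \<open>As \<open>base h\<close> is \<sigma>^(-1) x for x = x0 + h, this is
  f^\<sigma>_\<alpha>(\<sigma>^(-1) x) up to the Gamma factor.\<close>

definition Main :: "real \<Rightarrow> complex" where
  "Main h = (LINT \<tau>:{0<..}|lborel. of_real (\<tau> powr (\<alpha> - 1)) * G (Complex (base h) \<tau>))"

definition rker :: "real \<Rightarrow> real \<Rightarrow> complex" where
  "rker h \<tau> = of_real (\<tau> powr (\<alpha> - 1)) * ((zfac h \<tau> powr of_real \<beta> - 1) * G (Complex (base h) \<tau>))"

definition rker' :: "real \<Rightarrow> real \<Rightarrow> complex" where
  "rker' h \<tau> = of_real (\<tau> powr (\<alpha> - 1)) *
    ((zfac h \<tau> powr of_real \<beta> - 1) * (of_real (1 / (q * h\<^sup>2)) * deriv G (Complex (base h) \<tau>))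
      + (- \<i> * of_real (q * \<tau>)) * (of_real \<beta> * zfac h \<tau> powr (of_real \<beta> - 1)) * G (Complex (base h) \<tau>))"

definition Rem :: "real \<Rightarrow> complex" where
  "Rem h = (LINT \<tau>:{0<..}|lborel. rker h \<tau>)"

lemma G_holomorphic: "G holomorphic_on upper_half"
  using G by (simp add: decays_def)

lemma dG_holomorphic: "deriv G holomorphic_on upper_half"
  by (rule holomorphic_deriv[OF G_holomorphic open_upper_half])

lemma rker_integrable: "set_integrable lborel {0<..} (rker h)"
proof -
  have "set_integrable lborel {0<..} (\<lambda>\<tau>. of_real (\<tau> powr (\<alpha> - 1)) * zfac h \<tau> powr of_real \<beta> * G (Complex (base h) \<tau>)
      - of_real (\<tau> powr (\<alpha> - 1)) * zfac h \<tau> powr of_real 0 * G (Complex (base h) \<tau>))"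
    by (intro set_integral_diff(1) Semi_integrable)
  moreover have "of_real (\<tau> powr (\<alpha> - 1)) * zfac h \<tau> powr of_real \<beta> * G (Complex (base h) \<tau>)
      - of_real (\<tau> powr (\<alpha> - 1)) * zfac h \<tau> powr of_real 0 * G (Complex (base h) \<tau>) = rker h \<tau>" for \<tau>
    using zfac_nonpos[of h \<tau>] by (auto simp: rker_def algebra_simps)
  ultimately show ?thesis by simp
qed

lemma Semi_eq: "Semi h = Main h + Rem h"
proof -
  have "set_integrable lborel {0<..} (\<lambda>\<tau>. of_real (\<tau> powr (\<alpha> - 1)) * G (Complex (base h) \<tau>))"
    by (rule decays_integrable[OF G s_less])
  then have "Main h + Rem h = (LINT \<tau>:{0<..}|lborel. of_real (\<tau> powr (\<alpha> - 1)) * G (Complex (base h) \<tau>) + rker h \<tau>)"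
    unfolding Main_def Rem_def by (rule set_integral_add(2)[OF _ rker_integrable, symmetric])
  also have "\<dots> = Semi h"
    unfolding Semi_def rker_def \<beta>_def base_def by (simp add: algebra_simps)
  finally show ?thesis by simp
qed

lemma zfac_powr_deriv:
  "((\<lambda>h. zfac h \<tau> powr of_real \<gamma>) has_vector_derivative
    (- \<i> * of_real (q * \<tau>)) * (of_real \<gamma> * zfac h \<tau> powr (of_real \<gamma> - 1))) (at h)"
proof -
  have "((\<lambda>h. zfac h \<tau>) has_vector_derivative - \<i> * of_real (q * \<tau>)) (at h)"
    unfolding zfac_def by (auto intro!: derivative_eq_intros)
  from field_vector_diff_chain_at[OF this has_field_derivative_powr[OF zfac_nonpos]]
  show ?thesis unfolding comp_def .
qed

text \<open>The weight equals 1 at h = 0, so the mean value inequality in h yields the factor |h|.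
  The accompanying factor \<tau> is just as important: it offsets the power lost when G is
  differentiated.\<close>

lemma zfac_powr_minus_one:
  assumes "\<tau> \<ge> 0" "\<bar>h\<bar> \<le> H"
  shows "norm (zfac h \<tau> powr of_real \<beta> - 1) \<le> (q * \<bar>\<beta>\<bar> * (1 + q * H) powr \<bar>\<beta> - 1\<bar>) * \<tau> * (1 + \<tau>) powr \<bar>\<beta> - 1\<bar> * \<bar>h\<bar>"
proof -
  have z0: "zfac 0 \<tau> powr of_real \<beta> = 1" by (simp add: zfac_def)
  have "norm (zfac h \<tau> powr of_real \<beta> - zfac 0 \<tau> powr of_real \<beta>) \<le>
      ((q * \<bar>\<beta>\<bar> * (1 + q * H) powr \<bar>\<beta> - 1\<bar>) * \<tau> * (1 + \<tau>) powr \<bar>\<beta> - 1\<bar>) * norm (h - 0)"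
  proof (rule vector_derivative_bound[where S = "{-H..H}" and f = "\<lambda>h. zfac h \<tau> powr of_real \<beta>"
        and f' = "\<lambda>h. (- \<i> * of_real (q * \<tau>)) * (of_real \<beta> * zfac h \<tau> powr (of_real \<beta> - 1))"])
    fix x assume x: "x \<in> {-H..H}"
    show "((\<lambda>h. zfac h \<tau> powr of_real \<beta>) has_vector_derivative
        (- \<i> * of_real (q * \<tau>)) * (of_real \<beta> * zfac x \<tau> powr (of_real \<beta> - 1))) (at x within {-H..H})"
      by (rule has_vector_derivative_at_within[OF zfac_powr_deriv])
    have "norm (zfac x \<tau> powr of_real (\<beta> - 1)) \<le> ((1 + q * H) * (1 + \<tau>)) powr \<bar>\<beta> - 1\<bar>"
      using x by (intro norm_zfac_powr assms) auto
    also have "\<dots> = (1 + q * H) powr \<bar>\<beta> - 1\<bar> * (1 + \<tau>) powr \<bar>\<beta> - 1\<bar>" by (rule powr_mult)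
    finally have "q * \<tau> * (\<bar>\<beta>\<bar> * norm (zfac x \<tau> powr of_real (\<beta> - 1))) \<le> q * \<tau> * (\<bar>\<beta>\<bar> * ((1 + q * H) powr \<bar>\<beta> - 1\<bar> * (1 + \<tau>) powr \<bar>\<beta> - 1\<bar>))"
      using q assms(1) by (intro mult_left_mono) auto
    moreover have "norm ((- \<i> * of_real (q * \<tau>)) * (of_real \<beta> * zfac x \<tau> powr (of_real \<beta> - 1))) = q * \<tau> * (\<bar>\<beta>\<bar> * norm (zfac x \<tau> powr of_real (\<beta> - 1)))"
      unfolding norm_mult norm_of_real using q assms(1) by (simp add: abs_mult)
    ultimately show "norm ((- \<i> * of_real (q * \<tau>)) * (of_real \<beta> * zfac x \<tau> powr (of_real \<beta> - 1))) \<le>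
       (q * \<bar>\<beta>\<bar> * (1 + q * H) powr \<bar>\<beta> - 1\<bar>) * \<tau> * (1 + \<tau>) powr \<bar>\<beta> - 1\<bar>"
      by (simp only: mult_ac)
  qed (use assms in auto)
  then show ?thesis unfolding z0 by simp
qed

text \<open>Bounds for G do not depend on the real part, so it does not matter that
  \<open>base h\<close> runs off to infinity as h tends to 0.\<close>

lemma Rem_bound:
  obtains C where "C \<ge> 0" "\<And>h. \<bar>h\<bar> \<le> 1 \<Longrightarrow> norm (Rem h) \<le> C * \<bar>h\<bar>"
proof -
  obtain C d where C: "C > 0" "d > 0" and b: "\<And>x t. t > 0 \<Longrightarrow> (1 + t) powr \<bar>\<beta> - 1\<bar> * norm (G (Complex x t)) \<le> C * t powr (- s) * exp (- d * t)"
    using decays_poly_bound[OF G, of "\<bar>\<beta> - 1\<bar>"] by auto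
  define A where "A = q * \<bar>\<beta>\<bar> * (1 + q * 1) powr \<bar>\<beta> - 1\<bar> * C"
  have A: "A \<ge> 0" using q C by (simp add: A_def)
  define w where "w t = t powr (\<alpha> - s + 1 - 1) * exp (- d * t)" for t
  have wi: "set_integrable lborel {0<..} w"
    unfolding w_def using s_less C by (intro set_integrable_powr_exp) auto
  have rb: "norm (rker h t) \<le> A * \<bar>h\<bar> * w t" if h: "\<bar>h\<bar> \<le> 1" and t: "t > 0" for h t
  proof -
    have "norm (rker h t) = t powr (\<alpha> - 1) * (norm (zfac h t powr of_real \<beta> - 1) * norm (G (Complex (base h) t)))"
      by (simp add: rker_def norm_mult)
    also have "\<dots> \<le> t powr (\<alpha> - 1) * (((q * \<bar>\<beta>\<bar> * (1 + q * 1) powr \<bar>\<beta> - 1\<bar>) * t * (1 + t) powr \<bar>\<beta> - 1\<bar> * \<bar>h\<bar>) * norm (G (Complex (base h) t)))"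
      using t h by (intro mult_left_mono mult_right_mono zfac_powr_minus_one) auto
    also have "\<dots> = (q * \<bar>\<beta>\<bar> * (1 + q * 1) powr \<bar>\<beta> - 1\<bar>) * \<bar>h\<bar> * (t powr (\<alpha> - 1) * t) * ((1 + t) powr \<bar>\<beta> - 1\<bar> * norm (G (Complex (base h) t)))"
      by (simp only: mult_ac)
    also have "\<dots> \<le> (q * \<bar>\<beta>\<bar> * (1 + q * 1) powr \<bar>\<beta> - 1\<bar>) * \<bar>h\<bar> * (t powr (\<alpha> - 1) * t) * (C * t powr (- s) * exp (- d * t))"
      using t q by (intro mult_left_mono b) auto
    also have "\<dots> = A * \<bar>h\<bar> * ((t powr (\<alpha> - 1) * t) * t powr (- s) * exp (- d * t))" by (simp only: A_def mult_ac)
    also have "(t powr (\<alpha> - 1) * t) * t powr (- s) = t powr (\<alpha> - s + 1 - 1)"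
      using t by (simp add: powr_diff powr_minus field_simps)
    finally show ?thesis by (simp only: w_def)
  qed
  have "norm (Rem h) \<le> (A * (LINT t:{0<..}|lborel. w t)) * \<bar>h\<bar>" if h: "\<bar>h\<bar> \<le> 1" for h
  proof -
    have "norm (Rem h) \<le> (LINT t:{0<..}|lborel. A * \<bar>h\<bar> * w t)"
      unfolding Rem_def set_lebesgue_integral_def
    proof (rule Bochner_Integration.integral_norm_bound_integral)
      show "integrable lborel (\<lambda>x. indicat_real {0<..} x *\<^sub>R rker h x)"
        using rker_integrable by (simp add: set_integrable_def)
      have "set_integrable lborel {0<..} (\<lambda>t. A * \<bar>h\<bar> * w t)" by (intro set_integrable_mult_right wi)
      then show "integrable lborel (\<lambda>x. indicat_real {0<..} x *\<^sub>R (A * \<bar>h\<bar> * w x))" unfolding set_integrable_def .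
      show "norm (indicat_real {0<..} x *\<^sub>R rker h x) \<le> indicat_real {0<..} x *\<^sub>R (A * \<bar>h\<bar> * w x)" for x
        using rb[OF h, of x] by (auto simp: indicator_def)
    qed
    also have "\<dots> = (A * (LINT t:{0<..}|lborel. w t)) * \<bar>h\<bar>" by simp
    finally show ?thesis .
  qed
  moreover have "(LINT t:{0<..}|lborel. w t) \<ge> 0"
    unfolding set_lebesgue_integral_def by (intro Bochner_Integration.integral_nonneg) (auto simp: w_def indicator_def)
  ultimately show ?thesis using A that by (meson mult_nonneg_nonneg)
qed

lemma base_deriv:
  assumes "h \<noteq> 0" "\<tau> > 0" "g holomorphic_on upper_half"
  shows "((\<lambda>h. g (Complex (base h) \<tau>)) has_vector_derivative of_real (1 / (q * h\<^sup>2)) * deriv g (Complex (base h) \<tau>)) (at h)"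
proof -
  have "(base has_real_derivative 1 / (q * h\<^sup>2)) (at h)"
    unfolding base_def[abs_def] using assms(1) q by (auto intro!: derivative_eq_intros simp: power2_eq_square)
  then have "((\<lambda>h. of_real (base h) + \<i> * of_real \<tau>) has_vector_derivative of_real (1 / (q * h\<^sup>2)) + 0) (at h)"
    by (intro has_vector_derivative_add has_vector_derivative_of_real) auto
  then have 1: "((\<lambda>h. Complex (base h) \<tau>) has_vector_derivative of_real (1 / (q * h\<^sup>2))) (at h)"
    by (simp add: Complex_eq)
  have "(g has_field_derivative deriv g (Complex (base h) \<tau>)) (at (Complex (base h) \<tau>))"
    by (rule holomorphic_derivI[OF assms(3) open_upper_half]) (use assms in \<open>simp add: upper_half_def\<close>)
  from field_vector_diff_chain_at[OF 1 this] show ?thesis by (simp add: comp_def)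
qed

text \<open>Differentiating G costs one power of \<tau>, while the weight minus 1 supplies one: both
  summands of \<open>rker'\<close> are dominated by integrable powers near \<tau> = 0 under the sole
  condition s < \<alpha>.\<close>

lemma Rem_C1:
  obtains R' where "\<And>h. h \<noteq> 0 \<Longrightarrow> (Rem has_vector_derivative R' h) (at h)" "continuous_on (- {0}) R'"
proof -
  define N where "N = \<bar>\<beta> - 1\<bar>"
  have dG: "decays (s + 1) (deriv G)" by (rule decays_deriv[OF G s])
  obtain C d where C: "C > 0" "d > 0" and b: "\<And>x t. t > 0 \<Longrightarrow> (1 + t) powr N * norm (G (Complex x t)) \<le> C * t powr (- s) * exp (- d * t)"
    using decays_poly_bound[OF G, of N] by (auto simp: N_def)
  obtain C' d' where C': "C' > 0" "d' > 0" and b': "\<And>x t. t > 0 \<Longrightarrow> (1 + t) powr N * norm (deriv G (Complex x t)) \<le> C' * t powr (- (s + 1)) * exp (- d' * t)"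
    using decays_poly_bound[OF dG, of N] by (auto simp: N_def)
  have rc: "continuous_on {0<..} (rker' h)" for h
  proof -
    have "continuous_on {0<..} (\<lambda>\<tau>::real. \<i> * complex_of_real (q * \<tau>))" by (intro continuous_intros)
    moreover have "continuous_on {0<..} (\<lambda>\<tau>::real. complex_of_real (\<tau> powr (\<alpha> - 1)))" by (intro continuous_intros) auto
    ultimately show ?thesis
      unfolding rker'_def[abs_def]
      by (intro continuous_on_add continuous_on_mult continuous_on_diff continuous_on_const continuous_on_minus zfac_continuous
          G_line_continuous G_holomorphic dG_holomorphic) (auto intro!: continuous_intros)
  qed
  have key: "(Rem has_vector_derivative (LINT t:{0<..}|lborel. rker' h0 t)) (at h0)
      \<and> isCont (\<lambda>h. LINT t:{0<..}|lborel. rker' h t) h0" if h0: "h0 \<noteq> 0" for h0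
  proof -
    define H where "H = 2 * \<bar>h0\<bar>"
    define m where "m = 4 / (q * h0\<^sup>2)"
    define A where "A = q * \<bar>\<beta>\<bar> * (1 + q * H) powr N"
    have pos: "H > 0" "m > 0" "A \<ge> 0" using h0 q by (auto simp: H_def m_def A_def)
    \<comment> \<open>One majorant on the whole interval |h - h0| < |h0|/2: the first summand
      controls the derivative of G, the second the derivative of the weight.\<close>
    define w where "w t = A * H * m * C' * (t powr (\<alpha> - s - 1) * exp (- d' * t)) + A * C * (t powr (\<alpha> - s + 1 - 1) * exp (- d * t))" for t
    have wi: "set_integrable lborel {0<..} w"
      unfolding w_def using s_less C C' by (intro set_integral_add(1) set_integrable_mult_right set_integrable_powr_exp) auto
    have near: "h \<noteq> 0" "\<bar>h\<bar> \<le> H" "\<bar>1 / (q * h\<^sup>2)\<bar> \<le> m" if h: "\<bar>h - h0\<bar> < \<bar>h0\<bar> / 2" for h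
    proof -
      have 1: "\<bar>h\<bar> \<ge> \<bar>h0\<bar> / 2" "\<bar>h\<bar> \<le> 2 * \<bar>h0\<bar>" using h by linarith+
      then show "h \<noteq> 0" "\<bar>h\<bar> \<le> H" using h0 by (auto simp: H_def)
      have "(\<bar>h0\<bar> / 2)\<^sup>2 \<le> \<bar>h\<bar>\<^sup>2" using 1 by (intro power_mono) auto
      then have "h0\<^sup>2 / 4 \<le> h\<^sup>2" by (simp add: power_divide)
      then have "1 / (q * h\<^sup>2) \<le> 1 / (q * (h0\<^sup>2 / 4))"
        using q h0 \<open>h \<noteq> 0\<close> by (intro divide_left_mono mult_left_mono mult_pos_pos) auto
      then show "\<bar>1 / (q * h\<^sup>2)\<bar> \<le> m" using q by (simp add: m_def)
    qed
    have bound: "norm (rker' h t) \<le> w t" if h: "\<bar>h - h0\<bar> < \<bar>h0\<bar> / 2" and t: "t \<in> {0<..}" for h t :: real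
    proof -
      have t0: "t > 0" using t by simp
      note n = near[OF h]
      have z1: "norm (zfac h t powr of_real \<beta> - 1) \<le> A * t * (1 + t) powr N * H"
      proof -
        have "norm (zfac h t powr of_real \<beta> - 1) \<le> A * t * (1 + t) powr N * \<bar>h\<bar>"
          unfolding A_def N_def using t0 n by (intro zfac_powr_minus_one) auto
        also have "\<dots> \<le> A * t * (1 + t) powr N * H" using n t0 pos by (intro mult_left_mono) auto
        finally show ?thesis .
      qed
      have z2: "norm (zfac h t powr (of_real \<beta> - 1)) \<le> (1 + q * H) powr N * (1 + t) powr N"
        using norm_zfac_powr[of t h H "\<beta> - 1"] t0 n by (simp add: N_def powr_mult)
      have "norm ((zfac h t powr of_real \<beta> - 1) * (of_real (1 / (q * h\<^sup>2)) * deriv G (Complex (base h) t)))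
          \<le> (A * t * (1 + t) powr N * H) * (m * norm (deriv G (Complex (base h) t)))"
        unfolding norm_mult norm_of_real using z1 n pos t0 by (intro mult_mono) auto
      also have "\<dots> = A * H * m * t * ((1 + t) powr N * norm (deriv G (Complex (base h) t)))" by (simp only: mult_ac)
      also have "\<dots> \<le> A * H * m * t * (C' * t powr (- (s + 1)) * exp (- d' * t))"
        using pos t0 by (intro mult_left_mono b') auto
      finally have p1: "norm ((zfac h t powr of_real \<beta> - 1) * (of_real (1 / (q * h\<^sup>2)) * deriv G (Complex (base h) t)))
          \<le> A * H * m * t * (C' * t powr (- (s + 1)) * exp (- d' * t))" .
      have "norm ((- \<i> * of_real (q * t)) * (of_real \<beta> * zfac h t powr (of_real \<beta> - 1)) * G (Complex (base h) t))
          = (q * t) * (\<bar>\<beta>\<bar> * norm (zfac h t powr (of_real \<beta> - 1))) * norm (G (Complex (base h) t))"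
        unfolding norm_mult norm_of_real using q t0 by (simp add: abs_mult)
      also have "\<dots> \<le> (q * t) * (\<bar>\<beta>\<bar> * ((1 + q * H) powr N * (1 + t) powr N)) * norm (G (Complex (base h) t))"
        using q t0 z2 by (intro mult_right_mono mult_left_mono) auto
      also have "\<dots> = A * t * ((1 + t) powr N * norm (G (Complex (base h) t)))" by (simp only: A_def mult_ac)
      also have "\<dots> \<le> A * t * (C * t powr (- s) * exp (- d * t))" using pos t0 by (intro mult_left_mono b) auto
      finally have p2: "norm ((- \<i> * of_real (q * t)) * (of_real \<beta> * zfac h t powr (of_real \<beta> - 1)) * G (Complex (base h) t))
          \<le> A * t * (C * t powr (- s) * exp (- d * t))" .
      have "norm (rker' h t) \<le> t powr (\<alpha> - 1) * (A * H * m * t * (C' * t powr (- (s + 1)) * exp (- d' * t)) + A * t * (C * t powr (- s) * exp (- d * t)))"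
        unfolding rker'_def norm_mult[of "complex_of_real (t powr (\<alpha> - 1))"]
        using norm_triangle_le[OF add_mono[OF p1 p2]] by (simp add: mult_left_mono)
      also have "\<dots> = A * H * m * C' * ((t powr (\<alpha> - 1) * t * t powr (- (s + 1))) * exp (- d' * t)) + A * C * ((t powr (\<alpha> - 1) * t * t powr (- s)) * exp (- d * t))"
        by (simp add: algebra_simps)
      also have "t powr (\<alpha> - 1) * t * t powr (- (s + 1)) = t powr (\<alpha> - s - 1)"
        using t0 powr_diff[of t "\<alpha> - 1" s] by (simp add: powr_minus powr_add powr_diff field_simps)
      also have "t powr (\<alpha> - 1) * t * t powr (- s) = t powr (\<alpha> - s + 1 - 1)"
        using t0 by (simp add: powr_diff powr_minus field_simps)
      finally show ?thesis by (simp only: w_def)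
    qed
    have e: "\<bar>h0\<bar> / 2 > 0" using h0 by simp
    have D: "(Rem has_vector_derivative (LINT t:{0<..}|lborel. rker' h0 t)) (at h0)"
      unfolding Rem_def[abs_def]
    proof (rule has_vector_derivative_integral_dominated[OF e _ _ bound wi])
      show "set_integrable lborel {0<..} (rker h)" for h by (rule rker_integrable)
      show "set_borel_measurable lborel {0<..} (rker' h0)"
        by (rule set_borel_measurable_continuous_on_interval[OF rc]) auto
      fix h t :: real assume h: "\<bar>h - h0\<bar> < \<bar>h0\<bar> / 2" and t: "t \<in> {0<..}"
      have t0: "t > 0" using t by simp
      have "((\<lambda>h. zfac h t powr of_real \<beta> - 1) has_vector_derivative (- \<i> * of_real (q * t)) * (of_real \<beta> * zfac h t powr (of_real \<beta> - 1)) - 0) (at h)"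
        by (intro has_vector_derivative_diff zfac_powr_deriv has_vector_derivative_const)
      from has_vector_derivative_mult_right[OF has_vector_derivative_mult[OF this base_deriv[OF near(1)[OF h] t0 G_holomorphic]], of "of_real (t powr (\<alpha> - 1))"]
      show "((\<lambda>h. rker h t) has_vector_derivative rker' h t) (at h)" unfolding rker_def rker'_def by simp
    qed
    have "isCont (\<lambda>h. LINT t:{0<..}|lborel. rker' h t) h0"
    proof (rule isCont_integral_dominated[OF e _ bound wi])
      show "set_borel_measurable lborel {0<..} (rker' h)" for h
        by (rule set_borel_measurable_continuous_on_interval[OF rc]) auto
      fix t :: real assume t: "t \<in> {0<..}"
      then have t0: "t > 0" by simp
      have z: "isCont (\<lambda>h. zfac h t powr of_real \<gamma>) h0" for \<gamma>
        using has_vector_derivative_continuous[OF zfac_powr_deriv] .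
      have z': "isCont (\<lambda>h. zfac h t powr (of_real \<beta> - 1)) h0" using z[of "\<beta> - 1"] by simp
      have g1: "isCont (\<lambda>h. G (Complex (base h) t)) h0"
        by (rule has_vector_derivative_continuous[OF base_deriv[OF h0 t0 G_holomorphic]])
      have g2: "isCont (\<lambda>h. deriv G (Complex (base h) t)) h0"
        by (rule has_vector_derivative_continuous[OF base_deriv[OF h0 t0 dG_holomorphic]])
      have i: "isCont (\<lambda>h. complex_of_real (1 / (q * h\<^sup>2))) h0"
        using h0 q by (intro continuous_intros) auto
      show "isCont (\<lambda>h. rker' h t) h0"
        unfolding rker'_def by (intro continuous_add continuous_mult continuous_diff continuous_const z z' g1 g2 i)
    qed
    with D show ?thesis by blast
  qed
  show ?thesis
    by (rule that[of "\<lambda>h. LINT t:{0<..}|lborel. rker' h t"])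
      (use key in \<open>auto intro!: continuous_at_imp_continuous_on\<close>)
qed

theorem local_expansion:
  obtains S where "smooth S" "\<And>h. h \<noteq> 0 \<Longrightarrow> (LINT t:{0<..<1}|lborel. of_real (t powr (\<alpha> - 1)) * K (Complex h t)) =
    of_real (q powr \<alpha> * \<bar>h\<bar> powr (2 * \<alpha>)) * of_real h powr (- of_real r) * (Main h + Rem h) + S h"
proof -
  define c where "c = \<i> powr of_real \<alpha>"
  have c: "c \<noteq> 0" by (simp add: c_def)
  define S where "S h = (\<i> / c) * Vert (\<alpha> - 1) h + (1 / c) * Horiz (of_real h)" for h
  have "smooth S" unfolding S_def[abs_def] by (intro smooth_add smooth_cmult smooth_Vert smooth_Horiz)
  moreover have "(LINT t:{0<..<1}|lborel. of_real (t powr (\<alpha> - 1)) * K (Complex h t)) =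
    of_real (q powr \<alpha> * \<bar>h\<bar> powr (2 * \<alpha>)) * of_real h powr (- of_real r) * (Main h + Rem h) + S h" if "h \<noteq> 0" for h
  proof -
    define I where "I = (LINT t:{0<..<1}|lborel. of_real (t powr (\<alpha> - 1)) * K (Complex h t))"
    define M where "M = of_real (q powr \<alpha> * \<bar>h\<bar> powr (2 * \<alpha>)) * complex_of_real h powr (- of_real r)"
    have "c * I = M * c * (Main h + Rem h) + \<i> * Vert (\<alpha> - 1) h + Horiz (of_real h)"
      unfolding I_def M_def c_def Semi_eq[symmetric] by (rule contour_identity[OF that])
    also have "\<dots> = c * (M * (Main h + Rem h) + S h)" using c by (simp add: S_def field_simps)
    finally show ?thesis using c unfolding I_def M_def by simp
  qed
  ultimately show ?thesis using that by blast
qed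

end

text \<open>On each half-line the phase of h^(-r) is constant, so the product is a constant multiple
  of the real power |h|^(a-r).\<close>

lemma abs_powr_times_powr_deriv:
  fixes a r h :: real
  assumes "h \<noteq> 0"
  shows "((\<lambda>h. of_real (\<bar>h\<bar> powr a) * complex_of_real h powr (- of_real r)) has_vector_derivative
    of_real ((a - r) / h) * (of_real (\<bar>h\<bar> powr a) * complex_of_real h powr (- of_real r))) (at h)"
proof -
  define \<epsilon> :: real where "\<epsilon> = sgn h"
  define c where "c = (if h > 0 then 1 else exp (- (of_real r * (\<i> * of_real pi))))"
  define U where "U = (if h > 0 then {0<..} else {..<0::real})"
  have U: "open U" "h \<in> U" using assms by (auto simp: U_def)
  have eq: "of_real (\<bar>x\<bar> powr a) * complex_of_real x powr (- of_real r) = c * of_real ((\<epsilon> * x) powr (a - r))" if x: "x \<in> U" for x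
  proof (cases "h > 0")
    case True
    then have "x > 0" using x by (simp add: U_def)
    then have "complex_of_real x powr (- of_real r) = of_real (x powr (- r))" using powr_of_real[of x "-r"] by simp
    then show ?thesis using True \<open>x > 0\<close> by (simp add: c_def \<epsilon>_def powr_diff powr_minus divide_inverse flip: of_real_mult of_real_inverse)
  next
    case False
    then have "x < 0" "h < 0" using x assms by (auto simp: U_def)
    have "Ln (complex_of_real x) = of_real (ln (- x)) + \<i> * of_real pi"
    proof -
      have "Ln (- complex_of_real x) = of_real (ln (- x))" using \<open>x < 0\<close> Ln_of_real[of "- x"] by simp
      then show ?thesis using \<open>x < 0\<close> Ln_minus[of "of_real (- x)"] by simp
    qed
    then have "complex_of_real x powr (- of_real r) = exp (of_real (- r * ln (- x))) * c"
      using \<open>x < 0\<close> False by (simp add: powr_def c_def algebra_simps flip: exp_add)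
    also have "exp (complex_of_real (- r * ln (- x))) = of_real ((- x) powr (- r))"
      using \<open>x < 0\<close> by (simp add: powr_def exp_of_real[symmetric])
    finally show ?thesis using \<open>x < 0\<close> \<open>h < 0\<close>
      by (simp add: \<epsilon>_def powr_diff powr_minus divide_inverse mult_ac flip: of_real_mult of_real_inverse)
  qed
  have eh: "\<epsilon> * h > 0" using assms by (simp add: \<epsilon>_def sgn_if)
  have "((\<lambda>x. (\<epsilon> * x) powr (a - r)) has_real_derivative (a - r) / h * (\<epsilon> * h) powr (a - r)) (at h)"
    using eh assms by (auto intro!: derivative_eq_intros simp: powr_diff field_simps)
  from has_vector_derivative_mult_right[OF has_vector_derivative_of_real[OF this], of c]
  have "((\<lambda>x. c * of_real ((\<epsilon> * x) powr (a - r))) has_vector_derivative of_real ((a - r) / h) * (c * of_real ((\<epsilon> * h) powr (a - r)))) (at h)"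
    by (simp add: mult_ac)
  then show ?thesis
    unfolding eq[OF U(2)] by (rule has_vector_derivative_transform_within_open[OF _ U]) (simp add: eq)
qed

lemma error_term_regularity:
  fixes S Q :: "real \<Rightarrow> complex" and x0 :: real
  assumes S: "smooth S" and "\<sigma> > 0"
    and Q': "\<And>h. h \<noteq> 0 \<Longrightarrow> (Q has_vector_derivative Q' h) (at h)" "continuous_on (- {0}) Q'"
    and Qb: "\<And>h. h \<noteq> 0 \<Longrightarrow> \<bar>h\<bar> \<le> 1 \<Longrightarrow> norm (Q h) \<le> C * \<bar>h\<bar> powr \<sigma>"
  defines "E \<equiv> \<lambda>x. S (x - x0) + (if x = x0 then 0 else Q (x - x0))"
  shows "C10 (- {x0}) E" "Cs_at \<sigma> x0 E"
proof -
  obtain S' where S': "\<And>x. (S has_vector_derivative S' x) (at x)" "continuous_on UNIV S'"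
    using smooth_C1[OF S] by blast
  have shift: "((\<lambda>x. x - x0) has_vector_derivative 1) (at x)" for x
    by (auto intro!: derivative_eq_intros)
  have dE: "(E has_vector_derivative S' (x - x0) + Q' (x - x0)) (at x)" if x: "x \<noteq> x0" for x
  proof -
    have "((\<lambda>x. S (x - x0)) has_vector_derivative S' (x - x0)) (at x)"
      using vector_diff_chain_at[OF shift S'(1)] by (simp add: comp_def)
    moreover have "((\<lambda>x. Q (x - x0)) has_vector_derivative Q' (x - x0)) (at x)"
      using vector_diff_chain_at[OF shift Q'(1)] x by (simp add: comp_def)
    ultimately have "((\<lambda>x. S (x - x0) + Q (x - x0)) has_vector_derivative S' (x - x0) + Q' (x - x0)) (at x)"
      by (rule has_vector_derivative_add)
    then show ?thesis
      by (rule has_vector_derivative_transform_within_open[of _ _ _ "- {x0}"]) (use x in \<open>auto simp: E_def\<close>)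
  qed
  show "C10 (- {x0}) E"
    unfolding C10_def
  proof (intro exI[of _ "\<lambda>x. S' (x - x0) + Q' (x - x0)"] conjI ballI)
    show "continuous_on (- {x0}) (\<lambda>x. S' (x - x0) + Q' (x - x0))"
      by (intro continuous_on_add continuous_on_compose2[OF S'(2)] continuous_on_compose2[OF Q'(2)] continuous_intros) auto
  qed (use dE in auto)
  have "\<forall>\<^sub>F x in at x0. x \<noteq> x0 \<and> \<bar>x - x0\<bar> \<le> 1"
    unfolding eventually_at by (intro exI[of _ 1]) (auto simp: dist_real_def)
  note near = this
  have cE: "isCont E x" for x
  proof (cases "x = x0")
    case False
    then show ?thesis using has_vector_derivative_continuous[OF dE] by blast
  next
    case True
    have abs0: "((\<lambda>x. \<bar>x - x0\<bar>) \<longlongrightarrow> 0) (at x0)"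
      using tendsto_rabs[OF LIM_zero[OF tendsto_ident_at[of x0 UNIV]]] by simp
    have "((\<lambda>x. \<bar>x - x0\<bar> powr \<sigma>) \<longlongrightarrow> 0) (at x0)"
      by (rule tendsto_zero_powrI[OF abs0 tendsto_const _ \<open>\<sigma> > 0\<close>]) simp
    then have l: "((\<lambda>x. C * \<bar>x - x0\<bar> powr \<sigma>) \<longlongrightarrow> 0) (at x0)" by (rule tendsto_mult_right_zero)
    have "\<forall>\<^sub>F x in at x0. norm (E x - S (x - x0)) \<le> C * \<bar>x - x0\<bar> powr \<sigma>"
      using near by eventually_elim (use Qb in \<open>auto simp: E_def\<close>)
    then have 1: "((\<lambda>x. E x - S (x - x0)) \<longlongrightarrow> 0) (at x0)" by (rule Lim_null_comparison[OF _ l])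
    have "isCont (\<lambda>x. S (x - x0)) x0"
      using has_vector_derivative_continuous[OF vector_diff_chain_at[OF shift S'(1), of x0]] by (simp add: comp_def)
    then have 2: "((\<lambda>x. S (x - x0)) \<longlongrightarrow> S 0) (at x0)" unfolding isCont_def by simp
    from tendsto_add[OF 1 2] have "(E \<longlongrightarrow> S 0) (at x0)" by simp
    then show ?thesis unfolding True isCont_def by (simp add: E_def)
  qed
  \<comment> \<open>The largest integer strictly below \<sigma>: degree n is admissible, and the
    Taylor error of order n + 1 is at least as small as the required order \<sigma>.\<close>
  define n where "n = nat \<lceil>\<sigma>\<rceil> - 1"
  have n: "real n < \<sigma>" "\<sigma> \<le> real (Suc n)"
  proof -
    have c: "\<lceil>\<sigma>\<rceil> \<ge> 1" using \<open>\<sigma> > 0\<close> by linarith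
    then have "int n = \<lceil>\<sigma>\<rceil> - 1" unfolding n_def by linarith
    then have "real n = real_of_int \<lceil>\<sigma>\<rceil> - 1" by (metis of_int_1 of_int_diff of_int_of_nat_eq)
    then show "real n < \<sigma>" "\<sigma> \<le> real (Suc n)" by linarith+
  qed
  obtain P B where P: "degree P < Suc n" "B \<ge> 0" "\<And>h. \<bar>h\<bar> \<le> 1 \<Longrightarrow> norm (S h - poly P (complex_of_real h)) \<le> B * \<bar>h\<bar> ^ Suc n"
    using smooth_taylor[OF S, of n] by blast
  show "Cs_at \<sigma> x0 E"
    unfolding Cs_at_def
  proof (intro conjI exI[of _ P] exI[of _ "B + C"])
    show "continuous_on UNIV E" using cE by (simp add: continuous_at_imp_continuous_on)
    show "real (degree P) < \<sigma>" using P(1) n(1) by linarith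
    show "\<forall>\<^sub>F x in at x0. norm (E x - poly P (of_real (x - x0))) \<le> (B + C) * \<bar>x - x0\<bar> powr \<sigma>"
      using near
    proof eventually_elim
      case (elim x)
      define h where "h = x - x0"
      have h: "h \<noteq> 0" "\<bar>h\<bar> \<le> 1" using elim by (auto simp: h_def)
      have "norm (E x - poly P (of_real h)) \<le> norm (S h - poly P (of_real h)) + norm (Q h)"
        using norm_triangle_ineq[of "S h - poly P (of_real h)" "Q h"] elim by (simp add: E_def h_def algebra_simps)
      also have "\<dots> \<le> B * \<bar>h\<bar> ^ Suc n + C * \<bar>h\<bar> powr \<sigma>" by (intro add_mono P(3) Qb h)
      also have "\<dots> \<le> B * \<bar>h\<bar> powr \<sigma> + C * \<bar>h\<bar> powr \<sigma>"
      proof (intro add_right_mono mult_left_mono P(2))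
        have "\<bar>h\<bar> ^ Suc n = \<bar>h\<bar> powr real (Suc n)" using h powr_realpow[of "\<bar>h\<bar>" "Suc n"] by simp
        also have "\<dots> \<le> \<bar>h\<bar> powr \<sigma>" using h n(2) by (intro powr_mono') auto
        finally show "\<bar>h\<bar> ^ Suc n \<le> \<bar>h\<bar> powr \<sigma>" .
      qed
      finally show ?case by (simp add: h_def algebra_simps)
    qed
  qed
qed

subsection \<open>Cusp widths\<close>

lemma imult_assoc: "imult (imult g h) k = imult g (imult h k)"
  by (cases g; cases h; cases k) (simp add: algebra_simps)

lemma imult_iid [simp]: "imult iid g = g" "imult g iid = g"
  by (cases g; simp add: iid_def)+

lemma idet_imult: "idet (imult g h) = idet g * idet h"
  by (cases g; cases h) (simp add: algebra_simps)

lemma idet_iinv: "idet (iinv g) = idet g"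
  by (cases g) (simp add: algebra_simps)

lemma imult_iinv: "g \<in> SL2Z \<Longrightarrow> imult (iinv g) g = iid" "g \<in> SL2Z \<Longrightarrow> imult g (iinv g) = iid"
  by (cases g; simp add: SL2Z_def iid_def algebra_simps)+

lemma imult_iinv_left: "g \<in> SL2Z \<Longrightarrow> imult (iinv g) (imult g h) = h"
  "g \<in> SL2Z \<Longrightarrow> imult g (imult (iinv g) h) = h"
  by (simp_all add: imult_iinv flip: imult_assoc)

lemma SL2Z_closed: "g \<in> SL2Z \<Longrightarrow> h \<in> SL2Z \<Longrightarrow> imult g h \<in> SL2Z" "g \<in> SL2Z \<Longrightarrow> iinv g \<in> SL2Z" "iid \<in> SL2Z"
  by (simp_all add: SL2Z_def idet_imult idet_iinv) (simp add: iid_def)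

text \<open>The stabilizer of infinity: translations up to sign, a commutative group.\<close>

definition upper_tri :: "imat set" where
  "upper_tri = {u \<in> SL2Z. case u of IM a b c d \<Rightarrow> c = 0}"

lemma upper_triE:
  assumes "u \<in> upper_tri"
  obtains a b where "u = IM a b 0 a" "a = 1 \<or> a = -1"
proof -
  obtain a b c d where u: "u = IM a b c d" by (cases u)
  with assms have "c = 0" "a * d = 1" by (auto simp: upper_tri_def SL2Z_def)
  then have "a = 1 \<and> d = 1 \<or> a = -1 \<and> d = -1" by (simp add: zmult_eq_1_iff)
  then show ?thesis using that u \<open>c = 0\<close> by auto
qed

lemma upper_tri_closed:
  "iid \<in> upper_tri"
  "u \<in> upper_tri \<Longrightarrow> v \<in> upper_tri \<Longrightarrow> imult u v \<in> upper_tri"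
  "u \<in> upper_tri \<Longrightarrow> iinv u \<in> upper_tri"
  "u \<in> upper_tri \<Longrightarrow> v \<in> upper_tri \<Longrightarrow> imult u v = imult v u"
proof -
  show "iid \<in> upper_tri" by (simp add: upper_tri_def SL2Z_def iid_def)
  show "u \<in> upper_tri \<Longrightarrow> v \<in> upper_tri \<Longrightarrow> imult u v \<in> upper_tri"
    by (elim upper_triE) (auto simp: upper_tri_def SL2Z_def)
  show "u \<in> upper_tri \<Longrightarrow> iinv u \<in> upper_tri"
    by (elim upper_triE) (auto simp: upper_tri_def SL2Z_def)
  show "u \<in> upper_tri \<Longrightarrow> v \<in> upper_tri \<Longrightarrow> imult u v = imult v u"
    by (elim upper_triE) auto
qed

text \<open>Conjugation by \<gamma> carries the stabilizer of \<gamma>(infinity) to that of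
  infinity; after clearing denominators both sides say that the same lower left entry
  vanishes.\<close>

lemma cusp_act_iff_lower_left:
  assumes "\<gamma> \<in> SL2Z" "g \<in> SL2Z"
  shows "cusp_act g (cusp_act \<gamma> CInf) = cusp_act \<gamma> CInf \<longleftrightarrow> imult (iinv \<gamma>) (imult g \<gamma>) \<in> upper_tri"
proof -
  obtain A B C D where \<gamma>: "\<gamma> = IM A B C D" by (cases \<gamma>)
  obtain a b c d where g: "g = IM a b c d" by (cases g)
  have det: "A * D - B * C = 1" "a * d - b * c = 1" using assms by (auto simp: \<gamma> g SL2Z_def)
  have mem: "imult (iinv \<gamma>) (imult g \<gamma>) \<in> SL2Z" using assms by (intro SL2Z_closed)
  have "imult (iinv \<gamma>) (imult g \<gamma>) \<in> upper_tri \<longleftrightarrow> A * (c * A + d * C) = C * (a * A + b * C)"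
    using mem by (auto simp: upper_tri_def \<gamma> g algebra_simps)
  also have "\<dots> \<longleftrightarrow> cusp_act g (cusp_act \<gamma> CInf) = cusp_act \<gamma> CInf"
  proof (cases "C = 0")
    case True
    then have "A \<noteq> 0" using det by auto
    then show ?thesis using True by (simp add: \<gamma> g)
  next
    case False
    define q :: rat where "q = of_int A / of_int C"
    have C: "of_int C \<noteq> (0::rat)" using False by simp
    have cusp: "cusp_act \<gamma> CInf = CQ q" using False by (simp add: \<gamma> q_def)
    have den: "of_int c * q + of_int d = of_int (c * A + d * C) / of_int C"
      using C by (simp add: q_def field_simps)
    have num: "of_int a * q + of_int b = of_int (a * A + b * C) / of_int C"
      using C by (simp add: q_def field_simps)
    show ?thesis
    proof (cases "c * A + d * C = 0")
      case True
      have "A * (c * A + d * C) \<noteq> C * (a * A + b * C)"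
      proof
        assume "A * (c * A + d * C) = C * (a * A + b * C)"
        then have e: "a * A + b * C = 0" using True False by simp
        \<comment> \<open>The image of the primitive column (A, C) under a matrix of determinant 1
          cannot vanish.\<close>
        have "C = a * (c * A + d * C) - c * (a * A + b * C)" using det(2) by algebra
        also have "\<dots> = 0" unfolding e True by simp
        finally have "C = 0" .
        then show False using False by simp
      qed
      moreover have "cusp_act g (CQ q) = CInf" unfolding g cusp_act.simps den using True by simp
      ultimately show ?thesis using cusp by simp
    next
      case nz: False
      then have nz': "(of_int (c * A + d * C) :: rat) \<noteq> 0" by (simp only: of_int_eq_0_iff not_False_eq_True)
      have "cusp_act g (CQ q) = CQ (of_int (a * A + b * C) / of_int (c * A + d * C))"
        unfolding g cusp_act.simps den num using nz' C by simp
      then have "cusp_act g (CQ q) = CQ q \<longleftrightarrow> (of_int (a * A + b * C) :: rat) / of_int (c * A + d * C) = of_int A / of_int C"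
        by (simp add: q_def)
      also have "\<dots> \<longleftrightarrow> of_int (C * (a * A + b * C)) = (of_int (A * (c * A + d * C)) :: rat)"
        unfolding frac_eq_eq[OF nz' C] by (simp only: of_int_mult mult_ac)
      finally show ?thesis using cusp by (auto simp only: of_int_eq_iff)
    qed
  qed
  finally show ?thesis ..
qed

lemma stab_eq:
  assumes "\<gamma> \<in> SL2Z"
  shows "stab (cusp_act \<gamma> CInf) = (\<lambda>u. imult \<gamma> (imult u (iinv \<gamma>))) ` upper_tri"
proof (intro equalityI subsetI)
  fix g assume "g \<in> stab (cusp_act \<gamma> CInf)"
  then have g: "g \<in> SL2Z" "cusp_act g (cusp_act \<gamma> CInf) = cusp_act \<gamma> CInf" by (auto simp: stab_def)
  then have "imult (iinv \<gamma>) (imult g \<gamma>) \<in> upper_tri" using cusp_act_iff_lower_left[OF assms] by blast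
  moreover have "g = imult \<gamma> (imult (imult (iinv \<gamma>) (imult g \<gamma>)) (iinv \<gamma>))"
    using assms by (simp add: imult_assoc imult_iinv imult_iinv_left)
  ultimately show "g \<in> (\<lambda>u. imult \<gamma> (imult u (iinv \<gamma>))) ` upper_tri" by blast
next
  fix g assume "g \<in> (\<lambda>u. imult \<gamma> (imult u (iinv \<gamma>))) ` upper_tri"
  then obtain u where u: "u \<in> upper_tri" "g = imult \<gamma> (imult u (iinv \<gamma>))" by blast
  then have "g \<in> SL2Z" using assms by (auto simp: upper_tri_def intro!: SL2Z_closed)
  moreover have "imult (iinv \<gamma>) (imult g \<gamma>) = u"
    using assms u by (simp add: imult_assoc imult_iinv imult_iinv_left)
  ultimately show "g \<in> stab (cusp_act \<gamma> CInf)"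
    using u cusp_act_iff_lower_left[OF assms, of g] by (simp add: stab_def)
qed

lemma rcoset_i_eq_iff:
  assumes "finite_index_subgroup \<Gamma>" "g \<in> SL2Z" "h \<in> SL2Z"
  shows "rcoset_i \<Gamma> g = rcoset_i \<Gamma> h \<longleftrightarrow> imult g (iinv h) \<in> \<Gamma>"
proof
  have \<Gamma>: "\<Gamma> \<subseteq> SL2Z" "iid \<in> \<Gamma>" "\<And>g h. g \<in> \<Gamma> \<Longrightarrow> h \<in> \<Gamma> \<Longrightarrow> imult g h \<in> \<Gamma>" "\<And>g. g \<in> \<Gamma> \<Longrightarrow> iinv g \<in> \<Gamma>"
    using assms(1) by (auto simp: finite_index_subgroup_def)
  {
    assume "rcoset_i \<Gamma> g = rcoset_i \<Gamma> h"
    moreover have "g \<in> rcoset_i \<Gamma> g" using \<Gamma>(2) by (auto simp: rcoset_i_def intro!: exI[of _ iid])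
    ultimately obtain k where k: "k \<in> \<Gamma>" "g = imult k h" by (auto simp: rcoset_i_def)
    then show "imult g (iinv h) \<in> \<Gamma>" using assms by (simp add: imult_assoc imult_iinv)
  next
    assume k: "imult g (iinv h) \<in> \<Gamma>"
    define k where "k = imult g (iinv h)"
    have kS: "k \<in> SL2Z" "k \<in> \<Gamma>" using k \<Gamma> by (auto simp: k_def)
    have g: "g = imult k h" using assms by (simp add: k_def imult_assoc imult_iinv)
    have h: "h = imult (iinv k) g" unfolding g using kS by (simp add: imult_iinv_left)
    show "rcoset_i \<Gamma> g = rcoset_i \<Gamma> h"
    proof (intro equalityI subsetI)
      fix x assume "x \<in> rcoset_i \<Gamma> g"
      then obtain l where "l \<in> \<Gamma>" "x = imult l g" by (auto simp: rcoset_i_def)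
      then have "imult l k \<in> \<Gamma>" "x = imult (imult l k) h" using kS \<Gamma> g by (auto simp: imult_assoc)
      then show "x \<in> rcoset_i \<Gamma> h" by (auto simp: rcoset_i_def)
    next
      fix x assume "x \<in> rcoset_i \<Gamma> h"
      then obtain l where "l \<in> \<Gamma>" "x = imult l h" by (auto simp: rcoset_i_def)
      then have "imult l (iinv k) \<in> \<Gamma>" "x = imult (imult l (iinv k)) g" using kS \<Gamma> h by (auto simp: imult_assoc)
      then show "x \<in> rcoset_i \<Gamma> g" by (auto simp: rcoset_i_def)
    qed
  }
qed

text \<open>Stabilizers of cusps are abelian, so \<open>stab \<a>\<close> modulo \<open>\<Gamma>\<close> is a finite group of order \<open>width \<Gamma> \<a>\<close>
  and the width annihilates it.\<close>

lemma translation_width: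
  assumes fi: "finite_index_subgroup \<Gamma>" and \<gamma>: "\<gamma> \<in> SL2Z"
  defines "w \<equiv> width \<Gamma> (cusp_act \<gamma> CInf)"
  shows "imult \<gamma> (imult (IM 1 (int w) 0 1) (iinv \<gamma>)) \<in> \<Gamma>" "w > 0"
proof -
  have \<Gamma>: "\<Gamma> \<subseteq> SL2Z" "iid \<in> \<Gamma>" "\<And>g h. g \<in> \<Gamma> \<Longrightarrow> h \<in> \<Gamma> \<Longrightarrow> imult g h \<in> \<Gamma>" "\<And>g. g \<in> \<Gamma> \<Longrightarrow> iinv g \<in> \<Gamma>"
    "finite (rcoset_i \<Gamma> ` SL2Z)"
    using fi by (auto simp: finite_index_subgroup_def)
  define c where "c u = imult \<gamma> (imult u (iinv \<gamma>))" for u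
  have c_mult: "c (imult u v) = imult (c u) (c v)" for u v
    using \<gamma> by (simp add: c_def imult_assoc imult_iinv_left)
  have c_S: "c u \<in> SL2Z" if "u \<in> upper_tri" for u using that \<gamma> by (auto simp: c_def upper_tri_def intro!: SL2Z_closed)
  have c_inv: "c (iinv u) = iinv (c u)" if "u \<in> upper_tri" for u
  proof -
    have "imult (c u) (c (iinv u)) = c iid" using that by (simp flip: c_mult) (simp add: upper_tri_def imult_iinv)
    also have "\<dots> = iid" using \<gamma> by (simp add: c_def imult_iinv)
    finally have "imult (iinv (c u)) (imult (c u) (c (iinv u))) = iinv (c u)" by simp
    then show ?thesis using c_S[OF that] by (simp add: imult_iinv_left)
  qed
  have tri: "iid \<in> upper_tri" "\<And>u v. u \<in> upper_tri \<Longrightarrow> v \<in> upper_tri \<Longrightarrow> imult u v \<in> upper_tri"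
    "\<And>u. u \<in> upper_tri \<Longrightarrow> iinv u \<in> upper_tri"
    "\<And>u v. u \<in> upper_tri \<Longrightarrow> v \<in> upper_tri \<Longrightarrow> imult u v = imult v u"
    using upper_tri_closed by blast+
  define U where "U = \<lparr>carrier = upper_tri, monoid.mult = imult, one = iid\<rparr>"
  have Us [simp]: "carrier U = upper_tri" "monoid.mult U = imult" "one U = iid" by (simp_all add: U_def)
  interpret U: comm_group U
  proof (rule comm_groupI)
    fix u assume "u \<in> carrier U"
    then show "\<exists>v\<in>carrier U. v \<otimes>\<^bsub>U\<^esub> u = \<one>\<^bsub>U\<^esub>"
      using tri(3) by (intro bexI[of _ "iinv u"]) (auto simp: upper_tri_def imult_iinv)
  qed (use tri in \<open>auto simp: imult_assoc\<close>)
  \<comment> \<open>The preimage of \<Gamma> under conjugation. Its cosets in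
    \<open>upper_tri\<close> correspond to the \<Gamma>-cosets met by the stabilizer, so the index
    is the width.\<close>
  define H where "H = {u \<in> upper_tri. c u \<in> \<Gamma>}"
  have inv_eq: "inv\<^bsub>U\<^esub> u = iinv u" if "u \<in> upper_tri" for u
    using that tri(3) by (intro U.inv_equality) (auto simp: upper_tri_def imult_iinv)
  have "c iid = iid" using \<gamma> by (simp add: c_def imult_iinv)
  have H: "subgroup H U"
    by (rule subgroup.intro) (use tri \<Gamma> \<open>c iid = iid\<close> in \<open>auto simp: H_def c_mult c_inv inv_eq\<close>)
  interpret Q: comm_group "U Mod H" by (rule U.abelian_FactGroup[OF H])
  interpret N: normal H U using H U.normal_iff_subgroup by blast
  have coset_iff: "H #>\<^bsub>U\<^esub> u = H #>\<^bsub>U\<^esub> v \<longleftrightarrow> rcoset_i \<Gamma> (c u) = rcoset_i \<Gamma> (c v)"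
    if uv: "u \<in> upper_tri" "v \<in> upper_tri" for u v
  proof -
    have "rcoset_i \<Gamma> (c u) = rcoset_i \<Gamma> (c v) \<longleftrightarrow> c (imult u (iinv v)) \<in> \<Gamma>"
      using rcoset_i_eq_iff[OF fi c_S[OF uv(1)] c_S[OF uv(2)]] uv by (simp add: c_mult c_inv)
    also have "\<dots> \<longleftrightarrow> imult u (iinv v) \<in> H" using uv tri by (auto simp: H_def)
    also have "\<dots> \<longleftrightarrow> u \<in> H #>\<^bsub>U\<^esub> v"
    proof -
      have "u \<in> H #>\<^bsub>U\<^esub> v \<longleftrightarrow> (\<exists>h\<in>H. u = imult h v)" by (auto simp: r_coset_def)
      also have "\<dots> \<longleftrightarrow> imult u (iinv v) \<in> H"
      proof
        assume "\<exists>h\<in>H. u = imult h v"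
        then show "imult u (iinv v) \<in> H" using uv by (auto simp: imult_assoc imult_iinv upper_tri_def)
      next
        assume "imult u (iinv v) \<in> H"
        moreover have "u = imult (imult u (iinv v)) v" using uv by (simp add: imult_assoc imult_iinv upper_tri_def)
        ultimately show "\<exists>h\<in>H. u = imult h v" by blast
      qed
      finally show ?thesis ..
    qed
    also have "\<dots> \<longleftrightarrow> H #>\<^bsub>U\<^esub> u = H #>\<^bsub>U\<^esub> v"
      using U.repr_independence[OF _ _ H, of u v] U.rcos_self[OF _ H, of u] uv by auto
    finally show ?thesis ..
  qed
  have carrier: "carrier (U Mod H) = (\<lambda>u. H #>\<^bsub>U\<^esub> u) ` upper_tri"
    by (auto simp: FactGroup_def RCOSETS_def)
  have img: "rcoset_i \<Gamma> ` stab (cusp_act \<gamma> CInf) = (\<lambda>u. rcoset_i \<Gamma> (c u)) ` upper_tri"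
    unfolding stab_eq[OF \<gamma>] c_def by auto
  have fin: "finite ((\<lambda>u. rcoset_i \<Gamma> (c u)) ` upper_tri)"
    using c_S by (intro finite_subset[OF _ \<Gamma>(5)]) auto
  define F where "F x = rcoset_i \<Gamma> (c (SOME u. u \<in> upper_tri \<and> x = H #>\<^bsub>U\<^esub> u))" for x
  have F: "F (H #>\<^bsub>U\<^esub> u) = rcoset_i \<Gamma> (c u)" if u: "u \<in> upper_tri" for u
  proof -
    have "\<exists>v. v \<in> upper_tri \<and> H #>\<^bsub>U\<^esub> u = H #>\<^bsub>U\<^esub> v" using u by blast
    from someI_ex[OF this] show ?thesis
      unfolding F_def using coset_iff[OF u] by blast
  qed
  have bij: "bij_betw F (carrier (U Mod H)) ((\<lambda>u. rcoset_i \<Gamma> (c u)) ` upper_tri)"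
    unfolding bij_betw_def inj_on_def carrier using F coset_iff by (auto simp: image_image)
  have cardw: "card (carrier (U Mod H)) = w"
    unfolding w_def width_def img by (rule bij_betw_same_card[OF bij])
  have finQ: "finite (carrier (U Mod H))" using bij_betw_finite[OF bij] fin by blast
  show "w > 0" unfolding cardw[symmetric] using finQ Q.one_closed by (auto simp: card_gt_0_iff)
  define T where "T = IM 1 1 0 1"
  have T: "T \<in> upper_tri" by (simp add: T_def upper_tri_def SL2Z_def)
  have Tpow: "T [^]\<^bsub>U\<^esub> n = IM 1 (int n) 0 1" for n :: nat
    by (induction n) (simp_all add: nat_pow_def T_def iid_def)
  have hom: "(\<lambda>a. H #>\<^bsub>U\<^esub> a) \<in> hom U (U Mod H)" by (rule N.r_coset_hom_Mod)
  have pow: "H #>\<^bsub>U\<^esub> (T [^]\<^bsub>U\<^esub> n) = (H #>\<^bsub>U\<^esub> T) [^]\<^bsub>U Mod H\<^esub> n" for n :: nat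
  proof (induction n)
    case 0
    then show ?case by (simp add: FactGroup_def U.coset_mult_one[unfolded Us] N.subset[unfolded Us])
  next
    case (Suc n)
    have "H #>\<^bsub>U\<^esub> (T [^]\<^bsub>U\<^esub> n \<otimes>\<^bsub>U\<^esub> T) = (H #>\<^bsub>U\<^esub> (T [^]\<^bsub>U\<^esub> n)) \<otimes>\<^bsub>U Mod H\<^esub> (H #>\<^bsub>U\<^esub> T)"
      using hom_mult[OF hom] T U.nat_pow_closed[of T n] by simp
    then show ?case using Suc by simp
  qed
  have "H #>\<^bsub>U\<^esub> T \<in> carrier (U Mod H)" unfolding carrier using T by blast
  \<comment> \<open>The order of the finite quotient kills the class of the translation by 1, so the
    translation by w lies in H.\<close>
  from Q.power_order_eq_one[OF finQ this] have "H #>\<^bsub>U\<^esub> (T [^]\<^bsub>U\<^esub> w) = H"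
    unfolding pow cardw by (simp add: FactGroup_def)
  then have "T [^]\<^bsub>U\<^esub> w \<in> H" using U.rcos_self[OF _ H, of "T [^]\<^bsub>U\<^esub> w"] T U.nat_pow_closed[of T w] by auto
  then show "imult \<gamma> (imult (IM 1 (int w) 0 1) (iinv \<gamma>)) \<in> \<Gamma>"
    unfolding Tpow by (simp add: H_def c_def)
qed

subsection \<open>Growth of modular forms\<close>

text \<open>After division by the character with multiplier \<zeta> the function has period 1 and
  descends to the punctured unit disc. Polynomial growth in one vertical strip makes the singularity
  at 0 removable, and the power series there is the expansion.\<close>

lemma q_expansion_exists:
  assumes g: "g holomorphic_on upper_half" and \<zeta>: "norm \<zeta> = 1"
    and per: "\<And>z. z \<in> upper_half \<Longrightarrow> g (z + 1) = \<zeta> * g z"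
    and growth: "\<And>z. \<bar>Re z\<bar> \<le> 1/2 \<Longrightarrow> Im z \<ge> Y \<Longrightarrow> norm (g z) \<le> C * Im z powr k"
    and "Y \<ge> 0" "k \<ge> 0"
  shows "\<exists>\<kappa> a. has_fexp g \<kappa> a"
proof -
  \<comment> \<open>The argument is taken in [0, 2 pi), which is the normalisation 0 <= \<kappa> <
    1.\<close>
  define \<kappa> where "\<kappa> = Arg2pi \<zeta> / (2 * pi)"
  have \<kappa>: "0 \<le> \<kappa>" "\<kappa> < 1" using Arg2pi_ge_0[of \<zeta>] Arg2pi_lt_2pi[of \<zeta>] by (auto simp: \<kappa>_def)
  have l\<kappa>: "\<zeta> = qchar \<kappa> 1"
    using Arg2pi[of \<zeta>] \<zeta> by (simp add: is_Arg_def \<kappa>_def qchar_def mult_ac)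
  define \<phi> where "\<phi> z = g z * qchar (- \<kappa>) z" for z
  have \<phi>1: "\<phi> (z + 1) = \<phi> z" if z: "z \<in> upper_half" for z
  proof -
    have "\<zeta> * qchar (- \<kappa>) 1 = 1" unfolding l\<kappa> by (simp flip: qchar_add_left)
    then show ?thesis unfolding \<phi>_def per[OF z] qchar_add by (simp add: mult_ac)
  qed
  have \<phi>nat: "\<phi> (z + of_nat n) = \<phi> z" if z: "z \<in> upper_half" for z n
  proof (induction n)
    case (Suc n)
    have "z + of_nat n \<in> upper_half" using z by (simp add: upper_half_def)
    from \<phi>1[OF this] Suc show ?case by (simp add: add_ac)
  qed simp
  have \<phi>int: "\<phi> (z + of_int n) = \<phi> z" if z: "z \<in> upper_half" for z n
  proof (cases "n \<ge> 0")
    case True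
    then show ?thesis using \<phi>nat[OF z, of "nat n"] by simp
  next
    case False
    have "z + of_int n \<in> upper_half" using z by (simp add: upper_half_def)
    from \<phi>nat[OF this, of "nat (- n)"] show ?thesis using False by simp
  qed
  define H where "H q = \<phi> (Ln q / (2 * of_real pi * \<i>))" for q
  have H: "H (qchar 1 z) = \<phi> z" if z: "z \<in> upper_half" for z
  proof -
    have q0: "qchar 1 z \<noteq> 0" by (simp add: qchar_def)
    have "exp (Ln (qchar 1 z)) = exp (2 * of_real pi * \<i> * z)" using q0 by (simp add: qchar_def)
    then obtain n :: int where "Ln (qchar 1 z) = 2 * of_real pi * \<i> * z + of_int (2 * n) * of_real pi * \<i>"
      unfolding exp_eq by (auto simp: algebra_simps)
    then have "Ln (qchar 1 z) / (2 * of_real pi * \<i>) = z + of_int n" by (simp add: field_simps)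
    then show ?thesis using \<phi>int[OF z] by (simp add: H_def)
  qed
  have \<phi>hol: "\<phi> holomorphic_on upper_half"
    unfolding \<phi>_def qchar_def by (intro holomorphic_intros g)
  have Hhol: "H holomorphic_on ball 0 1 - {0}"
    unfolding holomorphic_on_def
  proof
    fix q0 :: complex assume q0: "q0 \<in> ball 0 1 - {0}"
    define V where "V = ball q0 (norm q0) \<inter> ball 0 1"
    have V: "open V" "q0 \<in> V" using q0 by (auto simp: V_def)
    \<comment> \<open>A branch of the logarithm centred at q0: Re (q/q0) > 0 on V, so the cut of
      \<open>Ln\<close> is never met, even for negative q0. Periodicity makes the choice of branch
      irrelevant.\<close>
    define el where "el q = (Ln (q / q0) + Ln q0) / (2 * of_real pi * \<i>)" for q
    have right: "Re (q / q0) > 0" "q \<noteq> 0" if q: "q \<in> V" for q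
    proof -
      have d: "norm (q - q0) < norm q0" using q by (simp add: V_def dist_norm norm_minus_commute)
      have "q / q0 - 1 = (q - q0) / q0" using q0 by (simp add: diff_divide_distrib)
      then have "norm (q / q0 - 1) < 1" using d q0 by (simp add: norm_divide)
      then show "Re (q / q0) > 0" using abs_Re_le_cmod[of "q / q0 - 1"] by simp
      then show "q \<noteq> 0" by auto
    qed
    have elq: "qchar 1 (el q) = q" if q: "q \<in> V" for q
    proof -
      have "qchar 1 (el q) = exp (Ln (q / q0) + Ln q0)" by (simp add: qchar_def el_def)
      also have "\<dots> = q" using right[OF q] q0 by (simp add: exp_add)
      finally show ?thesis .
    qed
    have elup: "el q \<in> upper_half" if q: "q \<in> V" for q
    proof -
      have "exp (- (2 * pi * 1 * Im (el q))) < 1" using elq[OF q] norm_qchar[of 1 "el q"] q by (simp add: V_def)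
      then show ?thesis by (simp add: upper_half_def zero_less_mult_iff)
    qed
    have "(\<phi> \<circ> el) holomorphic_on V"
    proof (rule holomorphic_on_compose_gen[OF _ \<phi>hol])
      show "el holomorphic_on V" unfolding el_def[abs_def]
        using q0 right by (intro holomorphic_intros) (auto simp: complex_nonpos_Reals_iff dest!: right(1))
      show "el ` V \<subseteq> upper_half" using elup by blast
    qed
    moreover have "(\<phi> \<circ> el) q = H q" if "q \<in> V" for q using H[OF elup[OF that]] elq[OF that] by simp
    ultimately have "H holomorphic_on V" by (rule holomorphic_transform)
    then have "H field_differentiable at q0" using V by (simp add: holomorphic_on_imp_differentiable_at)
    then show "H field_differentiable at q0 within ball 0 1 - {0}" by (rule field_differentiable_at_within)
  qed
  \<comment> \<open>The twist by -\<kappa> contributes |q|^(-\<kappa>). Half of the remaining room 1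
    - \<kappa> absorbs the polynomial growth, and |q|^((1-\<kappa>)/2) is left over in |q
    H(q)|.\<close>
  obtain C2 where C2: "C2 > 0" "\<And>t. t \<ge> 0 \<Longrightarrow> (1 + t) powr k \<le> C2 * exp (pi * (1 - \<kappa>) * t)"
    using bounded_powr_exp[OF \<open>k \<ge> 0\<close>, of "pi * (1 - \<kappa>)"] \<kappa> by auto
  have lim: "(\<lambda>q. q * H q) \<midarrow>0\<rightarrow> 0"
  proof -
    have "\<forall>\<^sub>F q in at 0. norm (q * H q) \<le> (\<bar>C\<bar> * C2) * norm q powr ((1 - \<kappa>) / 2)"
      unfolding eventually_at
    proof (intro exI[of _ "exp (- (2 * pi * Y))"] conjI ballI impI)
      fix q :: complex assume "q \<noteq> 0 \<and> dist q 0 < exp (- (2 * pi * Y))"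
      then have q: "q \<noteq> 0" "norm q < exp (- (2 * pi * Y))" by auto
      define z where "z = Ln q / (2 * of_real pi * \<i>)"
      have "\<bar>Im (Ln q)\<bar> \<le> pi" using mpi_less_Im_Ln[of q] Im_Ln_le_pi[of q] q by auto
      then have Re: "\<bar>Re z\<bar> \<le> 1/2" by (simp add: z_def Re_divide Im_divide power2_eq_square field_simps)
      have qz: "qchar 1 z = q" using q by (simp add: qchar_def z_def)
      then have nq: "norm q = exp (- (2 * pi * Im z))" using norm_qchar[of 1 z] by simp
      then have Im: "Im z > Y" using q by simp
      have "norm (H q) = norm (g z) * exp (2 * pi * \<kappa> * Im z)"
        by (simp add: H_def \<phi>_def norm_mult norm_qchar z_def[symmetric])
      also have "\<dots> \<le> (\<bar>C\<bar> * (C2 * exp (pi * (1 - \<kappa>) * Im z))) * exp (2 * pi * \<kappa> * Im z)"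
      proof (rule mult_right_mono)
        have "Im z powr k \<le> (1 + Im z) powr k" using Im \<open>Y \<ge> 0\<close> \<open>k \<ge> 0\<close> by (intro powr_mono2) auto
        also have "\<dots> \<le> C2 * exp (pi * (1 - \<kappa>) * Im z)" using Im \<open>Y \<ge> 0\<close> by (intro C2(2)) auto
        finally have p: "Im z powr k \<le> C2 * exp (pi * (1 - \<kappa>) * Im z)" .
        have "norm (g z) \<le> C * Im z powr k" using Re Im by (intro growth) auto
        also have "\<dots> \<le> \<bar>C\<bar> * Im z powr k" by (intro mult_right_mono) auto
        also have "\<dots> \<le> \<bar>C\<bar> * (C2 * exp (pi * (1 - \<kappa>) * Im z))" by (intro mult_left_mono p) auto
        finally show "norm (g z) \<le> \<bar>C\<bar> * (C2 * exp (pi * (1 - \<kappa>) * Im z))" .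
      qed simp
      finally have "norm (H q) \<le> \<bar>C\<bar> * (C2 * exp (pi * (1 - \<kappa>) * Im z)) * exp (2 * pi * \<kappa> * Im z)" .
      then have "norm (q * H q) \<le> exp (- (2 * pi * Im z)) * (\<bar>C\<bar> * (C2 * exp (pi * (1 - \<kappa>) * Im z)) * exp (2 * pi * \<kappa> * Im z))"
        unfolding norm_mult nq by (intro mult_left_mono) auto
      also have "\<dots> = (\<bar>C\<bar> * C2) * (exp (- (2 * pi * Im z)) * exp (pi * (1 - \<kappa>) * Im z) * exp (2 * pi * \<kappa> * Im z))" by (simp only: mult_ac)
      also have "exp (- (2 * pi * Im z)) * exp (pi * (1 - \<kappa>) * Im z) * exp (2 * pi * \<kappa> * Im z) = exp (- (2 * pi * Im z) * ((1 - \<kappa>) / 2))"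
        unfolding exp_add[symmetric] by (rule arg_cong[where f = exp]) (simp add: field_simps)
      also have "\<dots> = norm q powr ((1 - \<kappa>) / 2)" unfolding nq by (simp add: powr_def mult.commute)
      finally show "norm (q * H q) \<le> (\<bar>C\<bar> * C2) * norm q powr ((1 - \<kappa>) / 2)" .
    qed auto
    moreover have "((\<lambda>q::complex. (\<bar>C\<bar> * C2) * norm q powr ((1 - \<kappa>) / 2)) \<longlongrightarrow> 0) (at 0)"
    proof (rule tendsto_mult_right_zero, rule tendsto_zero_powrI)
      show "((\<lambda>q::complex. norm q) \<longlongrightarrow> 0) (at 0)" by (rule tendsto_norm_zero) (rule tendsto_ident_at)
      show "((\<lambda>q::complex. (1 - \<kappa>) / 2) \<longlongrightarrow> (1 - \<kappa>) / 2) (at 0)" by (rule tendsto_const)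
    qed (use \<kappa> in auto)
    ultimately show ?thesis by (rule Lim_null_comparison)
  qed
  \<comment> \<open>It is q H(q) that tends to 0 and extends holomorphically; the quotient by q then
    extends H itself.\<close>
  define k1 where "k1 q = (if q = 0 then 0 else q * H q)" for q
  have k1: "k1 holomorphic_on ball 0 1"
    unfolding k1_def by (rule removable_singularity[OF _ _ lim]) (auto intro!: holomorphic_intros Hhol)
  define H1 where "H1 q = (if q = 0 then deriv k1 0 else (k1 q - k1 0) / (q - 0))" for q
  have H1: "H1 holomorphic_on ball 0 1"
    unfolding H1_def[abs_def] by (rule pole_lemma_open[OF k1]) auto
  have H1H: "H1 q = H q" if "q \<noteq> 0" for q using that by (simp add: H1_def k1_def)
  define a where "a n = (deriv ^^ n) H1 0 / fact n" for n
  have "has_fexp g \<kappa> a"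
    unfolding has_fexp_def
  proof (intro conjI ballI \<kappa>)
    fix z assume z: "z \<in> upper_half"
    have "qchar 1 z \<in> ball 0 1" using z norm_qchar[of 1 z] by (simp add: upper_half_def)
    from holomorphic_power_series[OF H1 this]
    have "(\<lambda>n. a n * qchar 1 z ^ n) sums H1 (qchar 1 z)" by (simp add: a_def)
    moreover have "H1 (qchar 1 z) = \<phi> z" using H1H[of "qchar 1 z"] H[OF z] by (simp add: qchar_def)
    ultimately have "(\<lambda>n. a n * qchar 1 z ^ n * qchar \<kappa> z) sums (\<phi> z * qchar \<kappa> z)" by (intro sums_mult2) simp
    moreover have "\<phi> z * qchar \<kappa> z = g z" by (simp add: \<phi>_def mult.assoc flip: qchar_add_left)
    moreover have "a n * qchar 1 z ^ n * qchar \<kappa> z = a n * exp (2 * of_real pi * \<i> * of_real (real n + \<kappa>) * z)" for n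
      unfolding qchar_def[symmetric] qchar_add_left qchar_of_nat by simp
    ultimately show "(\<lambda>n. a n * exp (2 * of_real pi * \<i> * of_real (real n + \<kappa>) * z)) sums g z" by simp
  qed
  then show ?thesis by blast
qed

lemma has_fexp_sums:
  "has_fexp g \<kappa> a \<Longrightarrow> z \<in> upper_half \<Longrightarrow> (\<lambda>n. a n * qchar (real n + \<kappa>) z) sums g z"
  by (simp add: has_fexp_def qchar_def)

lemma has_fexp_bounded:
  assumes "has_fexp g \<kappa> a" "\<epsilon> > 0"
  shows "\<exists>C. \<forall>z. Im z \<ge> \<epsilon> \<longrightarrow> norm (g z) \<le> C"
proof (intro exI allI impI)
  have \<kappa>: "\<kappa> \<ge> 0" using assms by (simp add: has_fexp_def)
  have sm: "summable (\<lambda>n. norm (a n) * exp (- (2 * pi * (real n + \<kappa>) * \<epsilon>)))"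
    by (rule summable_coeff_of_sums[OF has_fexp_sums[OF assms(1)] assms(2)])
  fix z assume z: "Im z \<ge> \<epsilon>"
  have "g z = (\<Sum>n. a n * qchar (real n + \<kappa>) z)"
    using has_fexp_sums[OF assms(1), of z] z assms(2) by (auto simp: upper_half_def sums_iff)
  also have "norm \<dots> \<le> (\<Sum>n. norm (a n) * exp (- (2 * pi * (real n + \<kappa>) * \<epsilon>)))"
  proof (rule norm_suminf_le[OF _ sm])
    fix n
    have "2 * pi * (real n + \<kappa>) * \<epsilon> \<le> 2 * pi * (real n + \<kappa>) * Im z" using z \<kappa> by (intro mult_left_mono) auto
    then show "norm (a n * qchar (real n + \<kappa>) z) \<le> norm (a n) * exp (- (2 * pi * (real n + \<kappa>) * \<epsilon>))"
      by (simp add: norm_mult norm_qchar mult_left_mono)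
  qed
  finally show "norm (g z) \<le> (\<Sum>n. norm (a n) * exp (- (2 * pi * (real n + \<kappa>) * \<epsilon>)))" .
qed

lemma has_fexp_fourier_exp:
  assumes "has_fexp g \<kappa> a"
  defines "\<kappa>' \<equiv> if \<kappa> > 0 then \<kappa> else 1" and "b \<equiv> if \<kappa> > 0 then a else (\<lambda>n. a (Suc n))"
  shows "fourier_exp \<kappa>' b (\<lambda>z. g z - (if \<kappa> > 0 then 0 else a 0))"
proof (cases "\<kappa> > 0")
  case True
  then show ?thesis using has_fexp_sums[OF assms(1)] by (simp add: fourier_exp_def \<kappa>'_def b_def)
next
  case False
  then have \<kappa>: "\<kappa> = 0" using assms by (simp add: has_fexp_def)
  have "(\<lambda>n. a (Suc n) * qchar (real n + 1) z) sums (g z - a 0)" if "z \<in> upper_half" for z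
  proof -
    have "(\<lambda>n. a n * qchar (real n) z) sums ((g z - a 0) + a 0 * qchar (real 0) z)"
      using has_fexp_sums[OF assms(1) that] unfolding \<kappa> by simp
    then have "(\<lambda>n. a (Suc n) * qchar (real (Suc n)) z) sums (g z - a 0)"
      by (subst sums_Suc_iff)
    then show ?thesis by (simp add: add.commute)
  qed
  then show ?thesis using False by (simp add: fourier_exp_def \<kappa>'_def b_def)
qed

section \<open>The action of matrices on the upper half-plane and the slash operator\<close>

fun jden :: "rmat \<Rightarrow> complex \<Rightarrow> complex" where
  "jden (RM a b c d) z = of_real c * z + of_real d"

lemma jfac_jden: "jfac M r z = jden M z powr of_real r"
  by (cases M) simp

lemma jden_nonzero: "rdet M \<noteq> 0 \<Longrightarrow> z \<in> upper_half \<Longrightarrow> jden M z \<noteq> 0"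
  by (cases M) (auto simp: upper_half_def complex_eq_iff)

lemma Im_moeb: "Im (moeb M z) = rdet M * Im z / (norm (jden M z))\<^sup>2"
  by (cases M) (simp add: Im_divide cmod_power2 algebra_simps)

lemma moeb_upper: "rdet M > 0 \<Longrightarrow> z \<in> upper_half \<Longrightarrow> moeb M z \<in> upper_half"
  using jden_nonzero[of M z] by (auto simp: Im_moeb upper_half_def intro!: divide_pos_pos mult_pos_pos)

text \<open>The factor cz + d is an exact cocycle, while its principal r-th power is one only up to
  a phase; composition is therefore stated for the denominators alone.\<close>

lemma moeb_rmult:
  assumes "jden B z \<noteq> 0"
  shows "jden (rmult A B) z = jden A (moeb B z) * jden B z" "moeb (rmult A B) z = moeb A (moeb B z)"
proof -
  obtain a b c d where A: "A = RM a b c d" by (cases A)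
  obtain a' b' c' d' where B: "B = RM a' b' c' d'" by (cases B)
  define k where "k = of_real c' * z + complex_of_real d'"
  define w where "w = moeb B z"
  have k: "k \<noteq> 0" using assms by (simp add: B k_def)
  have num: "of_real a' * z + of_real b' = w * k" using k by (simp add: w_def B k_def)
  have 1: "of_real (c * a' + d * c') * z + of_real (c * b' + d * d') = (of_real c * w + of_real d) * k"
  proof -
    have "of_real (c * a' + d * c') * z + of_real (c * b' + d * d') =
        of_real c * (of_real a' * z + of_real b') + of_real d * (of_real c' * z + complex_of_real d')"
      by (simp add: algebra_simps)
    also have "\<dots> = of_real c * (w * k) + of_real d * k" unfolding num k_def ..
    also have "\<dots> = (of_real c * w + of_real d) * k" by (simp add: algebra_simps)
    finally show ?thesis .
  qed
  have 2: "of_real (a * a' + b * c') * z + of_real (a * b' + b * d') = (of_real a * w + of_real b) * k"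
  proof -
    have "of_real (a * a' + b * c') * z + of_real (a * b' + b * d') =
        of_real a * (of_real a' * z + of_real b') + of_real b * (of_real c' * z + complex_of_real d')"
      by (simp add: algebra_simps)
    also have "\<dots> = of_real a * (w * k) + of_real b * k" unfolding num k_def ..
    also have "\<dots> = (of_real a * w + of_real b) * k" by (simp add: algebra_simps)
    finally show ?thesis .
  qed
  show "jden (rmult A B) z = jden A (moeb B z) * jden B z"
    unfolding w_def[symmetric] using 1 by (simp add: A B k_def)
  have "moeb (rmult A B) z = ((of_real a * w + of_real b) * k) / ((of_real c * w + of_real d) * k)"
    unfolding A B rmult.simps moeb.simps 1 2 ..
  then show "moeb (rmult A B) z = moeb A (moeb B z)"
    unfolding w_def[symmetric] using k by (simp add: A)
qed

lemma rdet_rmult: "rdet (rmult A B) = rdet A * rdet B"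
  by (cases A; cases B) (simp add: algebra_simps)

lemma rmult_assoc: "rmult (rmult A B) C = rmult A (rmult B C)"
  by (cases A; cases B; cases C) (simp add: algebra_simps)

lemma of_imat_imult: "of_imat (imult g h) = rmult (of_imat g) (of_imat h)"
  by (cases g; cases h) simp

lemma rdet_of_imat: "rdet (of_imat g) = of_int (idet g)"
  by (cases g) simp

lemma rdet_eta: "m > 0 \<Longrightarrow> rdet (eta m) = 1"
  by (simp add: eta_def)

lemma moeb_eta: "m > 0 \<Longrightarrow> moeb (eta m) z = of_nat m * z"
  by (simp add: eta_def flip: of_real_mult)

lemma jfac_holomorphic:
  assumes "rdet M \<noteq> 0"
  shows "(\<lambda>z. jfac M r z) holomorphic_on upper_half"
proof -
  obtain a b c d where M: "M = RM a b c d" by (cases M)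
  show ?thesis
  proof (cases "c = 0")
    case False
    then show ?thesis unfolding M jfac.simps
      by (intro holomorphic_intros) (auto simp: upper_half_def complex_nonpos_Reals_iff)
  qed (simp add: M)
qed

lemma moeb_holomorphic:
  assumes "rdet M \<noteq> 0"
  shows "moeb M holomorphic_on upper_half"
proof -
  obtain a b c d where M: "M = RM a b c d" by (cases M)
  show ?thesis
    unfolding M moeb.simps[abs_def] using jden_nonzero[OF assms] by (intro holomorphic_intros) (auto simp: M)
qed

lemma norm_slash:
  "rdet M = 1 \<Longrightarrow> norm (slash r f M z) = norm (f (moeb M z)) * norm (jden M z) powr (- r)"
  by (simp add: slash_def jfac_jden norm_mult norm_divide norm_powr_real_powr' powr_minus_divide)

text \<open>The height is divided by |cz + d|^2 and the slash operator divides by (cz + d)^r, so in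
  |f| y^(r/2) the two effects cancel and no branch is involved.\<close>

lemma norm_slash_times:
  assumes "rdet M = 1" "z \<in> upper_half"
  shows "norm (slash r f M z) * Im z powr (r / 2) = norm (f (moeb M z)) * Im (moeb M z) powr (r / 2)"
proof -
  have j: "norm (jden M z) > 0" using jden_nonzero[of M z] assms by simp
  have y: "Im z > 0" using assms by (simp add: upper_half_def)
  have "(norm (jden M z))\<^sup>2 = norm (jden M z) powr 2" using j by simp
  then have "((norm (jden M z))\<^sup>2) powr (r / 2) = norm (jden M z) powr r" by (simp only: powr_powr) simp
  then have "Im (moeb M z) powr (r / 2) = Im z powr (r / 2) * norm (jden M z) powr (- r)"
    using j y assms(1) by (simp add: Im_moeb powr_divide powr_minus_divide)
  then show ?thesis unfolding norm_slash[OF assms(1)] by simp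
qed

section \<open>Modular forms: expansions at the cusps and the growth exponent\<close>

locale modular =
  fixes \<Gamma> :: "imat set" and r :: real and \<mu> :: "imat \<Rightarrow> complex" and f :: "complex \<Rightarrow> complex"
  assumes fi: "finite_index_subgroup \<Gamma>" and r: "r > 0" and mf: "modular_form \<Gamma> r \<mu> f"
begin

lemma \<Gamma>: "\<Gamma> \<subseteq> SL2Z" "iid \<in> \<Gamma>" "\<And>g h. g \<in> \<Gamma> \<Longrightarrow> h \<in> \<Gamma> \<Longrightarrow> imult g h \<in> \<Gamma>" "\<And>g. g \<in> \<Gamma> \<Longrightarrow> iinv g \<in> \<Gamma>"
    "finite (rcoset_i \<Gamma> ` SL2Z)"
  using fi by (auto simp: finite_index_subgroup_def)

lemma f_holomorphic: "f holomorphic_on upper_half"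
  and norm_\<mu>: "\<And>\<gamma>. \<gamma> \<in> \<Gamma> \<Longrightarrow> norm (\<mu> \<gamma>) = 1"
  and f_moeb: "\<And>\<gamma> z. \<gamma> \<in> \<Gamma> \<Longrightarrow> z \<in> upper_half \<Longrightarrow> f (moeb (of_imat \<gamma>) z) = \<mu> \<gamma> * jfac (of_imat \<gamma>) r z * f z"
  using mf by (auto simp: modular_form_def)

lemma rdet_SL2Z: "g \<in> SL2Z \<Longrightarrow> rdet (of_imat g) = 1"
  by (simp add: rdet_of_imat SL2Z_def)

text \<open>\<open>Phi\<close> is \<open>\<Gamma>\<close>-invariant, so its growth is controlled by the finitely many cosets of \<open>\<Gamma>\<close> and the cusp expansions.\<close>

definition Phi :: "complex \<Rightarrow> real" where
  "Phi z = norm (f z) * Im z powr (r / 2)"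

lemma Phi_invariant:
  assumes "g \<in> \<Gamma>" "z \<in> upper_half"
  shows "Phi (moeb (of_imat g) z) = Phi z"
proof -
  have d: "rdet (of_imat g) = 1" using assms \<Gamma> rdet_SL2Z by blast
  have j: "norm (jden (of_imat g) z) > 0" using jden_nonzero[of "of_imat g" z] assms d by simp
  have "norm (slash r f (of_imat g) z) = norm (f z)"
    unfolding norm_slash[OF d] f_moeb[OF assms] using norm_\<mu>[OF assms(1)] j
    by (simp add: norm_mult jfac_jden norm_powr_real_powr' powr_minus field_simps)
  then show ?thesis using norm_slash_times[OF d assms(2), of r f] by (simp add: Phi_def)
qed

lemma slash_holomorphic:
  assumes "rdet M = 1"
  shows "slash r f M holomorphic_on upper_half"
proof -
  have "(f \<circ> moeb M) holomorphic_on upper_half"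
    by (rule holomorphic_on_compose_gen[OF moeb_holomorphic f_holomorphic]) (use assms moeb_upper in auto)
  moreover have "jfac M r z \<noteq> 0" if "z \<in> upper_half" for z
    using jden_nonzero[of M z] that assms by (simp add: jfac_jden)
  ultimately show ?thesis
    unfolding slash_def[abs_def] comp_def by (intro holomorphic_intros jfac_holomorphic) (use assms in auto)
qed

text \<open>The element h of \<Gamma> translates by the width in the coordinate of \<gamma>;
  conjugation by \<open>eta m\<close> rescales this to the translation by 1.\<close>

lemma scaling_matrixE:
  assumes "scaling_matrix \<Gamma> \<a> \<tau>"
  obtains \<gamma> m h where "\<gamma> \<in> SL2Z" "m > 0" "\<tau> = rmult (of_imat \<gamma>) (eta m)" "rdet \<tau> = 1" "\<a> = cusp_act \<gamma> CInf" "bottom_ok \<gamma>"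
    "h \<in> \<Gamma>" "rmult (of_imat h) \<tau> = rmult \<tau> (RM 1 1 0 1)"
proof -
  obtain \<gamma> where \<gamma>: "\<gamma> \<in> SL2Z" "cusp_act \<gamma> CInf = \<a>" "bottom_ok \<gamma>" "\<tau> = rmult (of_imat \<gamma>) (eta (width \<Gamma> \<a>))"
    using assms by (auto simp: scaling_matrix_def)
  define m where "m = width \<Gamma> \<a>"
  define h where "h = imult \<gamma> (imult (IM 1 (int m) 0 1) (iinv \<gamma>))"
  have h: "h \<in> \<Gamma>" "m > 0" using translation_width[OF fi \<gamma>(1)] by (auto simp: h_def m_def \<gamma>(2))
  have "imult h \<gamma> = imult \<gamma> (IM 1 (int m) 0 1)" using \<gamma>(1) by (simp add: h_def imult_assoc imult_iinv)
  then have "rmult (of_imat h) (of_imat \<gamma>) = rmult (of_imat \<gamma>) (RM 1 (real m) 0 1)"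
    by (simp flip: of_imat_imult) (simp add: of_imat_imult)
  then have "rmult (of_imat h) \<tau> = rmult (of_imat \<gamma>) (rmult (RM 1 (real m) 0 1) (eta m))"
    unfolding \<gamma>(4) m_def[symmetric] by (simp flip: rmult_assoc)
  also have "rmult (RM 1 (real m) 0 1) (eta m) = rmult (eta m) (RM 1 1 0 1)"
    using h(2) by (simp add: eta_def real_div_sqrt)
  finally have "rmult (of_imat h) \<tau> = rmult \<tau> (RM 1 1 0 1)" unfolding \<gamma>(4) m_def by (simp add: rmult_assoc)
  moreover have "rdet \<tau> = 1" unfolding \<gamma>(4) m_def[symmetric] using \<gamma>(1) h(2) by (simp add: rdet_rmult rdet_SL2Z rdet_eta)
  ultimately show ?thesis using that \<gamma> h m_def by auto
qed

text \<open>The ratio of automorphy factors is holomorphic and of modulus 1, hence constant by the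
  maximum modulus principle. This replaces any case analysis of the principal powers.\<close>

lemma slash_periodic:
  assumes "scaling_matrix \<Gamma> \<a> \<tau>"
  obtains \<zeta> where "norm \<zeta> = 1" "\<And>z. z \<in> upper_half \<Longrightarrow> slash r f \<tau> (z + 1) = \<zeta> * slash r f \<tau> z"
proof -
  obtain h where h: "h \<in> \<Gamma>" and \<tau>: "rdet \<tau> = 1" and ht: "rmult (of_imat h) \<tau> = rmult \<tau> (RM 1 1 0 1)"
    using scaling_matrixE[OF assms] by metis
  have dh: "rdet (of_imat h) = 1" using h \<Gamma> rdet_SL2Z by blast
  have up: "moeb \<tau> z \<in> upper_half" if "z \<in> upper_half" for z using moeb_upper[of \<tau> z] \<tau> that by simp
  have jn: "jden \<tau> z \<noteq> 0" if "z \<in> upper_half" for z using jden_nonzero[of \<tau> z] \<tau> that by simp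
  have up1: "z + 1 \<in> upper_half" if "z \<in> upper_half" for z using that by (simp add: upper_half_def)
  have shift: "moeb \<tau> (z + 1) = moeb (of_imat h) (moeb \<tau> z)" "jden \<tau> (z + 1) = jden (of_imat h) (moeb \<tau> z) * jden \<tau> z"
    if z: "z \<in> upper_half" for z
    using moeb_rmult[OF jn[OF z], of "of_imat h"] moeb_rmult[of "RM 1 1 0 1" z \<tau>] by (simp_all add: ht)
  define L where "L z = \<mu> h * jfac (of_imat h) r (moeb \<tau> z) * jfac \<tau> r z / jfac \<tau> r (z + 1)" for z
  have L: "slash r f \<tau> (z + 1) = L z * slash r f \<tau> z" if z: "z \<in> upper_half" for z
    using jn[OF z] jn[OF up1[OF z]] unfolding slash_def L_def shift(1)[OF z] f_moeb[OF h up[OF z]] by (simp add: jfac_jden)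
  have normL: "norm (L z) = 1" if z: "z \<in> upper_half" for z
  proof -
    have "jden (of_imat h) (moeb \<tau> z) \<noteq> 0" using jden_nonzero[of "of_imat h" "moeb \<tau> z"] dh up[OF z] by simp
    then show ?thesis unfolding L_def jfac_jden shift(2)[OF z] using norm_\<mu>[OF h] jn[OF z]
      by (simp add: norm_mult norm_divide norm_powr_real_powr' powr_mult)
  qed
  have Lhol: "L holomorphic_on upper_half"
  proof -
    have "((\<lambda>w. jfac (of_imat h) r w) \<circ> moeb \<tau>) holomorphic_on upper_half"
      by (rule holomorphic_on_compose_gen[OF moeb_holomorphic jfac_holomorphic]) (use \<tau> dh up in auto)
    moreover have "((\<lambda>w. jfac \<tau> r w) \<circ> (\<lambda>z. z + 1)) holomorphic_on upper_half"
      by (rule holomorphic_on_compose_gen[OF _ jfac_holomorphic]) (use \<tau> up1 in \<open>auto intro!: holomorphic_intros\<close>)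
    moreover have "jfac \<tau> r (z + 1) \<noteq> 0" if "z \<in> upper_half" for z using jn[OF up1[OF that]] by (simp add: jfac_jden)
    ultimately show ?thesis
      unfolding L_def[abs_def] comp_def by (intro holomorphic_intros jfac_holomorphic) (use \<tau> in auto)
  qed
  have i: "\<i> \<in> upper_half" by (simp add: upper_half_def)
  have "L constant_on upper_half"
    by (rule maximum_modulus_principle[OF Lhol open_upper_half convex_connected[OF convex_upper_half] open_upper_half subset_refl i])
      (simp add: normL i)
  then obtain \<zeta> where "\<And>z. z \<in> upper_half \<Longrightarrow> L z = \<zeta>" by (auto simp: constant_on_def)
  then show ?thesis using that[of \<zeta>] normL[OF i] L i by auto
qed

text \<open>Moderate growth is assumed only near the real axis. A representative with nonzero lower
  left entry sends the neighbourhood of infinity there; if \<gamma> fixes infinity, a parabolic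
  element of \<Gamma> fixing 0 provides one.\<close>

lemma lower_left_nonzero:
  assumes "\<gamma> \<in> SL2Z"
  obtains h a b c d where "h \<in> \<Gamma>" "imult h \<gamma> = IM a b c d" "c \<noteq> 0"
proof -
  obtain A B C D where \<gamma>: "\<gamma> = IM A B C D" by (cases \<gamma>)
  show ?thesis
  proof (cases "C = 0")
    case False
    then show ?thesis using that[of iid] \<gamma> \<Gamma>(2) by simp
  next
    case True
    then have A: "A \<noteq> 0" using assms by (auto simp: \<gamma> SL2Z_def)
    define S where "S = IM 0 (-1) 1 0"
    have "S \<in> SL2Z" by (simp add: S_def SL2Z_def)
    from translation_width[OF fi this] obtain w where w: "imult S (imult (IM 1 (int w) 0 1) (iinv S)) \<in> \<Gamma>" "w > 0" by blast
    have "imult S (imult (IM 1 (int w) 0 1) (iinv S)) = IM 1 0 (- int w) 1" by (simp add: S_def)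
    then have "IM 1 0 (- int w) 1 \<in> \<Gamma>" using w(1) by simp
    moreover have "imult (IM 1 0 (- int w) 1) \<gamma> = IM A B (- int w * A + C) (- int w * B + D)" by (simp add: \<gamma>)
    moreover have "- int w * A + C \<noteq> 0" using A w True by simp
    ultimately show ?thesis using that by blast
  qed
qed

text \<open>High points of the strip are moved by \<open>M\<close> to height comparable to 1/y,
  where the growth assumption on f applies; the invariance of |f| y^(r/2) transfers the estimate
  back.\<close>

lemma slash_polynomial_growth:
  assumes "scaling_matrix \<Gamma> \<a> \<tau>"
  obtains C k Y where "Y \<ge> 0" "k \<ge> 0" "\<And>z. \<bar>Re z\<bar> \<le> 1/2 \<Longrightarrow> Im z \<ge> Y \<Longrightarrow> norm (slash r f \<tau> z) \<le> C * Im z powr k"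
proof -
  obtain \<gamma> m where \<gamma>: "\<gamma> \<in> SL2Z" and m: "m > 0" and \<tau>: "\<tau> = rmult (of_imat \<gamma>) (eta m)" "rdet \<tau> = 1"
    using scaling_matrixE[OF assms] by metis
  obtain C0 k0 where Ck: "\<And>z. 0 < Im z \<Longrightarrow> Im z < 1 \<Longrightarrow> norm (f z) \<le> C0 * Im z powr (- k0)"
    using mf unfolding modular_form_def by blast
  obtain h a b c d where h: "h \<in> \<Gamma>" "imult h \<gamma> = IM a b c d" "c \<noteq> 0" using lower_left_nonzero[OF \<gamma>] by blast
  define M where "M = rmult (of_imat h) \<tau>"
  have dh: "rdet (of_imat h) = 1" using h \<Gamma> rdet_SL2Z by blast
  have dM: "rdet M = 1" unfolding M_def rdet_rmult dh \<tau>(2) by simp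
  define c' d' where "c' = of_int c * sqrt (real m)" and "d' = of_int d / sqrt (real m)"
  have M: "jden M z = of_real c' * z + of_real d'" for z
    unfolding M_def \<tau>(1) rmult_assoc[symmetric] of_imat_imult[symmetric] h(2) by (simp add: eta_def c'_def d'_def)
  have c': "c' \<noteq> 0" using h(3) m by (simp add: c'_def)
  have eq: "norm (slash r f \<tau> z) = norm (slash r f M z)" if z: "z \<in> upper_half" for z
  proof -
    have "moeb \<tau> z \<in> upper_half" using moeb_upper[of \<tau> z] \<tau> z by simp
    then have "Phi (moeb M z) = Phi (moeb \<tau> z)"
      unfolding M_def using moeb_rmult(2)[of \<tau> z "of_imat h"] jden_nonzero[of \<tau> z] \<tau>(2) z Phi_invariant[OF h(1)] by simp
    then have "norm (slash r f \<tau> z) * Im z powr (r / 2) = norm (slash r f M z) * Im z powr (r / 2)"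
      unfolding norm_slash_times[OF \<tau>(2) z] norm_slash_times[OF dM z] Phi_def by simp
    then show ?thesis using z by (simp add: upper_half_def)
  qed
  \<comment> \<open>The image height is at most 1 / (c'^2 y), and this threshold makes it at most
    1/2.\<close>
  define Y where "Y = max 1 (2 / c'\<^sup>2)"
  define L where "L = 2 * \<bar>c'\<bar> + \<bar>d'\<bar>"
  have L: "L > 0" using c' by (simp add: L_def add_pos_nonneg)
  define C where "C = \<bar>C0\<bar> * (L\<^sup>2) powr \<bar>k0\<bar> * \<bar>c'\<bar> powr (- r)"
  have main: "norm (slash r f \<tau> z) \<le> C * Im z powr \<bar>k0\<bar>" if z: "\<bar>Re z\<bar> \<le> 1/2" "Im z \<ge> Y" for z
  proof -
    define y where "y = Im z"
    have y: "y \<ge> 1" "y \<ge> 2 / c'\<^sup>2" using z by (auto simp: y_def Y_def)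
    have zu: "z \<in> upper_half" using y by (simp add: upper_half_def y_def)
    define j where "j = norm (jden M z)"
    have j1: "j \<ge> \<bar>c'\<bar> * y" using abs_Im_le_cmod[of "jden M z"] y by (simp add: j_def M y_def abs_mult)
    have j2: "j \<le> L * y"
    proof -
      have "norm z \<le> 1/2 + y" using cmod_le[of z] z y by (simp add: y_def)
      then have "norm z \<le> 2 * y" using y by simp
      have "j \<le> \<bar>c'\<bar> * norm z + \<bar>d'\<bar>" unfolding j_def M using norm_triangle_ineq[of "of_real c' * z" "of_real d'"] by (simp add: norm_mult)
      also have "\<dots> \<le> \<bar>c'\<bar> * (2 * y) + \<bar>d'\<bar> * y"
        using \<open>norm z \<le> 2 * y\<close> y by (intro add_mono mult_left_mono) (auto simp: mult_le_cancel_left1)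
      finally show ?thesis by (simp add: L_def algebra_simps)
    qed
    have jp: "j > 0" using j1 c' y mult_pos_pos[of "\<bar>c'\<bar>" y] by linarith
    define v where "v = Im (moeb M z)"
    have v: "v = y / j\<^sup>2" unfolding v_def Im_moeb dM by (simp add: j_def y_def)
    have vpos: "v > 0" using v jp y by simp
    have "v \<le> y / (\<bar>c'\<bar> * y)\<^sup>2" unfolding v using j1 y c' jp by (intro divide_left_mono power_mono) auto
    also have "\<dots> = 1 / (c'\<^sup>2 * y)" using y by (simp add: power2_eq_square)
    also have "\<dots> < 1"
    proof -
      have "c'\<^sup>2 * y \<ge> c'\<^sup>2 * (2 / c'\<^sup>2)" using y by (intro mult_left_mono) auto
      then show ?thesis using c' by simp
    qed
    finally have v1: "v < 1" .
    have vlow: "1 / (L\<^sup>2 * y) \<le> v"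
    proof -
      have "1 / (L\<^sup>2 * y) = y / (L * y)\<^sup>2" using y by (simp add: power2_eq_square)
      also have "\<dots> \<le> v" unfolding v using j2 jp y L by (intro divide_left_mono power_mono) auto
      finally show ?thesis .
    qed
    have Ly: "L\<^sup>2 * y > 0" using L y by simp
    have "v powr (- k0) \<le> v powr (- \<bar>k0\<bar>)" using vpos v1 by (intro powr_mono') auto
    also have "\<dots> \<le> (1 / (L\<^sup>2 * y)) powr (- \<bar>k0\<bar>)" using vlow Ly by (intro powr_mono2') auto
    also have "\<dots> = (L\<^sup>2) powr \<bar>k0\<bar> * y powr \<bar>k0\<bar>" by (simp add: powr_minus powr_divide powr_mult)
    finally have vp: "v powr (- k0) \<le> (L\<^sup>2) powr \<bar>k0\<bar> * y powr \<bar>k0\<bar>" .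
    have "norm (f (moeb M z)) \<le> C0 * v powr (- k0)" unfolding v_def using vpos v1 by (intro Ck) (auto simp: v_def)
    also have "\<dots> \<le> \<bar>C0\<bar> * v powr (- k0)" by (intro mult_right_mono) auto
    also have "\<dots> \<le> \<bar>C0\<bar> * ((L\<^sup>2) powr \<bar>k0\<bar> * y powr \<bar>k0\<bar>)" by (intro mult_left_mono vp) auto
    finally have A: "norm (f (moeb M z)) \<le> \<bar>C0\<bar> * ((L\<^sup>2) powr \<bar>k0\<bar> * y powr \<bar>k0\<bar>)" .
    have "\<bar>c'\<bar> \<le> \<bar>c'\<bar> * y" using y mult_left_mono[of 1 y "\<bar>c'\<bar>"] by simp
    then have "\<bar>c'\<bar> \<le> j" using j1 by linarith
    then have "j powr (- r) \<le> \<bar>c'\<bar> powr (- r)" using c' r by (intro powr_mono2') auto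
    then have "norm (slash r f \<tau> z) \<le> (\<bar>C0\<bar> * ((L\<^sup>2) powr \<bar>k0\<bar> * y powr \<bar>k0\<bar>)) * \<bar>c'\<bar> powr (- r)"
      unfolding eq[OF zu] norm_slash[OF dM] j_def[symmetric] using A by (intro mult_mono) auto
    then show ?thesis by (simp add: C_def y_def mult_ac)
  qed
  show ?thesis by (rule that[of Y "\<bar>k0\<bar>" C]) (use main in \<open>auto simp: Y_def\<close>)
qed

theorem slash_has_fexp:
  assumes "scaling_matrix \<Gamma> \<a> \<tau>"
  shows "has_fexp (slash r f \<tau>) (fkappa (slash r f \<tau>)) (fcoeff (slash r f \<tau>))"
proof -
  have d: "rdet \<tau> = 1" using scaling_matrixE[OF assms] by metis
  obtain \<zeta> where \<zeta>: "norm \<zeta> = 1" "\<And>z. z \<in> upper_half \<Longrightarrow> slash r f \<tau> (z + 1) = \<zeta> * slash r f \<tau> z"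
    using slash_periodic[OF assms] by metis
  obtain C k Y where "Y \<ge> 0" "k \<ge> 0" "\<And>z. \<bar>Re z\<bar> \<le> 1/2 \<Longrightarrow> Im z \<ge> Y \<Longrightarrow> norm (slash r f \<tau> z) \<le> C * Im z powr k"
    using slash_polynomial_growth[OF assms] by metis
  from q_expansion_exists[OF slash_holomorphic[OF d] \<zeta> this(3,1,2)]
  have "\<exists>a. has_fexp (slash r f \<tau>) (fkappa (slash r f \<tau>)) a" unfolding fkappa_def by (rule someI_ex)
  then show ?thesis unfolding fcoeff_def by (rule someI_ex)
qed

text \<open>Dirichlet's theorem with N about 1/sqrt y gives a coprime pair with |kx - h| <= sqrt y
  and k y <= 2 sqrt y. Hence |kz - h|^2 <= 5 y, and the new height is at least 1/5; no fundamental
  domain is needed.\<close>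

lemma reduction:
  assumes "z \<in> upper_half"
  obtains g where "g \<in> SL2Z" "Im (moeb (of_imat g) z) \<ge> 1/5"
proof (cases "Im z \<ge> 1/5")
  case True
  then show ?thesis using that[of iid] SL2Z_closed(3) by (simp add: iid_def)
next
  case False
  define x y where "x = Re z" and "y = Im z"
  have y: "0 < y" "y < 1" using False assms by (auto simp: y_def upper_half_def)
  define N where "N = nat \<lceil>1 / sqrt y\<rceil>"
  have s: "0 < sqrt y" "sqrt y < 1" using y by auto
  have N1: "1 / sqrt y \<le> real N" unfolding N_def using s by (simp add: of_nat_ceiling)
  have N2: "real N \<le> 2 / sqrt y"
  proof -
    have "real N \<le> 1 / sqrt y + 1" unfolding N_def using s by (simp add: of_nat_nat)
    moreover have "1 \<le> 1 / sqrt y" using s by simp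
    ultimately show ?thesis by simp
  qed
  have "real N > 0" using N1 s by (intro less_le_trans[OF _ N1]) simp
  then have Npos: "N > 0" by simp
  obtain h k where hk: "coprime h k" "0 < k" "k \<le> int N" "\<bar>of_int k * x - of_int h\<bar> < 1 / real N"
    using Dirichlet_approx_coprime[OF Npos, of x] by blast
  obtain p q where "p * h + q * k = 1" using hk(1) by (metis bezout_int coprime_iff_gcd_eq_1)
  then have det: "(- p) * (- h) - (- q) * k = 1" by simp
  define g where "g = IM (- p) (- q) k (- h)"
  have g: "g \<in> SL2Z" using det by (simp add: g_def SL2Z_def)
  have n: "(norm (jden (of_imat g) z))\<^sup>2 = (of_int k * x - of_int h)\<^sup>2 + (of_int k * y)\<^sup>2"
    by (simp add: g_def cmod_power2 x_def y_def)
  have "(of_int k * x - of_int h)\<^sup>2 \<le> (1 / real N)\<^sup>2" using hk(4) by (metis abs_le_square_iff abs_of_nonneg less_imp_le of_nat_0_le_iff zero_le_divide_1_iff)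
  also have "\<dots> \<le> (sqrt y)\<^sup>2"
  proof (rule power_mono)
    show "1 / real N \<le> sqrt y" using N1 s \<open>real N > 0\<close> by (simp add: field_simps)
  qed simp
  also have "\<dots> = y" using y by simp
  finally have a: "(of_int k * x - of_int h)\<^sup>2 \<le> y" .
  have "of_int k * y \<le> real N * y" using hk(3) y by (intro mult_right_mono) linarith+
  also have "\<dots> \<le> 2 / sqrt y * y" using N2 y by (intro mult_right_mono) auto
  also have "\<dots> = 2 * sqrt y" using y by (simp add: real_div_sqrt field_simps)
  finally have "(of_int k * y)\<^sup>2 \<le> (2 * sqrt y)\<^sup>2" using hk(2) y by (intro power_mono) auto
  then have b: "(of_int k * y)\<^sup>2 \<le> 4 * y" using y by (simp add: power_mult_distrib)
  have pos: "(norm (jden (of_imat g) z))\<^sup>2 > 0"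
    using jden_nonzero[of "of_imat g" z] assms rdet_SL2Z[OF g] by simp
  have "(norm (jden (of_imat g) z))\<^sup>2 \<le> 5 * y" unfolding n using a b by simp
  then have "1/5 \<le> y / (norm (jden (of_imat g) z))\<^sup>2" using pos by (simp add: field_simps)
  then show ?thesis using that[OF g] by (simp add: Im_moeb rdet_SL2Z[OF g] y_def)
qed

text \<open>The growth exponent of \<open>Phi\<close> towards a cusp: a constant term contributes
  y^(r/2), while for a cusp form \<open>Phi\<close> stays bounded.\<close>

definition cusp_exp :: real where
  "cusp_exp = (if cusp_form \<Gamma> r f then 0 else r / 2)"

lemma cusp_exp: "0 \<le> cusp_exp" "alpha0 \<Gamma> r f = r / 2 + cusp_exp"
  using r by (auto simp: cusp_exp_def alpha0_def)

lemma slash_cusp_bound: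
  assumes "scaling_matrix \<Gamma> \<a> \<tau>" "\<epsilon> > 0"
  shows "\<exists>C. \<forall>z. Im z \<ge> \<epsilon> \<longrightarrow> norm (slash r f \<tau> z) * Im z powr (r / 2) \<le> C * Im z powr cusp_exp"
proof -
  note fe = slash_has_fexp[OF assms(1)]
  obtain C0 where C0: "\<And>z. Im z \<ge> \<epsilon> \<Longrightarrow> norm (slash r f \<tau> z) \<le> C0" using has_fexp_bounded[OF fe assms(2)] by blast
  show ?thesis
  proof (cases "cusp_form \<Gamma> r f")
    case False
    then show ?thesis using C0 by (intro exI[of _ C0]) (auto simp: cusp_exp_def intro!: mult_right_mono)
  next
    case True
    then have "cuspidal_at r f \<tau>" using assms(1) by (auto simp: cusp_form_def)
    then have "fourier_exp (if fkappa (slash r f \<tau>) > 0 then fkappa (slash r f \<tau>) else 1)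
        (if fkappa (slash r f \<tau>) > 0 then fcoeff (slash r f \<tau>) else (\<lambda>n. fcoeff (slash r f \<tau>) (Suc n))) (slash r f \<tau>)"
      using has_fexp_fourier_exp[OF fe] by (auto simp: cuspidal_at_def split: if_splits)
    then obtain \<kappa> b where fo: "fourier_exp \<kappa> b (slash r f \<tau>)" by blast
    then have \<kappa>: "\<kappa> > 0" by (simp add: fourier_exp_def)
    obtain C1 where C1: "\<And>z. Im z \<ge> 1 \<Longrightarrow> norm (slash r f \<tau> z) \<le> C1 * exp (- (pi * \<kappa> * Im z))" using fourier_exp_decay[OF fo] by blast
    obtain C2 where C2: "C2 > 0" "\<And>t. t \<ge> 0 \<Longrightarrow> (1 + t) powr (r / 2) \<le> C2 * exp (pi * \<kappa> * t)"
      using bounded_powr_exp[of "r / 2" "pi * \<kappa>"] r \<kappa> by auto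
    have "norm (slash r f \<tau> z) * Im z powr (r / 2) \<le> (\<bar>C0\<bar> + \<bar>C1\<bar> * C2) * Im z powr cusp_exp" if z: "Im z \<ge> \<epsilon>" for z
    proof -
      have y: "Im z > 0" using z assms(2) by simp
      have e1: "Im z powr cusp_exp = 1" using True y by (simp add: cusp_exp_def)
      show ?thesis
      proof (cases "Im z \<ge> 1")
        case True
        have p: "Im z powr (r / 2) \<le> C2 * exp (pi * \<kappa> * Im z)"
          using C2(2)[of "Im z"] y powr_mono2[of "r / 2" "Im z" "1 + Im z"] r by simp
        have "norm (slash r f \<tau> z) \<le> C1 * exp (- (pi * \<kappa> * Im z))" by (rule C1[OF True])
        also have "\<dots> \<le> \<bar>C1\<bar> * exp (- (pi * \<kappa> * Im z))" by (intro mult_right_mono) auto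
        finally have "norm (slash r f \<tau> z) * Im z powr (r / 2) \<le> (\<bar>C1\<bar> * exp (- (pi * \<kappa> * Im z))) * (C2 * exp (pi * \<kappa> * Im z))"
          using p by (intro mult_mono) auto
        also have "\<dots> = \<bar>C1\<bar> * C2" by (simp add: exp_minus)
        finally show ?thesis using e1 by simp
      next
        case False
        have "norm (slash r f \<tau> z) * Im z powr (r / 2) \<le> \<bar>C0\<bar> * 1"
          using C0[OF z] y False r by (intro mult_mono powr_le1) auto
        moreover have "\<bar>C1\<bar> * C2 \<ge> 0" using C2 by simp
        ultimately show ?thesis using e1 by simp
      qed
    qed
    then show ?thesis by blast
  qed
qed

lemma Phi_coset_bound:
  assumes "g \<in> SL2Z"
  shows "\<exists>C\<ge>0. \<forall>w. Im w \<ge> 1/5 \<longrightarrow> Phi (moeb (of_imat g) w) \<le> C * Im w powr cusp_exp"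
proof -
  obtain a b c d where g: "g = IM a b c d" by (cases g)
  \<comment> \<open>Changing the sign of g does not change its action, but makes the bottom row
    admissible for a scaling matrix.\<close>
  define g' where "g' = (if bottom_ok g then g else IM (-a) (-b) (-c) (-d))"
  have g': "g' \<in> SL2Z" "bottom_ok g'"
  proof -
    show "g' \<in> SL2Z" using assms by (simp add: g'_def g SL2Z_def)
    have "c = 0 \<Longrightarrow> d = 1 \<or> d = -1" using assms by (auto simp: g SL2Z_def zmult_eq_1_iff)
    then show "bottom_ok g'" by (auto simp: g'_def g)
  qed
  have gg': "moeb (of_imat g) w = moeb (of_imat g') w" for w
  proof -
    have "(- (of_int a * w) - of_int b) / (- (of_int c * w) - of_int d) = (of_int a * w + of_int b) / (of_int c * w + complex_of_int d)"
      using minus_divide_divide[of "of_int a * w + of_int b" "of_int c * w + complex_of_int d"] by (simp only: minus_add_distrib) simp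
    then show ?thesis by (simp add: g'_def g)
  qed
  define \<a> where "\<a> = cusp_act g' CInf"
  define m where "m = width \<Gamma> \<a>"
  have m: "m > 0" using translation_width(2)[OF fi g'(1)] by (simp add: m_def \<a>_def)
  define \<sigma> where "\<sigma> = rmult (of_imat g') (eta m)"
  have sc: "scaling_matrix \<Gamma> \<a> \<sigma>" unfolding scaling_matrix_def \<sigma>_def m_def \<a>_def using g' by blast
  have d: "rdet \<sigma> = 1" using g' m by (simp add: \<sigma>_def rdet_rmult rdet_SL2Z rdet_eta)
  obtain C where C: "\<And>z. Im z \<ge> 1 / (5 * real m) \<Longrightarrow> norm (slash r f \<sigma> z) * Im z powr (r / 2) \<le> C * Im z powr cusp_exp"
    using slash_cusp_bound[OF sc, of "1 / (5 * real m)"] m by auto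
  have "Phi (moeb (of_imat g) w) \<le> (\<bar>C\<bar> / real m powr cusp_exp) * Im w powr cusp_exp" if w: "Im w \<ge> 1/5" for w
  proof -
    define z where "z = w / of_nat m"
    have wz: "w = of_nat m * z" using m by (simp add: z_def)
    have Imz: "Im z = Im w / real m" by (simp add: z_def)
    then have Im: "Im z \<ge> 1 / (5 * real m)" using w m by (simp add: field_simps)
    then have zu: "z \<in> upper_half" using m less_le_trans[of 0 "1 / (5 * real m)" "Im z"] by (simp add: upper_half_def)
    have je: "jden (eta m) z \<noteq> 0" using jden_nonzero[of "eta m" z] rdet_eta[OF m] zu by simp
    have "moeb \<sigma> z = moeb (of_imat g') w"
      unfolding \<sigma>_def moeb_rmult(2)[OF je] moeb_eta[OF m] wz ..
    then have "Phi (moeb (of_imat g) w) = norm (slash r f \<sigma> z) * Im z powr (r / 2)"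
      unfolding norm_slash_times[OF d zu] Phi_def gg' by simp
    also have "\<dots> \<le> C * Im z powr cusp_exp" by (rule C[OF Im])
    also have "\<dots> \<le> \<bar>C\<bar> * Im z powr cusp_exp" by (intro mult_right_mono) auto
    also have "\<dots> = (\<bar>C\<bar> / real m powr cusp_exp) * Im w powr cusp_exp" unfolding Imz by (simp add: powr_divide)
    finally show ?thesis .
  qed
  then show ?thesis by (intro exI[of _ "\<bar>C\<bar> / real m powr cusp_exp"]) auto
qed

lemma Phi_bound:
  "\<exists>C\<ge>0. \<forall>g\<in>SL2Z. \<forall>w. Im w \<ge> 1/5 \<longrightarrow> Phi (moeb (of_imat g) w) \<le> C * Im w powr cusp_exp"
proof -
  define rep where "rep X = (SOME g. g \<in> SL2Z \<and> rcoset_i \<Gamma> g = X)" for X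
  have rep: "rep (rcoset_i \<Gamma> g) \<in> SL2Z" "rcoset_i \<Gamma> (rep (rcoset_i \<Gamma> g)) = rcoset_i \<Gamma> g" if "g \<in> SL2Z" for g
    using someI_ex[of "\<lambda>g'. g' \<in> SL2Z \<and> rcoset_i \<Gamma> g' = rcoset_i \<Gamma> g"] that by (auto simp: rep_def)
  define B where "B X = (SOME C. C \<ge> 0 \<and> (\<forall>w. Im w \<ge> 1/5 \<longrightarrow> Phi (moeb (of_imat (rep X)) w) \<le> C * Im w powr cusp_exp))" for X
  have B: "B X \<ge> 0" "\<And>w. Im w \<ge> 1/5 \<Longrightarrow> Phi (moeb (of_imat (rep X)) w) \<le> B X * Im w powr cusp_exp" if "X \<in> rcoset_i \<Gamma> ` SL2Z" for X
  proof -
    have "rep X \<in> SL2Z" using that rep by auto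
    from someI_ex[OF Phi_coset_bound[OF this, unfolded Bex_def]]
    show "B X \<ge> 0" "\<And>w. Im w \<ge> 1/5 \<Longrightarrow> Phi (moeb (of_imat (rep X)) w) \<le> B X * Im w powr cusp_exp" unfolding B_def by blast+
  qed
  define C where "C = (\<Sum>X\<in>rcoset_i \<Gamma> ` SL2Z. B X)"
  have "Phi (moeb (of_imat g) w) \<le> C * Im w powr cusp_exp" if g: "g \<in> SL2Z" and w: "Im w \<ge> 1/5" for g w
  proof -
    define X where "X = rcoset_i \<Gamma> g"
    have X: "X \<in> rcoset_i \<Gamma> ` SL2Z" using g by (simp add: X_def)
    define h where "h = imult g (iinv (rep X))"
    have repX: "rep X \<in> SL2Z" "rcoset_i \<Gamma> g = rcoset_i \<Gamma> (rep X)" using rep[OF g] by (auto simp: X_def)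
    have h: "h \<in> \<Gamma>" using rcoset_i_eq_iff[OF fi g repX(1)] repX(2) by (simp add: h_def)
    have gh: "g = imult h (rep X)" using repX by (simp add: h_def imult_assoc imult_iinv)
    have wu: "w \<in> upper_half" using w by (simp add: upper_half_def)
    have j: "jden (of_imat (rep X)) w \<noteq> 0" using jden_nonzero[of "of_imat (rep X)" w] wu rdet_SL2Z[OF repX(1)] by simp
    have "moeb (of_imat (rep X)) w \<in> upper_half" using moeb_upper[of "of_imat (rep X)" w] wu rdet_SL2Z[OF repX(1)] by simp
    then have "Phi (moeb (of_imat g) w) = Phi (moeb (of_imat (rep X)) w)"
      unfolding gh of_imat_imult moeb_rmult(2)[OF j] by (rule Phi_invariant[OF h])
    also have "\<dots> \<le> B X * Im w powr cusp_exp" by (rule B(2)[OF X w])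
    also have "\<dots> \<le> C * Im w powr cusp_exp"
      unfolding C_def using X B(1) \<Gamma>(5) by (intro mult_right_mono member_le_sum) auto
    finally show ?thesis .
  qed
  moreover have "C \<ge> 0" unfolding C_def using B(1) by (rule sum_nonneg)
  ultimately show ?thesis by blast
qed

text \<open>A point of height y is moved by \<open>reduction\<close> to a point w of height between
  1/5 and (m+1)/y, where \<open>Phi\<close> is at most a multiple of Im w^cusp_exp. Dividing by
  y^(r/2) gives the exponent r/2 + cusp_exp.\<close>

theorem slash_growth:
  assumes "scaling_matrix \<Gamma> \<a> \<tau>"
  shows "\<exists>C. \<forall>z. 0 < Im z \<longrightarrow> Im z < 1 \<longrightarrow> norm (slash r f \<tau> z) \<le> C * Im z powr (- alpha0 \<Gamma> r f)"
proof -
  obtain \<gamma> m where \<gamma>: "\<gamma> \<in> SL2Z" and m: "m > 0" and \<tau>: "\<tau> = rmult (of_imat \<gamma>) (eta m)" "rdet \<tau> = 1"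
    using scaling_matrixE[OF assms] by metis
  obtain C where C: "C \<ge> 0" "\<And>g w. g \<in> SL2Z \<Longrightarrow> Im w \<ge> 1/5 \<Longrightarrow> Phi (moeb (of_imat g) w) \<le> C * Im w powr cusp_exp"
    using Phi_bound by blast
  have "norm (slash r f \<tau> z) \<le> (C * (real m + 1) powr cusp_exp) * Im z powr (- alpha0 \<Gamma> r f)" if z: "0 < Im z" "Im z < 1" for z
  proof -
    define y where "y = Im z"
    have y: "0 < y" "y < 1" using z by (auto simp: y_def)
    have zu: "z \<in> upper_half" using z by (simp add: upper_half_def)
    define v where "v = of_nat m * z"
    have v: "v \<in> upper_half" "Im v = m * y" using m z by (auto simp: v_def upper_half_def y_def)
    have je: "jden (eta m) z \<noteq> 0" using jden_nonzero[of "eta m" z] rdet_eta[OF m] zu by simp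
    have \<tau>z: "moeb \<tau> z = moeb (of_imat \<gamma>) v" unfolding \<tau>(1) moeb_rmult(2)[OF je] moeb_eta[OF m] v_def ..
    have \<tau>u: "moeb \<tau> z \<in> upper_half" using moeb_upper[of \<tau> z] \<tau>(2) zu by simp
    obtain g where g: "g \<in> SL2Z" "Im (moeb (of_imat g) (moeb \<tau> z)) \<ge> 1/5" using reduction[OF \<tau>u] by blast
    define w where "w = moeb (of_imat g) (moeb \<tau> z)"
    have jg: "jden (of_imat g) (moeb \<tau> z) \<noteq> 0" using jden_nonzero[of "of_imat g"] rdet_SL2Z[OF g(1)] \<tau>u by simp
    have "moeb (of_imat (iinv g)) w = moeb \<tau> z"
    proof -
      have "moeb (of_imat (iinv g)) w = moeb (of_imat (imult (iinv g) g)) (moeb \<tau> z)"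
        unfolding w_def of_imat_imult moeb_rmult(2)[OF jg] ..
      then show ?thesis using g(1) by (simp add: imult_iinv) (simp add: iid_def)
    qed
    then have "Phi (moeb \<tau> z) \<le> C * Im w powr cusp_exp" using C(2)[OF SL2Z_closed(2)[OF g(1)], of w] g(2) by (simp add: w_def)
    moreover have "Im w \<le> (real m + 1) / y"
    proof -
      \<comment> \<open>The upper bound on Im w comes from integrality of the bottom row: either c =
        0 and the denominator has modulus 1, or |c| >= 1 and its modulus is at least m y.\<close>
      define k where "k = imult g \<gamma>"
      have k: "k \<in> SL2Z" unfolding k_def by (intro SL2Z_closed g \<gamma>)
      have j\<gamma>: "jden (of_imat \<gamma>) v \<noteq> 0" using jden_nonzero[of "of_imat \<gamma>" v] v rdet_SL2Z[OF \<gamma>] by simp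
      have wk: "w = moeb (of_imat k) v" unfolding w_def \<tau>z k_def of_imat_imult moeb_rmult(2)[OF j\<gamma>] ..
      obtain a b c d where kk: "k = IM a b c d" by (cases k)
      have Iw: "Im w = m * y / (norm (jden (of_imat k) v))\<^sup>2" unfolding wk Im_moeb rdet_SL2Z[OF k] v(2) by simp
      have mp: "real m \<ge> 1" using m by simp
      show ?thesis
      proof (cases "c = 0")
        case True
        then have "d = 1 \<or> d = -1" using k by (auto simp: kk SL2Z_def zmult_eq_1_iff)
        then have "norm (jden (of_imat k) v) = 1" using True by (auto simp: kk)
        then have "Im w = m * y" using Iw by simp
        also have "\<dots> \<le> real m * 1" using y by (intro mult_left_mono) auto
        also have "\<dots> \<le> (real m + 1) / y"
        proof -
          have "(real m + 1) * y \<le> real m + 1" using y by (intro mult_left_le) auto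
          then have "real m + 1 \<le> (real m + 1) / y" using y by (simp add: le_divide_eq)
          then show ?thesis by simp
        qed
        finally show ?thesis .
      next
        case False
        have "real m * y * 1 \<le> real m * y * \<bar>of_int c\<bar>" using False y by (intro mult_left_mono) auto
        also have "\<dots> = \<bar>Im (jden (of_imat k) v)\<bar>" using y v(2) by (simp add: kk abs_mult)
        also have "\<dots> \<le> norm (jden (of_imat k) v)" by (rule abs_Im_le_cmod)
        finally have "real m * y \<le> norm (jden (of_imat k) v)" by simp
        moreover have "0 < real m * y" using y mp by simp
        ultimately have "Im w \<le> m * y / (real m * y)\<^sup>2"
          unfolding Iw by (intro frac_le power_mono zero_less_power) linarith+
        also have "\<dots> = 1 / (real m * y)" using y mp by (simp add: power2_eq_square)
        also have "\<dots> = (1 / real m) / y" by simp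
        also have "\<dots> \<le> (real m + 1) / y"
        proof (rule divide_right_mono)
          have "1 / real m \<le> 1" using mp by simp
          then show "1 / real m \<le> real m + 1" by linarith
        qed (use y in simp)
        finally show ?thesis .
      qed
    qed
    moreover have "Im w \<ge> 0" using g(2) by (simp add: w_def)
    ultimately have "Phi (moeb \<tau> z) \<le> C * ((real m + 1) / y) powr cusp_exp"
      using C(1) cusp_exp(1) by (meson mult_left_mono order_trans powr_mono2)
    then have "norm (slash r f \<tau> z) * y powr (r / 2) \<le> C * ((real m + 1) / y) powr cusp_exp"
      unfolding y_def norm_slash_times[OF \<tau>(2) zu] Phi_def .
    then have "norm (slash r f \<tau> z) * y powr (r / 2) * y powr (- (r / 2)) \<le> C * ((real m + 1) / y) powr cusp_exp * y powr (- (r / 2))"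
      by (rule mult_right_mono) simp
    moreover have "y powr (r / 2) * y powr (- (r / 2)) = 1" using y by (simp flip: powr_add)
    moreover have "((real m + 1) / y) powr cusp_exp * y powr (- (r / 2)) = (real m + 1) powr cusp_exp * y powr (- alpha0 \<Gamma> r f)"
    proof -
      have "((real m + 1) / y) powr cusp_exp = (real m + 1) powr cusp_exp * y powr (- cusp_exp)" by (simp add: powr_divide powr_minus_divide)
      moreover have "y powr (- cusp_exp) * y powr (- (r / 2)) = y powr (- alpha0 \<Gamma> r f)" using y by (simp add: cusp_exp(2) add.commute flip: powr_add)
      ultimately show ?thesis by simp
    qed
    ultimately show ?thesis by (simp add: y_def mult.assoc)
  qed
  then show ?thesis by blast
qed

end

subsection \<open>Expansion at a cusp\<close>

lemma LINT_scale:
  fixes \<phi> :: "real \<Rightarrow> complex"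
  assumes "m > 0"
  shows "(LINT t:{0<..}|lborel. \<phi> t) = of_real (1 / m) * (LINT u:{0<..}|lborel. \<phi> (u / m))"
proof -
  have "(LINT t:{0<..}|lborel. \<phi> t) = \<bar>1 / m\<bar> *\<^sub>R (\<integral>u. indicator {0<..} (0 + (1 / m) * u) *\<^sub>R \<phi> (0 + (1 / m) * u) \<partial>lborel)"
    unfolding set_lebesgue_integral_def using assms by (intro lborel_integral_real_affine) auto
  also have "(\<lambda>u. indicat_real {0<..} (0 + (1 / m) * u) *\<^sub>R \<phi> (0 + (1 / m) * u)) = (\<lambda>u. indicat_real {0<..} u *\<^sub>R \<phi> (u / m))"
    using assms by (auto simp: fun_eq_iff indicator_def zero_less_divide_iff)
  finally show ?thesis using assms by (simp add: set_lebesgue_integral_def scaleR_conv_of_real)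
qed

lemma powr_int_nonneg:
  assumes "\<beta> \<in> \<int>" "\<beta> > -1"
  obtains N :: nat where "\<beta> = real N"
proof -
  obtain k :: int where k: "\<beta> = of_int k" using assms(1) by (auto elim: Ints_cases)
  then have "k \<ge> 0" using assms(2) by linarith
  then show ?thesis using that[of "nat k"] k by simp
qed

text \<open>For h of either sign, Ln (-i h) = Ln h - i pi/2. In the logarithmic case the constant i
  pi/2 multiplies h^\<beta>, a polynomial because an integral \<beta> above -1 is
  nonnegative.\<close>

lemma chi_rotate:
  assumes "h \<noteq> 0" "\<beta> > -1"
  defines "k \<equiv> exp (- (of_real \<beta> * (\<i> * of_real pi / 2)))"
  shows "chi \<beta> (- \<i> * of_real h) = k * chi \<beta> (of_real h) - (if \<beta> \<in> \<int> then k * (\<i> * of_real pi / 2) * of_real h ^ nat \<lfloor>\<beta>\<rfloor> else 0)"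
proof -
  define l where "l = Ln (complex_of_real h)"
  have L: "Ln (- \<i> * of_real h) = l - \<i> * of_real pi / 2"
  proof (cases "h > 0")
    case True
    have "Ln (of_real h * (- \<i>)) = ln h + Ln (- \<i>)" using True Ln_times_of_real[of h "- \<i>"] by (simp add: Ln_of_real del: mult_minus_right)
    then show ?thesis using True by (simp add: l_def Ln_of_real mult.commute)
  next
    case False
    then have h: "h < 0" using assms(1) by simp
    have "Ln (of_real (- h) * \<i>) = ln (- h) + Ln \<i>" using h Ln_times_of_real[of "- h" \<i>] by (simp add: Ln_of_real del: of_real_minus)
    moreover have "l = ln (- h) + \<i> * of_real pi"
    proof -
      have "Ln (- complex_of_real h) = of_real (ln (- h))" using h Ln_of_real[of "- h"] by simp
      then show ?thesis using h Ln_minus[of "of_real (- h)"] by (simp add: l_def)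
    qed
    ultimately show ?thesis by (simp add: mult.commute)
  qed
  have p: "(- \<i> * of_real h) powr of_real \<beta> = k * of_real h powr of_real \<beta>"
  proof -
    have "(- \<i> * of_real h) powr of_real \<beta> = exp (of_real \<beta> * Ln (- \<i> * of_real h))" using assms(1) by (simp add: powr_def)
    also have "\<dots> = k * exp (of_real \<beta> * l)" unfolding L k_def by (simp add: algebra_simps flip: exp_add)
    finally show ?thesis using assms(1) by (simp add: powr_def l_def)
  qed
  show ?thesis
  proof (cases "\<beta> \<in> \<int>")
    case False
    then show ?thesis using p by (simp add: chi_def)
  next
    case True
    then obtain N where N: "\<beta> = real N" using powr_int_nonneg assms(2) by blast
    have hN: "complex_of_real h powr of_real \<beta> = of_real h ^ N" using assms(1) by (simp add: N powr_nat)
    have "chi \<beta> (- \<i> * of_real h) = k * of_real h powr of_real \<beta> * (l - \<i> * of_real pi / 2)"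
      using True p L by (simp add: chi_def)
    also have "\<dots> = k * (of_real h powr of_real \<beta> * l) - k * (\<i> * of_real pi / 2) * of_real h powr of_real \<beta>"
      by (simp add: algebra_simps)
    finally have E: "chi \<beta> (- \<i> * of_real h) = k * (of_real h ^ N * l) - k * (\<i> * of_real pi / 2) * of_real h ^ N"
      unfolding hN .
    have "chi \<beta> (of_real h) = of_real h ^ N * l" using True hN by (simp add: chi_def l_def)
    moreover have "nat \<lfloor>\<beta>\<rfloor> = N" by (simp add: N)
    ultimately show ?thesis using True by (simp only: E if_True)
  qed
qed

lemma powr_i_times:
  assumes "Re v > 0"
  shows "(\<i> * v) powr a = \<i> powr a * v powr a"
proof -
  have v: "v \<noteq> 0" using assms by auto
  have "\<bar>Im (Ln v)\<bar> < pi / 2" using Re_Ln_pos_lt[OF v] assms by simp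
  then have "Ln (\<i> * v) = Ln \<i> + Ln v" using v by (intro Ln_times_simple) auto
  then show ?thesis using v by (simp add: powr_def distrib_left exp_add)
qed

lemma power_integrable_unit:
  assumes "\<alpha> > 0"
  shows "set_integrable lborel {0<..<1} (\<lambda>t. complex_of_real (t powr (\<alpha> - 1)))"
proof (rule set_integrable_powr_exp_bound[where p = \<alpha> and C = "exp 1" and d = 1])
  show "continuous_on {0<..<1} (\<lambda>t. complex_of_real (t powr (\<alpha> - 1)))" by (intro continuous_intros) auto
  fix t :: real assume "t \<in> {0<..<1}"
  then have "1 \<le> exp 1 * exp (- 1 * t)" by (simp flip: exp_add)
  from mult_left_mono[OF this, of "t powr (\<alpha> - 1)"]
  show "norm (complex_of_real (t powr (\<alpha> - 1))) \<le> exp 1 * t powr (\<alpha> - 1) * exp (- 1 * t)" by (simp add: mult_ac)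
qed (use assms in auto)

lemma J_integrable:
  assumes "\<alpha> > 0" "r \<ge> 0" "h \<noteq> 0"
  shows "set_integrable lborel {0<..<1} (\<lambda>t. complex_of_real (t powr (\<alpha> - 1)) * Complex h t powr (- of_real r))"
proof (rule set_integrable_powr_exp_bound[where p = \<alpha> and C = "\<bar>h\<bar> powr (- r) * exp 1" and d = 1])
  show "continuous_on {0<..<1} (\<lambda>t. complex_of_real (t powr (\<alpha> - 1)) * Complex h t powr (- of_real r))"
    by (intro continuous_on_mult continuous_on_powr_slit)
      (auto simp: complex_nonpos_Reals_iff Complex_eq intro!: continuous_intros)
  fix t :: real assume t: "t \<in> {0<..<1}"
  have n: "norm (Complex h t) \<ge> \<bar>h\<bar>" using abs_Re_le_cmod[of "Complex h t"] by simp
  have "norm (complex_of_real (t powr (\<alpha> - 1)) * Complex h t powr (- of_real r)) = t powr (\<alpha> - 1) * norm (Complex h t) powr (- r)"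
    by (simp add: norm_mult norm_powr_real_powr')
  also have "\<dots> \<le> t powr (\<alpha> - 1) * \<bar>h\<bar> powr (- r)" using n assms by (intro mult_left_mono powr_mono2') auto
  also have "\<dots> \<le> t powr (\<alpha> - 1) * \<bar>h\<bar> powr (- r) * (exp 1 * exp (- 1 * t))"
  proof -
    have "1 \<le> exp 1 * exp (- 1 * t)" using t by (simp flip: exp_add)
    from mult_left_mono[OF this, of "t powr (\<alpha> - 1) * \<bar>h\<bar> powr (- r)"] show ?thesis by simp
  qed
  finally show "norm (complex_of_real (t powr (\<alpha> - 1)) * Complex h t powr (- of_real r)) \<le> \<bar>h\<bar> powr (- r) * exp 1 * t powr (\<alpha> - 1) * exp (- 1 * t)"
    by (simp add: mult_ac)
qed (use assms in auto)

text \<open>One factors h + it = i (t - i h), where t - i h lies in the right half-plane, so the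
  power splits off i^(-r); then s = t^\<alpha> is substituted.\<close>

lemma J_eq_Jint:
  assumes "\<alpha> > 0" "r \<ge> 0" "h \<noteq> 0"
  shows "(LINT t:{0<..<1}|lborel. complex_of_real (t powr (\<alpha> - 1)) * Complex h t powr (- of_real r)) =
    \<i> powr (- of_real r) / of_real \<alpha> * Jint \<alpha> r (- \<i> * of_real h)"
proof -
  define y where "y = - \<i> * complex_of_real h"
  have y: "y \<notin> \<real>\<^sub>\<le>\<^sub>0" using assms by (auto simp: y_def complex_nonpos_Reals_iff)
  define F where "F v = (of_real (v powr (1/\<alpha>)) + of_real 1 * y) powr (- of_real r)" for v :: real
  define G where "G t = complex_of_real (t powr (\<alpha> - 1)) * (of_real t + y) powr (- of_real r)" for t
  have "((\<lambda>t. (\<alpha> * t powr (\<alpha> - 1)) *\<^sub>R F (t powr \<alpha>)) has_integral (integral {0 powr \<alpha>..1 powr \<alpha>} F)) {0..1}"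
  proof (rule has_integral_substitution_strong[where s = "{0}" and c = 0 and d = 1])
    show "(\<lambda>t. t powr \<alpha>) ` {0..1} \<subseteq> {0..1}" using assms by (auto simp: powr_le1)
    show "continuous_on {0..1} F" unfolding F_def
      using Jint_domain[OF y] by (intro continuous_on_powr_slit continuous_intros continuous_on_root_powr assms) auto
    show "continuous_on {0..1} (\<lambda>t. t powr \<alpha>)" using continuous_on_root_powr[of "1/\<alpha>"] assms by simp
    show "((\<lambda>t. t powr \<alpha>) has_real_derivative \<alpha> * t powr (\<alpha> - 1)) (at t within {0..1})" if "t \<in> {0..1} - {0}" for t
      by (rule has_field_derivative_at_within, rule has_real_derivative_powr) (use that in auto)
  qed auto
  then have 1: "((\<lambda>t. (\<alpha> * t powr (\<alpha> - 1)) *\<^sub>R F (t powr \<alpha>)) has_integral Jint \<alpha> r y) {0..1}"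
    by (simp add: Jint_def F_def[abs_def])
  have FG: "(\<alpha> * t powr (\<alpha> - 1)) *\<^sub>R F (t powr \<alpha>) = of_real \<alpha> * G t" if "t \<in> {0..1}" for t
    using that assms by (simp add: F_def G_def powr_powr scaleR_conv_of_real)
  have "((\<lambda>t. of_real \<alpha> * G t) has_integral Jint \<alpha> r y) {0..1}"
    by (rule has_integral_eq[OF _ 1]) (use FG in auto)
  from has_integral_mult_right[OF this, of "\<i> powr (- of_real r) / of_real \<alpha>"]
  have "((\<lambda>t. \<i> powr (- of_real r) * G t) has_integral (\<i> powr (- of_real r) / of_real \<alpha> * Jint \<alpha> r y)) {0..1}"
    using assms by simp
  then have 2: "integral {0<..<1} (\<lambda>t. \<i> powr (- of_real r) * G t) = \<i> powr (- of_real r) / of_real \<alpha> * Jint \<alpha> r y"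
    unfolding integral_open_interval_real[symmetric] by (rule integral_unique)
  have eq: "complex_of_real (t powr (\<alpha> - 1)) * Complex h t powr (- of_real r) = \<i> powr (- of_real r) * G t" if t: "t \<in> {0<..<1}" for t
  proof -
    have "Complex h t = \<i> * (of_real t + y)" by (simp add: y_def Complex_eq algebra_simps)
    then have "Complex h t powr (- of_real r) = \<i> powr (- of_real r) * (of_real t + y) powr (- of_real r)"
      using powr_i_times[of "of_real t + y"] t by (simp add: y_def)
    then show ?thesis by (simp add: G_def)
  qed
  have "(LINT t:{0<..<1}|lborel. complex_of_real (t powr (\<alpha> - 1)) * Complex h t powr (- of_real r)) =
      integral {0<..<1} (\<lambda>t. complex_of_real (t powr (\<alpha> - 1)) * Complex h t powr (- of_real r))"
    by (rule set_borel_integral_eq_integral(2)[OF J_integrable[OF assms]])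
  also have "\<dots> = integral {0<..<1} (\<lambda>t. \<i> powr (- of_real r) * G t)" by (rule integral_cong[OF eq])
  also note 2
  finally show ?thesis by (simp add: y_def)
qed

lemma J_expansion:
  assumes "\<alpha> > 0" "r > 0" "\<alpha> - r > -1"
  obtains A S where "A \<noteq> 0" "smooth S" "\<And>h. h \<noteq> 0 \<Longrightarrow>
    (LINT t:{0<..<1}|lborel. complex_of_real (t powr (\<alpha> - 1)) * Complex h t powr (- of_real r)) = A * psi \<alpha> r h + S h"
proof -
  obtain A S where A: "A \<noteq> 0" and S: "S holomorphic_on {y. Re y > -1}"
    and J: "\<And>y. y \<in> slit \<Longrightarrow> Jint \<alpha> r y = A * chi (\<alpha> - r) y + S y"
    using Jint_expansion[OF assms] by blast
  define \<beta> where "\<beta> = \<alpha> - r"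
  define c where "c = \<i> powr (- of_real r) / of_real \<alpha>"
  have c: "c \<noteq> 0" using assms by (simp add: c_def)
  define k where "k = exp (- (of_real \<beta> * (\<i> * of_real pi / 2)))"
  \<comment> \<open>The smooth part: the holomorphic function evaluated at -i w together with the
    monomial produced by rotating the logarithm. Since Re (-i w) = Im w, the half-plane Im w > -1
    contains the real line.\<close>
  define F where "F w = c * S (- \<i> * w) + (- (c * A * (if \<beta> \<in> \<int> then k * (\<i> * of_real pi / 2) else 0))) * w ^ nat \<lfloor>\<beta>\<rfloor>" for w
  have "F holomorphic_on {w. Im w > -1}"
  proof -
    have "(S \<circ> (\<lambda>w. - \<i> * w)) holomorphic_on {w. Im w > -1}"
      by (rule holomorphic_on_compose_gen[OF _ S]) (auto intro!: holomorphic_intros)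
    then show ?thesis unfolding F_def[abs_def] comp_def by (intro holomorphic_intros)
  qed
  then have "smooth (\<lambda>h. F (of_real h))" by (rule smooth_holomorphic[rotated]) (auto intro: open_halfspace_Im_gt)
  moreover have "(LINT t:{0<..<1}|lborel. complex_of_real (t powr (\<alpha> - 1)) * Complex h t powr (- of_real r)) = (c * A * k) * psi \<alpha> r h + F (of_real h)"
    if h: "h \<noteq> 0" for h
  proof -
    have "- \<i> * of_real h \<in> slit" using h by (auto simp: slit_def complex_nonpos_Reals_iff)
    from J[OF this] have "(LINT t:{0<..<1}|lborel. complex_of_real (t powr (\<alpha> - 1)) * Complex h t powr (- of_real r)) =
        c * (A * chi \<beta> (- \<i> * of_real h) + S (- \<i> * of_real h))"
      using J_eq_Jint[of \<alpha> r h] assms h by (simp add: c_def \<beta>_def)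
    also have "chi \<beta> (- \<i> * of_real h) = k * psi \<alpha> r h - (if \<beta> \<in> \<int> then k * (\<i> * of_real pi / 2) * of_real h ^ nat \<lfloor>\<beta>\<rfloor> else 0)"
      using chi_rotate[OF h, of \<beta>] assms(3) by (simp add: k_def \<beta>_def chi_def psi_def)
    finally show ?thesis by (cases "\<beta> \<in> \<int>") (simp_all add: F_def algebra_simps)
  qed
  moreover have "c * A * k \<noteq> 0" using c A by (simp add: k_def)
  ultimately show ?thesis using that by blast
qed

section \<open>Smoothness of the integral over large heights\<close>

lemma decays_higher_deriv: "decays s g \<Longrightarrow> s \<ge> 0 \<Longrightarrow> decays (s + real k) ((deriv ^^ k) g)"
proof (induction k)
  case (Suc k)
  then have "decays (s + real k + 1) (deriv ((deriv ^^ k) g))" by (intro decays_deriv) auto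
  then show ?case by (simp add: add_ac)
qed auto

lemma upper_integral_deriv:
  assumes "decays s g" "s \<ge> 0"
  shows "((\<lambda>h. LINT t:{1..}|lborel. of_real (t powr (\<alpha> - 1)) * g (Complex (x0 + h) t)) has_vector_derivative
    (LINT t:{1..}|lborel. of_real (t powr (\<alpha> - 1)) * deriv g (Complex (x0 + h) t))) (at h)"
proof -
  \<comment> \<open>For t >= 1 the factor with exponent -s' is at most 1 and t^(\<alpha>-1) is at
    most t^|\<alpha>|, so one exponent serves for g and for its derivative.\<close>
  have bound: "\<exists>C d. d > 0 \<and> (\<forall>x t. t \<ge> 1 \<longrightarrow> norm (of_real (t powr (\<alpha> - 1)) * f (Complex x t)) \<le> C * (t powr ((\<bar>\<alpha>\<bar> + 1) - 1) * exp (- d * t)))"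
    if dec: "decays s' f" and "s' \<ge> 0" for s' f
  proof -
    obtain C d where C: "C > 0" "d > 0" and b: "\<And>z. z \<in> upper_half \<Longrightarrow> norm (f z) \<le> C * Im z powr (- s') * exp (- d * Im z)"
      using dec unfolding decays_def by blast
    have "norm (of_real (t powr (\<alpha> - 1)) * f (Complex x t)) \<le> C * (t powr ((\<bar>\<alpha>\<bar> + 1) - 1) * exp (- d * t))" if t: "t \<ge> 1" for x t
    proof -
      have "norm (of_real (t powr (\<alpha> - 1)) * f (Complex x t)) \<le> t powr (\<alpha> - 1) * (C * t powr (- s') * exp (- d * t))"
        unfolding norm_mult using b[of "Complex x t"] t by (simp add: upper_half_def mult_left_mono)
      also have "\<dots> = C * ((t powr (\<alpha> - 1) * t powr (- s')) * exp (- d * t))" by (simp only: mult_ac)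
      also have "t powr (\<alpha> - 1) * t powr (- s') = t powr (\<alpha> - 1 - s')" using t by (simp flip: powr_add)
      also have "C * (t powr (\<alpha> - 1 - s') * exp (- d * t)) \<le> C * (t powr ((\<bar>\<alpha>\<bar> + 1) - 1) * exp (- d * t))"
        using t C \<open>s' \<ge> 0\<close> by (intro mult_left_mono mult_right_mono powr_mono) auto
      finally show ?thesis .
    qed
    then show ?thesis using C by blast
  qed
  have wint: "set_integrable lborel {1..} (\<lambda>t. C * (t powr ((\<bar>\<alpha>\<bar> + 1) - 1) * exp (- d * t)))" if "d > 0" for C d :: real
  proof -
    have "set_integrable lborel {0<..} (\<lambda>t. C * (t powr ((\<bar>\<alpha>\<bar> + 1) - 1) * exp (- d * t)))"
      using set_integrable_powr_exp[of "\<bar>\<alpha>\<bar> + 1" d] that by (intro set_integrable_mult_right) auto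
    then show ?thesis by (rule set_integrable_subset) auto
  qed
  have cont: "continuous_on {1..} (\<lambda>t. of_real (t powr (\<alpha> - 1)) * f (Complex x t))" if "f holomorphic_on upper_half" for f :: "complex \<Rightarrow> complex" and x
  proof -
    have "continuous_on {1..} (\<lambda>t. f (Complex x t))"
      by (rule continuous_on_compose2[OF holomorphic_on_imp_continuous_on[OF that]])
        (auto simp: upper_half_def Complex_eq intro!: continuous_intros)
    then show ?thesis by (intro continuous_intros) auto
  qed
  have hol: "g holomorphic_on upper_half" using assms by (simp add: decays_def)
  have hol': "deriv g holomorphic_on upper_half" by (rule holomorphic_deriv[OF hol open_upper_half])
  obtain C1 d1 where d1: "d1 > 0" and b1: "\<And>x t. t \<ge> 1 \<Longrightarrow> norm (of_real (t powr (\<alpha> - 1)) * g (Complex x t)) \<le> C1 * (t powr ((\<bar>\<alpha>\<bar> + 1) - 1) * exp (- d1 * t))"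
    using bound[OF assms] by blast
  obtain C2 d2 where d2: "d2 > 0" and b2: "\<And>x t. t \<ge> 1 \<Longrightarrow> norm (of_real (t powr (\<alpha> - 1)) * deriv g (Complex x t)) \<le> C2 * (t powr ((\<bar>\<alpha>\<bar> + 1) - 1) * exp (- d2 * t))"
    using bound[OF decays_deriv[OF assms]] assms(2) by auto
  show ?thesis
  proof (rule has_vector_derivative_integral_dominated[where e = 1, OF _ _ _ _ wint[OF d2, of C2]])
    show "set_integrable lborel {1..} (\<lambda>t. of_real (t powr (\<alpha> - 1)) * g (Complex (x0 + h) t))" for h
      by (rule set_integrable_dominated[OF cont[OF hol] _ wint[OF d1, of C1]]) (use b1 in auto)
    show "set_borel_measurable lborel {1..} (\<lambda>t. of_real (t powr (\<alpha> - 1)) * deriv g (Complex (x0 + h) t))"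
      by (rule set_borel_measurable_continuous_on_interval[OF cont[OF hol']]) auto
    fix h' t :: real assume t: "t \<in> {1..}"
    show "norm (of_real (t powr (\<alpha> - 1)) * deriv g (Complex (x0 + h') t)) \<le> C2 * (t powr ((\<bar>\<alpha>\<bar> + 1) - 1) * exp (- d2 * t))"
      using b2 t by auto
    have "((\<lambda>h. Complex (x0 + h) t) has_vector_derivative 1) (at h')"
      unfolding Complex_eq by (auto intro!: derivative_eq_intros)
    moreover have "(g has_field_derivative deriv g (Complex (x0 + h') t)) (at (Complex (x0 + h') t))"
      by (rule holomorphic_derivI[OF hol open_upper_half]) (use t in \<open>simp add: upper_half_def\<close>)
    ultimately have "((\<lambda>h. g (Complex (x0 + h) t)) has_vector_derivative 1 * deriv g (Complex (x0 + h') t)) (at h')"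
      by (rule field_vector_diff_chain_at[unfolded comp_def])
    from has_vector_derivative_mult_right[OF this, of "of_real (t powr (\<alpha> - 1))"]
    show "((\<lambda>h. of_real (t powr (\<alpha> - 1)) * g (Complex (x0 + h) t)) has_vector_derivative of_real (t powr (\<alpha> - 1)) * deriv g (Complex (x0 + h') t)) (at h')"
      by simp
  qed simp
qed

lemma smooth_upper_integral:
  assumes "decays s g" "s \<ge> 0"
  shows "smooth (\<lambda>h. LINT t:{1..}|lborel. of_real (t powr (\<alpha> - 1)) * g (Complex (x0 + h) t))"
  unfolding smooth_def
proof (intro exI[of _ "\<lambda>k h. LINT t:{1..}|lborel. of_real (t powr (\<alpha> - 1)) * (deriv ^^ k) g (Complex (x0 + h) t)"] conjI allI)
  fix k h
  show "((\<lambda>h. LINT t:{1..}|lborel. of_real (t powr (\<alpha> - 1)) * (deriv ^^ k) g (Complex (x0 + h) t)) has_vector_derivative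
      (LINT t:{1..}|lborel. of_real (t powr (\<alpha> - 1)) * (deriv ^^ Suc k) g (Complex (x0 + h) t))) (at h)"
    using upper_integral_deriv[OF decays_higher_deriv[OF assms, of k], of \<alpha> x0 h] assms(2) by simp
qed simp

context modular
begin

definition const_term :: "rmat \<Rightarrow> complex" where
  "const_term \<tau> = (if fkappa (slash r f \<tau>) > 0 then 0 else fcoeff (slash r f \<tau>) 0)"

definition tail_part :: "rmat \<Rightarrow> complex \<Rightarrow> complex" where
  "tail_part \<tau> z = slash r f \<tau> z - const_term \<tau>"

lemma const_term_eq: "const_term \<tau> = cusp_value r f \<tau>"
  by (simp add: const_term_def cusp_value_def cuspidal_at_def)

lemma alpha0_pos: "alpha0 \<Gamma> r f > 0"
  using r by (simp add: alpha0_def)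

lemma tail_fourier_exp:
  assumes "scaling_matrix \<Gamma> \<a> \<tau>"
  shows "fourier_exp (if fkappa (slash r f \<tau>) > 0 then fkappa (slash r f \<tau>) else 1)
      (if fkappa (slash r f \<tau>) > 0 then fcoeff (slash r f \<tau>) else (\<lambda>n. fcoeff (slash r f \<tau>) (Suc n))) (tail_part \<tau>)"
  using has_fexp_fourier_exp[OF slash_has_fexp[OF assms]] unfolding tail_part_def[abs_def] const_term_def .

lemma tail_decays:
  assumes "scaling_matrix \<Gamma> \<a> \<tau>"
  shows "decays (alpha0 \<Gamma> r f) (tail_part \<tau>)"
proof -
  obtain C where C: "\<And>z. 0 < Im z \<Longrightarrow> Im z < 1 \<Longrightarrow> norm (slash r f \<tau> z) \<le> C * Im z powr (- alpha0 \<Gamma> r f)"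
    using slash_growth[OF assms] by blast
  have d: "rdet \<tau> = 1" using scaling_matrixE[OF assms] by metis
  show ?thesis
  proof (rule decaysI[OF tail_fourier_exp[OF assms]])
    show "tail_part \<tau> holomorphic_on upper_half"
      unfolding tail_part_def[abs_def] by (intro holomorphic_intros slash_holomorphic d)
    show "alpha0 \<Gamma> r f \<ge> 0" using alpha0_pos by simp
    fix z assume z: "0 < Im z" "Im z < 1"
    have "1 = 1 powr (- alpha0 \<Gamma> r f)" by simp
    also have "\<dots> \<le> Im z powr (- alpha0 \<Gamma> r f)" using z alpha0_pos by (intro powr_mono2') auto
    finally have "norm (const_term \<tau>) * 1 \<le> norm (const_term \<tau>) * Im z powr (- alpha0 \<Gamma> r f)" by (intro mult_left_mono) auto
    then show "norm (tail_part \<tau> z) \<le> (C + norm (const_term \<tau>)) * Im z powr (- alpha0 \<Gamma> r f)"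
      using C[OF z] norm_triangle_ineq4[of "slash r f \<tau> z" "const_term \<tau>"] by (simp add: tail_part_def distrib_right)
  qed
qed

lemma frac_sigma_integral:
  assumes "scaling_matrix \<Gamma> \<a> \<tau>" "\<alpha> > alpha0 \<Gamma> r f"
  shows "frac_sigma r f \<tau> \<alpha> x = of_real ((2 * pi) powr \<alpha> / Gamma \<alpha>) *
    (LINT t:{0<..}|lborel. of_real (t powr (\<alpha> - 1)) * tail_part \<tau> (Complex x t))"
proof -
  define \<kappa> where "\<kappa> = fkappa (slash r f \<tau>)"
  define a where "a = fcoeff (slash r f \<tau>)"
  define F where "F n = (if real n + \<kappa> > 0 then a n * of_real ((real n + \<kappa>) powr (- \<alpha>)) *
              exp (2 * of_real pi * \<i> * of_real ((real n + \<kappa>) * x)) else 0)" for n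
  have \<kappa>0: "\<kappa> \<ge> 0" using slash_has_fexp[OF assms(1)] by (simp add: has_fexp_def \<kappa>_def)
  have q: "exp (2 * of_real pi * \<i> * of_real (\<nu> * x)) = qchar \<nu> (of_real x)" for \<nu>
    by (simp add: qchar_def mult.assoc)
  define V where "V = of_real ((2 * pi) powr \<alpha> / Gamma \<alpha>) * (LINT t:{0<..}|lborel. of_real (t powr (\<alpha> - 1)) * tail_part \<tau> (Complex x t))"
  note S = fractional_series_sums[OF tail_fourier_exp[OF assms(1)] tail_decays[OF assms(1)] less_imp_le[OF alpha0_pos] assms(2), of x,
      folded V_def \<kappa>_def a_def]
  have "F sums V"
  proof (cases "\<kappa> > 0")
    case True
    then have "F = (\<lambda>n. a n * of_real ((real n + \<kappa>) powr (- \<alpha>)) * qchar (real n + \<kappa>) (of_real x))"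
      unfolding F_def q using True by (intro ext) (simp only: add_nonneg_pos[OF of_nat_0_le_iff] if_True)
    then show ?thesis using S[unfolded if_P[OF True]] by (simp only:)
  next
    case False
    then have \<kappa>: "\<kappa> = 0" using \<kappa>0 by simp
    have "F (Suc n) = a (Suc n) * of_real ((real n + 1) powr (- \<alpha>)) * qchar (real n + 1) (of_real x)" for n
      unfolding F_def q \<kappa> by (simp add: add.commute)
    then have "(\<lambda>n. F (Suc n)) sums V" using S False by simp
    \<comment> \<open>For \<kappa> = 0 the term with n = 0 is set to zero by the case distinction in
      the series, so the re-indexing changes no value.\<close>
    then have "F sums (V + F 0)" by (rule sums_Suc)
    then show ?thesis by (simp add: F_def \<kappa>)
  qed
  then have "suminf F = V" by (rule sums_unique[symmetric])
  then show ?thesis unfolding frac_sigma_def Let_def V_def F_def \<kappa>_def a_def .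
qed

lemma scaling_matrix_infinity: "scaling_matrix \<Gamma> CInf (eta (width \<Gamma> CInf))" "width \<Gamma> CInf > 0"
proof -
  have c: "cusp_act iid CInf = CInf" "bottom_ok iid" by (simp_all add: iid_def)
  have "rmult (of_imat iid) (eta m) = eta m" for m by (simp add: iid_def eta_def)
  then show "scaling_matrix \<Gamma> CInf (eta (width \<Gamma> CInf))"
    unfolding scaling_matrix_def using SL2Z_closed(3) c by metis
  show "width \<Gamma> CInf > 0" using translation_width(2)[OF fi SL2Z_closed(3)] c(1) by simp
qed

end

lemma decays_scale:
  assumes "decays s G" "m > 0"
  shows "decays s (\<lambda>z. G (z / of_real m))"
proof -
  obtain C d where C: "C > 0" "d > 0" and hol: "G holomorphic_on upper_half"
    and b: "\<And>z. z \<in> upper_half \<Longrightarrow> norm (G z) \<le> C * Im z powr (- s) * exp (- d * Im z)"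
    using assms(1) by (auto simp: decays_def)
  have up: "z / of_real m \<in> upper_half" if "z \<in> upper_half" for z
    using that assms(2) by (simp add: upper_half_def)
  have "(G \<circ> (\<lambda>z. z / of_real m)) holomorphic_on upper_half"
    by (rule holomorphic_on_compose_gen[OF _ hol]) (use up assms(2) in \<open>auto intro!: holomorphic_intros\<close>)
  moreover have "norm (G (z / of_real m)) \<le> (C * (1 / m) powr (- s)) * Im z powr (- s) * exp (- (d / m) * Im z)"
    if z: "z \<in> upper_half" for z
  proof -
    have "(Im z / m) powr (- s) = (1 / m) powr (- s) * Im z powr (- s)"
      using z assms(2) powr_mult[of "1 / m" "Im z" "- s"] by (simp add: upper_half_def)
    then show ?thesis using b[OF up[OF z]] by (simp add: mult_ac)
  qed
  moreover have "C * (1 / m) powr (- s) > 0" "d / m > 0" using C assms(2) by auto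
  ultimately show ?thesis unfolding decays_def comp_def by blast
qed

lemma powr_inverse_scaled:
  assumes "c > 0" "Im u > 0"
  shows "(1 / (of_real c * u)) powr of_real r = of_real (c powr (- r)) * u powr (- of_real r)"
proof -
  have u: "u \<notin> \<real>\<^sub>\<le>\<^sub>0" "u \<noteq> 0" using assms by (auto simp: complex_nonpos_Reals_iff)
  have "Ln (of_real (1 / c) * inverse u) = of_real (ln (1 / c)) + Ln (inverse u)"
    using assms u Ln_times_of_real[of "1 / c" "inverse u"] by (simp add: Ln_of_real del: of_real_divide)
  moreover have "1 / (of_real c * u) = of_real (1 / c) * inverse u" by (simp add: field_simps)
  ultimately have L: "Ln (1 / (of_real c * u)) = - of_real (ln c) - Ln u"
    using assms Ln_inverse[OF u(1)] by (simp only:) (simp add: ln_div)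
  have "(1 / (of_real c * u)) powr of_real r = exp (of_real r * Ln (1 / (of_real c * u)))"
    using assms u by (simp add: powr_def)
  also have "\<dots> = exp (of_real (- r * ln c)) * exp (- of_real r * Ln u)"
    unfolding L exp_add[symmetric] by (rule arg_cong[where f = exp]) (simp add: algebra_simps)
  finally show ?thesis unfolding exp_of_real using assms u by (simp add: powr_def)
qed

context modular
begin

text \<open>At a finite cusp the normalisation of the bottom row gives C < 0. Hence Cz + D = 1 / (c
  u) with c = -C > 0, and a positive multiple of 1/u has a principal power that splits without a
  phase.\<close>

lemma slash_inversion:
  assumes "scaling_matrix \<Gamma> (CQ x0) \<sigma>"
  obtains c e where "c > 0"
    "\<And>u. Im u > 0 \<Longrightarrow> f (of_real (of_rat x0) + u) =
      of_real (c powr (- r)) * u powr (- of_real r) * slash r f \<sigma> (of_real e - 1 / (of_real (c\<^sup>2) * u))"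
    "\<And>h. h \<noteq> 0 \<Longrightarrow> rinv_act \<sigma> (of_rat x0 + h) = e - 1 / (c\<^sup>2 * h)"
proof -
  obtain \<gamma> m where \<gamma>: "\<gamma> \<in> SL2Z" "m > 0" "\<sigma> = rmult (of_imat \<gamma>) (eta m)" "rdet \<sigma> = 1" "CQ x0 = cusp_act \<gamma> CInf" "bottom_ok \<gamma>"
    using scaling_matrixE[OF assms] by metis
  obtain a' b' c' d' where g: "\<gamma> = IM a' b' c' d'" by (cases \<gamma>)
  have c': "c' < 0" "x0 = of_int a' / of_int c'" using \<gamma>(5,6) by (auto simp: g split: if_splits)
  obtain A B C D where S: "\<sigma> = RM A B C D" by (cases \<sigma>)
  have AC: "A = of_int a' * sqrt m" "C = of_int c' * sqrt m" using \<gamma>(3) by (simp_all add: g S eta_def)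
  have C: "C < 0" using c' \<gamma>(2) by (simp add: AC mult_neg_pos)
  have x0: "real_of_rat x0 = A / C" using \<gamma>(2) by (simp add: c'(2) AC of_rat_divide)
  have det: "A * D - B * C = 1" using \<gamma>(4) by (simp add: S)
  show ?thesis
  proof (rule that[of "- C" "- D / C"])
    show "- C > 0" using C by simp
    show "rinv_act \<sigma> (of_rat x0 + h) = - D / C - 1 / ((- C)\<^sup>2 * h)" if "h \<noteq> 0" for h
    proof -
      have "- C * (A / C + h) + A = - (C * h)" "D * (A / C + h) - B = 1 / C + D * h"
        using C det by (simp_all add: field_simps)
      then have "rinv_act \<sigma> (of_rat x0 + h) = (1 / C + D * h) / (- (C * h))" by (simp only: S rinv_act.simps x0)
      then show ?thesis using C that by (simp add: field_simps power2_eq_square)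
    qed
    fix u :: complex assume u: "Im u > 0"
    define z where "z = of_real (- D / C) - 1 / (of_real ((- C)\<^sup>2) * u)"
    have u0: "u \<noteq> 0" "complex_of_real C \<noteq> 0" using u C by auto
    have det': "of_real A * of_real D - of_real B * of_real C = (1 :: complex)"
      using arg_cong[OF det, of complex_of_real] by simp
    have j: "of_real C * z + of_real D = 1 / (of_real (- C) * u)"
      using u0 by (simp add: z_def field_simps power2_eq_square)
    have "of_real A * z + of_real B = (of_real A / of_real C + u) * (1 / (of_real (- C) * u))"
    proof -
      have "of_real A * z + of_real B = - ((of_real A * of_real D - of_real B * of_real C) / of_real C) - of_real A / ((of_real C)\<^sup>2 * u)"
        using u0 by (simp add: z_def field_simps power2_eq_square)
      also have "\<dots> = (of_real A / of_real C + u) * (1 / (of_real (- C) * u))"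
        unfolding det' using u0 by (simp add: field_simps power2_eq_square)
      finally show ?thesis .
    qed
    then have "moeb \<sigma> z = of_real (of_rat x0) + u"
      using u0 by (simp add: S j x0)
    then have "slash r f \<sigma> z = f (of_real (of_rat x0) + u) / (of_real ((- C) powr (- r)) * u powr (- of_real r))"
      using powr_inverse_scaled[of "- C" u r] u C j by (simp add: slash_def \<gamma>(4)) (simp add: S)
    then show "f (of_real (of_rat x0) + u) = of_real ((- C) powr (- r)) * u powr (- of_real r) *
      slash r f \<sigma> (of_real (- D / C) - 1 / (of_real ((- C)\<^sup>2) * u))"
      unfolding z_def[symmetric] using u0 C by simp
  qed
qed

lemma slash_eta:
  assumes "m > 0"
  shows "f z = of_real ((1 / sqrt m) powr r) * slash r f (eta m) (z / of_real m)"
proof -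
  have "slash r f (eta m) (z / of_real m) = f z / of_real ((1 / sqrt m) powr r)"
    using assms by (simp add: slash_def rdet_eta moeb_eta jfac_jden) (simp add: eta_def powr_of_real flip: of_real_divide)
  then show ?thesis using assms by simp
qed

lemma frac_int_integral:
  assumes "\<alpha> > alpha0 \<Gamma> r f"
  defines "m \<equiv> real (width \<Gamma> CInf)" and "\<tau> \<equiv> eta (width \<Gamma> CInf)"
  shows "frac_int \<Gamma> r f \<alpha> x = of_real ((2 * pi) powr \<alpha> / Gamma \<alpha> * m powr (- \<alpha>)) *
    (LINT t:{0<..}|lborel. of_real (t powr (\<alpha> - 1)) * tail_part \<tau> (Complex x t / of_real m))"
proof -
  have m: "m > 0" using scaling_matrix_infinity(2) by (simp add: m_def)
  have "(LINT t:{0<..}|lborel. complex_of_real (t powr (\<alpha> - 1)) * tail_part \<tau> (Complex (x / m) t)) =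
      of_real (1 / m) * (LINT u:{0<..}|lborel. of_real ((u / m) powr (\<alpha> - 1)) * tail_part \<tau> (Complex (x / m) (u / m)))"
    by (rule LINT_scale[OF m])
  also have "(LINT u:{0<..}|lborel. of_real ((u / m) powr (\<alpha> - 1)) * tail_part \<tau> (Complex (x / m) (u / m))) =
      (LINT u:{0<..}|lborel. of_real (m powr (1 - \<alpha>)) * (of_real (u powr (\<alpha> - 1)) * tail_part \<tau> (Complex x u / of_real m)))"
  proof (rule set_lebesgue_integral_cong)
    show "\<forall>u. u \<in> {0<..} \<longrightarrow> complex_of_real ((u / m) powr (\<alpha> - 1)) * tail_part \<tau> (Complex (x / m) (u / m)) =
        of_real (m powr (1 - \<alpha>)) * (of_real (u powr (\<alpha> - 1)) * tail_part \<tau> (Complex x u / of_real m))"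
    proof (intro allI impI)
      fix u :: real assume "u \<in> {0<..}"
      then have "(u / m) powr (\<alpha> - 1) = m powr (1 - \<alpha>) * u powr (\<alpha> - 1)"
        using m by (simp add: powr_divide powr_diff field_simps)
      moreover have "Complex (x / m) (u / m) = Complex x u / of_real m" by (simp add: complex_eq_iff)
      ultimately show "complex_of_real ((u / m) powr (\<alpha> - 1)) * tail_part \<tau> (Complex (x / m) (u / m)) =
        of_real (m powr (1 - \<alpha>)) * (of_real (u powr (\<alpha> - 1)) * tail_part \<tau> (Complex x u / of_real m))" by simp
    qed
  qed simp
  also have "\<dots> = of_real (m powr (1 - \<alpha>)) * (LINT u:{0<..}|lborel. of_real (u powr (\<alpha> - 1)) * tail_part \<tau> (Complex x u / of_real m))"
    by (rule set_integral_mult_right)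
  also have "of_real (1 / m) * (of_real (m powr (1 - \<alpha>)) * (LINT u:{0<..}|lborel. of_real (u powr (\<alpha> - 1)) * tail_part \<tau> (Complex x u / of_real m)))
     = of_real (m powr (- \<alpha>)) * (LINT u:{0<..}|lborel. complex_of_real (u powr (\<alpha> - 1)) * tail_part \<tau> (Complex x u / of_real m))"
  proof -
    have "m powr (1 - \<alpha>) = m powr 1 * m powr (- \<alpha>)" by (subst powr_add[symmetric]) simp
    then show ?thesis using m by simp
  qed
  finally have *: "(LINT t:{0<..}|lborel. complex_of_real (t powr (\<alpha> - 1)) * tail_part \<tau> (Complex (x / m) t)) =
     of_real (m powr (- \<alpha>)) * (LINT u:{0<..}|lborel. complex_of_real (u powr (\<alpha> - 1)) * tail_part \<tau> (Complex x u / of_real m))" .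
  have "frac_int \<Gamma> r f \<alpha> x = frac_sigma r f \<tau> \<alpha> (x / m)" by (simp add: frac_int_def \<tau>_def m_def Let_def)
  also have "\<dots> = of_real ((2 * pi) powr \<alpha> / Gamma \<alpha>) *
    (LINT t:{0<..}|lborel. of_real (t powr (\<alpha> - 1)) * tail_part \<tau> (Complex (x / m) t))"
    unfolding \<tau>_def by (rule frac_sigma_integral[OF scaling_matrix_infinity(1) assms(1)])
  finally show ?thesis unfolding * by (simp add: mult.assoc)
qed

end

context inversion
begin

text \<open>The prefactor has order 2\<alpha> - r and \<open>Rem\<close> contributes one more power
  of |h|; this product is the only part of the error that is not smooth at the cusp.\<close>

lemma scaled_Rem_regularity:
  fixes k :: complex and x0 :: real
  assumes "smooth S"
  defines "E \<equiv> \<lambda>x. S (x - x0) + (if x = x0 then 0 else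
    k * (of_real (\<bar>x - x0\<bar> powr (2 * \<alpha>)) * of_real (x - x0) powr (- of_real r)) * Rem (x - x0))"
    and "\<omega> \<equiv> 2 * \<alpha> - r + 1"
  assumes "\<omega> > 0"
  shows "C10 (- {x0}) E" "Cs_at \<omega> x0 E"
proof -
  define p where "p h = of_real (\<bar>h\<bar> powr (2 * \<alpha>)) * complex_of_real h powr (- of_real r)" for h
  obtain C where C: "C \<ge> 0" "\<And>h. \<bar>h\<bar> \<le> 1 \<Longrightarrow> norm (Rem h) \<le> C * \<bar>h\<bar>" using Rem_bound by blast
  obtain R' where R: "\<And>h. h \<noteq> 0 \<Longrightarrow> (Rem has_vector_derivative R' h) (at h)" "continuous_on (- {0}) R'"
    using Rem_C1 by blast
  define Q where "Q h = k * p h * Rem h" for h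
  define p' where "p' h = of_real ((2 * \<alpha> - r) / h) * p h" for h
  define Q' where "Q' h = k * (p h * R' h + p' h * Rem h)" for h
  have dp: "(p has_vector_derivative p' h) (at h)" if "h \<noteq> 0" for h
    using abs_powr_times_powr_deriv[OF that, of "2 * \<alpha>" r] unfolding p_def[abs_def] p'_def .
  have dQ: "(Q has_vector_derivative Q' h) (at h)" if "h \<noteq> 0" for h
    using has_vector_derivative_mult_right[OF has_vector_derivative_mult[OF dp[OF that] R(1)[OF that]], of k]
    by (simp add: Q_def[abs_def] Q'_def mult.assoc)
  have contR: "continuous_on (- {0}) Rem" and contp: "continuous_on (- {0}) p"
    using R(1) dp by (auto intro!: continuous_at_imp_continuous_on has_vector_derivative_continuous)
  have "continuous_on (- {0}) p'" unfolding p'_def by (intro continuous_intros contp) auto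
  then have cQ: "continuous_on (- {0}) Q'" unfolding Q'_def by (intro continuous_intros contp contR R(2))
  have Qb: "norm (Q h) \<le> (norm k * C) * \<bar>h\<bar> powr \<omega>" if h: "h \<noteq> 0" "\<bar>h\<bar> \<le> 1" for h
  proof -
    have "norm (p h) = \<bar>h\<bar> powr (2 * \<alpha>) * \<bar>h\<bar> powr (- r)"
      by (simp add: p_def norm_mult norm_powr_real_powr')
    then have "norm (p h) = \<bar>h\<bar> powr (2 * \<alpha> - r)" by (simp flip: powr_add)
    then have "norm (Q h) \<le> norm k * \<bar>h\<bar> powr (2 * \<alpha> - r) * (C * \<bar>h\<bar>)"
      unfolding Q_def norm_mult using C(2)[OF h(2)] by (intro mult_mono) auto
    also have "\<dots> = (norm k * C) * (\<bar>h\<bar> powr (2 * \<alpha> - r) * \<bar>h\<bar> powr 1)" using h by (simp add: mult_ac)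
    also have "\<bar>h\<bar> powr (2 * \<alpha> - r) * \<bar>h\<bar> powr 1 = \<bar>h\<bar> powr \<omega>" unfolding \<omega>_def by (rule powr_add[symmetric])
    finally show ?thesis .
  qed
  have "E = (\<lambda>x. S (x - x0) + (if x = x0 then 0 else Q (x - x0)))" unfolding E_def Q_def p_def ..
  with error_term_regularity[OF assms(1) \<open>\<omega> > 0\<close> dQ cQ Qb, of x0]
  show "C10 (- {x0}) E" "Cs_at \<omega> x0 E" by simp_all
qed

end


context modular
begin

text \<open>The form is compared at two cusps: at infinity it defines the integral on the left, at
  x0 it defines the local model. The two constant terms differ and must be moved across the identity
  for \<open>K\<close>.\<close>

lemma cusp_expansion:
  assumes \<alpha>: "\<alpha> > alpha0 \<Gamma> r f" and \<sigma>: "scaling_matrix \<Gamma> (CQ x0) \<sigma>"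
  shows "\<exists>(A::complex) (B::real) (E::real \<Rightarrow> complex). A \<noteq> 0 \<and> B > 0 \<and>
     (\<forall>x. x \<noteq> of_rat x0 \<longrightarrow>
        frac_int \<Gamma> r f \<alpha> x =
          A * \<i> powr (- of_real \<alpha>) * cusp_value r f \<sigma> * psi \<alpha> r (x - of_rat x0)
          + of_real (B * \<bar>x - of_rat x0\<bar> powr (2 * \<alpha>)) * of_real (x - of_rat x0) powr (- of_real r)
            * frac_sigma r f \<sigma> \<alpha> (rinv_act \<sigma> x)
          + E x) \<and>
     C10 (- {of_rat x0}) E \<and>
     Cs_at (2 * \<alpha> - r + 1) (of_rat x0) E"
proof -
  define X where "X = real_of_rat x0"
  define s where "s = alpha0 \<Gamma> r f"
  define m where "m = real (width \<Gamma> CInf)"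
  define \<tau> where "\<tau> = eta (width \<Gamma> CInf)"
  define j where "j = (1 / sqrt m) powr r"
  define b where "b = const_term \<sigma>"
  define g where "g z = tail_part \<tau> (z / of_real m)" for z
  have m: "m > 0" using scaling_matrix_infinity(2) by (simp add: m_def)
  have j: "j > 0" using m by (simp add: j_def)
  have s: "s > 0" "s < \<alpha>" "s \<ge> r / 2" using alpha0_pos \<alpha> r by (simp_all add: s_def alpha0_def)
  have a0: "\<alpha> > 0" "2 * \<alpha> - r + 1 > 0" using s by simp_all
  have dg: "decays s g" unfolding g_def[abs_def] s_def \<tau>_def
    by (rule decays_scale[OF tail_decays[OF scaling_matrix_infinity(1)] m])
  obtain c e where c: "c > 0"
    and inv: "\<And>u. Im u > 0 \<Longrightarrow> f (of_real X + u) =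
      of_real (c powr (- r)) * u powr (- of_real r) * slash r f \<sigma> (of_real e - 1 / (of_real (c\<^sup>2) * u))"
    and act: "\<And>h. h \<noteq> 0 \<Longrightarrow> rinv_act \<sigma> (X + h) = e - 1 / (c\<^sup>2 * h)"
    using slash_inversion[OF \<sigma>, folded X_def] by blast
  define l where "l = c powr (- r)"
  have l: "l > 0" using c by (simp add: l_def)
  interpret I: inversion "c\<^sup>2" e r s \<alpha> "tail_part \<sigma>"
    using c r s tail_decays[OF \<sigma>] by unfold_locales (simp_all add: s_def)
  define a where "a = of_real j * const_term \<tau>"
  \<comment> \<open>Both expressions for f(x0 + u) are equated. The constant a from infinity yields
    a constant integral, hence smooth; the constant b at the cusp meets u^(-r) and produces
    \<psi>.\<close>
  have K: "I.K u = of_real (j / l) * g (of_real X + u) - b * u powr (- of_real r) + a / of_real l" if "Im u > 0" for u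
  proof -
    have "of_real j * g (of_real X + u) + a = f (of_real X + u)"
      using slash_eta[of "width \<Gamma> CInf" "of_real X + u"] scaling_matrix_infinity(2)
      by (simp add: g_def tail_part_def a_def \<tau>_def j_def m_def algebra_simps)
    also have "\<dots> = of_real l * (I.K u + b * u powr (- of_real r))"
      unfolding inv[OF that] by (simp add: I.K_def I.winv_def tail_part_def b_def l_def algebra_simps)
    finally have "I.K u + b * u powr (- of_real r) = (of_real j * g (of_real X + u) + a) / of_real l"
      using l by simp
    then show ?thesis by (simp add: add_divide_distrib eq_diff_eq[symmetric] mult.commute[of b])
  qed
  define P where "P = (LINT t:{0<..<1}|lborel. complex_of_real (t powr (\<alpha> - 1)))"
  define J where "J h = (LINT t:{0<..<1}|lborel. complex_of_real (t powr (\<alpha> - 1)) * Complex h t powr (- of_real r))" for h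
  define V where "V h = (LINT t:{0<..<1}|lborel. complex_of_real (t powr (\<alpha> - 1)) * g (Complex (X + h) t))" for h
  define T where "T h = (LINT t:{1..}|lborel. complex_of_real (t powr (\<alpha> - 1)) * g (Complex (X + h) t))" for h
  have gint: "set_integrable lborel {0<..} (\<lambda>t. complex_of_real (t powr (\<alpha> - 1)) * g (Complex x t))" for x
    by (rule decays_integrable[OF dg s(2)])
  have gint01: "set_integrable lborel {0<..<1} (\<lambda>t. complex_of_real (t powr (\<alpha> - 1)) * g (Complex x t))" for x
    by (rule set_integrable_subset[OF gint]) auto
  have split: "(LINT t:{0<..}|lborel. complex_of_real (t powr (\<alpha> - 1)) * g (Complex (X + h) t)) = V h + T h" for h
  proof -
    have un: "{0<..} = {0<..<1} \<union> {1::real..}" by auto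
    have "set_integrable lborel {1..} (\<lambda>t. complex_of_real (t powr (\<alpha> - 1)) * g (Complex (X + h) t))"
      by (rule set_integrable_subset[OF gint]) auto
    then show ?thesis unfolding V_def T_def un using gint01 by (intro set_integral_Un) auto
  qed
  have KV: "(LINT t:{0<..<1}|lborel. complex_of_real (t powr (\<alpha> - 1)) * I.K (Complex h t)) =
      of_real (j / l) * V h - b * J h + a / of_real l * P" if h: "h \<noteq> 0" for h
  proof -
    have "(LINT t:{0<..<1}|lborel. complex_of_real (t powr (\<alpha> - 1)) * I.K (Complex h t)) =
      (LINT t:{0<..<1}|lborel. of_real (j / l) * (complex_of_real (t powr (\<alpha> - 1)) * g (Complex (X + h) t))
        - b * (complex_of_real (t powr (\<alpha> - 1)) * Complex h t powr (- of_real r)) + a / of_real l * complex_of_real (t powr (\<alpha> - 1)))"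
    proof (rule set_lebesgue_integral_cong)
      show "\<forall>t. t \<in> {0<..<1} \<longrightarrow> complex_of_real (t powr (\<alpha> - 1)) * I.K (Complex h t) =
        of_real (j / l) * (complex_of_real (t powr (\<alpha> - 1)) * g (Complex (X + h) t))
        - b * (complex_of_real (t powr (\<alpha> - 1)) * Complex h t powr (- of_real r)) + a / of_real l * complex_of_real (t powr (\<alpha> - 1))"
      proof (intro allI impI)
        fix t :: real assume "t \<in> {0<..<1}"
        then have "Im (Complex h t) > 0" by simp
        moreover have "of_real X + Complex h t = Complex (X + h) t" by (simp add: complex_eq_iff)
        ultimately show "complex_of_real (t powr (\<alpha> - 1)) * I.K (Complex h t) =
        of_real (j / l) * (complex_of_real (t powr (\<alpha> - 1)) * g (Complex (X + h) t))
        - b * (complex_of_real (t powr (\<alpha> - 1)) * Complex h t powr (- of_real r)) + a / of_real l * complex_of_real (t powr (\<alpha> - 1))"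
          using K[of "Complex h t"] by (simp only:) (simp only: ring_distribs mult_ac)
      qed
    qed simp
    also have "\<dots> = of_real (j / l) * V h - b * J h + a / of_real l * P"
    proof -
      have i1: "set_integrable lborel {0<..<1} (\<lambda>t. of_real (j / l) * (complex_of_real (t powr (\<alpha> - 1)) * g (Complex (X + h) t)))"
        using gint01 by (rule set_integrable_mult_right)
      have i2: "set_integrable lborel {0<..<1} (\<lambda>t. b * (complex_of_real (t powr (\<alpha> - 1)) * Complex h t powr (- of_real r)))"
        using J_integrable[OF a0(1) less_imp_le[OF r] h] by (rule set_integrable_mult_right)
      have i3: "set_integrable lborel {0<..<1} (\<lambda>t. a / of_real l * complex_of_real (t powr (\<alpha> - 1)))"
        using power_integrable_unit[OF a0(1)] by (rule set_integrable_mult_right)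
      show ?thesis unfolding V_def J_def P_def set_integral_mult_right[symmetric]
        using set_integral_add(2)[OF set_integral_diff(1)[OF i1 i2] i3] set_integral_diff(2)[OF i1 i2] by simp
    qed
    finally show ?thesis .
  qed
  obtain S1 where S1: "smooth S1" and KE: "\<And>h. h \<noteq> 0 \<Longrightarrow> (LINT t:{0<..<1}|lborel. of_real (t powr (\<alpha> - 1)) * I.K (Complex h t)) =
    of_real ((c\<^sup>2) powr \<alpha> * \<bar>h\<bar> powr (2 * \<alpha>)) * of_real h powr (- of_real r) * (I.Main h + I.Rem h) + S1 h"
    using I.local_expansion by blast
  obtain A1 S2 where A1: "A1 \<noteq> 0" and S2: "smooth S2" and JE: "\<And>h. h \<noteq> 0 \<Longrightarrow> b * J h = A1 * b * psi \<alpha> r h + S2 h"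
  proof (cases "b = 0")
    case True
    \<comment> \<open>The \<psi> term is zero and any nonzero constant will do. Here \<alpha> may be
      only slightly above r/2, so the condition \<alpha> - r > -1 of \<open>J_expansion\<close>
      cannot be relied on.\<close>
    show ?thesis by (rule that[of 1 "\<lambda>_. 0"]) (simp_all add: True smooth_const)
  next
    case False
    \<comment> \<open>A nonzero value at one cusp forces \<alpha>0 = r, so \<alpha> - r is positive
      and the expansion of the singular integral applies.\<close>
    then have "\<not> cusp_form \<Gamma> r f"
      using \<sigma> unfolding b_def const_term_eq cusp_value_def cusp_form_def by metis
    then have "\<alpha> - r > -1" using \<alpha> by (simp add: alpha0_def)
    from J_expansion[OF a0(1) r this] obtain A S where "A \<noteq> 0" "smooth S" "\<And>h. h \<noteq> 0 \<Longrightarrow> J h = A * psi \<alpha> r h + S h"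
      unfolding J_def by blast
    then show ?thesis by (intro that[of A "\<lambda>h. b * S h"] smooth_cmult) (simp_all add: algebra_simps)
  qed
  define k where "k = (2 * pi) powr \<alpha> / Gamma \<alpha>"
  define n where "n = m powr (- \<alpha>) * (l / j)"
  \<comment> \<open>The Gamma factor k is absent because it is already contained in
    \<open>frac_sigma\<close>; n collects m^(-\<alpha>) from rescaling the Mellin integral and l / j
    from passing between f and its two slashed forms.\<close>
  define B where "B = n * (c\<^sup>2) powr \<alpha>"
  have k: "k > 0" using a0 by (simp add: k_def Gamma_real_pos)
  have n: "n > 0" using m l j by (simp add: n_def)
  have B: "B > 0" using n c by (simp add: B_def)
  \<comment> \<open>Division by i^(-\<alpha>) compensates the factor displayed in the expansion;
    here the Gamma factor k does remain.\<close>
  define A where "A = of_real (k * n) * A1 / \<i> powr (- of_real \<alpha>)"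
  have A: "A \<noteq> 0" using k n A1 by (simp add: A_def)
  define S where "S h = of_real (k * m powr (- \<alpha>)) * T h + of_real (k * n) * (S1 h + (S2 h + - (a / of_real l * P)))" for h
  have "smooth T" unfolding T_def[abs_def] by (rule smooth_upper_integral[OF dg less_imp_le[OF s(1)]])
  then have smS: "smooth S" unfolding S_def[abs_def] by (intro smooth_add smooth_cmult smooth_const S1 S2)
  define E where "E x = S (x - X) + (if x = X then 0 else
    of_real (k * B) * (of_real (\<bar>x - X\<bar> powr (2 * \<alpha>)) * of_real (x - X) powr (- of_real r)) * I.Rem (x - X))" for x
  have reg: "C10 (- {X}) E" "Cs_at (2 * \<alpha> - r + 1) X E"
    unfolding E_def[abs_def] by (rule I.scaled_Rem_regularity[OF smS a0(2)])+
  have main: "frac_int \<Gamma> r f \<alpha> x = A * \<i> powr (- of_real \<alpha>) * cusp_value r f \<sigma> * psi \<alpha> r (x - X)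
      + of_real (B * \<bar>x - X\<bar> powr (2 * \<alpha>)) * of_real (x - X) powr (- of_real r) * frac_sigma r f \<sigma> \<alpha> (rinv_act \<sigma> x) + E x"
    if x: "x \<noteq> X" for x
  proof -
    define h where "h = x - X"
    have h: "h \<noteq> 0" "x = X + h" using x by (simp_all add: h_def)
    define p where "p = of_real (\<bar>h\<bar> powr (2 * \<alpha>)) * complex_of_real h powr (- of_real r)"
    have e1: "frac_sigma r f \<sigma> \<alpha> (rinv_act \<sigma> x) = of_real k * I.Main h"
      using frac_sigma_integral[OF \<sigma> \<alpha>, of "rinv_act \<sigma> x"] act[OF h(1)] by (simp add: k_def I.Main_def I.base_def h(2))
    have e2: "A * \<i> powr (- of_real \<alpha>) * cusp_value r f \<sigma> * psi \<alpha> r h = of_real (k * n) * (A1 * b * psi \<alpha> r h)"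
      by (simp add: A_def b_def const_term_eq)
    have "frac_int \<Gamma> r f \<alpha> x = of_real (k * m powr (- \<alpha>)) * (V h + T h)"
      unfolding frac_int_integral[OF \<alpha>, of x] using split[of h] by (simp add: k_def m_def \<tau>_def g_def h(2))
    then have e3: "frac_int \<Gamma> r f \<alpha> x = of_real (k * m powr (- \<alpha>)) * V h + of_real (k * m powr (- \<alpha>)) * T h"
      by (simp only: distrib_left)
    have e4: "of_real (k * m powr (- \<alpha>)) * V h =
        of_real (k * n) * (of_real ((c\<^sup>2) powr \<alpha>) * p * (I.Main h + I.Rem h) + S1 h + (A1 * b * psi \<alpha> r h + S2 h) - a / of_real l * P)"
    proof -
      have "of_real (j / l) * V h = of_real ((c\<^sup>2) powr \<alpha>) * p * (I.Main h + I.Rem h) + S1 h + (A1 * b * psi \<alpha> r h + S2 h) - a / of_real l * P"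
        using KE[OF h(1)] KV[OF h(1)] JE[OF h(1)] by (simp add: p_def algebra_simps)
      moreover have "of_real (k * m powr (- \<alpha>)) * V h = of_real (k * n) * (of_real (j / l) * V h)"
        using j l by (simp add: n_def)
      ultimately show ?thesis by simp
    qed
    have e5: "E x = S h + of_real (k * B) * p * I.Rem h" using x by (simp add: E_def h_def p_def)
    show ?thesis unfolding h_def[symmetric] e3 e4 e2 e1 e5 S_def B_def p_def
      by (simp add: algebra_simps)
  qed
  show ?thesis
    using A B main reg unfolding X_def by blast
qed

end

theorem theorem4:
  fixes \<Gamma> :: "imat set" and r :: real and \<mu> :: "imat \<Rightarrow> complex"
    and f :: "complex \<Rightarrow> complex" and \<alpha> :: real and x0 :: rat and \<sigma> :: rmat
  assumes "finite_index_subgroup \<Gamma>"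
    and "r > 0"
    and "modular_form \<Gamma> r \<mu> f"
    and "\<exists>z\<in>upper_half. f z \<noteq> 0"
    and "\<forall>\<a> \<tau>. scaling_matrix \<Gamma> \<a> \<tau> \<longrightarrow> fkappa (slash r f \<tau>) \<in> \<rat>"
    and "\<alpha> > alpha0 \<Gamma> r f"
    and "scaling_matrix \<Gamma> (CQ x0) \<sigma>"
  shows "\<exists>(A::complex) (B::real) (E::real \<Rightarrow> complex). A \<noteq> 0 \<and> B > 0 \<and>
     (\<forall>x. x \<noteq> of_rat x0 \<longrightarrow>
        frac_int \<Gamma> r f \<alpha> x =
          A * \<i> powr (- of_real \<alpha>) * cusp_value r f \<sigma> * psi \<alpha> r (x - of_rat x0)
          + of_real (B * \<bar>x - of_rat x0\<bar> powr (2 * \<alpha>)) * of_real (x - of_rat x0) powr (- of_real r)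
            * frac_sigma r f \<sigma> \<alpha> (rinv_act \<sigma> x)
          + E x) \<and>
     C10 (- {of_rat x0}) E \<and>
     Cs_at (2 * \<alpha> - r + 1) (of_rat x0) E"
proof -
  interpret modular \<Gamma> r \<mu> f using assms(1-3) by unfold_locales
  show ?thesis by (rule cusp_expansion[OF assms(6,7)])
qed

end
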